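(* Let $B$ be an nFBDD over $n$ variables (with at least one model), $\varepsilon>0$ and $0<\delta<1$. The algorithm $\mathsf{approxMCnFBDD}(B,\varepsilon,\delta)$ described in the context runs in time $O(n^{11}|B|^{10}\varepsilon^{-4}\log(\delta^{-1}))$ and returns $\mathsf{est}$ with the guarantee that $$\Pr\left[(1-\varepsilon)\,|B^{-1}(1)| \le \mathsf{est} \le (1+\varepsilon)\,|B^{-1}(1)|\right] \ge 1-\delta .$$
   Context: nFBDD. A non-deterministic binary decision diagram (nBDD) $B$ is a finite directed acyclic graph with a single source $q_{\text{source}}$ and two sinks labeled $0$ and $1$, in which every other node is either a decision node $ite(x,q_1,q_0)$, labeled by a Boolean variable $x$ and having a $0$-edge to $q_0$ and a $1$-edge to $q_1$ (possibly $q_0=q_1$), or a $\lor$-node, i.e. an unlabeled node with arbitrarily many children. For a node $q$, $var(q)$ is the set of variables labeling decision nodes reachable from $q$ (including $q$), $var(B)=var(q_{\text{source}})$, and $\mathsf{mod}(q)$ is the set of assignments $\alpha: var(q)\to\{0,1\}$ for which at least one path from $q$ to the $1$-sink follows the $\alpha(x)$-edge at every decision node $ite(x,q_1,q_0)$ it visits and any edge at the $\lor$-nodes it visits. $B^{-1}(1)=\mathsf{mod}(q_{\text{source}})$ is the set of models of $B$. $B$ is over $n$ variables when $|var(B)|=n$. The size $|B|$ is the number of edges of $B$. An nFBDD (non-deterministic read-once branching program) is an nBDD in which every path contains, for each variable, at most one decision node labeled by it. It is $1$-complete when along every path from the source to the $1$-sink every variable occurs exactly once; $0$-reduced when it has no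 decision node $ite(x,0\text{-sink},0\text{-sink})$ and no $\lor$-node having the $0$-sink among its children; alternating when its source is a $\lor$-node, every $\lor$-node has only decision nodes as children, and every decision node has only $\lor$-nodes and sinks as children. The nodes of a $1$-complete, $0$-reduced, alternating nFBDD over $n$ variables are organized in layers $L_0,\dots,L_{2n}$: $L_0$ contains the sinks and, for $i\ge1$, $L_i$ contains the nodes whose children, except the $0$-sink, are in $L_{i-1}$. The children of every node $q$ form an ordered sequence $\mathsf{children}(q)$. Algorithm $\mathsf{approxMCnFBDD}(B,\varepsilon,\delta)$. First make $B$ alternating, $1$-complete and $0$-reduced, without changing the function it computes (this can be done in time $O(n|B|^2)$); from here on, within the description of the algorithm, $B$ denotes the resulting nFBDD. Set $n=|var(B)|$, $m=\lceil 8\ln(1/\delta)\rceil$, $\kappa=\frac{\varepsilon}{1+\varepsilon}$, $n_s=\lceil 4n/\kappa^2\rceil$, $n_t=16n|B|$, $\theta=\lceil 16n_sn_t(1+\kappa)|B|\rceil$. For $j=1,\dots,m$ let $\mathsf{est}_j$ be the output of an independent run of $\mathsf{approxMCnFBDD\_core}(B,n,n_s,n_t,\theta)$. Return $\mathrm{median}(\mathsf{est}_1,\dots,\mathsf{est}_m)$. (In the claim, $|B|$ is the size of the input nFBDD.) Conventions and subroutines. $1/\infty=0$, $1/0=\infty$; $\alpha_\emptyset$ is the empty assignment. For sets of assignments, $S\otimes S'=\{\alpha\cup\alpha'\mid\alpha\in S,\alpha'\in S'\}$. $\mathsf{reduce}(S,p)$, with $p\in[0,1]$, returns the random subset $S'$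 of $S$ obtained by adding each element of $S$ to $S'$ with probability $p$. $\mathsf{union}(q,S_1,\dots,S_k)$, for $\mathsf{children}(q)=(q_1,\dots,q_k)$, is the set of all $\alpha$ such that for some $i$, $\alpha\in S_i$ and $\alpha\notin\mathsf{mod}(q_j)$ for every $j<i$. $\mathsf{round}(q,\infty)=\infty$, and for $v>0$, $\mathsf{round}(q,v)$ is the smallest value $\ge v$ of the form $\frac{1+\kappa}{l}$ with $l$ an integer between $1$ and $2^n$ ($\infty$ if no such value exists). Algorithm $\mathsf{approxMCnFBDD\_core}(B,n,n_s,n_t,\theta)$. It computes $p(q)$ and sets $S^r(q)$, $1\le r\le n_sn_t$, for the nodes $q$. Initially $p(1\text{-sink})=1$, $p(0\text{-sink})=\infty$, $S^r(1\text{-sink})=\{\alpha_\emptyset\}$, $S^r(0\text{-sink})=\emptyset$. For $i=1,\dots,2n$ and each $q\in L_i$, $p(q)$ and the $S^r(q)$ are computed as below, and if then $|S^r(q)|\ge\theta$ for some $r$, the algorithm stops and returns $0$. After all nodes are processed it returns $1/p(q_{\text{source}})$. If $q=ite(x,q_1,q_0)$: $p(q)=\mathsf{round}\big(q,(\frac1{p(q_0)}+\frac1{p(q_1)})^{-1}\big)$ and, for all $r$, $S^r(q)=\big(\mathsf{reduce}(S^r(q_0),\frac{p(q)}{p(q_0)})\otimes\{\{x\mapsto0\}\}\big)\cup\big(\mathsf{reduce}(S^r(q_1),\frac{p(q)}{p(q_1)})\otimes\{\{x\mapsto1\}\}\big)$. If $q$ is a $\lor$-node with $\mathsf{children}(q)=(q_1,\dots,q_k)$: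 $\rho(q)=\min(p(q_1),\dots,p(q_k))$; for all $r$, $\hat S^r(q)=\mathsf{union}\big(q,\mathsf{reduce}(S^r(q_1),\frac{\rho(q)}{p(q_1)}),\dots,\mathsf{reduce}(S^r(q_k),\frac{\rho(q)}{p(q_k)})\big)$; $M_j(q)=\frac1{\rho(q)n_s}\sum_{r=(j-1)n_s+1}^{j n_s}|\hat S^r(q)|$ for $1\le j\le n_t$; $\hat\rho(q)=\mathrm{median}(M_1(q),\dots,M_{n_t}(q))^{-1}$; $p(q)=\mathsf{round}(q,\min(\rho(q),\hat\rho(q)))$; and, for all $r$, $S^r(q)=\mathsf{reduce}(\hat S^r(q),\frac{p(q)}{\rho(q)})$.
   Formalization: round(q,v) is capped at 1, since as printed ite(x,1-sink,0-sink) gets p=1+κ and reduce is called with probability above 1; the O-bound is for n≥1, ε≤ε0, δ≤δ0<1 with a constant depending on ε0, δ0, as it fails literally for ε→∞, δ→1 or n=0. *)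

theory Defs
  imports "HOL-Probability.Probability"
begin

section \<open>Non-deterministic binary decision diagrams\<close>

text \<open>\<open>Ite x q1 q0\<close> has its 1-edge to \<open>q1\<close> and its 0-edge to \<open>q0\<close>; the children of an
  \<open>Or\<close>-node are an ordered sequence, and parallel edges out of an \<open>Or\<close>-node are tolerated.\<close>

datatype ('q, 'v) gate = Sink bool | Ite 'v 'q 'q | Or "'q list"

fun gate_children :: "('q, 'v) gate \<Rightarrow> 'q list" where
  "gate_children (Sink b) = []"
| "gate_children (Ite x q1 q0) = [q1, q0]"
| "gate_children (Or qs) = qs"

record ('q, 'v) bdd =
  nodes :: "'q list"
  gate_of :: "'q \<Rightarrow> ('q, 'v) gate"
  source :: 'q

definition children :: "('q, 'v) bdd \<Rightarrow> 'q \<Rightarrow> 'q list" where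
  "children B q = gate_children (gate_of B q)"

definition edges :: "('q, 'v) bdd \<Rightarrow> ('q \<times> 'q) set" where
  "edges B = {(q, c). q \<in> set (nodes B) \<and> c \<in> set (children B q)}"

definition bdd_size :: "('q, 'v) bdd \<Rightarrow> nat" where
  "bdd_size B = (\<Sum>q\<leftarrow>nodes B. length (children B q))"

definition is_sink :: "('q, 'v) bdd \<Rightarrow> 'q \<Rightarrow> bool" where
  "is_sink B q \<longleftrightarrow> (\<exists>b. gate_of B q = Sink b)"

definition is_decision :: "('q, 'v) bdd \<Rightarrow> 'q \<Rightarrow> bool" where
  "is_decision B q \<longleftrightarrow> (\<exists>x q1 q0. gate_of B q = Ite x q1 q0)"

definition is_or :: "('q, 'v) bdd \<Rightarrow> 'q \<Rightarrow> bool" where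
  "is_or B q \<longleftrightarrow> (\<exists>qs. gate_of B q = Or qs)"

definition decides :: "('q, 'v) bdd \<Rightarrow> 'v \<Rightarrow> 'q \<Rightarrow> bool" where
  "decides B x q \<longleftrightarrow> (\<exists>q1 q0. gate_of B q = Ite x q1 q0)"

definition node_vars :: "('q, 'v) bdd \<Rightarrow> 'q \<Rightarrow> 'v set" where
  "node_vars B q = {x. \<exists>q'. (q, q') \<in> (edges B)\<^sup>* \<and> decides B x q'}"

definition bdd_vars :: "('q, 'v) bdd \<Rightarrow> 'v set" where
  "bdd_vars B = node_vars B (source B)"

text \<open>No \<open>Or\<close>-node is childless, since otherwise it would be a third sink of the graph.
  The sinks are exempted from being reachable, so that a constant sink may be left unused.\<close>

definition nBDD :: "('q, 'v) bdd \<Rightarrow> bool" where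
  "nBDD B \<longleftrightarrow>
     distinct (nodes B) \<and> source B \<in> set (nodes B) \<and>
     (\<forall>q\<in>set (nodes B). set (children B q) \<subseteq> set (nodes B)) \<and>
     acyclic (edges B) \<and>
     (\<forall>b. \<exists>!q. q \<in> set (nodes B) \<and> gate_of B q = Sink b) \<and>
     (\<forall>q\<in>set (nodes B). gate_of B q \<noteq> Or []) \<and>
     (\<forall>q. (q, source B) \<notin> edges B) \<and>
     (\<forall>q\<in>set (nodes B). q \<noteq> source B \<longrightarrow> \<not> is_sink B q \<longrightarrow> (\<exists>q'. (q', q) \<in> edges B))"

text \<open>\<open>accepts B \<alpha> q\<close>: some path from \<open>q\<close> to the 1-sink is consistent with \<open>\<alpha>\<close>.
  Assignments are partial maps whose domain is the set of assigned variables.\<close>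

inductive accepts :: "('q, 'v) bdd \<Rightarrow> ('v \<rightharpoonup> bool) \<Rightarrow> 'q \<Rightarrow> bool"
  for B :: "('q, 'v) bdd" and \<alpha> :: "'v \<rightharpoonup> bool" where
  accepts_sink: "gate_of B q = Sink True \<Longrightarrow> accepts B \<alpha> q"
| accepts_ite: "gate_of B q = Ite x q1 q0 \<Longrightarrow> \<alpha> x = Some b \<Longrightarrow>
    accepts B \<alpha> (if b then q1 else q0) \<Longrightarrow> accepts B \<alpha> q"
| accepts_or: "gate_of B q = Or qs \<Longrightarrow> c \<in> set qs \<Longrightarrow> accepts B \<alpha> c \<Longrightarrow> accepts B \<alpha> q"

definition Mod :: "('q, 'v) bdd \<Rightarrow> 'q \<Rightarrow> ('v \<rightharpoonup> bool) set" where
  "Mod B q = {\<alpha>. dom \<alpha> = node_vars B q \<and> accepts B \<alpha> q}"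

definition models :: "('q, 'v) bdd \<Rightarrow> ('v \<rightharpoonup> bool) set" where
  "models B = Mod B (source B)"

definition is_path :: "('q, 'v) bdd \<Rightarrow> 'q list \<Rightarrow> bool" where
  "is_path B \<pi> \<longleftrightarrow> \<pi> \<noteq> [] \<and> set \<pi> \<subseteq> set (nodes B) \<and> successively (\<lambda>q c. (q, c) \<in> edges B) \<pi>"

definition occurrences :: "('q, 'v) bdd \<Rightarrow> 'v \<Rightarrow> 'q list \<Rightarrow> nat" where
  "occurrences B x \<pi> = length (filter (decides B x) \<pi>)"

definition nFBDD :: "('q, 'v) bdd \<Rightarrow> bool" where
  "nFBDD B \<longleftrightarrow> nBDD B \<and> (\<forall>\<pi> x. is_path B \<pi> \<longrightarrow> occurrences B x \<pi> \<le> 1)"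

definition one_complete :: "('q, 'v) bdd \<Rightarrow> bool" where
  "one_complete B \<longleftrightarrow>
     (\<forall>\<pi>. is_path B \<pi> \<and> hd \<pi> = source B \<and> gate_of B (last \<pi>) = Sink True \<longrightarrow>
        (\<forall>x\<in>bdd_vars B. occurrences B x \<pi> = 1))"

definition zero_reduced :: "('q, 'v) bdd \<Rightarrow> bool" where
  "zero_reduced B \<longleftrightarrow> (\<forall>q\<in>set (nodes B).
     (is_decision B q \<longrightarrow> (\<exists>c\<in>set (children B q). gate_of B c \<noteq> Sink False)) \<and>
     (is_or B q \<longrightarrow> (\<forall>c\<in>set (children B q). gate_of B c \<noteq> Sink False)))"

definition alternating :: "('q, 'v) bdd \<Rightarrow> bool" where
  "alternating B \<longleftrightarrow> is_or B (source B) \<and> (\<forall>q\<in>set (nodes B).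
     (is_or B q \<longrightarrow> (\<forall>c\<in>set (children B q). is_decision B c)) \<and>
     (is_decision B q \<longrightarrow> (\<forall>c\<in>set (children B q). is_or B c \<or> is_sink B c)))"

definition normal_form_of :: "('p, 'v) bdd \<Rightarrow> ('q, 'v) bdd \<Rightarrow> bool" where
  "normal_form_of B' B \<longleftrightarrow> nFBDD B' \<and> alternating B' \<and> one_complete B' \<and> zero_reduced B' \<and>
     bdd_vars B' = bdd_vars B \<and> models B' = models B"

section \<open>Preprocessing\<close>

text \<open>The diagram is first read as a graph of jumps between its satisfiable decision nodes and its
  1-sink, with the \<open>Or\<close>-nodes contracted. An origin of a jump is \<open>None\<close> (the start of a path) or
  \<open>Some (d, b)\<close> (the \<open>b\<close>-edge of the decision node \<open>d\<close>).\<close>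

type_synonym 'q origin = "('q \<times> bool) option"

definition or_step :: "('q, 'v) bdd \<Rightarrow> ('q \<times> 'q) set" where
  "or_step B = {(q, c). q \<in> set (nodes B) \<and> is_or B q \<and> c \<in> set (children B q)}"

definition targets :: "('q, 'v) bdd \<Rightarrow> 'q \<Rightarrow> 'q list" where
  "targets B q = filter (\<lambda>t. (q, t) \<in> (or_step B)\<^sup>* \<and> \<not> is_or B t \<and> Mod B t \<noteq> {}) (nodes B)"

definition live_decisions :: "('q, 'v) bdd \<Rightarrow> 'q list" where
  "live_decisions B = filter (\<lambda>q. is_decision B q \<and> Mod B q \<noteq> {}) (nodes B)"

definition origins :: "('q, 'v) bdd \<Rightarrow> 'q origin list" where
  "origins B = None # [Some (d, b). d \<leftarrow> live_decisions B, b \<leftarrow> [True, False]]"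

fun origin_head :: "('q, 'v) bdd \<Rightarrow> 'q origin \<Rightarrow> 'q" where
  "origin_head B None = source B"
| "origin_head B (Some (d, b)) = (case gate_of B d of Ite x q1 q0 \<Rightarrow> if b then q1 else q0 | _ \<Rightarrow> d)"

text \<open>The variables that remain to be tested after following the origin.\<close>

fun origin_vars :: "('q, 'v) bdd \<Rightarrow> 'q origin \<Rightarrow> 'v set" where
  "origin_vars B None = bdd_vars B"
| "origin_vars B (Some (d, b)) = node_vars B d - {x. decides B x d}"

definition var_list :: "('q, 'v) bdd \<Rightarrow> 'v list" where
  "var_list B =
     remdups (concat (map (\<lambda>q. case gate_of B q of Ite x q1 q0 \<Rightarrow> [x] | _ \<Rightarrow> []) (nodes B)))"

definition pads :: "('q, 'v) bdd \<Rightarrow> 'q origin \<Rightarrow> 'q \<Rightarrow> 'v list" where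
  "pads B o' t = filter (\<lambda>x. x \<in> origin_vars B o' \<and> x \<notin> node_vars B t) (var_list B)"

text \<open>In the normal form, \<open>Dec d\<close> is a copy of \<open>d\<close>, \<open>Join o\<close> is the \<open>Or\<close>-node entered through the
  origin \<open>o\<close>, and a jump from \<open>o\<close> to \<open>t\<close> runs through the void tests \<open>Pad o t y\<close> of the variables
  \<open>y\<close> skipped by it, \<open>PadJoin o t y\<close> being the \<open>Or\<close>-node below \<open>Pad o t y\<close>.\<close>

datatype ('q, 'v) nnode =
    NSink bool
  | Dec 'q
  | Join "'q origin"
  | Pad "'q origin" 'q 'v
  | PadJoin "'q origin" 'q 'v

definition entry :: "('q, 'v) bdd \<Rightarrow> 'q origin \<Rightarrow> ('q, 'v) nnode" where
  "entry B o' =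
     (if targets B (origin_head B o') = [] then NSink False
      else if origin_vars B o' = {} then NSink True
      else Join o')"

fun route :: "'q origin \<Rightarrow> 'q \<Rightarrow> 'v list \<Rightarrow> ('q, 'v) nnode" where
  "route o' t [] = Dec t"
| "route o' t (y # ys) = Pad o' t y"

definition pads_after :: "('q, 'v) bdd \<Rightarrow> 'q origin \<Rightarrow> 'q \<Rightarrow> 'v \<Rightarrow> 'v list" where
  "pads_after B o' t y = tl (dropWhile (\<lambda>z. z \<noteq> y) (pads B o' t))"

definition below_pad :: "('q, 'v) bdd \<Rightarrow> 'q origin \<Rightarrow> 'q \<Rightarrow> 'v \<Rightarrow> ('q, 'v) nnode" where
  "below_pad B o' t y =
     (if pads_after B o' t y = [] \<and> is_sink B t then NSink True else PadJoin o' t y)"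

fun normal_gate :: "('q, 'v) bdd \<Rightarrow> ('q, 'v) nnode \<Rightarrow> (('q, 'v) nnode, 'v) gate" where
  "normal_gate B (NSink b) = Sink b"
| "normal_gate B (Dec d) =
     (case gate_of B d of
        Ite x q1 q0 \<Rightarrow> Ite x (entry B (Some (d, True))) (entry B (Some (d, False)))
      | _ \<Rightarrow> Sink False)"
| "normal_gate B (Join o') =
     Or (map (\<lambda>t. route o' t (pads B o' t)) (targets B (origin_head B o')))"
| "normal_gate B (Pad o' t y) = Ite y (below_pad B o' t y) (below_pad B o' t y)"
| "normal_gate B (PadJoin o' t y) = Or [route o' t (pads_after B o' t y)]"

definition jumps :: "('q, 'v) bdd \<Rightarrow> ('q origin \<times> 'q) list" where
  "jumps B = [(o', t). o' \<leftarrow> origins B, t \<leftarrow> targets B (origin_head B o'), origin_vars B o' \<noteq> {}]"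

definition normal_nodes :: "('q, 'v) bdd \<Rightarrow> ('q, 'v) nnode list" where
  "normal_nodes B =
     [NSink False, NSink True]
     @ map Dec (live_decisions B)
     @ filter (\<lambda>q. \<exists>o'. q = Join o') (map (entry B) (origins B))
     @ [Pad o' t y. (o', t) \<leftarrow> jumps B, y \<leftarrow> pads B o' t]
     @ filter (\<lambda>q. q \<noteq> NSink True) [below_pad B o' t y. (o', t) \<leftarrow> jumps B, y \<leftarrow> pads B o' t]"

definition normalise :: "('q, 'v) bdd \<Rightarrow> (('q, 'v) nnode, 'v) bdd" where
  "normalise B =
     \<lparr>nodes = normal_nodes B, gate_of = normal_gate B, source = entry B None\<rparr>"

text \<open>Running time of \<open>normalise\<close>: one bottom-up pass over the nodes and edges of \<open>B\<close> computes,
  as bit vectors over variables and over nodes, the sets \<open>node_vars B q\<close> and \<open>targets B q\<close> and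
  the emptiness of \<open>Mod B q\<close>; then \<open>pads B o t\<close> is computed for each origin \<open>o\<close> and node \<open>t\<close>;
  finally the nodes and edges of the result are written.\<close>

definition normalise_time :: "('q, 'v) bdd \<Rightarrow> nat" where
  "normalise_time B =
     (length (nodes B) + bdd_size B) * (1 + card (bdd_vars B) + length (nodes B))
     + length (origins B) * length (nodes B) * (1 + card (bdd_vars B))
     + length (nodes (normalise B)) + bdd_size (normalise B)"

section \<open>Randomised computations with running time\<close>

text \<open>A randomised computation is the joint distribution of its result and its number of steps.
  Arithmetic, comparisons, memory accesses and the draw of a Bernoulli variable take one step each.\<close>

type_synonym 'a rand = "('a \<times> nat) pmf"

definition ret :: "'a \<Rightarrow> 'a rand" where
  "ret a = return_pmf (a, 0)"

definition charge :: "nat \<Rightarrow> unit rand" where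
  "charge t = return_pmf ((), t)"

definition bind_rand :: "'a rand \<Rightarrow> ('a \<Rightarrow> 'b rand) \<Rightarrow> 'b rand"  (infixl "\<bind>\<^sub>t" 54) where
  "m \<bind>\<^sub>t f = bind_pmf m (\<lambda>(a, s). map_pmf (\<lambda>(b, t). (b, s + t)) (f a))"

primrec map_rand :: "('a \<Rightarrow> 'b rand) \<Rightarrow> 'a list \<Rightarrow> 'b list rand" where
  "map_rand f [] = ret []"
| "map_rand f (x # xs) = f x \<bind>\<^sub>t (\<lambda>y. map_rand f xs \<bind>\<^sub>t (\<lambda>ys. ret (y # ys)))"

section \<open>The algorithm\<close>

definition median :: "'a::{linorder, numeral, inverse} list \<Rightarrow> 'a" where
  "median xs =
     (let ys = sort xs; k = length xs in (ys ! ((k - 1) div 2) + ys ! (k div 2)) / 2)"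

definition otimes :: "('v \<rightharpoonup> bool) set \<Rightarrow> ('v \<rightharpoonup> bool) set \<Rightarrow> ('v \<rightharpoonup> bool) set"  (infixl "\<otimes>\<^sub>a" 70) where
  "S \<otimes>\<^sub>a S' = {\<alpha> ++ \<alpha>' | \<alpha> \<alpha>'. \<alpha> \<in> S \<and> \<alpha>' \<in> S'}"

definition reduce :: "'a set \<Rightarrow> ennreal \<Rightarrow> 'a set rand" where
  "reduce S p =
     map_pmf (\<lambda>keep. ({a \<in> S. keep a}, card S)) (Pi_pmf S False (\<lambda>_. bernoulli_pmf (enn2real p)))"

definition union_children ::
    "('q, 'v) bdd \<Rightarrow> 'q \<Rightarrow> ('v \<rightharpoonup> bool) set list \<Rightarrow> ('v \<rightharpoonup> bool) set" where
  "union_children B q Ss =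
     {\<alpha>. \<exists>i<length (children B q). \<alpha> \<in> Ss ! i \<and> (\<forall>j<i. \<alpha> \<notin> Mod B (children B q ! j))}"

text \<open>The values \<open>p(q)\<close> are used as sampling probabilities. Without the bound \<open>min 1\<close>, a decision
  node whose children are the 1-sink and the 0-sink would get \<open>p(q) = 1 + \<kappa>\<close>, and \<open>reduce\<close> would
  be called on the 1-sink with probability \<open>p(q) / 1 > 1\<close>.\<close>

definition round_up :: "nat \<Rightarrow> real \<Rightarrow> ennreal \<Rightarrow> ennreal" where
  "round_up n \<kappa> v =
     (let G = {g. \<exists>l::nat. 1 \<le> l \<and> l \<le> 2 ^ n \<and> g = ennreal ((1 + \<kappa>) / real l) \<and> v \<le> g}
      in if G = {} then \<infinity> else min 1 (Min G))"

primrec layer :: "('q, 'v) bdd \<Rightarrow> nat \<Rightarrow> 'q list" where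
  "layer B 0 = filter (is_sink B) (nodes B)"
| "layer B (Suc i) =
     filter (\<lambda>q. \<not> is_sink B q \<and>
       (\<forall>c\<in>set (children B q). gate_of B c \<noteq> Sink False \<longrightarrow> c \<in> set (layer B i))) (nodes B)"

text \<open>The values \<open>p(q)\<close>, and the lists of the sample sets of each node, indexed from 0 instead
  of 1. Entries of nodes that have not been processed yet are never read.\<close>

type_synonym ('q, 'v) state = "('q \<Rightarrow> ennreal) \<times> ('q \<Rightarrow> ('v \<rightharpoonup> bool) set list)"

definition initial_state :: "('q, 'v) bdd \<Rightarrow> nat \<Rightarrow> ('q, 'v) state" where
  "initial_state B N =
     ((\<lambda>q. if gate_of B q = Sink True then 1 else \<infinity>),
      (\<lambda>q. replicate N (if gate_of B q = Sink True then {Map.empty} else {})))"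

text \<open>Steps at a decision node: besides the draws made by \<open>reduce\<close>, each selected assignment is
  copied and extended, \<open>round_up\<close> searches for its \<open>l\<close> by bisection in \<open>{1..2^n}\<close>, and the sizes
  of the resulting sample sets are compared with the threshold.\<close>

definition decision_step ::
    "('q, 'v) bdd \<Rightarrow> nat \<Rightarrow> real \<Rightarrow> nat \<Rightarrow> ('q, 'v) state \<Rightarrow> 'v \<Rightarrow> 'q \<Rightarrow> 'q
      \<Rightarrow> (ennreal \<times> ('v \<rightharpoonup> bool) set list) rand" where
  "decision_step B n \<kappa> N st x q1 q0 =
     (let p = fst st; S = snd st;
          pq = round_up n \<kappa> (inverse (1 / p q0 + 1 / p q1))
      in charge (1 + n + N) \<bind>\<^sub>t (\<lambda>_.
         map_rand (\<lambda>r.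
           reduce (S q0 ! r) (pq / p q0) \<bind>\<^sub>t (\<lambda>A0.
           reduce (S q1 ! r) (pq / p q1) \<bind>\<^sub>t (\<lambda>A1.
           charge (1 + (card A0 + card A1) * (1 + n)) \<bind>\<^sub>t (\<lambda>_.
           ret ((A0 \<otimes>\<^sub>a {[x \<mapsto> False]}) \<union> (A1 \<otimes>\<^sub>a {[x \<mapsto> True]}))))))
         [0..<N] \<bind>\<^sub>t (\<lambda>Sq.
         ret (pq, Sq))))"

text \<open>Steps at an \<open>Or\<close>-node: to form the union, each selected assignment is evaluated once, by
  a bottom-up pass over all nodes and edges of \<open>B\<close>, and the outcome is then looked up at the
  children of \<open>q\<close>. The medians are computed by linear-time selection.\<close>

definition or_step_sample ::
    "('q, 'v) bdd \<Rightarrow> nat \<Rightarrow> real \<Rightarrow> nat \<Rightarrow> nat \<Rightarrow> ('q, 'v) state \<Rightarrow> 'q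
      \<Rightarrow> (ennreal \<times> ('v \<rightharpoonup> bool) set list) rand" where
  "or_step_sample B n \<kappa> ns nt st q =
     (let p = fst st; S = snd st; N = ns * nt; qs = children B q;
          \<rho> = Min (p ` set qs)
      in charge (1 + n + length qs + N + nt) \<bind>\<^sub>t (\<lambda>_.
         map_rand (\<lambda>r.
           map_rand (\<lambda>c. reduce (S c ! r) (\<rho> / p c)) qs \<bind>\<^sub>t (\<lambda>As.
           charge (1 + length qs
             + (\<Sum>A\<leftarrow>As. card A * (1 + length (nodes B) + bdd_size B + length qs))) \<bind>\<^sub>t (\<lambda>_.
           ret (union_children B q As))))
         [0..<N] \<bind>\<^sub>t (\<lambda>Sh.
         let M = (\<lambda>j. 1 / (\<rho> * of_nat ns) * (\<Sum>r = j * ns..<(j + 1) * ns. of_nat (card (Sh ! r))));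
             \<rho>h = inverse (median (map M [0..<nt]));
             pq = round_up n \<kappa> (min \<rho> \<rho>h)
         in map_rand (\<lambda>r. reduce (Sh ! r) (pq / \<rho>)) [0..<N] \<bind>\<^sub>t (\<lambda>Sq.
            ret (pq, Sq)))))"

definition node_step ::
    "('q, 'v) bdd \<Rightarrow> nat \<Rightarrow> real \<Rightarrow> nat \<Rightarrow> nat \<Rightarrow> ('q, 'v) state \<Rightarrow> 'q
      \<Rightarrow> (ennreal \<times> ('v \<rightharpoonup> bool) set list) rand" where
  "node_step B n \<kappa> ns nt st q =
     (case gate_of B q of
        Sink b \<Rightarrow> ret (fst st q, snd st q)
      | Ite x q1 q0 \<Rightarrow> decision_step B n \<kappa> (ns * nt) st x q1 q0
      | Or qs \<Rightarrow> or_step_sample B n \<kappa> ns nt st q)"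

text \<open>The result \<open>None\<close> means that the run has been stopped by the threshold \<open>\<theta>\<close>.\<close>

primrec process ::
    "('q, 'v) bdd \<Rightarrow> nat \<Rightarrow> real \<Rightarrow> nat \<Rightarrow> nat \<Rightarrow> nat \<Rightarrow> 'q list \<Rightarrow> ('q, 'v) state
      \<Rightarrow> ('q, 'v) state option rand" where
  "process B n \<kappa> ns nt \<theta> [] st = ret (Some st)"
| "process B n \<kappa> ns nt \<theta> (q # qs) st =
     node_step B n \<kappa> ns nt st q \<bind>\<^sub>t (\<lambda>(pq, Sq).
     if \<exists>A\<in>set Sq. card A \<ge> \<theta> then ret None
     else process B n \<kappa> ns nt \<theta> qs ((fst st)(q := pq), (snd st)(q := Sq)))"

definition approxMCnFBDD_core ::
    "('q, 'v) bdd \<Rightarrow> nat \<Rightarrow> real \<Rightarrow> nat \<Rightarrow> nat \<Rightarrow> nat \<Rightarrow> real rand" where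
  "approxMCnFBDD_core B n \<kappa> ns nt \<theta> =
     charge (1 + ns * nt + (1 + 2 * n) * (length (nodes B) + bdd_size B)) \<bind>\<^sub>t (\<lambda>_.
     process B n \<kappa> ns nt \<theta> (concat (map (layer B) [1..<2 * n + 1])) (initial_state B (ns * nt))
       \<bind>\<^sub>t (\<lambda>res.
     ret (case res of None \<Rightarrow> 0 | Some st \<Rightarrow> enn2real (1 / fst st (source B)))))"

definition approxMCnFBDD :: "('q, 'v) bdd \<Rightarrow> real \<Rightarrow> real \<Rightarrow> real rand" where
  "approxMCnFBDD B \<epsilon> \<delta> =
     (let B' = normalise B;
          n = card (bdd_vars B');
          m = nat \<lceil>8 * ln (1 / \<delta>)\<rceil>;
          \<kappa> = \<epsilon> / (1 + \<epsilon>);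
          ns = nat \<lceil>4 * real n / \<kappa>\<^sup>2\<rceil>;
          nt = 16 * n * bdd_size B';
          \<theta> = nat \<lceil>16 * real ns * real nt * (1 + \<kappa>) * real (bdd_size B')\<rceil>
      in charge (1 + normalise_time B) \<bind>\<^sub>t (\<lambda>_.
         map_rand (\<lambda>_. approxMCnFBDD_core B' n \<kappa> ns nt \<theta>) [0..<m] \<bind>\<^sub>t (\<lambda>ests.
         charge m \<bind>\<^sub>t (\<lambda>_.
         ret (median ests)))))"

end

theory Submission
  imports Defs
begin

text \<open>Suppose that the values \<open>p(q)\<close> were fixed in advance to be \<open>h(q)\<close>. Then the samples with different
  indices are independent, and two models of a node \<open>q\<close> occur together in a sample of \<open>q\<close> with probability
  \<open>h(q)\<^sup>2\<close> times the sum of the increments of \<open>1 / h\<close> along the common part of their derivation chains.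
  A model of an intermediate node \<open>c\<close> extends to at most \<open>|mod(q)| / |mod(c)|\<close> models of \<open>q\<close>, so if
  \<open>1 / h(c) \<le> (1 + u) |mod(c)|\<close> at the nodes \<open>c\<close> below \<open>q\<close>, the variance of the estimator of \<open>|mod(q)|\<close> is
  at most \<open>((1 + u) (1 + ln |mod(q)|) - 1) |mod(q)|\<^sup>2\<close>. By Cantelli's inequality the mean of \<open>n\<^sub>s\<close>
  samples fails with probability at most \<open>1 / 3\<close>, and the median of \<open>n\<^sub>t\<close> means with a probability that is
  exponentially small in \<open>n |B|\<close>.

  The algorithm chooses \<open>p(q)\<close> depending on the samples. On the event that it chooses the values \<open>h\<close>, it is
  dominated by the process in which \<open>h\<close> is imposed. As the values are rounded to \<open>2 ^ n\<close> numbers and are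
  determined by those at the \<open>Or\<close>-nodes, there are few possible \<open>h\<close>, and a union bound over them
  applies. The threshold is reached with small probability because the indicator of \<open>\<alpha> \<in> S\<^sup>r(q)\<close> divided
  by \<open>p(q)\<close> has mean 1.\<close>

section \<open>Tail bounds\<close>

text \<open>The numbers of samples are fixed by the algorithm, and this shapes the estimates. With
  \<open>ns\<close> about \<open>4 * n / \<kappa>\<^sup>2\<close> the variance of a block mean is
  only known to be at most half the squared tolerance. Chebyshev's inequality would then give the
  failure probability \<open>1 / 2\<close>, which no median can improve, so each direction is
  bounded separately by a one-sided inequality. Rounding has a second effect besides making the
  values finite in number: it raises \<open>p(q)\<close>, so upper bounds on \<open>1 / p(q)\<close>
  survive, while lower bounds survive only if they have the form \<open>l / (1 + \<kappa>)\<close>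
  for an integer \<open>l\<close>. Hence the integral targets \<open>sg m\<close> and
  \<open>(m + 1) div 2\<close>. In the union bound each Or-node costs a factor \<open>2 ^ n\<close>.
  The \<open>16 * n * bdd_size B\<close> blocks pay for it because
  \<open>(8 / 9) ^ 8 < 1 / 2\<close>. The threshold needs no imposed values: \<open>p(q)\<close> may
  depend on the samples, but it enters only as the last thinning probability and cancels in the
  normalised indicator. What it does need is an upper bound on \<open>p(q)\<close> times the number
  of models, which is why lower bounds on \<open>1 / p\<close> are tracked at all nodes when
  \<open>\<epsilon> < 1\<close>.\<close>

lemma sum_pow_half_bad:
  fixes D :: "'i \<Rightarrow> 'a pmf" and r f :: real
  assumes A: "finite A" and r: "r > 1" and f: "f \<ge> 0"
    and bad: "\<And>j. j \<in> A \<Longrightarrow> measure_pmf.prob (D j) (Bad j) \<le> f"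
  shows "measure_pmf.prob (Pi_pmf A d D) {g. card A \<le> 2 * card {j\<in>A. g j \<in> Bad j}}
     \<le> ((1 + (r\<^sup>2 - 1) * f) / r) ^ card A"
proof -
  \<comment> \<open>Markov's inequality for the product of \<open>h\<close>: it is at least
    \<open>r ^ card A\<close> once half of the coordinates are bad, and its mean factorises by
    independence. The quotient in the bound is least for \<open>r\<^sup>2 = (1 - f) / f\<close>,
    where it equals \<open>2 * sqrt (f * (1 - f))\<close>; hence \<open>r = sqrt 2\<close> for
    \<open>f = 1 / 3\<close> and \<open>r = sqrt 3\<close> for \<open>f = 1 / 4\<close> in the two
    applications.\<close>
  define h where "h = (\<lambda>j (x::'a). if x \<in> Bad j then ennreal (r\<^sup>2) else 1)"
  have r2: "r\<^sup>2 \<ge> 1" using r by (simp add: one_le_power)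
  have one: "(\<integral>\<^sup>+x. h j x \<partial>D j) \<le> ennreal (1 + (r\<^sup>2 - 1) * f)" if j: "j \<in> A" for j
  proof -
    have "ennreal (r\<^sup>2) = 1 + ennreal (r\<^sup>2 - 1)"
      using r2 by (simp flip: ennreal_plus ennreal_1)
    then have "h j x = 1 + ennreal (r\<^sup>2 - 1) * indicator (Bad j) x" for x
      by (auto simp: h_def indicator_def)
    then have "(\<integral>\<^sup>+x. h j x \<partial>D j) = 1 + ennreal (r\<^sup>2 - 1) * emeasure (D j) (Bad j)"
      by (simp add: nn_integral_add nn_integral_cmult)
    also have "\<dots> = ennreal (1 + (r\<^sup>2 - 1) * measure_pmf.prob (D j) (Bad j))"
      using r2 by (simp add: measure_pmf.emeasure_eq_measure ennreal_mult[symmetric] ennreal_1[symmetric] ennreal_plus[symmetric] del: ennreal_1 ennreal_plus)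
    also have "\<dots> \<le> ennreal (1 + (r\<^sup>2 - 1) * f)"
      using bad[OF j] r2 by (intro ennreal_leI add_left_mono mult_left_mono) auto
    finally show ?thesis .
  qed
  have "ennreal (r ^ card A) * emeasure (Pi_pmf A d D) {g. card A \<le> 2 * card {j\<in>A. g j \<in> Bad j}}
      = (\<integral>\<^sup>+g. ennreal (r ^ card A) * indicator {g. card A \<le> 2 * card {j\<in>A. g j \<in> Bad j}} g \<partial>Pi_pmf A d D)"
    by (subst nn_integral_cmult) auto
  also have "\<dots> \<le> (\<integral>\<^sup>+g. (\<Prod>j\<in>A. h j (g j)) \<partial>Pi_pmf A d D)"
  proof (rule nn_integral_mono)
    fix g :: "'i \<Rightarrow> 'a"
    have "(\<Prod>j\<in>A. h j (g j)) = (\<Prod>j\<in>{j\<in>A. g j \<in> Bad j}. ennreal (r\<^sup>2))"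
      unfolding h_def using A by (simp only: prod.inter_filter)
    also have "\<dots> = ennreal (r ^ (2 * card {j\<in>A. g j \<in> Bad j}))"
      using r by (simp add: ennreal_power power_mult)
    finally show "ennreal (r ^ card A) * indicator {g. card A \<le> 2 * card {j\<in>A. g j \<in> Bad j}} g \<le> (\<Prod>j\<in>A. h j (g j))"
      using r by (auto simp: indicator_def intro!: ennreal_leI power_increasing)
  qed
  also have "\<dots> = (\<Prod>j\<in>A. \<integral>\<^sup>+x. h j x \<partial>D j)" by (rule nn_integral_prod_Pi_pmf[OF A])
  also have "\<dots> \<le> (\<Prod>j\<in>A. ennreal (1 + (r\<^sup>2 - 1) * f))"
    using one by (intro prod_mono_ennreal) auto
  also have "\<dots> = ennreal ((1 + (r\<^sup>2 - 1) * f) ^ card A)"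
    using r2 f by (simp add: ennreal_power del: ennreal_plus)
  finally have "r ^ card A * measure_pmf.prob (Pi_pmf A d D) {g. card A \<le> 2 * card {j\<in>A. g j \<in> Bad j}}
      \<le> (1 + (r\<^sup>2 - 1) * f) ^ card A"
    using r r2 f by (simp add: measure_pmf.emeasure_eq_measure ennreal_mult[symmetric])
  then show ?thesis using r by (simp add: power_divide field_simps)
qed

lemma finite_set_Pi_pmf:
  "finite A \<Longrightarrow> (\<And>x. x \<in> A \<Longrightarrow> finite (set_pmf (p x))) \<Longrightarrow> finite (set_pmf (Pi_pmf A d p))"
  by (auto simp: set_Pi_pmf)

lemma expectation_component_Pi_pmf:
  fixes Y :: "'a \<Rightarrow> real"
  assumes "finite A" "k \<in> A"
  shows "measure_pmf.expectation (Pi_pmf A d (\<lambda>_. D)) (\<lambda>g. Y (g k)) = measure_pmf.expectation D Y"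
proof -
  have "measure_pmf.expectation (map_pmf (\<lambda>g. g k) (Pi_pmf A d (\<lambda>_. D))) Y
      = measure_pmf.expectation (Pi_pmf A d (\<lambda>_. D)) (\<lambda>g. Y (g k))"
    by simp
  then show ?thesis using Pi_pmf_component[OF assms(1), of k d "\<lambda>_. D"] assms(2) by simp
qed

lemma expectation_pair_Pi_pmf:
  fixes Y :: "'a \<Rightarrow> real"
  assumes A: "finite A" and fin: "finite (set_pmf D)" and ij: "i \<in> A" "j \<in> A" "i \<noteq> j"
  shows "measure_pmf.expectation (Pi_pmf A d (\<lambda>_. D)) (\<lambda>g. Y (g i) * Y (g j))
       = (measure_pmf.expectation D Y)\<^sup>2"
proof -
  let ?P = "Pi_pmf A d (\<lambda>_. D)"
  have finP: "finite (set_pmf ?P)" using A fin by (intro finite_set_Pi_pmf) auto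
  note comp = expectation_component_Pi_pmf[OF A, where Y = Y and d = d and D = D]
  have "prob_space.indep_vars (measure_pmf ?P) (\<lambda>_. count_space UNIV) (\<lambda>x f. f x) {i, j}"
    by (rule prob_space.indep_vars_subset[OF prob_space_measure_pmf indep_vars_Pi_pmf[OF A]]) (use ij in auto)
  then have "prob_space.indep_vars (measure_pmf ?P) (\<lambda>_. borel) (\<lambda>x f. Y (f x)) {i, j}"
    by (rule prob_space.indep_vars_compose2[OF prob_space_measure_pmf]) auto
  then have "(\<integral>g. (\<Prod>k\<in>{i,j}. Y (g k)) \<partial>?P) = (\<Prod>k\<in>{i,j}. \<integral>g. Y (g k) \<partial>?P)"
    by (intro prob_space.indep_vars_lebesgue_integral[OF prob_space_measure_pmf]) (use finP in \<open>auto intro!: integrable_measure_pmf_finite\<close>)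
  then show ?thesis using ij comp by (simp add: power2_eq_square)
qed

text \<open>The cross terms vanish, since the coordinates are independent and centred.\<close>

lemma expectation_square_sum_Pi_pmf:
  fixes Y :: "'a \<Rightarrow> real"
  assumes A: "finite A" and fin: "finite (set_pmf D)" and mean: "measure_pmf.expectation D Y = 0"
  shows "measure_pmf.expectation (Pi_pmf A d (\<lambda>_. D)) (\<lambda>g. (\<Sum>i\<in>A. Y (g i))\<^sup>2)
       = real (card A) * measure_pmf.expectation D (\<lambda>x. (Y x)\<^sup>2)"
proof -
  let ?P = "Pi_pmf A d (\<lambda>_. D)"
  have finP: "finite (set_pmf ?P)" using A fin by (intro finite_set_Pi_pmf) auto
  note comp = expectation_component_Pi_pmf[OF A, where Y = "\<lambda>x. (Y x)\<^sup>2" and d = d and D = D]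
  have "measure_pmf.expectation ?P (\<lambda>g. (\<Sum>i\<in>A. Y (g i))\<^sup>2)
      = measure_pmf.expectation ?P (\<lambda>g. \<Sum>i\<in>A. \<Sum>j\<in>A. Y (g i) * Y (g j))"
    by (simp add: power2_eq_square sum_product)
  also have "\<dots> = (\<Sum>i\<in>A. \<Sum>j\<in>A. measure_pmf.expectation ?P (\<lambda>g. Y (g i) * Y (g j)))"
    using finP by (subst Bochner_Integration.integral_sum)
      (auto intro!: integrable_measure_pmf_finite sum.cong Bochner_Integration.integral_sum)
  also have "\<dots> = (\<Sum>i\<in>A. \<Sum>j\<in>A. if j = i then measure_pmf.expectation D (\<lambda>x. (Y x)\<^sup>2) else 0)"
    using comp expectation_pair_Pi_pmf[OF A fin, of _ _ d Y] mean
    by (intro sum.cong refl) (auto simp: power2_eq_square)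
  also have "\<dots> = real (card A) * measure_pmf.expectation D (\<lambda>x. (Y x)\<^sup>2)"
    using A by (simp add: sum.delta)
  finally show ?thesis .
qed

text \<open>Cantelli's inequality with the shift \<open>a / 2\<close>, which is optimal when the variance is \<open>a\<^sup>2 / 2\<close>.\<close>

lemma cantelli_third:
  fixes Z :: "'a \<Rightarrow> real"
  assumes fin: "finite (set_pmf P)" and mean: "measure_pmf.expectation P Z = 0"
    and var: "measure_pmf.expectation P (\<lambda>x. (Z x)\<^sup>2) \<le> a\<^sup>2 / 2" and a: "a > 0"
  shows "measure_pmf.prob P {x. Z x \<ge> a} \<le> 1 / 3"
proof -
  have int: "integrable (measure_pmf P) f" for f :: "'a \<Rightarrow> real"
    by (rule integrable_measure_pmf_finite[OF fin])
  have "measure_pmf.prob P {x. Z x \<ge> a} = measure_pmf.expectation P (indicator {x. Z x \<ge> a})"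
    by simp
  \<comment> \<open>The parabola dominates the indicator: it is nonnegative and takes the value 1 at
    \<open>Z x = a\<close>.\<close>
  also have "\<dots> \<le> measure_pmf.expectation P (\<lambda>x. (4 / (9 * a\<^sup>2)) * (Z x + a / 2)\<^sup>2)"
  proof (rule integral_mono[OF int int])
    fix x
    show "indicator {x. Z x \<ge> a} x \<le> 4 / (9 * a\<^sup>2) * (Z x + a / 2)\<^sup>2"
    proof (cases "Z x \<ge> a")
      case True
      then have "(3 * a / 2)\<^sup>2 \<le> (Z x + a / 2)\<^sup>2" using a by (intro power_mono) auto
      then have "1 \<le> 4 / (9 * a\<^sup>2) * (Z x + a / 2)\<^sup>2"
        using a by (simp add: field_simps power2_eq_square)
      then show ?thesis using True by (simp only: indicator_simps mem_Collect_eq)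
    qed simp
  qed
  also have "\<dots> = (4 / (9 * a\<^sup>2)) * (measure_pmf.expectation P (\<lambda>x. (Z x)\<^sup>2 + a * Z x + a\<^sup>2 / 4))"
    by (subst integral_mult_right_zero) (simp add: power2_eq_square algebra_simps)
  also have "measure_pmf.expectation P (\<lambda>x. (Z x)\<^sup>2 + a * Z x + a\<^sup>2 / 4)
      = measure_pmf.expectation P (\<lambda>x. (Z x)\<^sup>2) + a\<^sup>2 / 4"
    using int mean by (simp add: Bochner_Integration.integral_add)
  also have "(4 / (9 * a\<^sup>2)) * \<dots> \<le> (4 / (9 * a\<^sup>2)) * (a\<^sup>2 / 2 + a\<^sup>2 / 4)"
    using var a by (intro mult_left_mono add_right_mono) auto
  also have "\<dots> = 1 / 3" using a by (simp add: field_simps)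
  finally show ?thesis .
qed

text \<open>The variance of the sum is \<open>card A\<close> times that of one copy, hence at most
  half the square of \<open>real (card A) * a\<close>, which is exactly what
  \<open>cantelli_third\<close> asks. Both directions come from one argument with the sign
  \<open>s\<close>.\<close>

lemma mean_tail_third:
  fixes X :: "'a \<Rightarrow> real"
  assumes A: "finite A" and fin: "finite (set_pmf D)"
    and mean: "measure_pmf.expectation D X = \<mu>"
    and var: "measure_pmf.expectation D (\<lambda>x. (X x)\<^sup>2) - \<mu>\<^sup>2 \<le> real (card A) * a\<^sup>2 / 2" and a: "a > 0"
    and ne: "A \<noteq> {}"
  shows "measure_pmf.prob (Pi_pmf A d (\<lambda>_. D)) {g. (\<Sum>i\<in>A. X (g i)) \<ge> real (card A) * (\<mu> + a)} \<le> 1 / 3"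
    and "measure_pmf.prob (Pi_pmf A d (\<lambda>_. D)) {g. (\<Sum>i\<in>A. X (g i)) \<le> real (card A) * (\<mu> - a)} \<le> 1 / 3"
proof -
  let ?P = "Pi_pmf A d (\<lambda>_. D)"
  have finP: "finite (set_pmf ?P)" using A fin by (intro finite_set_Pi_pmf) auto
  have int: "integrable (measure_pmf D) f" for f :: "'a \<Rightarrow> real"
    by (rule integrable_measure_pmf_finite[OF fin])
  have cpos: "real (card A) > 0" using A ne by (simp add: card_gt_0_iff)
  have gen: "measure_pmf.prob ?P {g. (\<Sum>i\<in>A. s * (X (g i) - \<mu>)) \<ge> real (card A) * a} \<le> 1 / 3"
    if s: "s = 1 \<or> s = -1" for s :: real
  proof (rule cantelli_third[OF finP])
    have s2: "s\<^sup>2 = 1" using s by auto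
    have m0: "measure_pmf.expectation D (\<lambda>x. s * (X x - \<mu>)) = 0"
      using int mean by simp
    have v: "measure_pmf.expectation D (\<lambda>x. (s * (X x - \<mu>))\<^sup>2) = measure_pmf.expectation D (\<lambda>x. (X x)\<^sup>2) - \<mu>\<^sup>2"
    proof -
      have "measure_pmf.expectation D (\<lambda>x. (s * (X x - \<mu>))\<^sup>2)
          = measure_pmf.expectation D (\<lambda>x. (X x)\<^sup>2 - (2 * \<mu>) * X x + \<mu>\<^sup>2)"
        by (simp only: power_mult_distrib s2 power2_diff mult_1_left) (simp add: algebra_simps)
      also have "\<dots> = measure_pmf.expectation D (\<lambda>x. (X x)\<^sup>2) - \<mu>\<^sup>2"
        using int mean by (simp add: power2_eq_square)
      finally show ?thesis .
    qed
    show "measure_pmf.expectation ?P (\<lambda>g. \<Sum>i\<in>A. s * (X (g i) - \<mu>)) = 0"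
      using finP m0 expectation_component_Pi_pmf[OF A, where Y = "\<lambda>x. s * (X x - \<mu>)" and d = d and D = D]
      by (subst Bochner_Integration.integral_sum) (auto intro!: integrable_measure_pmf_finite sum.neutral)
    have "measure_pmf.expectation ?P (\<lambda>g. (\<Sum>i\<in>A. s * (X (g i) - \<mu>))\<^sup>2)
       = real (card A) * (measure_pmf.expectation D (\<lambda>x. (X x)\<^sup>2) - \<mu>\<^sup>2)"
      using expectation_square_sum_Pi_pmf[OF A fin m0, of d] v by simp
    also have "\<dots> \<le> real (card A) * (real (card A) * a\<^sup>2 / 2)"
      using var by (intro mult_left_mono) auto
    finally show "measure_pmf.expectation ?P (\<lambda>g. (\<Sum>i\<in>A. s * (X (g i) - \<mu>))\<^sup>2) \<le> (real (card A) * a)\<^sup>2 / 2"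
      by (simp add: power2_eq_square mult_ac)
    show "real (card A) * a > 0" using cpos a by simp
  qed
  show "measure_pmf.prob ?P {g. (\<Sum>i\<in>A. X (g i)) \<ge> real (card A) * (\<mu> + a)} \<le> 1 / 3"
    using gen[of 1] by (simp add: sum_subtractf algebra_simps)
  show "measure_pmf.prob ?P {g. (\<Sum>i\<in>A. X (g i)) \<le> real (card A) * (\<mu> - a)} \<le> 1 / 3"
    using gen[of "-1"] by (simp add: sum_subtractf algebra_simps)
qed

text \<open>The samples are drawn as one flat family, whereas the median sees them block by block.
  The fibre of the regrouping map over an \<open>f\<close> with default values off the blocks
  contains, up to null functions, only the \<open>g\<close> that reads \<open>f\<close> at quotient
  and remainder, so equality of the laws reduces to regrouping a finite product of point
  probabilities.\<close>

lemma Pi_pmf_blocks: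
  fixes D :: "'a pmf" and k b :: nat
  assumes b: "b > 0"
  shows "map_pmf (\<lambda>g j. if j < k then (\<lambda>i. if i < b then g (j * b + i) else d) else (\<lambda>_. d))
           (Pi_pmf {..<k * b} d (\<lambda>_. D))
       = Pi_pmf {..<k} (\<lambda>_. d) (\<lambda>_. Pi_pmf {..<b} d (\<lambda>_. D))" (is "map_pmf ?\<Phi> ?P = ?Q")
proof (rule pmf_eqI)
  fix f :: "nat \<Rightarrow> nat \<Rightarrow> 'a"
  have lt: "j * b + i < k * b" if "j < k" "i < b" for i j :: nat
  proof -
    have "j * b + i < Suc j * b" using that by simp
    also have "\<dots> \<le> k * b" using that by (intro mult_le_mono1) auto
    finally show ?thesis .
  qed
  show "pmf (map_pmf ?\<Phi> ?P) f = pmf ?Q f"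
  proof (cases "\<forall>j i. \<not> (j < k \<and> i < b) \<longrightarrow> f j i = d")
    case True
    define g where "g = (\<lambda>r. if r < k * b then f (r div b) (r mod b) else d)"
    have \<Phi>g: "?\<Phi> g = f"
    proof (intro ext)
      fix j i
      show "?\<Phi> g j i = f j i"
        using True lt[of j i] by (auto simp: g_def)
    qed
    have "pmf (map_pmf ?\<Phi> ?P) f = measure_pmf.prob ?P (?\<Phi> -` {f})" by (simp add: pmf_map)
    also have "\<dots> = measure_pmf.prob ?P {g}"
    proof (rule measure_prob_cong_0)
      fix h assume h: "h \<in> ?\<Phi> -` {f} - {g}"
      then have "h \<noteq> g" "?\<Phi> h = f" by auto
      \<comment> \<open>Any other function with the same image agrees with \<open>g\<close> inside
        the index range. It must therefore differ from the default \<open>d\<close> outside of it,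
        which has probability 0.\<close>
      have "\<exists>r. r \<notin> {..<k*b} \<and> h r \<noteq> d"
      proof (rule ccontr)
        assume neg: "\<not> ?thesis"
        have "h r = g r" for r
        proof (cases "r < k * b")
          case True
          then have "r div b < k" by (simp add: less_mult_imp_div_less)
          moreover have "r mod b < b" using b by simp
          ultimately have "?\<Phi> h (r div b) (r mod b) = h r" by simp
          moreover have "?\<Phi> h (r div b) (r mod b) = f (r div b) (r mod b)"
            using \<open>?\<Phi> h = f\<close> by (rule fun_cong[OF fun_cong])
          ultimately show ?thesis using True by (simp add: g_def)
        qed (use neg in \<open>auto simp: g_def\<close>)
        then show False using \<open>h \<noteq> g\<close> by auto
      qed
      then show "pmf ?P h = 0" by (intro pmf_Pi_outside) auto
    next
      fix h assume "h \<in> {g} - ?\<Phi> -` {f}"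
      then show "pmf ?P h = 0" using \<Phi>g by auto
    qed
    also have "\<dots> = pmf ?P g" by (simp add: measure_pmf_single)
    also have "\<dots> = (\<Prod>r<k*b. pmf D (g r))" by (intro pmf_Pi') (auto simp: g_def)
    also have "\<dots> = (\<Prod>j<k. \<Prod>r\<in>{j*b..<j*b+b}. pmf D (g r))"
      by (simp add: prod.nat_group)
    also have "\<dots> = (\<Prod>j<k. \<Prod>i<b. pmf D (f j i))"
    proof (rule prod.cong[OF refl])
      fix j assume j: "j \<in> {..<k}"
      have "(\<Prod>r\<in>{j*b..<j*b+b}. pmf D (g r)) = (\<Prod>i\<in>{0..<b}. pmf D (g (i + j*b)))"
        using prod.shift_bounds_nat_ivl[of "\<lambda>r. pmf D (g r)" 0 "j*b" b] by (simp add: add.commute)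
      also have "\<dots> = (\<Prod>i<b. pmf D (f j i))"
        using j lt by (intro prod.cong) (auto simp: g_def add.commute)
      finally show "(\<Prod>r\<in>{j*b..<j*b+b}. pmf D (g r)) = (\<Prod>i<b. pmf D (f j i))" .
    qed
    also have "\<dots> = pmf ?Q f"
    proof -
      have "pmf ?Q f = (\<Prod>j<k. pmf (Pi_pmf {..<b} d (\<lambda>_. D)) (f j))"
        using True by (intro pmf_Pi') auto
      also have "\<dots> = (\<Prod>j<k. \<Prod>i<b. pmf D (f j i))"
        using True by (intro prod.cong refl pmf_Pi') auto
      finally show ?thesis by simp
    qed
    finally show ?thesis .
  next
    case False
    then obtain j i where ji: "\<not> (j < k \<and> i < b)" "f j i \<noteq> d" by blast
    have "f \<notin> range ?\<Phi>"
    proof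
      assume "f \<in> range ?\<Phi>"
      then obtain g where "f = ?\<Phi> g" by blast
      then show False using ji by (auto split: if_splits)
    qed
    then have "f \<notin> set_pmf (map_pmf ?\<Phi> ?P)" by auto
    then have l: "pmf (map_pmf ?\<Phi> ?P) f = 0" by (simp only: set_pmf_iff not_not)
    have "pmf ?Q f = 0"
    proof (cases "j < k")
      case True
      then have "pmf (Pi_pmf {..<b} d (\<lambda>_. D)) (f j) = 0" using ji by (intro pmf_Pi_outside) auto
      then show ?thesis using True by (subst pmf_Pi) (auto simp: prod_zero_iff)
    next
      case False
      then have "\<exists>x. x \<notin> {..<k} \<and> f x \<noteq> (\<lambda>_. d)" using ji by auto
      then show ?thesis by (intro pmf_Pi_outside) auto
    qed
    with l show ?thesis by simp
  qed
qed

section \<open>Diagrams and their normal form\<close>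

lemma node_vars_mono: "(q, q') \<in> (edges B)\<^sup>* \<Longrightarrow> node_vars B q' \<subseteq> node_vars B q"
  unfolding node_vars_def by (auto intro: rtrancl_trans)

lemma node_vars_rec:
  assumes "q \<in> set (nodes B)"
  shows "node_vars B q = {x. decides B x q} \<union> (\<Union>c\<in>set (children B q). node_vars B c)"
proof
  show "node_vars B q \<subseteq> {x. decides B x q} \<union> (\<Union>c\<in>set (children B q). node_vars B c)"
  proof
    fix x assume "x \<in> node_vars B q"
    then obtain q' where "(q, q') \<in> (edges B)\<^sup>*" "decides B x q'" by (auto simp: node_vars_def)
    then show "x \<in> {x. decides B x q} \<union> (\<Union>c\<in>set (children B q). node_vars B c)"
      by (cases rule: converse_rtranclE) (auto simp: node_vars_def edges_def)
  qed
  show "{x. decides B x q} \<union> (\<Union>c\<in>set (children B q). node_vars B c) \<subseteq> node_vars B q"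
  proof (intro Un_least UN_least)
    show "{x. decides B x q} \<subseteq> node_vars B q" by (auto simp: node_vars_def)
    fix c assume "c \<in> set (children B q)"
    then have "(q, c) \<in> edges B" using assms by (simp add: edges_def)
    then show "node_vars B c \<subseteq> node_vars B q" by (intro node_vars_mono) auto
  qed
qed

lemma node_vars_sink:
  "q \<in> set (nodes B) \<Longrightarrow> gate_of B q = Sink b \<Longrightarrow> node_vars B q = {}"
  by (simp add: node_vars_rec decides_def children_def)

lemma node_vars_ite:
  "q \<in> set (nodes B) \<Longrightarrow> gate_of B q = Ite x q1 q0 \<Longrightarrow>
     node_vars B q = insert x (node_vars B q1 \<union> node_vars B q0)"
  by (auto simp: node_vars_rec[of q] decides_def children_def)

lemma node_vars_or:
  "q \<in> set (nodes B) \<Longrightarrow> gate_of B q = Or qs \<Longrightarrow> node_vars B q = (\<Union>c\<in>set qs. node_vars B c)"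
  by (simp add: node_vars_rec decides_def children_def)

lemma accepts_sink_iff: "gate_of B q = Sink b \<Longrightarrow> accepts B \<alpha> q \<longleftrightarrow> b"
  by (subst accepts.simps) auto

lemma accepts_ite_iff: "gate_of B q = Ite x q1 q0 \<Longrightarrow>
   accepts B \<alpha> q \<longleftrightarrow> (\<exists>b. \<alpha> x = Some b \<and> accepts B \<alpha> (if b then q1 else q0))"
  by (subst accepts.simps) auto

lemma accepts_or_iff: "gate_of B q = Or qs \<Longrightarrow> accepts B \<alpha> q \<longleftrightarrow> (\<exists>c\<in>set qs. accepts B \<alpha> c)"
  by (subst accepts.simps) auto

locale nbdd =
  fixes B :: "('q, 'v) bdd"
  assumes nbdd: "nBDD B"
begin

lemma distinct_nodes: "distinct (nodes B)"
  and source_node: "source B \<in> set (nodes B)"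
  and children_nodes: "q \<in> set (nodes B) \<Longrightarrow> c \<in> set (children B q) \<Longrightarrow> c \<in> set (nodes B)"
  and acyclic_edges: "acyclic (edges B)"
  and sink_ex1: "\<exists>!q. q \<in> set (nodes B) \<and> gate_of B q = Sink b"
  and or_nonempty: "q \<in> set (nodes B) \<Longrightarrow> gate_of B q \<noteq> Or []"
  and parent_ex: "q \<in> set (nodes B) \<Longrightarrow> q \<noteq> source B \<Longrightarrow> \<not> is_sink B q \<Longrightarrow> \<exists>q'. (q', q) \<in> edges B"
  using nbdd unfolding nBDD_def by auto

lemma edge_nodes: "(q, c) \<in> edges B \<Longrightarrow> q \<in> set (nodes B) \<and> c \<in> set (nodes B)"
  using children_nodes by (auto simp: edges_def)

lemma rtrancl_nodes: "(q, c) \<in> (edges B)\<^sup>* \<Longrightarrow> q \<in> set (nodes B) \<Longrightarrow> c \<in> set (nodes B)"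
  by (induction rule: rtrancl_induct) (auto dest: edge_nodes)

lemma wf_edges: "wf (edges B)" and wf_edges_converse: "wf ((edges B)\<inverse>)"
proof -
  have "edges B \<subseteq> set (nodes B) \<times> set (nodes B)" using edge_nodes by auto
  then have "finite (edges B)" by (rule finite_subset) auto
  then show "wf (edges B)" "wf ((edges B)\<inverse>)"
    using acyclic_edges by (auto intro: finite_acyclic_wf finite_acyclic_wf_converse)
qed

lemma node_vars_subset_var_list: "q \<in> set (nodes B) \<Longrightarrow> node_vars B q \<subseteq> set (var_list B)"
proof
  fix x assume q: "q \<in> set (nodes B)" and "x \<in> node_vars B q"
  then obtain q' where "(q, q') \<in> (edges B)\<^sup>*" "decides B x q'" by (auto simp: node_vars_def)
  moreover from this q have "q' \<in> set (nodes B)" by (auto intro: rtrancl_nodes)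
  ultimately show "x \<in> set (var_list B)"
    by (auto simp: var_list_def decides_def intro!: bexI[of _ q'])
qed

lemma finite_node_vars: "q \<in> set (nodes B) \<Longrightarrow> finite (node_vars B q)"
  using node_vars_subset_var_list finite_subset by blast

text \<open>Acceptance at \<open>q\<close> only reads variables that label decision nodes reachable
  from \<open>q\<close>, and agreement on these is inherited along every edge. So variables outside
  \<open>node_vars B q\<close> can be set or erased at will.\<close>

lemma accepts_mono:
  assumes "accepts B \<alpha> q" "q \<in> set (nodes B)"
    and "\<And>x b. x \<in> node_vars B q \<Longrightarrow> \<alpha> x = Some b \<Longrightarrow> \<beta> x = Some b"
  shows "accepts B \<beta> q"
  using assms
proof (induction rule: accepts.induct)
  case (accepts_sink q) then show ?case by (simp add: accepts.accepts_sink)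
next
  case (accepts_ite q x q1 q0 b)
  have nv: "node_vars B q = insert x (node_vars B q1 \<union> node_vars B q0)"
    using accepts_ite by (simp add: node_vars_ite)
  have "(if b then q1 else q0) \<in> set (nodes B)"
    using accepts_ite children_nodes[of q] by (auto simp: children_def)
  then have "accepts B \<beta> (if b then q1 else q0)"
    by (intro accepts_ite.IH) (use accepts_ite.prems nv in \<open>auto split: if_splits\<close>)
  moreover have "\<beta> x = Some b" using accepts_ite nv by auto
  ultimately show ?case using accepts_ite by (simp add: accepts.accepts_ite)
next
  case (accepts_or q qs c)
  have nv: "node_vars B q = (\<Union>c\<in>set qs. node_vars B c)"
    using accepts_or by (simp add: node_vars_or)
  have "c \<in> set (nodes B)"
    using accepts_or children_nodes[of q] by (auto simp: children_def)
  then have "accepts B \<beta> c"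
    by (intro accepts_or.IH) (use accepts_or nv in auto)
  then show ?case using accepts_or by (blast intro: accepts.accepts_or)
qed

lemma Mod_nonempty_iff:
  assumes q: "q \<in> set (nodes B)"
  shows "Mod B q \<noteq> {} \<longleftrightarrow> (\<exists>\<alpha>. accepts B \<alpha> q)"
proof
  assume "\<exists>\<alpha>. accepts B \<alpha> q"
  then obtain \<alpha> where a: "accepts B \<alpha> q" by blast
  \<comment> \<open>Variables below \<open>q\<close> that \<open>\<alpha>\<close> leaves open
    receive the arbitrary value \<open>True\<close>; the accepting path does not visit them.\<close>
  let ?\<beta> = "\<lambda>x. if x \<in> node_vars B q then (case \<alpha> x of None \<Rightarrow> Some True | Some b \<Rightarrow> Some b) else None"
  have "accepts B ?\<beta> q" by (rule accepts_mono[OF a q]) auto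
  moreover have "dom ?\<beta> = node_vars B q" by (auto split: option.splits if_splits)
  ultimately show "Mod B q \<noteq> {}" by (auto simp: Mod_def)
qed (auto simp: Mod_def)

text \<open>Climbing from parent to parent ends because the edge relation is well-founded, and the
  only non-sink node without a parent is the source.\<close>

lemma reachable_nonsink:
  "q \<in> set (nodes B) \<Longrightarrow> \<not> is_sink B q \<Longrightarrow> (source B, q) \<in> (edges B)\<^sup>*"
proof (induction q rule: wf_induct_rule[OF wf_edges])
  case (1 q)
  show ?case
  proof (cases "q = source B")
    case False
    then obtain q' where q': "(q', q) \<in> edges B" using 1 parent_ex by blast
    then have "\<not> is_sink B q'" "q' \<in> set (nodes B)" by (auto simp: edges_def is_sink_def children_def)
    then have "(source B, q') \<in> (edges B)\<^sup>*" using 1 q' by blast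
    then show ?thesis using q' by simp
  qed simp
qed

lemma path_ex:
  assumes "(a, b) \<in> (edges B)\<^sup>*" "a \<in> set (nodes B)"
  shows "\<exists>\<pi>. is_path B \<pi> \<and> hd \<pi> = a \<and> last \<pi> = b"
  using assms
proof (induction rule: converse_rtrancl_induct)
  case base
  then show ?case by (intro exI[of _ "[b]"]) (auto simp: is_path_def)
next
  case (step a c)
  then obtain \<pi> where \<pi>: "is_path B \<pi>" "hd \<pi> = c" "last \<pi> = b" using edge_nodes by blast
  then show ?case using step
    by (intro exI[of _ "a # \<pi>"]) (auto simp: is_path_def successively_Cons)
qed

end

locale nfbdd =
  fixes B :: "('q, 'v) bdd"
  assumes nfbdd: "nFBDD B"

sublocale nfbdd \<subseteq> nbdd
  by unfold_locales (use nfbdd in \<open>simp add: nFBDD_def\<close>)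

context nfbdd
begin

text \<open>A second test of \<open>x\<close> below \<open>c\<close> would lie on a common path with
  \<open>q\<close>.\<close>

lemma read_once:
  assumes q: "q \<in> set (nodes B)" and g: "gate_of B q = Ite x q1 q0" and c: "c = q1 \<or> c = q0"
  shows "x \<notin> node_vars B c"
proof
  assume "x \<in> node_vars B c"
  then obtain q' where q': "(c, q') \<in> (edges B)\<^sup>*" "decides B x q'" by (auto simp: node_vars_def)
  have e: "(q, c) \<in> edges B" using q g c by (auto simp: edges_def children_def)
  with q' obtain \<pi> where \<pi>: "is_path B \<pi>" "hd \<pi> = c" "last \<pi> = q'"
    using path_ex[of c q'] edge_nodes by blast
  have "is_path B (q # \<pi>)" using \<pi> e q by (auto simp: is_path_def successively_Cons)
  then have "occurrences B x (q # \<pi>) \<le> 1" using nfbdd by (simp add: nFBDD_def)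
  moreover have "decides B x q" using g by (simp add: decides_def)
  ultimately have "filter (decides B x) \<pi> = []" by (simp add: occurrences_def)
  moreover have "q' \<in> set \<pi>" using \<pi> by (metis is_path_def last_in_set)
  ultimately show False using q' by (auto simp: filter_empty_conv)
qed

text \<open>At a decision node the model of the child is changed at the tested variable so that the
  edge to \<open>c\<close> is taken; by the read-once property this does not disturb acceptance at
  \<open>c\<close>. So liveness is inherited upwards, and every decision node met when climbing from
  a live node is the start of two origins.\<close>

lemma live_parent:
  assumes e: "(q, c) \<in> edges B" and c: "Mod B c \<noteq> {}"
  shows "Mod B q \<noteq> {}"
proof -
  have q: "q \<in> set (nodes B)" "c \<in> set (nodes B)" using e edge_nodes by auto
  then obtain \<alpha> where \<alpha>: "accepts B \<alpha> c" using c Mod_nonempty_iff by blast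
  show ?thesis
  proof (cases "gate_of B q")
    case (Sink b) then show ?thesis using e by (simp add: edges_def children_def)
  next
    case (Ite x q1 q0)
    then have c': "c = q1 \<or> c = q0" using e by (auto simp: edges_def children_def)
    define b where "b = (c = q1)"
    have cb: "c = (if b then q1 else q0)" using c' by (auto simp: b_def)
    have "accepts B (\<alpha>(x \<mapsto> b)) c"
      by (rule accepts_mono[OF \<alpha> q(2)]) (use read_once[OF q(1) Ite c'] in auto)
    then have "accepts B (\<alpha>(x \<mapsto> b)) q" using Ite cb by (simp add: accepts_ite_iff)
    then show ?thesis using q Mod_nonempty_iff by blast
  next
    case (Or qs)
    then have "accepts B \<alpha> q" using e \<alpha> by (auto simp: accepts_or_iff edges_def children_def)
    then show ?thesis using q Mod_nonempty_iff by blast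
  qed
qed

section \<open>Contraction of the Or-nodes into jumps\<close>

lemma or_step_edges: "or_step B \<subseteq> edges B"
  by (auto simp: or_step_def edges_def)

lemma targets_iff: "t \<in> set (targets B q) \<longleftrightarrow>
    t \<in> set (nodes B) \<and> (q, t) \<in> (or_step B)\<^sup>* \<and> \<not> is_or B t \<and> Mod B t \<noteq> {}"
  by (auto simp: targets_def)

lemma accepts_or_steps: "(q, t) \<in> (or_step B)\<^sup>* \<Longrightarrow> accepts B \<alpha> t \<Longrightarrow> accepts B \<alpha> q"
  by (induction rule: converse_rtrancl_induct)
    (auto simp: or_step_def is_or_def children_def intro: accepts_or)

text \<open>An accepting path leaves the Or-nodes at a first sink or decision node. That node
  accepts an assignment, so it passes the liveness filter in \<open>targets\<close>, and the
  contraction loses no accepting path.\<close>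

lemma accepts_iff_targets:
  assumes "q \<in> set (nodes B)"
  shows "accepts B \<alpha> q \<longleftrightarrow> (\<exists>t\<in>set (targets B q). accepts B \<alpha> t)"
proof
  assume "accepts B \<alpha> q"
  then show "\<exists>t\<in>set (targets B q). accepts B \<alpha> t" using assms
  proof (induction rule: accepts.induct)
    case (accepts_sink q)
    then have "accepts B \<alpha> q" by (simp add: accepts.accepts_sink)
    then show ?case using accepts_sink Mod_nonempty_iff
      by (intro bexI[of _ q]) (auto simp: targets_iff is_or_def)
  next
    case (accepts_ite q x q1 q0 b)
    then have "accepts B \<alpha> q" by (simp add: accepts.accepts_ite)
    then show ?case using accepts_ite Mod_nonempty_iff
      by (intro bexI[of _ q]) (auto simp: targets_iff is_or_def)
  next
    case (accepts_or q qs c)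
    then have s: "(q, c) \<in> or_step B" by (auto simp: or_step_def is_or_def children_def)
    then obtain t where "t \<in> set (targets B c)" "accepts B \<alpha> t"
      using accepts_or children_nodes[of q c] by (auto simp: or_step_def)
    then show ?case using converse_rtrancl_into_rtrancl[OF s] by (intro bexI[of _ t]) (auto simp: targets_iff)
  qed
qed (auto simp: targets_iff intro: accepts_or_steps)

lemma targets_vars: "t \<in> set (targets B q) \<Longrightarrow> node_vars B t \<subseteq> node_vars B q"
  using rtrancl_mono[OF or_step_edges] by (intro node_vars_mono) (auto simp: targets_iff)

text \<open>The 0-sink has no model, so liveness leaves only the 1-sink among the sinks.\<close>

lemma target_cases:
  assumes "t \<in> set (targets B q)"
  obtains (decision) x t1 t0 where "gate_of B t = Ite x t1 t0" "t \<in> set (live_decisions B)"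
    | (sink) "gate_of B t = Sink True" "node_vars B t = {}"
proof (cases "gate_of B t")
  case (Sink b)
  have "b"
  proof (rule ccontr)
    assume "\<not> b"
    then have "Mod B t = {}" using Sink by (auto simp: Mod_def accepts_sink_iff)
    then show False using assms by (simp add: targets_iff)
  qed
  then show ?thesis using Sink assms sink by (auto simp: targets_iff node_vars_sink)
next
  case (Ite x t1 t0)
  then show ?thesis using assms decision by (auto simp: targets_iff live_decisions_def is_decision_def)
next
  case (Or qs)
  then show ?thesis using assms by (auto simp: targets_iff is_or_def)
qed

lemma origins_iff: "o' \<in> set (origins B) \<longleftrightarrow>
    o' = None \<or> (\<exists>d b. o' = Some (d, b) \<and> d \<in> set (live_decisions B))"
  by (auto simp: origins_def)

lemma live_decisions_iff: "d \<in> set (live_decisions B) \<longleftrightarrow>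
    d \<in> set (nodes B) \<and> is_decision B d \<and> Mod B d \<noteq> {}"
  by (auto simp: live_decisions_def)

lemma origin_head_node: "o' \<in> set (origins B) \<Longrightarrow> origin_head B o' \<in> set (nodes B)"
  using source_node children_nodes
  by (auto simp: origins_iff live_decisions_iff is_decision_def children_def)

lemma origin_head_vars:
  assumes "o' \<in> set (origins B)"
  shows "node_vars B (origin_head B o') \<subseteq> origin_vars B o'"
proof (cases o')
  case (Some p)
  moreover obtain d b where p: "p = (d, b)" by (cases p)
  ultimately obtain x q1 q0 where d: "d \<in> set (nodes B)" and g: "gate_of B d = Ite x q1 q0"
    using assms by (auto simp: origins_iff live_decisions_iff is_decision_def)
  show ?thesis using Some p g read_once[OF d g] by (auto simp: decides_def node_vars_ite[OF d g])
qed (simp add: bdd_vars_def)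

lemma origin_vars_subset: "o' \<in> set (origins B) \<Longrightarrow> origin_vars B o' \<subseteq> bdd_vars B"
proof (cases o')
  case (Some p)
  assume "o' \<in> set (origins B)"
  moreover obtain d b where "p = (d, b)" by (cases p)
  ultimately have "o' = Some (d, b)" "d \<in> set (nodes B)" "\<not> is_sink B d"
    using Some by (auto simp: origins_iff live_decisions_iff is_decision_def is_sink_def)
  then show ?thesis using node_vars_mono[OF reachable_nonsink[of d]] by (auto simp: bdd_vars_def)
qed (simp add: bdd_vars_def)

lemma bdd_vars_var_list: "bdd_vars B \<subseteq> set (var_list B)"
  using node_vars_subset_var_list source_node by (simp add: bdd_vars_def)

lemma jumps_iff: "(o', t) \<in> set (jumps B) \<longleftrightarrow>
    o' \<in> set (origins B) \<and> t \<in> set (targets B (origin_head B o')) \<and> origin_vars B o' \<noteq> {}"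
  by (auto simp: jumps_def)

lemma distinct_pads: "distinct (pads B o' t)"
  by (simp add: pads_def var_list_def)

lemma set_pads:
  assumes "o' \<in> set (origins B)"
  shows "set (pads B o' t) = origin_vars B o' - node_vars B t"
  using origin_vars_subset[OF assms] bdd_vars_var_list by (auto simp: pads_def)

text \<open>A target tests at most the variables still expected at the origin, and the pads are
  precisely the missing ones. With the pads inserted, all jumps from one origin test the same
  variables, each of them once, which is the source of 1-completeness.\<close>

lemma jump_vars:
  assumes "(o', t) \<in> set (jumps B)"
  shows "origin_vars B o' = set (pads B o' t) \<union> node_vars B t" "node_vars B t \<inter> set (pads B o' t) = {}"
  using assms set_pads[of o' t] origin_head_vars[of o'] targets_vars[of t "origin_head B o'"]
  by (auto simp: jumps_iff)

text \<open>The pads are distinct, so the variable \<open>y\<close> alone fixes the position in the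
  list. This is why a pad node need not carry an index.\<close>

lemma pads_after_split:
  assumes "pads B o' t = xs @ y # ys"
  shows "pads_after B o' t y = ys"
proof -
  have "y \<notin> set xs" using distinct_pads[of o' t] assms by auto
  then have "dropWhile (\<lambda>z. z \<noteq> y) (xs @ y # ys) = y # ys"
    by (subst dropWhile_append2) auto
  then show ?thesis using assms by (simp add: pads_after_def)
qed

lemma pads_split:
  assumes "y \<in> set (pads B o' t)"
  obtains xs where "pads B o' t = xs @ y # pads_after B o' t y"
  using assms pads_after_split by (metis split_list)

lemma entry_join: "(o', t) \<in> set (jumps B) \<Longrightarrow> entry B o' = Join o'"
  by (auto simp: jumps_iff entry_def)

section \<open>Nodes and gates of the normal form\<close>

abbreviation "N \<equiv> normalise B"

lemma normalise_simps [simp]: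
  "nodes N = normal_nodes B" "gate_of N = normal_gate B" "source N = entry B None"
  by (simp_all add: normalise_def)

lemma in_normal_nodes:
  "NSink b \<in> set (normal_nodes B)"
  "Dec d \<in> set (normal_nodes B) \<longleftrightarrow> d \<in> set (live_decisions B)"
  "Join o' \<in> set (normal_nodes B) \<longleftrightarrow> o' \<in> set (origins B) \<and> entry B o' = Join o'"
  "Pad o' t y \<in> set (normal_nodes B) \<longleftrightarrow> (o', t) \<in> set (jumps B) \<and> y \<in> set (pads B o' t)"
  "PadJoin o' t y \<in> set (normal_nodes B) \<longleftrightarrow>
     (o', t) \<in> set (jumps B) \<and> y \<in> set (pads B o' t) \<and> below_pad B o' t y = PadJoin o' t y"
proof -
  have e: "o1 = o'" if "entry B o1 = Join o'" for o1 o' using that by (simp add: entry_def split: if_splits)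
  have p: "o1 = o' \<and> t1 = t \<and> y1 = y" if "below_pad B o1 t1 y1 = PadJoin o' t y"
    for o1 t1 y1 o' t y using that by (simp add: below_pad_def split: if_splits)
  have ne: "entry B o1 \<noteq> Dec d" "entry B o1 \<noteq> Pad o' t y" "entry B o1 \<noteq> PadJoin o' t y" for o1 d o' t y
    by (auto simp: entry_def)
  have nb: "below_pad B o1 t1 y1 \<noteq> Dec d" "below_pad B o1 t1 y1 \<noteq> Pad o' t y" "below_pad B o1 t1 y1 \<noteq> Join o'"
    for o1 t1 y1 d o' t y
    by (auto simp: below_pad_def)
  note ns = ne[symmetric] nb[symmetric]
  have S: "q \<in> set (normal_nodes B) \<longleftrightarrow> q = NSink False \<or> q = NSink True \<or> q \<in> Dec ` set (live_decisions B)
     \<or> (\<exists>o1\<in>set (origins B). q = entry B o1 \<and> (\<exists>o'. q = Join o'))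
     \<or> (\<exists>o1 t1. (o1, t1) \<in> set (jumps B) \<and> q \<in> Pad o1 t1 ` set (pads B o1 t1))
     \<or> (\<exists>o1 t1. (o1, t1) \<in> set (jumps B) \<and> q \<in> below_pad B o1 t1 ` set (pads B o1 t1) \<and> q \<noteq> NSink True)" for q
  proof -
    have 1: "set [Pad o' t y. (o', t) \<leftarrow> jumps B, y \<leftarrow> pads B o' t]
        = (\<Union>p\<in>set (jumps B). Pad (fst p) (snd p) ` set (pads B (fst p) (snd p)))"
      by (simp add: case_prod_unfold)
    have 2: "set [below_pad B o' t y. (o', t) \<leftarrow> jumps B, y \<leftarrow> pads B o' t]
        = (\<Union>p\<in>set (jumps B). below_pad B (fst p) (snd p) ` set (pads B (fst p) (snd p)))"
      by (simp add: case_prod_unfold)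
    have "set (normal_nodes B) = {NSink False, NSink True} \<union> Dec ` set (live_decisions B)
       \<union> {q \<in> entry B ` set (origins B). \<exists>o'. q = Join o'}
       \<union> (\<Union>p\<in>set (jumps B). Pad (fst p) (snd p) ` set (pads B (fst p) (snd p)))
       \<union> {q \<in> \<Union>p\<in>set (jumps B). below_pad B (fst p) (snd p) ` set (pads B (fst p) (snd p)). q \<noteq> NSink True}"
      unfolding normal_nodes_def set_append set_filter 1 2 by (simp add: Un_assoc)
    then show ?thesis by (simp add: Bex_def image_iff) blast
  qed
  show "NSink b \<in> set (normal_nodes B)" unfolding S by (cases b) simp_all
  show "Dec d \<in> set (normal_nodes B) \<longleftrightarrow> d \<in> set (live_decisions B)"
    unfolding S by (auto simp: ns)
  show "Join o' \<in> set (normal_nodes B) \<longleftrightarrow> o' \<in> set (origins B) \<and> entry B o' = Join o'"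
  proof -
    have "Join o' \<in> set (normal_nodes B) \<longleftrightarrow> (\<exists>o1\<in>set (origins B). entry B o1 = Join o')"
      unfolding S by (auto simp: ns image_iff eq_commute[of "Join o'"])
    then show ?thesis using e by metis
  qed
  show "Pad o' t y \<in> set (normal_nodes B) \<longleftrightarrow> (o', t) \<in> set (jumps B) \<and> y \<in> set (pads B o' t)"
    unfolding S by (auto simp: ns)
  show "PadJoin o' t y \<in> set (normal_nodes B) \<longleftrightarrow>
     (o', t) \<in> set (jumps B) \<and> y \<in> set (pads B o' t) \<and> below_pad B o' t y = PadJoin o' t y"
  proof -
    have "PadJoin o' t y \<in> set (normal_nodes B) \<longleftrightarrow>
       (\<exists>(o1,t1)\<in>set (jumps B). \<exists>y1\<in>set (pads B o1 t1). below_pad B o1 t1 y1 = PadJoin o' t y)"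
      unfolding S by (auto simp: ns image_iff eq_commute[of "PadJoin o' t y"])
    then show ?thesis by (auto dest: p)
  qed
qed

text \<open>The variables that are still tested on every path from a node of the normal form to the 1-sink.\<close>

fun remaining :: "('q, 'v) nnode \<Rightarrow> 'v set" where
  "remaining (NSink b) = {}"
| "remaining (Dec d) = node_vars B d"
| "remaining (Join o') = origin_vars B o'"
| "remaining (Pad o' t y) = insert y (set (pads_after B o' t y)) \<union> node_vars B t"
| "remaining (PadJoin o' t y) = set (pads_after B o' t y) \<union> node_vars B t"

text \<open>The node of the original diagram that accepts the same assignments, see
  \<open>accepts_normal\<close>. A node in the interior of a jump stands for the target of that
  jump.\<close>

fun base :: "('q, 'v) nnode \<Rightarrow> 'q" where
  "base (NSink b) = (THE q. q \<in> set (nodes B) \<and> gate_of B q = Sink b)"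
| "base (Dec d) = d"
| "base (Join o') = origin_head B o'"
| "base (Pad o' t y) = t"
| "base (PadJoin o' t y) = t"

lemma route_props:
  assumes j: "(o', t) \<in> set (jumps B)" and p: "pads B o' t = xs @ ys" and ne: "ys \<noteq> [] \<or> \<not> is_sink B t"
  shows "route o' t ys \<in> set (nodes N)" "is_decision N (route o' t ys)"
    "remaining (route o' t ys) = set ys \<union> node_vars B t" "base (route o' t ys) = t"
proof -
  have t: "t \<in> set (targets B (origin_head B o'))" using j by (simp add: jumps_iff)
  have "route o' t ys \<in> set (nodes N) \<and> is_decision N (route o' t ys)
    \<and> remaining (route o' t ys) = set ys \<union> node_vars B t \<and> base (route o' t ys) = t"
  proof (cases ys)
    case Nil
    then have "\<not> is_sink B t" using ne by simp
    with t obtain x t1 t0 where "gate_of B t = Ite x t1 t0" "t \<in> set (live_decisions B)"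
      by (elim target_cases) (auto simp: is_sink_def)
    then show ?thesis using Nil by (auto simp: in_normal_nodes is_decision_def)
  next
    case (Cons y zs)
    then have "pads_after B o' t y = zs" using p by (intro pads_after_split) simp
    then show ?thesis using Cons j p by (auto simp: in_normal_nodes is_decision_def)
  qed
  then show "route o' t ys \<in> set (nodes N)" "is_decision N (route o' t ys)"
    "remaining (route o' t ys) = set ys \<union> node_vars B t" "base (route o' t ys) = t" by auto
qed

text \<open>An empty list of pads together with a sink as target would mean that nothing remains to
  be tested at the origin, and such origins have no jumps. This excludes the one situation in which
  \<open>route\<close> would point to a node that is not a decision node.\<close>

lemma jump_route:
  assumes j: "(o', t) \<in> set (jumps B)"
  shows "pads B o' t \<noteq> [] \<or> \<not> is_sink B t"
proof -
  have t: "t \<in> set (targets B (origin_head B o'))" using j by (simp add: jumps_iff)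
  then show ?thesis
  proof (cases rule: target_cases)
    case decision then show ?thesis by (simp add: is_sink_def)
  next
    case sink
    then show ?thesis using j jump_vars(1)[OF j] by (auto simp: jumps_iff)
  qed
qed

lemma entry_props:
  assumes o': "o' \<in> set (origins B)"
  shows "entry B o' \<in> set (nodes N)" "is_or N (entry B o') \<or> is_sink N (entry B o')"
    "entry B o' = NSink False \<or> remaining (entry B o') = origin_vars B o'"
    "entry B o' = NSink False \<longleftrightarrow> targets B (origin_head B o') = []"
    "entry B o' = NSink True \<longleftrightarrow> targets B (origin_head B o') \<noteq> [] \<and> origin_vars B o' = {}"
  using o' by (auto simp: entry_def in_normal_nodes is_or_def is_sink_def)

lemma below_pad_props:
  assumes j: "(o', t) \<in> set (jumps B)" and y: "y \<in> set (pads B o' t)"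
  shows "below_pad B o' t y \<in> set (nodes N)" "is_or N (below_pad B o' t y) \<or> is_sink N (below_pad B o' t y)"
    "below_pad B o' t y \<noteq> NSink False" "remaining (below_pad B o' t y) = remaining (Pad o' t y) - {y}"
    "y \<notin> set (pads_after B o' t y) \<union> node_vars B t"
proof -
  obtain xs where xs: "pads B o' t = xs @ y # pads_after B o' t y" using y by (rule pads_split)
  have "y \<notin> set (pads_after B o' t y)" using distinct_pads[of o' t] xs by (metis distinct.simps(2) distinct_append)
  moreover have "y \<notin> node_vars B t" using y jump_vars(2)[OF j] by auto
  ultimately show yn: "y \<notin> set (pads_after B o' t y) \<union> node_vars B t" by simp
  have t: "t \<in> set (targets B (origin_head B o'))" using j by (simp add: jumps_iff)
  have "node_vars B t = {}" if "is_sink B t"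
    using t that by (cases rule: target_cases) (auto simp: is_sink_def)
  then show "remaining (below_pad B o' t y) = remaining (Pad o' t y) - {y}"
    using yn by (auto simp: below_pad_def)
  show "below_pad B o' t y \<in> set (nodes N)" "is_or N (below_pad B o' t y) \<or> is_sink N (below_pad B o' t y)"
    "below_pad B o' t y \<noteq> NSink False"
    using j y by (auto simp: in_normal_nodes is_or_def is_sink_def below_pad_def)
qed

lemma live_gate:
  assumes "d \<in> set (live_decisions B)"
  obtains x q1 q0 where "gate_of B d = Ite x q1 q0"
    "normal_gate B (Dec d) = Ite x (entry B (Some (d, True))) (entry B (Some (d, False)))"
    "\<And>b. origin_head B (Some (d, b)) = (if b then q1 else q0)"
    "\<And>b. origin_vars B (Some (d, b)) = node_vars B d - {x}" "x \<in> node_vars B d"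
    "\<And>b. Some (d, b) \<in> set (origins B)"
proof -
  obtain x q1 q0 where g: "gate_of B d = Ite x q1 q0" using assms by (auto simp: live_decisions_iff is_decision_def)
  show thesis
    by (rule that[of x q1 q0]) (use g assms in \<open>auto simp: decides_def origins_iff live_decisions_iff node_vars_ite\<close>)
qed

lemma normal_sink: "q \<in> set (nodes N) \<Longrightarrow> gate_of N q = Sink b \<longleftrightarrow> q = NSink b"
  by (cases q) (auto simp: in_normal_nodes elim: live_gate)

text \<open>The 0-sink is exempt from the condition on \<open>remaining\<close>, because an edge to
  it may skip any number of variables. The third claim rests on the liveness of the copied decision
  nodes and yields 0-reducedness.\<close>

lemma normal_ite:
  assumes q: "q \<in> set (nodes N)" and g: "gate_of N q = Ite x e1 e0"
  shows "x \<in> remaining q"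
    "e \<in> {e1, e0} \<Longrightarrow> e \<in> set (nodes N) \<and> (is_or N e \<or> is_sink N e) \<and> (e = NSink False \<or> remaining e = remaining q - {x})"
    "\<exists>e\<in>{e1, e0}. e \<noteq> NSink False"
proof -
  have "x \<in> remaining q \<and> (\<forall>e\<in>{e1, e0}. e \<in> set (nodes N) \<and> (is_or N e \<or> is_sink N e) \<and> (e = NSink False \<or> remaining e = remaining q - {x}))
    \<and> (\<exists>e\<in>{e1, e0}. e \<noteq> NSink False)"
  proof (cases q)
    case (Dec d)
    then have d: "d \<in> set (live_decisions B)" using q by (simp add: in_normal_nodes)
    then obtain x' q1 q0 where l: "gate_of B d = Ite x' q1 q0"
      "normal_gate B (Dec d) = Ite x' (entry B (Some (d, True))) (entry B (Some (d, False)))"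
      "\<And>b. origin_head B (Some (d, b)) = (if b then q1 else q0)"
      "\<And>b. origin_vars B (Some (d, b)) = node_vars B d - {x'}" "x' \<in> node_vars B d"
      "\<And>b. Some (d, b) \<in> set (origins B)" by (rule live_gate) blast
    have e: "x = x'" "e1 = entry B (Some (d, True))" "e0 = entry B (Some (d, False))"
      using g Dec l(2) by auto
    \<comment> \<open>A live decision node accepts some assignment, and the edge chosen by that
      assignment leads to a head with at least one live target.\<close>
    have "\<exists>b. entry B (Some (d, b)) \<noteq> NSink False"
    proof -
      obtain \<alpha> where "accepts B \<alpha> d" using d Mod_nonempty_iff[of d] by (auto simp: live_decisions_iff)
      then obtain b where "accepts B \<alpha> (if b then q1 else q0)" using l(1) by (auto simp: accepts_ite_iff)
      then have "accepts B \<alpha> (origin_head B (Some (d, b)))" using l(3)[of b] by simp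
      then have "targets B (origin_head B (Some (d, b))) \<noteq> []"
        using accepts_iff_targets[OF origin_head_node[OF l(6)[of b]], of \<alpha>]
        by (metis bex_empty list.set(1))
      then show ?thesis using entry_props(4)[OF l(6)[of b]] by blast
    qed
    then have "\<exists>e\<in>{e1, e0}. e \<noteq> NSink False" using e by (metis (full_types) insertCI)
    then show ?thesis using e Dec l entry_props(1-3)[OF l(6)] by auto
  next
    case (Pad o' t y)
    then have "x = y" "e1 = below_pad B o' t y" "e0 = below_pad B o' t y" using g by auto
    then show ?thesis using Pad q below_pad_props[of o' t y] by (auto simp: in_normal_nodes)
  qed (use g in auto)
  then show "x \<in> remaining q"
    "e \<in> {e1, e0} \<Longrightarrow> e \<in> set (nodes N) \<and> (is_or N e \<or> is_sink N e) \<and> (e = NSink False \<or> remaining e = remaining q - {x})"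
    "\<exists>e\<in>{e1, e0}. e \<noteq> NSink False" by auto
qed

lemma normal_or:
  assumes q: "q \<in> set (nodes N)" and g: "gate_of N q = Or qs"
  shows "qs \<noteq> []"
    "c \<in> set qs \<Longrightarrow> c \<in> set (nodes N) \<and> is_decision N c \<and> remaining c = remaining q"
proof -
  have "qs \<noteq> [] \<and> (\<forall>c\<in>set qs. c \<in> set (nodes N) \<and> is_decision N c \<and> remaining c = remaining q)"
  proof (cases q)
    case (Dec d)
    then show ?thesis using q g by (auto simp: in_normal_nodes elim: live_gate)
  next
    case (Join o')
    then have o': "o' \<in> set (origins B)" "targets B (origin_head B o') \<noteq> []" "origin_vars B o' \<noteq> {}"
      and qs: "qs = map (\<lambda>t. route o' t (pads B o' t)) (targets B (origin_head B o'))"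
      using q g by (auto simp: in_normal_nodes entry_def split: if_splits)
    have "route o' t (pads B o' t) \<in> set (nodes N) \<and> is_decision N (route o' t (pads B o' t)) \<and>
        remaining (route o' t (pads B o' t)) = origin_vars B o'" if "t \<in> set (targets B (origin_head B o'))" for t
    proof -
      have j: "(o', t) \<in> set (jumps B)" using that o' by (simp add: jumps_iff)
      show ?thesis using route_props[OF j, of "[]" "pads B o' t"] jump_route[OF j] jump_vars[OF j] by simp
    qed
    then show ?thesis using qs Join o' by auto
  next
    case (PadJoin o' t y)
    then have j: "(o', t) \<in> set (jumps B)" and y: "y \<in> set (pads B o' t)" and b: "below_pad B o' t y = PadJoin o' t y"
      and qs: "qs = [route o' t (pads_after B o' t y)]" using q g by (auto simp: in_normal_nodes)
    obtain xs where xs: "pads B o' t = xs @ y # pads_after B o' t y" using y by (rule pads_split)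
    have ne: "pads_after B o' t y \<noteq> [] \<or> \<not> is_sink B t" using b by (auto simp: below_pad_def split: if_splits)
    show ?thesis using route_props[OF j _ ne, of "xs @ [y]"] xs qs PadJoin by simp
  qed (use g in auto)
  then show "qs \<noteq> []" "c \<in> set qs \<Longrightarrow> c \<in> set (nodes N) \<and> is_decision N c \<and> remaining c = remaining q" by auto
qed

end

section \<open>List facts, and nodes counted by edges\<close>

lemma distinct_concat_map:
  assumes "distinct xs" "\<And>x. x \<in> set xs \<Longrightarrow> distinct (g x)"
    and "\<And>x y. x \<in> set xs \<Longrightarrow> y \<in> set xs \<Longrightarrow> x \<noteq> y \<Longrightarrow> set (g x) \<inter> set (g y) = {}"
  shows "distinct (concat (map g xs))"
  using assms
proof (induction xs)
  case (Cons a xs)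
  have "set (g a) \<inter> (\<Union>x\<in>set xs. set (g x)) = {}" using Cons.prems(1) Cons.prems(3)[of a] by fastforce
  then show ?case using Cons by simp
qed simp

lemma distinct_filter_map:
  "distinct xs \<Longrightarrow> (\<And>a b. a \<in> set xs \<Longrightarrow> b \<in> set xs \<Longrightarrow> P (f a) \<Longrightarrow> f a = f b \<Longrightarrow> a = b)
    \<Longrightarrow> distinct (filter P (map f xs))"
  by (auto simp: filter_map distinct_map inj_on_def)

lemma sum_list_map_le:
  fixes f :: "'a \<Rightarrow> nat"
  assumes "\<And>x. x \<in> set xs \<Longrightarrow> f x \<le> c"
  shows "(\<Sum>x\<leftarrow>xs. f x) \<le> length xs * c"
  using assms
proof (induction xs)
  case (Cons a xs)
  then have "f a \<le> c" "(\<Sum>x\<leftarrow>xs. f x) \<le> length xs * c" by auto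
  then show ?case by simp
qed simp

context nbdd
begin

lemma bdd_size_concat: "bdd_size B = length (concat (map (children B) (nodes B)))"
  by (simp add: bdd_size_def length_concat o_def)

text \<open>Every node other than the source and the two sinks is a child of some node, so it is
  paid for by an edge.\<close>

lemma length_nodes_le: "length (nodes B) \<le> bdd_size B + 3"
proof -
  obtain sT where sT: "\<And>q. q \<in> set (nodes B) \<Longrightarrow> gate_of B q = Sink True \<Longrightarrow> q = sT"
    using sink_ex1[of True] by blast
  obtain sF where sF: "\<And>q. q \<in> set (nodes B) \<Longrightarrow> gate_of B q = Sink False \<Longrightarrow> q = sF"
    using sink_ex1[of False] by blast
  have "set (nodes B) \<subseteq> {source B, sT, sF} \<union> set (concat (map (children B) (nodes B)))"
  proof
    fix q assume q: "q \<in> set (nodes B)"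
    show "q \<in> {source B, sT, sF} \<union> set (concat (map (children B) (nodes B)))"
    proof (cases "q = source B \<or> is_sink B q")
      case True
      then show ?thesis using sT[OF q] sF[OF q]
        by (auto simp: is_sink_def) (metis (full_types))
    next
      case False
      then obtain q' where "(q', q) \<in> edges B" using q parent_ex by blast
      then show ?thesis by (auto simp: edges_def)
    qed
  qed
  then have "card (set (nodes B)) \<le> card ({source B, sT, sF} \<union> set (concat (map (children B) (nodes B))))"
    by (intro card_mono) auto
  also have "\<dots> \<le> card {source B, sT, sF} + card (set (concat (map (children B) (nodes B))))"
    by (rule card_Un_le)
  also have "\<dots> \<le> 3 + bdd_size B"
    unfolding bdd_size_concat by (intro add_mono card_length) (simp add: card_insert_if)
  finally show ?thesis using distinct_nodes by (simp add: distinct_card)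
qed

end

context nfbdd
begin

section \<open>Levels, tested variables and models of the normal form\<close>

lemma remaining_subset: "q \<in> set (nodes N) \<Longrightarrow> remaining q \<subseteq> bdd_vars B"
proof (cases q)
  case (Dec d)
  assume "q \<in> set (nodes N)"
  then have "d \<in> set (nodes B)" "\<not> is_sink B d"
    using Dec by (auto simp: in_normal_nodes live_decisions_iff is_decision_def is_sink_def)
  then show ?thesis using Dec node_vars_mono[OF reachable_nonsink[of d]] by (simp add: bdd_vars_def)
next
  case (Join o')
  assume "q \<in> set (nodes N)"
  then show ?thesis using Join origin_vars_subset[of o'] by (simp add: in_normal_nodes)
next
  case (Pad o' t y)
  assume "q \<in> set (nodes N)"
  then have j: "(o', t) \<in> set (jumps B)" and y: "y \<in> set (pads B o' t)" using Pad by (auto simp: in_normal_nodes)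
  obtain xs where xs: "pads B o' t = xs @ y # pads_after B o' t y" using y by (rule pads_split)
  have "set (pads_after B o' t y) \<subseteq> set (pads B o' t)" by (subst xs) auto
  then have "remaining q \<subseteq> origin_vars B o'" using jump_vars(1)[OF j] y Pad by auto
  then show ?thesis using origin_vars_subset[of o'] j by (auto simp: jumps_iff)
next
  case (PadJoin o' t y)
  assume "q \<in> set (nodes N)"
  then have j: "(o', t) \<in> set (jumps B)" and y: "y \<in> set (pads B o' t)" using PadJoin by (auto simp: in_normal_nodes)
  obtain xs where xs: "pads B o' t = xs @ y # pads_after B o' t y" using y by (rule pads_split)
  have "set (pads_after B o' t y) \<subseteq> set (pads B o' t)" by (subst xs) auto
  then have "remaining q \<subseteq> origin_vars B o'" using jump_vars(1)[OF j] y PadJoin by auto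
  then show ?thesis using origin_vars_subset[of o'] j by (auto simp: jumps_iff)
qed simp

lemma finite_bdd_vars: "finite (bdd_vars B)"
  using finite_node_vars source_node by (simp add: bdd_vars_def)

lemma finite_remaining: "q \<in> set (nodes N) \<Longrightarrow> finite (remaining q)"
  using remaining_subset finite_bdd_vars finite_subset by blast

lemma remaining_true_sink: "is_sink N e \<Longrightarrow> e \<in> set (nodes N) \<Longrightarrow> remaining e = {}"
proof -
  assume "is_sink N e" and e: "e \<in> set (nodes N)"
  then obtain b where "gate_of N e = Sink b" by (metis is_sink_def)
  then have "e = NSink b" using normal_sink[OF e] by blast
  then show ?thesis by simp
qed

text \<open>Or-nodes and decision nodes alternate, and each decision uses up one variable, so this
  is the length of every path to the 1-sink. Sinks get level 0 by truncated subtraction.\<close>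

definition level :: "('q, 'v) nnode \<Rightarrow> nat" where
  "level q = (if is_or N q then 2 * card (remaining q) else 2 * card (remaining q) - 1)"

lemma level_ite:
  assumes q: "q \<in> set (nodes N)" and g: "gate_of N q = Ite x e1 e0" and e: "e \<in> {e1, e0}" "e \<noteq> NSink False"
  shows "Suc (level e) = level q"
proof -
  note i = normal_ite(1)[OF q g] normal_ite(2)[OF q g e(1)]
  have fin: "finite (remaining q)" using q by (rule finite_remaining)
  have r: "remaining e = remaining q - {x}" using i e by blast
  have c: "card (remaining e) = card (remaining q) - 1" using r i(1) fin by simp
  have pos: "card (remaining q) > 0" using i(1) fin by (auto simp: card_gt_0_iff)
  have nor: "\<not> is_or N q" using g by (simp add: is_or_def)
  show ?thesis
  proof (cases "is_or N e")
    case True then show ?thesis using c pos nor by (simp add: level_def)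
  next
    case False
    then have "is_sink N e" using i by blast
    then have "remaining e = {}" using remaining_true_sink i by blast
    then show ?thesis using c pos nor False by (simp add: level_def)
  qed
qed

lemma level_or:
  assumes q: "q \<in> set (nodes N)" and g: "gate_of N q = Or qs" and c: "c \<in> set qs"
  shows "Suc (level c) = level q"
proof -
  note i = normal_or(2)[OF q g c]
  obtain x e1 e0 where "gate_of N c = Ite x e1 e0" using i by (auto simp: is_decision_def simp del: normalise_simps)
  then have "x \<in> remaining c" "\<not> is_or N c" using normal_ite(1)[of c] i
    by (auto simp: is_or_def simp del: normalise_simps)
  then have "card (remaining c) > 0" using finite_remaining[of c] i by (auto simp: card_gt_0_iff)
  then show ?thesis using i g \<open>\<not> is_or N c\<close> by (simp add: level_def is_or_def)
qed

text \<open>Into the 0-sink the level may drop by more than one and \<open>remaining\<close>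
  collapses to the empty set; therefore only a strict decrease is claimed in general, and the
  equation for \<open>remaining\<close> is restricted to the other children.\<close>

lemma normal_edge:
  assumes e: "(q, c) \<in> edges N"
  shows "q \<in> set (nodes N)" "c \<in> set (nodes N)" "level c < level q" "remaining c \<subseteq> remaining q"
    "decides N x q \<Longrightarrow> x \<in> remaining q \<and> x \<notin> remaining c"
    "c \<noteq> NSink False \<Longrightarrow> remaining q = remaining c \<union> {x. decides N x q}"
proof -
  show q: "q \<in> set (nodes N)" using e by (simp add: edges_def del: normalise_simps)
  have cc: "c \<in> set (children N q)" using e by (simp add: edges_def)
  have "c \<in> set (nodes N) \<and> level c < level q \<and> remaining c \<subseteq> remaining q
     \<and> (\<forall>x. decides N x q \<longrightarrow> x \<in> remaining q \<and> x \<notin> remaining c)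
     \<and> (c \<noteq> NSink False \<longrightarrow> remaining q = remaining c \<union> {x. decides N x q})"
  proof (cases "gate_of N q")
    case (Sink b) then show ?thesis using cc by (simp add: children_def)
  next
    case (Ite x e1 e0)
    then have c': "c \<in> {e1, e0}" using cc by (simp add: children_def)
    note i = normal_ite(1)[OF q Ite] normal_ite(2)[OF q Ite c']
    have d: "decides N y q \<longleftrightarrow> y = x" for y using Ite by (auto simp: decides_def)
    have "level c < level q"
    proof (cases "c = NSink False")
      case True
      have "card (remaining q) > 0" using i(1) finite_remaining[OF q] by (auto simp: card_gt_0_iff)
      then have "level q > 0" by (simp add: level_def)
      moreover have "level c = 0" using True by (simp add: level_def is_or_def)
      ultimately show ?thesis by simp
    next
      case False
      then show ?thesis using level_ite[OF q Ite c'] by simp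
    qed
    moreover have "c = NSink False \<Longrightarrow> remaining c = {}" by simp
    ultimately show ?thesis using i d by auto
  next
    case (Or qs)
    then have c': "c \<in> set qs" using cc by (simp add: children_def)
    have "\<not> decides N y q" for y using Or by (simp add: decides_def)
    then show ?thesis using normal_or(2)[OF q Or c'] level_or[OF q Or c'] by auto
  qed
  then show "c \<in> set (nodes N)" "level c < level q" "remaining c \<subseteq> remaining q"
    "decides N x q \<Longrightarrow> x \<in> remaining q \<and> x \<notin> remaining c"
    "c \<noteq> NSink False \<Longrightarrow> remaining q = remaining c \<union> {x. decides N x q}" by auto
qed

lemma normal_acyclic: "acyclic (edges N)"
proof -
  have "(edges N)\<inverse> \<subseteq> Wellfounded.measure level" using normal_edge(3) by auto
  then have "wf ((edges N)\<inverse>)" by (rule wf_subset[OF wf_measure])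
  then show ?thesis using wf_acyclic acyclic_converse by blast
qed

lemma normal_child_ex:
  assumes q: "q \<in> set (nodes N)" and "\<not> is_sink N q"
  shows "\<exists>c. (q, c) \<in> edges N \<and> c \<noteq> NSink False"
proof (cases "gate_of N q")
  case (Sink b) then show ?thesis using assms by (simp add: is_sink_def)
next
  case (Ite x e1 e0)
  then show ?thesis using normal_ite(3)[OF q Ite] q by (auto simp: edges_def children_def)
next
  case (Or qs)
  obtain c where c: "c \<in> set qs" using normal_or(1)[OF q Or] by (cases qs) auto
  then have "is_decision N c" using normal_or(2)[OF q Or] by blast
  then show ?thesis using c q Or by (auto simp: edges_def children_def is_decision_def)
qed

text \<open>\<open>remaining\<close> is computed from the original diagram. It agrees with the
  variables tested in the normal form because every inner node has a child other than the 0-sink,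
  which already accounts for all variables except the one tested at the node itself.\<close>

lemma node_vars_normal: "q \<in> set (nodes N) \<Longrightarrow> node_vars N q = remaining q"
proof (induction "level q" arbitrary: q rule: less_induct)
  case less
  have IH: "node_vars N c = remaining c" if "c \<in> set (children N q)" for c
  proof -
    have "(q, c) \<in> edges N" using that less.prems by (simp add: edges_def)
    then show ?thesis using normal_edge less.hyps by blast
  qed
  have r: "node_vars N q = {x. decides N x q} \<union> (\<Union>c\<in>set (children N q). remaining c)"
    using node_vars_rec[OF less.prems] IH by simp
  show ?case
  proof (cases "is_sink N q")
    case True
    then have "children N q = []" "\<And>x. \<not> decides N x q"
      by (auto simp: is_sink_def decides_def children_def)
    then show ?thesis using r remaining_true_sink[OF True less.prems] by simp
  next
    case False
    then obtain c where c: "(q, c) \<in> edges N" "c \<noteq> NSink False" using normal_child_ex less.prems by blast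
    have "remaining q \<subseteq> node_vars N q" unfolding normal_edge(6)[OF c] r using c by (auto simp: edges_def)
    moreover have "node_vars N q \<subseteq> remaining q"
      unfolding r using c normal_edge(4,5) less.prems by (fastforce simp: edges_def)
    ultimately show ?thesis by blast
  qed
qed

text \<open>A test of \<open>x\<close> removes \<open>x\<close> from \<open>remaining\<close> for
  good, so there is at most one. Apart from an edge into the 0-sink nothing else removes
  \<open>x\<close>, and \<open>remaining\<close> is empty at the 1-sink, so a path that ends there
  has at least one.\<close>

lemma normal_occurrences:
  "is_path N \<pi> \<Longrightarrow> occurrences N x \<pi> \<le> (if x \<in> remaining (hd \<pi>) then 1 else 0)"
  "is_path N \<pi> \<Longrightarrow> gate_of N (last \<pi>) = Sink True \<Longrightarrow> x \<in> remaining (hd \<pi>) \<Longrightarrow> occurrences N x \<pi> \<ge> 1"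
proof -
  have "is_path N \<pi> \<Longrightarrow> occurrences N x \<pi> \<le> (if x \<in> remaining (hd \<pi>) then 1 else 0) \<and>
    (gate_of N (last \<pi>) = Sink True \<longrightarrow> x \<in> remaining (hd \<pi>) \<longrightarrow> occurrences N x \<pi> \<ge> 1)"
  proof (induction \<pi>)
    case Nil then show ?case by (simp add: is_path_def)
  next
    case (Cons q \<pi>)
    have q: "q \<in> set (nodes N)" using Cons.prems by (simp add: is_path_def)
    show ?case
    proof (cases \<pi>)
      case Nil
      have "decides N x q \<Longrightarrow> x \<in> remaining q" using normal_ite(1)[OF q] by (auto simp: decides_def)
      moreover have "gate_of N q = Sink True \<Longrightarrow> remaining q = {}" using normal_sink[OF q, of True] by auto
      ultimately show ?thesis using Nil by (auto simp: occurrences_def)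
    next
      case (Cons c \<rho>)
      have p: "is_path N \<pi>" and e: "(q, c) \<in> edges N"
        using Cons.prems Cons by (auto simp: is_path_def)
      note IH = Cons.IH[OF p]
      have occ: "occurrences N x (q # \<pi>) = (if decides N x q then 1 else 0) + occurrences N x \<pi>"
        by (simp add: occurrences_def)
      have hd: "hd \<pi> = c" "last (q # \<pi>) = last \<pi>" using Cons by auto
      have "occurrences N x (q # \<pi>) \<le> (if x \<in> remaining q then 1 else 0)"
        using IH normal_edge(4,5)[OF e] hd by (auto simp: occ split: if_splits)
      moreover have "occurrences N x (q # \<pi>) \<ge> 1" if l: "gate_of N (last \<pi>) = Sink True" "x \<in> remaining q"
      proof (cases "c = NSink False")
        case True
        \<comment> \<open>A path that enters the 0-sink ends in it, contrary to ending in the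
          1-sink.\<close>
        have "\<rho> = []"
        proof (rule ccontr)
          assume "\<rho> \<noteq> []"
          then obtain c' where "(c, c') \<in> edges N" using p Cons by (cases \<rho>) (auto simp: is_path_def)
          then show False using True by (simp add: edges_def children_def)
        qed
        then show ?thesis using l True Cons by simp
      next
        case False
        then show ?thesis using IH l normal_edge(6)[OF e False] hd by (auto simp: occ)
      qed
      ultimately show ?thesis using hd by simp
    qed
  qed
  then show "is_path N \<pi> \<Longrightarrow> occurrences N x \<pi> \<le> (if x \<in> remaining (hd \<pi>) then 1 else 0)"
    "is_path N \<pi> \<Longrightarrow> gate_of N (last \<pi>) = Sink True \<Longrightarrow> x \<in> remaining (hd \<pi>) \<Longrightarrow> occurrences N x \<pi> \<ge> 1"
    by blast+
qed

text \<open>The two edges of a pad lead to the same node, but a test of an unassigned variable still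
  blocks a path; hence the assumption on \<open>dom \<alpha>\<close>. The Or-nodes entered through
  an origin are matched with the original diagram by \<open>accepts_iff_targets\<close>.\<close>

lemma accepts_normal:
  assumes "q \<in> set (nodes N)" "remaining q \<subseteq> dom \<alpha>"
  shows "accepts N \<alpha> q \<longleftrightarrow> accepts B \<alpha> (base q)"
  using assms
proof (induction "level q" arbitrary: q rule: less_induct)
  case less
  note q = less.prems(1)
  have IH: "accepts N \<alpha> c \<longleftrightarrow> accepts B \<alpha> (base c)" if "(q, c) \<in> edges N" for c
    using that normal_edge[OF that] less by blast
  show ?case
  proof (cases q)
    case (NSink b)
    have "gate_of B (base q) = Sink b" unfolding NSink base.simps by (rule the1I2[OF sink_ex1]) simp
    then show ?thesis using NSink by (simp add: accepts_sink_iff)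
  next
    case (Dec d)
    then have d: "d \<in> set (live_decisions B)" using q by (simp add: in_normal_nodes)
    then obtain x q1 q0 where l: "gate_of B d = Ite x q1 q0"
      "normal_gate B (Dec d) = Ite x (entry B (Some (d, True))) (entry B (Some (d, False)))"
      "\<And>b. origin_head B (Some (d, b)) = (if b then q1 else q0)"
      "\<And>b. origin_vars B (Some (d, b)) = node_vars B d - {x}" "x \<in> node_vars B d"
      "\<And>b. Some (d, b) \<in> set (origins B)" by (rule live_gate) blast
    have E: "accepts N \<alpha> (entry B (Some (d, b))) \<longleftrightarrow> accepts B \<alpha> (origin_head B (Some (d, b)))" for b
    proof -
      let ?o = "Some (d, b)"
      have e: "(q, entry B ?o) \<in> edges N"
        using Dec l(2) q by (cases b) (auto simp: edges_def children_def)
      note hn = origin_head_node[OF l(6)[of b]]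
      consider "entry B ?o = NSink False" "targets B (origin_head B ?o) = []"
        | "entry B ?o = NSink True" "targets B (origin_head B ?o) \<noteq> []" "origin_vars B ?o = {}"
        | "entry B ?o = Join ?o"
        by (metis entry_def)
      then show ?thesis
      proof cases
        case 1
        then show ?thesis using accepts_iff_targets[OF hn, of \<alpha>] by (simp add: accepts_sink_iff)
      next
        case 2
        then obtain t where t: "t \<in> set (targets B (origin_head B ?o))" by (cases "targets B (origin_head B ?o)") auto
        \<comment> \<open>An origin at which no variable remains can only jump to a target that
          tests nothing, hence to the 1-sink. Its entry is therefore rightly the 1-sink.\<close>
        have v: "node_vars B t = {}" using targets_vars[OF t] origin_head_vars[OF l(6)[of b]] 2(3) by blast
        have "accepts B \<alpha> t" using t
        proof (cases rule: target_cases)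
          case (decision x t1 t0)
          then have "x \<in> node_vars B t" using t by (simp add: targets_iff node_vars_ite)
          then show ?thesis using v by simp
        qed (simp add: accepts_sink_iff)
        then show ?thesis using 2 t accepts_iff_targets[OF hn, of \<alpha>] by (auto simp: accepts_sink_iff)
      next
        case 3
        then show ?thesis using IH[OF e] by simp
      qed
    qed
    have "accepts N \<alpha> q \<longleftrightarrow> (\<exists>b. \<alpha> x = Some b \<and> accepts N \<alpha> (entry B (Some (d, b))))"
    proof -
      have g: "gate_of N q = Ite x (entry B (Some (d, True))) (entry B (Some (d, False)))" using Dec l(2) by simp
      have "(if b then entry B (Some (d, True)) else entry B (Some (d, False))) = entry B (Some (d, b))" for b
        by simp
      then show ?thesis unfolding accepts_ite_iff[OF g] by simp
    qed
    also have "\<dots> \<longleftrightarrow> (\<exists>b. \<alpha> x = Some b \<and> accepts B \<alpha> (origin_head B (Some (d, b))))"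
      by (simp only: E)
    also have "\<dots> \<longleftrightarrow> accepts B \<alpha> d"
      unfolding l(3) accepts_ite_iff[OF l(1)] by (rule refl)
    finally show ?thesis using Dec by simp
  next
    case (Join o')
    then have o': "o' \<in> set (origins B)" "origin_vars B o' \<noteq> {}"
      using q by (auto simp: in_normal_nodes entry_def split: if_splits)
    have R: "accepts N \<alpha> (route o' t (pads B o' t)) \<longleftrightarrow> accepts B \<alpha> t"
      if t: "t \<in> set (targets B (origin_head B o'))" for t
    proof -
      have j: "(o', t) \<in> set (jumps B)" using t o' by (simp add: jumps_iff)
      have e: "(q, route o' t (pads B o' t)) \<in> edges N" using Join t q by (auto simp: edges_def children_def)
      show ?thesis using IH[OF e] route_props(4)[OF j, of "[]" "pads B o' t"] jump_route[OF j] by simp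
    qed
    have "accepts N \<alpha> q \<longleftrightarrow> (\<exists>t\<in>set (targets B (origin_head B o')). accepts N \<alpha> (route o' t (pads B o' t)))"
      using Join by (simp add: accepts_or_iff)
    then show ?thesis using R Join accepts_iff_targets[OF origin_head_node[OF o'(1)]] by simp
  next
    case (Pad o' t y)
    then have j: "(o', t) \<in> set (jumps B)" and y: "y \<in> set (pads B o' t)" using q by (auto simp: in_normal_nodes)
    have e: "(q, below_pad B o' t y) \<in> edges N" using Pad q by (simp add: edges_def children_def)
    have "accepts N \<alpha> (below_pad B o' t y) \<longleftrightarrow> accepts B \<alpha> t"
    proof (cases "below_pad B o' t y = PadJoin o' t y")
      case True then show ?thesis using IH[OF e] by simp
    next
      case False
      then have s: "is_sink B t" "below_pad B o' t y = NSink True" by (auto simp: below_pad_def split: if_splits)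
      have "t \<in> set (targets B (origin_head B o'))" using j by (simp add: jumps_iff)
      then have "gate_of B t = Sink True" using s by (cases rule: target_cases) (auto simp: is_sink_def)
      then show ?thesis using s by (simp add: accepts_sink_iff)
    qed
    moreover have "\<exists>b. \<alpha> y = Some b" using less.prems Pad by auto
    moreover have "gate_of N q = Ite y (below_pad B o' t y) (below_pad B o' t y)" using Pad by simp
    note accepts_ite_iff[OF this, of \<alpha>]
    ultimately show ?thesis using Pad by simp
  next
    case (PadJoin o' t y)
    then have j: "(o', t) \<in> set (jumps B)" and y: "y \<in> set (pads B o' t)" and b: "below_pad B o' t y = PadJoin o' t y"
      using q by (auto simp: in_normal_nodes)
    obtain xs where xs: "pads B o' t = xs @ y # pads_after B o' t y" using y by (rule pads_split)
    have ne: "pads_after B o' t y \<noteq> [] \<or> \<not> is_sink B t" using b by (auto simp: below_pad_def split: if_splits)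
    have e: "(q, route o' t (pads_after B o' t y)) \<in> edges N" using PadJoin q by (simp add: edges_def children_def)
    have "accepts N \<alpha> q \<longleftrightarrow> accepts N \<alpha> (route o' t (pads_after B o' t y))"
      using PadJoin by (simp add: accepts_or_iff)
    then show ?thesis using IH[OF e] route_props(4)[OF j _ ne, of "xs @ [y]"] xs PadJoin by simp
  qed
qed

text \<open>Climb from \<open>q\<close> through Or-nodes until the source or an edge of a decision
  node is met. That decision node is live by \<open>live_parent\<close>, so its edge is an
  origin.\<close>

lemma live_jump_ex:
  assumes "q \<in> set (nodes B)" "Mod B q \<noteq> {}" "\<not> is_sink B q"
  shows "\<exists>o'\<in>set (origins B). (origin_head B o', q) \<in> (or_step B)\<^sup>*"
  using assms
proof (induction q rule: wf_induct_rule[OF wf_edges])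
  case (1 q)
  show ?case
  proof (cases "q = source B")
    case True
    then show ?thesis by (intro bexI[of _ None]) (auto simp: origins_iff)
  next
    case False
    then obtain q' where e: "(q', q) \<in> edges B" using 1 parent_ex by blast
    then have q': "q' \<in> set (nodes B)" "Mod B q' \<noteq> {}" "\<not> is_sink B q'"
      using live_parent[OF e] 1 by (auto simp: edges_def is_sink_def children_def)
    show ?thesis
    proof (cases "gate_of B q'")
      case (Sink b) then show ?thesis using q' by (simp add: is_sink_def)
    next
      case (Ite x q1 q0)
      then have "q = q1 \<or> q = q0" using e by (auto simp: edges_def children_def)
      then have "origin_head B (Some (q', q = q1)) = q" using Ite by auto
      moreover have "Some (q', q = q1) \<in> set (origins B)"
        using q' Ite by (auto simp: origins_iff live_decisions_iff is_decision_def)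
      ultimately show ?thesis by (intro bexI) auto
    next
      case (Or qs)
      then have "(q', q) \<in> or_step B" using e by (auto simp: edges_def or_step_def is_or_def)
      moreover obtain o' where "o' \<in> set (origins B)" "(origin_head B o', q') \<in> (or_step B)\<^sup>*"
        using 1 e q' by blast
      ultimately show ?thesis by (meson rtrancl.rtrancl_into_rtrancl)
    qed
  qed
qed

text \<open>A copied decision node is the target of a jump by \<open>live_jump_ex\<close>, and its
  parent is the last Or-node of that jump. A pad has its predecessor on its own jump. An Or-node
  that starts a jump hangs below the copy of the decision node of its origin.\<close>

lemma normal_parent_ex:
  assumes q: "q \<in> set (nodes N)" and ns: "q \<noteq> Join None" "\<not> is_sink N q"
  shows "\<exists>q'. (q', q) \<in> edges N"
proof -
  have rt: "\<exists>q'. (q', route o' t ys) \<in> edges N"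
    if j: "(o', t) \<in> set (jumps B)" and p: "pads B o' t = xs @ ys" and ne: "ys \<noteq> [] \<or> \<not> is_sink B t" for o' t xs ys
  proof (cases xs rule: rev_cases)
    case Nil
    then have "(Join o', route o' t ys) \<in> edges N"
      using j p entry_join[OF j] by (auto simp: edges_def in_normal_nodes children_def jumps_iff)
    then show ?thesis by blast
  next
    case (snoc zs z)
    then have z: "pads_after B o' t z = ys" "z \<in> set (pads B o' t)" using p by (auto intro: pads_after_split)
    then have "below_pad B o' t z = PadJoin o' t z" using ne by (auto simp: below_pad_def)
    then have "(PadJoin o' t z, route o' t ys) \<in> edges N"
      using j z by (simp add: edges_def in_normal_nodes children_def)
    then show ?thesis by blast
  qed
  show ?thesis
  proof (cases q)
    case (NSink b) then show ?thesis using ns by (simp add: is_sink_def)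
  next
    case (Dec d)
    then have d: "d \<in> set (live_decisions B)" using q by (simp add: in_normal_nodes)
    then have d': "d \<in> set (nodes B)" "Mod B d \<noteq> {}" "\<not> is_sink B d" "\<not> is_or B d"
      by (auto simp: live_decisions_iff is_decision_def is_sink_def is_or_def)
    then obtain o' where o': "o' \<in> set (origins B)" "(origin_head B o', d) \<in> (or_step B)\<^sup>*"
      using live_jump_ex by blast
    then have t: "d \<in> set (targets B (origin_head B o'))" using d' by (simp add: targets_iff)
    obtain x where "x \<in> node_vars B d" using d by (elim live_gate)
    then have "origin_vars B o' \<noteq> {}" using targets_vars[OF t] origin_head_vars[OF o'(1)] by blast
    then have "(o', d) \<in> set (jumps B)" using t o' by (simp add: jumps_iff)
    then show ?thesis using rt[of o' d "pads B o' d" "[]"] d' Dec by simp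
  next
    case (Join o')
    then have o': "o' \<in> set (origins B)" "entry B o' = Join o'" using q by (auto simp: in_normal_nodes)
    then obtain d b where d: "o' = Some (d, b)" "d \<in> set (live_decisions B)" using ns Join by (auto simp: origins_iff)
    obtain x where "normal_gate B (Dec d) = Ite x (entry B (Some (d, True))) (entry B (Some (d, False)))"
      using d(2) by (elim live_gate)
    then have "(Dec d, q) \<in> edges N"
      using d Join o' by (cases b) (auto simp: edges_def in_normal_nodes children_def simp del: normal_gate.simps)
    then show ?thesis by blast
  next
    case (Pad o' t y)
    then have j: "(o', t) \<in> set (jumps B)" and y: "y \<in> set (pads B o' t)" using q by (auto simp: in_normal_nodes)
    obtain xs where "pads B o' t = xs @ y # pads_after B o' t y" using y by (rule pads_split)
    then show ?thesis using rt[OF j] Pad by fastforce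
  next
    case (PadJoin o' t y)
    then have "(Pad o' t y, q) \<in> edges N" using q by (auto simp: edges_def in_normal_nodes children_def)
    then show ?thesis by blast
  qed
qed

lemma join_none_no_parent: "(q, Join None) \<notin> edges N"
proof
  assume e: "(q, Join None) \<in> edges N"
  have en: "entry B (Some p) \<noteq> Join None" for p by (simp add: entry_def)
  have rn: "route o' t ys \<noteq> Join None" for o' t ys by (cases ys) auto
  have bn: "below_pad B o' t y \<noteq> Join None" for o' t y by (simp add: below_pad_def)
  show False
    using e by (cases q) (auto simp: edges_def children_def in_normal_nodes en[symmetric] rn[symmetric] bn[symmetric]
      simp del: normal_gate.simps(2) elim!: live_gate)
qed

lemma distinct_origins: "distinct (origins B)"
  unfolding origins_def
  using distinct_nodes by (auto simp: live_decisions_def intro!: distinct_concat_map)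

lemma distinct_jumps: "distinct (jumps B)"
  unfolding jumps_def
  using distinct_nodes by (auto simp: targets_def intro!: distinct_concat_map distinct_origins)

lemma distinct_normal_nodes: "distinct (nodes N)"
proof -
  have 1: "distinct (map Dec (live_decisions B))"
    using distinct_nodes by (auto simp: live_decisions_def distinct_map inj_on_def)
  have 2: "distinct (filter (\<lambda>q. \<exists>o'. q = Join o') (map (entry B) (origins B)))"
    by (rule distinct_filter_map[OF distinct_origins]) (auto simp: entry_def split: if_splits)
  have 3: "distinct [Pad o' t y. (o', t) \<leftarrow> jumps B, y \<leftarrow> pads B o' t]"
    by (intro distinct_concat_map distinct_jumps) (auto simp: distinct_map inj_on_def distinct_pads)
  have 4: "distinct (filter (\<lambda>q. q \<noteq> NSink True) [below_pad B o' t y. (o', t) \<leftarrow> jumps B, y \<leftarrow> pads B o' t])"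
    unfolding filter_concat map_map
    by (intro distinct_concat_map distinct_jumps)
      (auto simp: below_pad_def split: if_splits intro!: distinct_filter_map distinct_pads)
  have ne: "entry B o1 \<noteq> Dec d" "entry B o1 \<noteq> Pad o' t y" "entry B o1 \<noteq> PadJoin o' t y" for o1 d o' t y
    by (auto simp: entry_def)
  have nb: "below_pad B o1 t1 y1 \<noteq> Dec d" "below_pad B o1 t1 y1 \<noteq> Pad o' t y" "below_pad B o1 t1 y1 \<noteq> Join o'"
    "below_pad B o1 t1 y1 \<noteq> NSink False"
    for o1 t1 y1 d o' t y
    by (auto simp: below_pad_def)
  show ?thesis
    unfolding normalise_simps normal_nodes_def distinct_append
    using 1 2 3 4 by (auto simp: ne nb ne[symmetric] nb[symmetric])
qed

text \<open>All counts are made against the number \<open>s\<close> of edges. There are at most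
  \<open>s / 2\<close> decision nodes, hence at most \<open>2 * s\<close> origins; with at most
  \<open>4 * s\<close> nodes this gives at most \<open>8 * s\<^sup>2\<close> jumps, each with at
  most \<open>n\<close> pads. The nodes of the result have at most two children, except the
  \<open>Join\<close> nodes, whose children correspond to jumps.\<close>

lemma normal_size_bounds:
  assumes n: "n = card (bdd_vars B)" "n \<ge> 1"
  shows "length (nodes N) \<le> 21 * n * (bdd_size B)\<^sup>2" "bdd_size N \<le> 33 * n * (bdd_size B)\<^sup>2"
    "normalise_time B \<le> 100 * n * (bdd_size B)\<^sup>2" "bdd_size B \<ge> 1"
proof -
  define s where "s = bdd_size B"
  define D where "D = length (live_decisions B)"
  define ND where "ND = length (nodes B)"
  define P where "P = (\<Sum>p\<leftarrow>jumps B. length (pads B (fst p) (snd p)))"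
  have s2: "2 * card {q \<in> set (nodes B). is_decision B q} \<le> s"
  proof -
    have "2 * card {q \<in> set (nodes B). is_decision B q} = (\<Sum>q\<in>{q \<in> set (nodes B). is_decision B q}. length (children B q))"
      by (simp add: children_def is_decision_def) (subst sum.cong[OF refl, where h = "\<lambda>_. 2"], auto)
    also have "\<dots> \<le> (\<Sum>q\<in>set (nodes B). length (children B q))" by (intro sum_mono2) auto
    also have "\<dots> = s" using distinct_nodes by (simp add: s_def bdd_size_def sum_list_distinct_conv_sum_set)
    finally show ?thesis .
  qed
  have D: "2 * D \<le> s"
  proof -
    have "D = card (set (live_decisions B))"
      using distinct_nodes by (simp add: D_def live_decisions_def distinct_card del: set_filter)
    also have "\<dots> \<le> card {q \<in> set (nodes B). is_decision B q}"
      by (intro card_mono) (auto simp: live_decisions_iff)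
    finally show ?thesis using s2 by simp
  qed
  have s1: "s \<ge> 1"
  proof -
    obtain x where "x \<in> bdd_vars B" using n by (cases "bdd_vars B = {}") auto
    then obtain q where "(source B, q) \<in> (edges B)\<^sup>*" "decides B x q" by (auto simp: bdd_vars_def node_vars_def)
    then have "q \<in> {q \<in> set (nodes B). is_decision B q}"
      using source_node rtrancl_nodes by (auto simp: decides_def is_decision_def)
    then have "card {q \<in> set (nodes B). is_decision B q} > 0" by (auto simp: card_gt_0_iff)
    then show ?thesis using s2 by simp
  qed
  then show "bdd_size B \<ge> 1" by (simp add: s_def)
  have ND: "ND \<le> 4 * s" using length_nodes_le s1 by (simp add: ND_def s_def)
  have O: "length (origins B) = 1 + 2 * D"
    by (simp add: origins_def D_def length_concat o_def sum_list_triv)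
  have O2: "1 + 2 * D \<le> 2 * s" using D s1 by simp
  have tg: "length (targets B q) \<le> ND" for q by (simp add: targets_def ND_def)
  have J: "length (jumps B) \<le> (1 + 2 * D) * ND"
  proof -
    have "length (jumps B) = (\<Sum>o'\<leftarrow>origins B. length (concat (map (\<lambda>t. if origin_vars B o' \<noteq> {} then [(o', t)] else []) (targets B (origin_head B o')))))"
      by (simp add: jumps_def length_concat o_def)
    also have "\<dots> \<le> length (origins B) * ND"
    proof (rule sum_list_map_le)
      fix o'
      have "length (concat (map (\<lambda>t. if origin_vars B o' \<noteq> {} then [(o', t)] else []) (targets B (origin_head B o'))))
         \<le> length (targets B (origin_head B o')) * 1"
        unfolding length_concat map_map by (rule sum_list_map_le) simp
      then show "length (concat (map (\<lambda>t. if origin_vars B o' \<noteq> {} then [(o', t)] else []) (targets B (origin_head B o')))) \<le> ND"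
        using tg[of "origin_head B o'"] by simp
    qed
    finally show ?thesis using O by simp
  qed
  have pl: "length (pads B o' t) \<le> n" if "(o', t) \<in> set (jumps B)" for o' t
  proof -
    have "length (pads B o' t) = card (set (pads B o' t))" using distinct_pads by (simp add: distinct_card)
    also have "\<dots> \<le> n" unfolding n using that set_pads[of o' t] origin_vars_subset[of o']
      by (intro card_mono finite_bdd_vars) (auto simp: jumps_iff)
    finally show ?thesis .
  qed
  have "P \<le> length (jumps B) * n" unfolding P_def by (rule sum_list_map_le) (use pl in auto)
  also have "\<dots> \<le> (1 + 2 * D) * ND * n" using J by simp
  also have "\<dots> \<le> (2 * s) * (4 * s) * n" using O2 ND by (intro mult_le_mono) auto
  finally have P: "P \<le> 8 * (n * s\<^sup>2)" by (simp add: power2_eq_square mult_ac)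
  have l1: "length [Pad o' t y. (o', t) \<leftarrow> jumps B, y \<leftarrow> pads B o' t] = P"
    by (simp add: P_def length_concat o_def case_prod_unfold)
  have l2: "length (filter (\<lambda>q. q \<noteq> NSink True) [below_pad B o' t y. (o', t) \<leftarrow> jumps B, y \<leftarrow> pads B o' t]) \<le> P"
    by (rule order_trans[OF length_filter_le]) (simp add: P_def length_concat o_def case_prod_unfold)
  have l3: "length (filter (\<lambda>q. \<exists>o'. q = Join o') (map (entry B) (origins B))) \<le> 1 + 2 * D"
    by (rule order_trans[OF length_filter_le]) (simp add: O)
  have ns: "s \<le> n * s\<^sup>2" "1 \<le> n * s\<^sup>2" "s\<^sup>2 \<le> n * s\<^sup>2"
  proof -
    show "s\<^sup>2 \<le> n * s\<^sup>2" using n by simp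
    moreover have "s \<le> s\<^sup>2" using s1 by (simp add: power2_eq_square)
    ultimately show "s \<le> n * s\<^sup>2" "1 \<le> n * s\<^sup>2" using s1 by linarith+
  qed
  have "length (nodes N) \<le> 2 + D + (1 + 2 * D) + P + P"
    using l2 l3 unfolding normalise_simps normal_nodes_def length_append l1 length_map D_def by simp
  also have "\<dots> \<le> 2 + s + 2 * s + 16 * (n * s\<^sup>2)" using O2 D P by simp
  also have "\<dots> \<le> 21 * (n * s\<^sup>2)" using ns by linarith
  finally show LN: "length (nodes N) \<le> 21 * n * (bdd_size B)\<^sup>2" by (simp add: s_def mult.assoc)
  let ?f = "\<lambda>q. length (children N q)"
  have f1: "(\<Sum>q\<leftarrow>map Dec (live_decisions B). ?f q) \<le> D * 2"
  proof -
    have "(\<Sum>q\<leftarrow>map Dec (live_decisions B). ?f q) \<le> length (map (Dec :: 'q \<Rightarrow> ('q, 'v) nnode) (live_decisions B)) * 2"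
      by (rule sum_list_map_le) (auto simp: children_def split: gate.split)
    then show ?thesis by (simp add: D_def)
  qed
  have f2: "(\<Sum>q\<leftarrow>filter (\<lambda>q. \<exists>o'. q = Join o') (map (entry B) (origins B)). ?f q) \<le> (1 + 2 * D) * ND"
  proof -
    have "(\<Sum>q\<leftarrow>filter (\<lambda>q. \<exists>o'. q = Join o') (map (entry B) (origins B)). ?f q)
       \<le> length (filter (\<lambda>q. \<exists>o'. q = Join o') (map (entry B) (origins B))) * ND"
      by (rule sum_list_map_le) (use tg in \<open>auto simp: children_def\<close>)
    also have "\<dots> \<le> (1 + 2 * D) * ND" using l3 by (rule mult_le_mono1)
    finally show ?thesis .
  qed
  have f3: "(\<Sum>q\<leftarrow>[Pad o' t y. (o', t) \<leftarrow> jumps B, y \<leftarrow> pads B o' t]. ?f q) \<le> P * 2"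
    unfolding l1[symmetric] by (rule sum_list_map_le) (auto simp: children_def)
  have f4: "(\<Sum>q\<leftarrow>filter (\<lambda>q. q \<noteq> NSink True) [below_pad B o' t y. (o', t) \<leftarrow> jumps B, y \<leftarrow> pads B o' t]. ?f q) \<le> P * 1"
    by (rule order_trans[OF sum_list_map_le[where c = 1] mult_le_mono1[OF l2]])
      (auto simp: children_def below_pad_def split: if_splits)
  have "bdd_size N \<le> 0 + D * 2 + (1 + 2 * D) * ND + P * 2 + P * 1"
    using f1 f2 f3 f4 unfolding bdd_size_def normalise_simps normal_nodes_def map_append sum_list_append
    by (simp add: children_def[of _ "NSink _"])
  also have "\<dots> \<le> s + (2 * s) * (4 * s) + 24 * (n * s\<^sup>2)"
    using D P mult_le_mono[OF O2 ND] by linarith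
  also have "\<dots> = s + 8 * s\<^sup>2 + 24 * (n * s\<^sup>2)" by (simp add: power2_eq_square)
  also have "\<dots> \<le> 33 * (n * s\<^sup>2)" using ns by linarith
  finally show LE: "bdd_size N \<le> 33 * n * (bdd_size B)\<^sup>2" by (simp add: s_def mult.assoc)
  have t1: "(ND + s) * (1 + n + ND) \<le> 30 * (n * s\<^sup>2)"
  proof -
    have "1 + n + ND \<le> 6 * (n * s)"
    proof -
      have "n \<le> n * s" "s \<le> n * s" using n s1 by auto
      then show ?thesis using ND n by linarith
    qed
    then have "(ND + s) * (1 + n + ND) \<le> (5 * s) * (6 * (n * s))" using ND by (intro mult_le_mono) auto
    then show ?thesis by (simp add: power2_eq_square mult_ac)
  qed
  have "length (origins B) * ND * (1 + n) \<le> (2 * s) * (4 * s) * (2 * n)"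
    unfolding O using O2 ND n by (intro mult_le_mono) auto
  then have t2: "length (origins B) * ND * (1 + n) \<le> 16 * (n * s\<^sup>2)" by (simp add: power2_eq_square mult_ac)
  show "normalise_time B \<le> 100 * n * (bdd_size B)\<^sup>2"
    using t1 t2 LN LE unfolding normalise_time_def n(1)[symmetric] ND_def[symmetric] s_def[symmetric]
    by (simp add: mult.assoc)
qed

end

section \<open>Correctness of the normal form\<close>

locale nfbdd_live = nfbdd +
  assumes models_nonempty: "models B \<noteq> {}" and vars_nonempty: "bdd_vars B \<noteq> {}"
begin

text \<open>Without a model the entry at the start would be the 0-sink, and without a variable the
  1-sink. Only in the remaining case is the source an Or-node, as an alternating diagram
  requires.\<close>

lemma source_normal: "source N = Join None"
proof -
  obtain \<alpha> where "accepts B \<alpha> (source B)" using models_nonempty by (auto simp: models_def Mod_def)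
  then have "targets B (source B) \<noteq> []" using accepts_iff_targets[OF source_node] by (metis bex_empty list.set(1))
  then show ?thesis using vars_nonempty by (simp add: entry_def)
qed

lemma source_normal_node: "Join None \<in> set (nodes N)"
  using source_normal by (simp add: in_normal_nodes origins_iff)

lemma bdd_vars_normal: "bdd_vars N = bdd_vars B"
  using node_vars_normal[OF source_normal_node] source_normal by (simp add: bdd_vars_def)

lemma models_normal: "models N = models B"
  using accepts_normal[OF source_normal_node] node_vars_normal[OF source_normal_node] source_normal
  by (auto simp: models_def Mod_def bdd_vars_def)

lemma normal_form: "normal_form_of N B"
proof -
  have nb: "nBDD N"
    unfolding nBDD_def
  proof (intro conjI ballI allI impI)
    show "distinct (nodes N)" by (rule distinct_normal_nodes)
    show "source N \<in> set (nodes N)" using source_normal source_normal_node by simp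
    show "acyclic (edges N)" by (rule normal_acyclic)
    show "(q, source N) \<notin> edges N" for q using source_normal join_none_no_parent by simp
    fix q assume q: "q \<in> set (nodes N)"
    show "set (children N q) \<subseteq> set (nodes N)"
      using normal_edge(2)[of q] q by (auto simp: edges_def)
    show "gate_of N q \<noteq> Or []" using normal_or(1)[OF q] by blast
    show "\<exists>q'. (q', q) \<in> edges N" if "q \<noteq> source N" "\<not> is_sink N q"
      using that source_normal normal_parent_ex[OF q] by simp
  next
    fix b
    show "\<exists>!q. q \<in> set (nodes N) \<and> gate_of N q = Sink b"
      by (rule ex1I[of _ "NSink b"]) (use normal_sink in \<open>auto simp: in_normal_nodes\<close>)
  qed
  have nf: "nFBDD N"
    unfolding nFBDD_def
  proof (intro conjI allI impI nb)
    fix \<pi> x assume "is_path N \<pi>"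
    then show "occurrences N x \<pi> \<le> 1" using normal_occurrences(1)[of \<pi> x] by (simp split: if_splits)
  qed
  have "alternating N"
    unfolding alternating_def
  proof (intro conjI ballI impI)
    show "is_or N (source N)" using source_normal by (simp add: is_or_def)
    fix q c assume q: "q \<in> set (nodes N)" and c: "c \<in> set (children N q)"
    show "is_decision N c" if "is_or N q"
      using that normal_or(2)[OF q] c by (auto simp: is_or_def children_def)
    show "is_or N c \<or> is_sink N c" if "is_decision N q"
    proof -
      from that obtain x e1 e0 where g: "gate_of N q = Ite x e1 e0" by (auto simp: is_decision_def)
      then have "c \<in> {e1, e0}" using c by (simp add: children_def)
      then show ?thesis using normal_ite(2)[OF q g] by blast
    qed
  qed
  moreover have "one_complete N"
    unfolding one_complete_def
  proof (intro allI impI ballI, elim conjE)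
    fix \<pi> x assume p: "is_path N \<pi>" "hd \<pi> = source N" "gate_of N (last \<pi>) = Sink True" and x: "x \<in> bdd_vars N"
    have "x \<in> remaining (hd \<pi>)" using x p bdd_vars_normal source_normal by simp
    then show "occurrences N x \<pi> = 1" using normal_occurrences[OF p(1), of x] p(3) by simp
  qed
  moreover have "zero_reduced N"
    unfolding zero_reduced_def
  proof (intro ballI conjI impI)
    fix q assume q: "q \<in> set (nodes N)"
    have F: "gate_of N c = Sink False \<Longrightarrow> c \<in> set (nodes N) \<Longrightarrow> c = NSink False" for c using normal_sink by blast
    show "\<exists>c\<in>set (children N q). gate_of N c \<noteq> Sink False" if "is_decision N q"
    proof -
      from that obtain x e1 e0 where g: "gate_of N q = Ite x e1 e0" by (auto simp: is_decision_def)
      obtain e where e: "e \<in> {e1, e0}" "e \<noteq> NSink False" using normal_ite(3)[OF q g] by blast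
      then have "gate_of N e \<noteq> Sink False" using normal_ite(2)[OF q g e(1)] F by blast
      moreover have "e \<in> set (children N q)" using e g by (auto simp: children_def)
      ultimately show ?thesis by blast
    qed
    show "gate_of N c \<noteq> Sink False" if "is_or N q" "c \<in> set (children N q)" for c
      using that normal_or(2)[OF q, of _ c] by (auto simp: is_or_def children_def is_decision_def)
  qed
  ultimately show ?thesis
    using nf bdd_vars_normal models_normal by (simp add: normal_form_of_def)
qed

text \<open>Such a node has a decision node as parent, whose variable is not tested below it. For a
  single variable this leaves the source as the only Or-node, a case in which the union bound has to
  be counted exactly.\<close>

lemma or_remaining_less:
  assumes q: "q \<in> set (nodes N)" and o: "is_or N q" and ns: "q \<noteq> Join None"
  shows "card (remaining q) < card (bdd_vars B)"
proof -
  obtain q' where e: "(q', q) \<in> edges N" using normal_parent_ex[OF q ns] o by (auto simp: is_or_def is_sink_def)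
  have q': "q' \<in> set (nodes N)" using normal_edge(1)[OF e] .
  have "is_decision N q'"
  proof (cases "gate_of N q'")
    case (Or qs)
    then have "is_decision N q" using normal_or(2)[OF q' Or, of q] e by (simp add: edges_def children_def)
    then show ?thesis using o by (auto simp: is_or_def is_decision_def)
  qed (use e in \<open>auto simp: edges_def children_def is_decision_def\<close>)
  then obtain x where "decides N x q'" by (auto simp: is_decision_def decides_def)
  then have "remaining q \<subset> remaining q'" using normal_edge(4,5)[OF e] by blast
  then have "remaining q \<subset> bdd_vars B" using remaining_subset[OF q'] by blast
  then show ?thesis by (rule psubset_card_mono[OF finite_bdd_vars])
qed

end

section \<open>Running time\<close>

text \<open>The predicate \<open>Q\<close> transports the bounds on the sizes of the sampled sets
  from one step to the cost of the next one.\<close>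

definition cost_le :: "'a rand \<Rightarrow> nat \<Rightarrow> ('a \<Rightarrow> bool) \<Rightarrow> bool" where
  "cost_le m T Q \<longleftrightarrow> (\<forall>(a, t)\<in>set_pmf m. t \<le> T \<and> Q a)"

lemma cost_le_ret: "Q a \<Longrightarrow> cost_le (ret a) T Q"
  by (simp add: cost_le_def ret_def)

lemma cost_le_charge: "t \<le> T \<Longrightarrow> cost_le (charge t) T (\<lambda>_. True)"
  by (simp add: cost_le_def charge_def)

lemma cost_le_bind:
  "cost_le m T P \<Longrightarrow> (\<And>a. P a \<Longrightarrow> cost_le (f a) T' Q) \<Longrightarrow> cost_le (m \<bind>\<^sub>t f) (T + T') Q"
  by (fastforce simp: cost_le_def bind_rand_def intro: add_mono)

lemma cost_le_mono: "cost_le m T P \<Longrightarrow> T \<le> T' \<Longrightarrow> (\<And>a. P a \<Longrightarrow> Q a) \<Longrightarrow> cost_le m T' Q"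
  by (fastforce simp: cost_le_def)

lemma cost_le_map_rand:
  "(\<And>x. x \<in> set xs \<Longrightarrow> cost_le (f x) T (P x)) \<Longrightarrow> cost_le (map_rand f xs) (length xs * T) (\<lambda>ys. list_all2 P xs ys)"
proof (induction xs)
  case Nil then show ?case by (simp add: cost_le_ret)
next
  case (Cons x xs)
  have "cost_le (map_rand f (x # xs)) (T + (length xs * T + 0)) (\<lambda>ys. list_all2 P (x # xs) ys)"
    unfolding map_rand.simps
    by (intro cost_le_bind[where P = "P x"] cost_le_bind[where P = "\<lambda>ys. list_all2 P xs ys"] cost_le_ret Cons) (use Cons in auto)
  then show ?case by simp
qed

lemma cost_le_reduce: "cost_le (reduce S p) (card S) (\<lambda>A. A \<subseteq> S)"
  by (auto simp: cost_le_def reduce_def)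

lemma finite_otimes: "finite S \<Longrightarrow> finite S' \<Longrightarrow> finite (S \<otimes>\<^sub>a S')"
proof -
  assume "finite S" "finite S'"
  moreover have "S \<otimes>\<^sub>a S' = (\<lambda>(a, b). a ++ b) ` (S \<times> S')" by (auto simp: otimes_def)
  ultimately show ?thesis by simp
qed

lemma union_children_subset:
  "length Ss = length (children B q) \<Longrightarrow> union_children B q Ss \<subseteq> \<Union> (set Ss)"
proof
  fix \<alpha> assume "length Ss = length (children B q)" "\<alpha> \<in> union_children B q Ss"
  then obtain i where "i < length Ss" "\<alpha> \<in> Ss ! i" by (auto simp: union_children_def)
  then show "\<alpha> \<in> \<Union> (set Ss)" by (intro UnionI[OF nth_mem])
qed

lemma card_Union_set_le:
  "(\<And>A. A \<in> set As \<Longrightarrow> finite A \<and> card A \<le> M) \<Longrightarrow> finite (\<Union> (set As)) \<and> card (\<Union> (set As)) \<le> length As * M"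
proof (induction As)
  case (Cons A As)
  then have "card A \<le> M" "card (\<Union> (set As)) \<le> length As * M" by auto
  moreover have "card (A \<union> \<Union> (set As)) \<le> card A + card (\<Union> (set As))" by (rule card_Un_le)
  ultimately have "card (A \<union> \<Union> (set As)) \<le> M + length As * M" by linarith
  then show ?case using Cons by simp
qed simp

definition small :: "nat \<Rightarrow> nat \<Rightarrow> ('v \<rightharpoonup> bool) set list \<Rightarrow> bool" where
  "small N M Ss \<longleftrightarrow> length Ss = N \<and> (\<forall>A\<in>set Ss. finite A \<and> card A \<le> M)"

lemma smallD: "small N M Ss \<Longrightarrow> r < N \<Longrightarrow> finite (Ss ! r) \<and> card (Ss ! r) \<le> M"
  by (auto simp: small_def)

lemma decision_step_cost_le:
  assumes S: "small N M (snd st q0)" "small N M (snd st q1)"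
  shows "cost_le (decision_step B n \<kappa> N st x q1 q0) ((1 + n + N) + N * (M + (M + (1 + 2 * M * (1 + n)))))
    (\<lambda>(p, Sq). length Sq = N \<and> (\<forall>A\<in>set Sq. finite A))"
proof -
  define pq where "pq = round_up n \<kappa> (inverse (1 / fst st q0 + 1 / fst st q1))"
  have one: "cost_le (reduce (snd st q0 ! r) (pq / fst st q0) \<bind>\<^sub>t (\<lambda>A0.
           reduce (snd st q1 ! r) (pq / fst st q1) \<bind>\<^sub>t (\<lambda>A1.
           charge (1 + (card A0 + card A1) * (1 + n)) \<bind>\<^sub>t (\<lambda>_.
           ret ((A0 \<otimes>\<^sub>a {[x \<mapsto> False]}) \<union> (A1 \<otimes>\<^sub>a {[x \<mapsto> True]}))))))
        (M + (M + (1 + 2 * M * (1 + n) + 0))) finite" if r: "r < N" for r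
  proof -
    note s0 = smallD[OF S(1) r] and s1 = smallD[OF S(2) r]
    show ?thesis
    proof (intro cost_le_bind cost_le_ret)
      show "cost_le (reduce (snd st q0 ! r) (pq / fst st q0)) M (\<lambda>A. A \<subseteq> snd st q0 ! r)"
        by (rule cost_le_mono[OF cost_le_reduce]) (use s0 in auto)
      show "cost_le (reduce (snd st q1 ! r) (pq / fst st q1)) M (\<lambda>A. A \<subseteq> snd st q1 ! r)"
        by (rule cost_le_mono[OF cost_le_reduce]) (use s1 in auto)
      fix A0 A1 assume A: "A0 \<subseteq> snd st q0 ! r" "A1 \<subseteq> snd st q1 ! r"
      have "card A0 \<le> M" "card A1 \<le> M" using A s0 s1 card_mono order_trans by blast+
      then have "(card A0 + card A1) * (1 + n) \<le> 2 * M * (1 + n)" by (intro mult_le_mono1) simp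
      then show "cost_le (charge (1 + (card A0 + card A1) * (1 + n))) (1 + 2 * M * (1 + n)) (\<lambda>_. True)"
        by (intro cost_le_charge) simp
      have "finite A0" "finite A1" using A s0 s1 finite_subset by blast+
      then show "finite ((A0 \<otimes>\<^sub>a {[x \<mapsto> False]}) \<union> (A1 \<otimes>\<^sub>a {[x \<mapsto> True]}))"
        by (simp add: finite_otimes)
    qed
  qed
  have "cost_le (decision_step B n \<kappa> N st x q1 q0)
     ((1 + n + N) + (length [0..<N] * (M + (M + (1 + 2 * M * (1 + n) + 0))) + 0))
    (\<lambda>(p, Sq). length Sq = N \<and> (\<forall>A\<in>set Sq. finite A))"
    unfolding decision_step_def Let_def pq_def[symmetric]
    by (intro cost_le_bind[OF cost_le_charge] cost_le_bind[OF cost_le_map_rand[where P = "\<lambda>_. finite"]] cost_le_ret one)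
      (auto simp: list_all2_conv_all_nth in_set_conv_nth)
  then show ?thesis by simp
qed

lemma or_step_sample_cost_le:
  fixes B :: "('q, 'v) bdd"
  assumes S: "\<And>c. small (ns * nt) M (snd st c)" and k: "k = length (children B q)" and N: "N = ns * nt"
  shows "cost_le (or_step_sample B n \<kappa> ns nt st q)
    ((1 + n + k + N + nt) + (N * (k * M + (1 + k + k * (M * (1 + length (nodes B) + bdd_size B + k)))) + N * (k * M)))
    (\<lambda>(p, Sq). length Sq = N \<and> (\<forall>A\<in>set Sq. finite A))"
proof -
  define \<rho> where "\<rho> = Min (fst st ` set (children B q))"
  let ?W = "1 + length (nodes B) + bdd_size B + k"
  have one: "cost_le (map_rand (\<lambda>c. reduce (snd st c ! r) (\<rho> / fst st c)) (children B q) \<bind>\<^sub>t (\<lambda>As.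
           charge (1 + k + (\<Sum>A\<leftarrow>As. card A * ?W)) \<bind>\<^sub>t (\<lambda>_.
           ret (union_children B q As))))
        (k * M + (1 + k + k * (M * ?W) + 0)) (\<lambda>A. finite A \<and> card A \<le> k * M)" if r: "r < N" for r
  proof -
    note s = smallD[OF S r[unfolded N]]
    show ?thesis
    proof (intro cost_le_bind cost_le_ret)
      show "cost_le (map_rand (\<lambda>c. reduce (snd st c ! r) (\<rho> / fst st c)) (children B q)) (k * M)
         (\<lambda>As. list_all2 (\<lambda>_ A. finite A \<and> card A \<le> M) (children B q) As)"
        unfolding k
      proof (rule cost_le_map_rand)
        fix c
        show "cost_le (reduce (snd st c ! r) (\<rho> / fst st c)) M (\<lambda>A. finite A \<and> card A \<le> M)"
          by (rule cost_le_mono[OF cost_le_reduce]) (use s[of c] in \<open>auto intro: finite_subset dest: card_mono\<close>)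
      qed
      fix As :: "('v \<rightharpoonup> bool) set list"
      assume "list_all2 (\<lambda>_ A. finite A \<and> card A \<le> M) (children B q) As"
      then have len: "length As = k" and As: "\<And>A. A \<in> set As \<Longrightarrow> finite A \<and> card A \<le> M"
        unfolding k by (auto simp: list_all2_conv_all_nth in_set_conv_nth)
      have "(\<Sum>A\<leftarrow>As. card A * ?W) \<le> (\<Sum>A\<leftarrow>As. M * ?W)"
        by (intro sum_list_mono mult_le_mono1) (use As in auto)
      then have "(\<Sum>A\<leftarrow>As. card A * ?W) \<le> k * (M * ?W)" using len by (simp add: sum_list_triv)
      then show "cost_le (charge (1 + k + (\<Sum>A\<leftarrow>As. card A * ?W))) (1 + k + k * (M * ?W)) (\<lambda>_. True)"
        by (intro cost_le_charge) simp
      note U = card_Union_set_le[of As, OF As] union_children_subset[of As B q]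
      show "finite (union_children B q As) \<and> card (union_children B q As) \<le> k * M"
        using U len k by (meson card_mono finite_subset order_trans)
    qed
  qed
  have two: "cost_le (reduce (Sh ! r) p) (k * M) finite" if "list_all2 (\<lambda>_ A. finite A \<and> card A \<le> k * M) [0..<N] Sh" "r < N" for Sh r p
    by (rule cost_le_mono[OF cost_le_reduce]) (use that in \<open>auto simp: list_all2_conv_all_nth intro: finite_subset\<close>)
  have "cost_le (or_step_sample B n \<kappa> ns nt st q)
    ((1 + n + k + N + nt) + (length [0..<N] * (k * M + (1 + k + k * (M * ?W) + 0)) + (length [0..<N] * (k * M) + 0)))
    (\<lambda>(p, Sq). length Sq = N \<and> (\<forall>A\<in>set Sq. finite A))"
    unfolding or_step_sample_def Let_def \<rho>_def[symmetric] k[symmetric] N[symmetric]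
    by (intro cost_le_bind[OF cost_le_charge] cost_le_bind[OF cost_le_map_rand[where P = "\<lambda>_ A. finite A \<and> card A \<le> k * M"]]
         cost_le_bind[OF cost_le_map_rand[where P = "\<lambda>_. finite"]] cost_le_ret one two)
      (auto simp: list_all2_conv_all_nth in_set_conv_nth)
  then show ?thesis by simp
qed

text \<open>\<open>L\<close> dominates all structural parameters, and the summand 1 in
  \<open>N\<close> keeps every factor positive. Then each summand of the exact cost is at most a
  small multiple of \<open>N * M * L\<close>, or of \<open>N * M * L * k\<close> for work repeated
  at each of the \<open>k\<close> children.\<close>

lemma node_step_cost_le:
  assumes S: "\<And>c. small (ns * nt) M (snd st c)" and q: "q \<in> set (nodes B)" and d: "distinct (nodes B)"
    and N: "N = ns * nt + 1" and M: "M \<ge> 1" and nt: "nt \<le> ns * nt"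
    and L: "L = 1 + n + length (nodes B) + bdd_size B"
  shows "cost_le (node_step B n \<kappa> ns nt st q) (10 * N * M * L * (1 + length (children B q)))
    (\<lambda>(p, Sq). length Sq = ns * nt \<and> (\<forall>A\<in>set Sq. finite A))"
proof (cases "gate_of B q")
  case (Sink b)
  then show ?thesis using S[of q] by (auto simp: node_step_def small_def intro!: cost_le_ret)
next
  case (Ite x q1 q0)
  have a: "1 \<le> N" "n \<le> L" "1 \<le> L" "N \<ge> ns * nt" using N L by auto
  have X: "N * M * L \<ge> 1" using a M by (metis le_numeral_extra(4) mult_le_mono nat_mult_1)
  have "1 + n \<le> N * M * L"
  proof -
    have "1 * 1 * L \<le> N * M * L" using a M by (intro mult_le_mono) auto
    then show ?thesis using L by simp
  qed
  moreover have "ns * nt * 1 * 1 \<le> N * M * L" using a M by (intro mult_le_mono) auto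
  moreover have "ns * nt * M * 1 \<le> N * M * L" using a M by (intro mult_le_mono) auto
  moreover have "ns * nt * M * (1 + n) \<le> N * M * L" using a M L by (intro mult_le_mono) auto
  ultimately have "(1 + n + ns * nt) + ns * nt * (M + (M + (1 + 2 * M * (1 + n)))) \<le> 10 * (N * M * L)"
    by (simp add: algebra_simps)
  also have "\<dots> \<le> 10 * N * M * L * (1 + length (children B q))" by simp
  finally have le: "(1 + n + ns * nt) + ns * nt * (M + (M + (1 + 2 * M * (1 + n)))) \<le> 10 * N * M * L * (1 + length (children B q))" .
  show ?thesis
    unfolding node_step_def Ite gate.case by (rule cost_le_mono[OF decision_step_cost_le[OF S S] le])
next
  case (Or qs)
  define k where "k = length (children B q)"
  have kb: "k \<le> bdd_size B"
    unfolding k_def bdd_size_def using q by (intro member_le_sum_list) auto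
  have a: "1 \<le> N" "n \<le> L" "1 \<le> L" "N \<ge> ns * nt" using N L by auto
  let ?Y = "N * M * L"
  have "1 + n \<le> ?Y"
  proof -
    have "1 * 1 * L \<le> N * M * L" using a M by (intro mult_le_mono) auto
    then show ?thesis using L by simp
  qed
  moreover have b: "ns * nt * 1 * 1 \<le> ?Y" using a M by (intro mult_le_mono) auto
  moreover have "nt \<le> ?Y" using b nt by (metis mult.right_neutral order_trans)
  moreover have "ns * nt * M * 1 \<le> ?Y" using a M by (intro mult_le_mono) auto
  then have "ns * nt * M * 1 * k \<le> ?Y * k" by (rule mult_le_mono1)
  moreover have "ns * nt * 1 * 1 * k \<le> ?Y * k" using b by (rule mult_le_mono1)
  moreover have "ns * nt * M * (1 + length (nodes B) + bdd_size B + k) \<le> N * M * (2 * L)"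
    using a M L kb by (intro mult_le_mono) auto
  then have "ns * nt * M * (1 + length (nodes B) + bdd_size B + k) * k \<le> N * M * (2 * L) * k" by (rule mult_le_mono1)
  moreover have "1 * 1 * 1 \<le> ?Y" using a M by (intro mult_le_mono) auto
  then have "1 * 1 * 1 * k \<le> ?Y * k" by (rule mult_le_mono1)
  moreover have E: "(1 + n + k + NN + nt) + (NN * (k * M + (1 + k + k * (M * W))) + NN * (k * M))
     = 1 + n + k + NN + nt + NN * M * 1 * k + NN * 1 * 1 + NN * 1 * 1 * k + NN * M * W * k + NN * M * 1 * k" for NN W
    by (simp add: algebra_simps)
  moreover have "N * M * (2 * L) * k = 2 * (?Y * k)" by simp
  ultimately have "(1 + n + k + ns * nt + nt) + (ns * nt * (k * M + (1 + k + k * (M * (1 + length (nodes B) + bdd_size B + k)))) + ns * nt * (k * M))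
     \<le> ?Y + ?Y * k + ?Y + ?Y + ?Y * k + ?Y + ?Y * k + 2 * (?Y * k) + ?Y * k"
    unfolding E by linarith
  also have "\<dots> \<le> 10 * N * M * L * (1 + k)" by (simp add: algebra_simps)
  finally have le: "(1 + n + k + ns * nt + nt) + (ns * nt * (k * M + (1 + k + k * (M * (1 + length (nodes B) + bdd_size B + k)))) + ns * nt * (k * M))
     \<le> 10 * N * M * L * (1 + k)" .
  show ?thesis
    unfolding node_step_def Or gate.case k_def[symmetric]
    by (rule cost_le_mono[OF or_step_sample_cost_le[OF S k_def refl] le])
qed

text \<open>The threshold is what bounds the running time: after a node the run goes on only if all
  its sample sets have fewer than \<open>\<theta>\<close> elements, so every later step reads small
  sets only.\<close>

lemma process_cost_le:
  assumes "\<And>c. small (ns * nt) \<theta> (snd st c)" "set qs \<subseteq> set (nodes B)"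
    and "distinct (nodes B)" "N = ns * nt + 1" "nt \<le> ns * nt" "\<theta> \<ge> 1"
    "L = 1 + n + length (nodes B) + bdd_size B"
  shows "cost_le (process B n \<kappa> ns nt \<theta> qs st) (10 * N * \<theta> * L * (\<Sum>q\<leftarrow>qs. 1 + length (children B q))) (\<lambda>_. True)"
  using assms(1,2)
proof (induction qs arbitrary: st)
  case Nil then show ?case by (simp add: cost_le_ret)
next
  case (Cons q qs)
  have "cost_le (process B n \<kappa> ns nt \<theta> (q # qs) st)
    (10 * N * \<theta> * L * (1 + length (children B q)) + 10 * N * \<theta> * L * (\<Sum>q\<leftarrow>qs. 1 + length (children B q))) (\<lambda>_. True)"
    unfolding process.simps
  proof (rule cost_le_bind[OF node_step_cost_le[OF Cons.prems(1) _ assms(3,4) assms(6,5,7)]])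
    show "q \<in> set (nodes B)" using Cons.prems by simp
    fix a :: "ennreal \<times> ('b \<Rightarrow> bool option) set list"
    assume "case a of (p, Sq) \<Rightarrow> length Sq = ns * nt \<and> (\<forall>A\<in>set Sq. finite A)"
    then obtain p Sq where a: "a = (p, Sq)" "length Sq = ns * nt" "\<forall>A\<in>set Sq. finite A" by (cases a) auto
    show "cost_le (case a of (pq, Sq) \<Rightarrow> if \<exists>A\<in>set Sq. card A \<ge> \<theta> then ret None
        else process B n \<kappa> ns nt \<theta> qs ((fst st)(q := pq), (snd st)(q := Sq)))
      (10 * N * \<theta> * L * (\<Sum>q\<leftarrow>qs. 1 + length (children B q))) (\<lambda>_. True)"
    proof (cases "\<exists>A\<in>set Sq. card A \<ge> \<theta>")
      case True then show ?thesis using a by (simp add: cost_le_ret)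
    next
      case False
      then have "small (ns * nt) \<theta> Sq" using a by (auto simp: small_def not_le less_imp_le)
      then have "\<And>c. small (ns * nt) \<theta> (snd ((fst st)(q := p), (snd st)(q := Sq)) c)"
        using Cons.prems(1) by simp
      then show ?thesis using a False Cons.IH Cons.prems by simp
    qed
  qed
  then show ?case by (simp add: algebra_simps)
qed

lemma layer_sum_le:
  fixes f :: "'q \<Rightarrow> nat"
  shows "(\<Sum>q\<leftarrow>layer B i. f q) \<le> (\<Sum>q\<leftarrow>nodes B. f q)"
proof -
  have "(\<Sum>q\<leftarrow>filter P xs. f q) \<le> (\<Sum>q\<leftarrow>xs. f q)" for P xs by (induction xs) auto
  then show ?thesis by (cases i) auto
qed

lemma layer_subset: "set (layer B i) \<subseteq> set (nodes B)"
  by (cases i) auto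

text \<open>Each of the \<open>2 * n\<close> layers is charged with all nodes and edges of the
  diagram, which suffices for the stated exponents.\<close>

lemma core_cost_le:
  fixes B :: "('a, 'b) bdd"
  assumes "distinct (nodes B)" "N = ns * nt + 1" "nt \<le> ns * nt" "\<theta> \<ge> 1" "n \<ge> 1"
    and L: "L = 1 + n + length (nodes B) + bdd_size B"
  shows "cost_le (approxMCnFBDD_core B n \<kappa> ns nt \<theta>) (25 * n * N * \<theta> * L\<^sup>2) (\<lambda>_. True)"
proof -
  let ?qs = "concat (map (layer B) [1..<2 * n + 1])"
  have sub: "set ?qs \<subseteq> set (nodes B)" using layer_subset by fastforce
  have "(\<Sum>q\<leftarrow>?qs. 1 + length (children B q)) = (\<Sum>i\<leftarrow>[1..<2*n+1]. \<Sum>q\<leftarrow>layer B i. 1 + length (children B q))"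
  proof -
    have "(\<Sum>q\<leftarrow>concat (map g xs). f q) = (\<Sum>i\<leftarrow>xs. \<Sum>q\<leftarrow>g i. f q)" for g :: "nat \<Rightarrow> 'a list" and f :: "'a \<Rightarrow> nat" and xs
      by (induction xs) auto
    then show ?thesis .
  qed
  also have "\<dots> \<le> (\<Sum>i\<leftarrow>[1..<2*n+1]. L)"
  proof (rule sum_list_mono)
    fix i
    have "(\<Sum>q\<leftarrow>layer B i. 1 + length (children B q)) \<le> (\<Sum>q\<leftarrow>nodes B. 1 + length (children B q))" by (rule layer_sum_le)
    also have "\<dots> = length (nodes B) + bdd_size B" by (simp add: bdd_size_def sum_list_Suc)
    finally show "(\<Sum>q\<leftarrow>layer B i. 1 + length (children B q)) \<le> L" using L by simp
  qed
  also have "\<dots> = 2 * n * L" by (simp add: sum_list_triv del: upt_Suc)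
  finally have sm: "(\<Sum>q\<leftarrow>?qs. 1 + length (children B q)) \<le> 2 * n * L" .
  have init_samples: "small (ns * nt) \<theta> (snd (initial_state B (ns * nt)) c)" for c
    using assms(4) by (auto simp: small_def initial_state_def)
  have "cost_le (approxMCnFBDD_core B n \<kappa> ns nt \<theta>)
    ((1 + ns * nt + (1 + 2 * n) * (length (nodes B) + bdd_size B)) + (10 * N * \<theta> * L * (\<Sum>q\<leftarrow>?qs. 1 + length (children B q)) + 0)) (\<lambda>_. True)"
    unfolding approxMCnFBDD_core_def
    by (intro cost_le_bind[OF cost_le_charge] cost_le_bind[OF process_cost_le[OF init_samples sub assms(1-4) L]] cost_le_ret) auto
  moreover have "(1 + ns * nt + (1 + 2 * n) * (length (nodes B) + bdd_size B)) + (10 * N * \<theta> * L * (\<Sum>q\<leftarrow>?qs. 1 + length (children B q)) + 0)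
     \<le> 25 * n * N * \<theta> * L\<^sup>2"
  proof -
    let ?Z = "n * N * \<theta> * L\<^sup>2"
    have one: "1 \<le> N" "1 \<le> L" using assms by auto
    then have LL: "L \<le> L\<^sup>2" "1 \<le> L\<^sup>2" by (auto simp: power2_eq_square)
    have "10 * N * \<theta> * L * (\<Sum>q\<leftarrow>?qs. 1 + length (children B q)) \<le> 10 * N * \<theta> * L * (2 * n * L)"
      using sm by (intro mult_le_mono) auto
    also have "\<dots> = 20 * ?Z" by (simp add: power2_eq_square mult_ac)
    finally have z1: "10 * N * \<theta> * L * (\<Sum>q\<leftarrow>?qs. 1 + length (children B q)) \<le> 20 * ?Z" .
    have "1 + ns * nt = 1 * N * 1 * 1" using assms by simp
    also have "\<dots> \<le> ?Z" using assms LL by (intro mult_le_mono) auto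
    finally have z2: "1 + ns * nt \<le> ?Z" .
    have "(1 + 2 * n) * (length (nodes B) + bdd_size B) \<le> (3 * n) * L" using assms by (intro mult_le_mono) auto
    also have "\<dots> = 3 * (n * 1 * 1 * L)" by simp
    also have "\<dots> \<le> 3 * ?Z" using assms LL one by (intro mult_le_mono) auto
    finally have z3: "(1 + 2 * n) * (length (nodes B) + bdd_size B) \<le> 3 * ?Z" .
    have "25 * n * N * \<theta> * L\<^sup>2 = 25 * ?Z" by simp
    then show ?thesis using z1 z2 z3 by linarith
  qed
  ultimately show ?thesis by (rule cost_le_mono) auto
qed

lemma approx_cost_le:
  assumes core: "cost_le (approxMCnFBDD_core (normalise B) n (\<epsilon> / (1 + \<epsilon>)) ns nt \<theta>) T (\<lambda>_. True)"
    and "n = card (bdd_vars (normalise B))" "ns = nat \<lceil>4 * real n / (\<epsilon> / (1 + \<epsilon>))\<^sup>2\<rceil>"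
    "nt = 16 * n * bdd_size (normalise B)"
    "\<theta> = nat \<lceil>16 * real ns * real nt * (1 + \<epsilon> / (1 + \<epsilon>)) * real (bdd_size (normalise B))\<rceil>"
    "m = nat \<lceil>8 * ln (1 / \<delta>)\<rceil>"
  shows "cost_le (approxMCnFBDD B \<epsilon> \<delta>) ((1 + normalise_time B) + (m * T + m)) (\<lambda>_. True)"
proof -
  have "cost_le (approxMCnFBDD B \<epsilon> \<delta>) ((1 + normalise_time B) + (length [0..<m] * T + (m + 0))) (\<lambda>_. True)"
    unfolding approxMCnFBDD_def Let_def assms(2-6)[symmetric]
    by (intro cost_le_bind[OF cost_le_charge] cost_le_bind[OF cost_le_map_rand[OF core]] cost_le_ret) auto
  then show ?thesis by simp
qed

lemma nat_ceiling_le: "0 \<le> x \<Longrightarrow> real (nat \<lceil>x\<rceil>) \<le> x + 1"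
  by linarith

text \<open>In orders of magnitude \<open>u\<close> is the size of the normal form, \<open>w\<close>
  the number of samples of a node and \<open>w * u\<close> the threshold, while \<open>y\<close>
  bounds \<open>1 / \<kappa>\<close>. The product \<open>X\<close> of these quantities expands to
  the power of \<open>n\<close>, \<open>s\<close> and \<open>y\<close>. The bound
  \<open>\<epsilon>0\<close> turns \<open>1 + \<epsilon>\<close> into a constant, and the positive
  lower bound \<open>l0\<close> on the logarithm absorbs the additive constants.\<close>

lemma time_numerics:
  fixes n s \<beta> V ns nt \<theta> N L m nT :: nat and \<epsilon> \<epsilon>0 \<delta> \<delta>0 c l l0 \<kappa> X K :: real
  assumes n: "n \<ge> 1" and s: "s \<ge> 1" and \<beta>: "\<beta> \<le> 33 * n * s\<^sup>2" and V: "V \<le> 21 * n * s\<^sup>2"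
    and \<epsilon>: "0 < \<epsilon>" "\<epsilon> \<le> \<epsilon>0" and l: "0 < l0" "l0 \<le> l" and \<kappa>: "\<kappa> = \<epsilon> / (1 + \<epsilon>)"
    and ns: "ns = nat \<lceil>4 * real n / \<kappa>\<^sup>2\<rceil>" and nt: "nt = 16 * n * \<beta>"
    and \<theta>: "\<theta> = nat \<lceil>16 * real ns * real nt * (1 + \<kappa>) * real \<beta>\<rceil>" and m: "m = nat \<lceil>8 * l\<rceil>"
    and N: "N = ns * nt + 1" and L: "L = 1 + n + V + \<beta>" and nT: "nT \<le> 100 * n * s\<^sup>2"
    and K: "K = 25 * 1057 * 56\<^sup>2 * 2641\<^sup>2"
  shows "real ((1 + nT) + (m * (25 * n * N * \<theta> * L\<^sup>2) + m))
     \<le> ((101 / l0 + (8 + 1 / l0) * (K + 1)) * (1 + \<epsilon>0) ^ 4) * real n ^ 11 * real s ^ 10 * (1 / \<epsilon>) ^ 4 * l"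
proof -
  define y where "y = (1 + \<epsilon>0) / \<epsilon>"
  have \<kappa>01: "0 < \<kappa>" "\<kappa> < 1" using \<epsilon> by (auto simp: \<kappa> field_simps)
  have ik: "1 / \<kappa> \<le> y" using \<epsilon> by (simp add: \<kappa> y_def field_simps)
  have y1: "y \<ge> 1" using \<epsilon> by (simp add: y_def)
  have yy: "1 / \<kappa>\<^sup>2 \<le> y\<^sup>2" "1 \<le> y\<^sup>2"
    using power_mono[OF ik, of 2] \<kappa>01 y1 by (auto simp: power_divide one_le_power)
  have rn: "real n \<ge> 1" and rs: "real s \<ge> 1" using n s by auto
  define u where "u = real n * real s ^ 2"
  have u1: "u \<ge> 1" unfolding u_def using rn rs by (metis mult_mono' one_le_power mult_1 zero_le_one)
  have r\<beta>: "real \<beta> \<le> 33 * u" using of_nat_mono[OF \<beta>, where 'a = real] by (simp add: u_def)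
  have rV: "real V \<le> 21 * u" using of_nat_mono[OF V, where 'a = real] by (simp add: u_def)
  have nu: "real n \<le> u" unfolding u_def using rn rs by (simp add: one_le_power)
  have rL: "real L \<le> 56 * u" using L r\<beta> rV u1 nu by simp
  have rns: "real ns \<le> 5 * real n * y\<^sup>2"
  proof -
    have "real ns \<le> 4 * real n / \<kappa>\<^sup>2 + 1" unfolding ns using \<kappa>01 by (intro nat_ceiling_le) auto
    also have "4 * real n / \<kappa>\<^sup>2 = 4 * real n * (1 / \<kappa>\<^sup>2)" by simp
    also have "\<dots> \<le> 4 * real n * y\<^sup>2" using yy by (intro mult_left_mono) auto
    also have "1 \<le> real n * y\<^sup>2" using rn yy by (metis mult_mono' mult_1 zero_le_one)
    finally show ?thesis by simp
  qed
  have rnt: "real nt \<le> 528 * (real n * u)" using mult_right_mono[OF r\<beta>, of "real n"] unfolding nt by (simp add: mult_ac)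
  define w where "w = real n ^ 2 * u * y\<^sup>2"
  have w1: "w \<ge> 1"
  proof -
    have "1 * 1 * 1 \<le> real n ^ 2 * u * y\<^sup>2" using rn u1 yy by (intro mult_mono) (auto simp: one_le_power)
    then show ?thesis by (simp add: w_def)
  qed
  have rN0: "real ns * real nt \<le> 2640 * w"
  proof -
    have "real ns * real nt \<le> (5 * real n * y\<^sup>2) * (528 * (real n * u))" using rns rnt by (intro mult_mono) auto
    then show ?thesis by (simp add: w_def power2_eq_square mult_ac)
  qed
  have rN: "real N \<le> 2641 * w" using rN0 w1 by (simp add: N)
  have r\<theta>: "real \<theta> \<le> 1057 * (2641 * w) * u"
  proof -
    have "real \<theta> \<le> 16 * real ns * real nt * (1 + \<kappa>) * real \<beta> + 1"
      unfolding \<theta> using \<kappa>01 by (intro nat_ceiling_le) auto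
    also have "16 * real ns * real nt * (1 + \<kappa>) * real \<beta> = 16 * (real ns * real nt) * (1 + \<kappa>) * real \<beta>" by simp
    also have "\<dots> \<le> 16 * (2640 * w) * 2 * (33 * u)"
      using \<kappa>01 r\<beta> w1 by (intro mult_mono mult_left_mono[OF rN0]) auto
    also have "1 \<le> w * u" using w1 u1 by (metis mult_mono' mult_1 zero_le_one)
    finally show ?thesis by (simp add: mult_ac)
  qed
  define X where "X = real n * (w * (w * u)) * u\<^sup>2"
  have core: "real (25 * n * N * \<theta> * L\<^sup>2) \<le> K * X"
  proof -
    have "real (25 * n * N * \<theta> * L\<^sup>2) = 25 * real n * real N * real \<theta> * (real L)\<^sup>2" by simp
    also have "\<dots> \<le> 25 * real n * (2641 * w) * (1057 * (2641 * w) * u) * (56 * u)\<^sup>2"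
      using rN r\<theta> rL w1 u1 by (intro mult_mono power_mono) auto
    also have "\<dots> = K * X" by (simp add: K X_def power2_eq_square)
    finally show ?thesis .
  qed
  have X1: "X \<ge> u"
  proof -
    have "1 * (1 * (1 * 1)) * u \<le> real n * (w * (w * u)) * u\<^sup>2"
      using rn w1 u1 by (intro mult_mono) (auto simp: power2_eq_square)
    then show ?thesis by (simp add: X_def)
  qed
  have rnT: "1 + real nT \<le> 101 * X"
    using of_nat_mono[OF nT, where 'a = real] X1 u1 by (simp add: u_def)
  have l0: "l > 0" using l by simp
  have rm: "real m \<le> (8 + 1 / l0) * l"
  proof -
    have "real m \<le> 8 * l + 1" unfolding m using l0 by (intro nat_ceiling_le) auto
    moreover have "1 \<le> (1 / l0) * l" using l by simp
    ultimately show ?thesis by (simp add: algebra_simps)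
  qed
  have K0: "K \<ge> 0" by (simp add: K)
  have "real ((1 + nT) + (m * (25 * n * N * \<theta> * L\<^sup>2) + m)) = (1 + real nT) + real m * (real (25 * n * N * \<theta> * L\<^sup>2) + 1)"
    by (simp add: algebra_simps)
  also have "\<dots> \<le> 101 * X + ((8 + 1 / l0) * l) * (K * X + X)"
    using rnT rm core X1 u1 K0 l by (intro add_mono mult_mono) auto
  also have "\<dots> \<le> (101 / l0 * l) * X + ((8 + 1 / l0) * l) * (K * X + X)"
  proof -
    have "101 \<le> 101 / l0 * l" using l by (simp add: field_simps)
    then show ?thesis using X1 u1 by (intro add_right_mono mult_right_mono) auto
  qed
  also have "\<dots> = (101 / l0 + (8 + 1 / l0) * (K + 1)) * l * X" by (simp add: algebra_simps add_divide_distrib)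
  also have "X = real n ^ 10 * real s ^ 10 * y ^ 4"
    by (simp add: X_def w_def u_def power2_eq_square numeral_eq_Suc mult_ac)
  \<comment> \<open>The count produces the exponent 10 for \<open>n\<close>; it is relaxed to the
    claimed 11.\<close>
  also have "(101 / l0 + (8 + 1 / l0) * (K + 1)) * l * (real n ^ 10 * real s ^ 10 * y ^ 4)
     \<le> (101 / l0 + (8 + 1 / l0) * (K + 1)) * l * (real n ^ 11 * real s ^ 10 * y ^ 4)"
    using l K0 rn y1 by (intro mult_left_mono mult_right_mono power_increasing) auto
  also have "\<dots> = ((101 / l0 + (8 + 1 / l0) * (K + 1)) * (1 + \<epsilon>0) ^ 4) * real n ^ 11 * real s ^ 10 * (1 / \<epsilon>) ^ 4 * l"
    by (simp add: y_def power_divide)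
  finally show ?thesis .
qed

section \<open>Derivation chains\<close>

text \<open>An assignment with domain \<open>A\<close> is determined by the set of its true
  variables.\<close>

lemma card_maps_le:
  assumes "finite A"
  shows "finite {m :: 'a \<rightharpoonup> bool. dom m = A}" "card {m :: 'a \<rightharpoonup> bool. dom m = A} \<le> 2 ^ card A"
proof -
  let ?f = "\<lambda>m :: 'a \<rightharpoonup> bool. {x. m x = Some True}"
  have inj: "inj_on ?f {m. dom m = A}"
  proof (rule inj_onI)
    fix m m' :: "'a \<rightharpoonup> bool"
    assume m: "m \<in> {m. dom m = A}" "m' \<in> {m. dom m = A}" "?f m = ?f m'"
    show "m = m'"
    proof
      fix x
      have "m x = None \<longleftrightarrow> m' x = None" using m by auto
      moreover have "m x = Some True \<longleftrightarrow> m' x = Some True" using m(3) by blast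
      ultimately show "m x = m' x" by - (cases "m x"; cases "m' x"; simp)
    qed
  qed
  have sub: "?f ` {m. dom m = A} \<subseteq> Pow A" by auto
  then show "finite {m :: 'a \<rightharpoonup> bool. dom m = A}"
    using assms inj by (meson finite_Pow_iff finite_imageD finite_subset)
  have "card {m :: 'a \<rightharpoonup> bool. dom m = A} = card (?f ` {m. dom m = A})" using inj by (simp add: card_image)
  also have "\<dots> \<le> card (Pow A)" using assms sub by (intro card_mono) auto
  finally show "card {m :: 'a \<rightharpoonup> bool. dom m = A} \<le> 2 ^ card A" using assms by (simp add: card_Pow)
qed

text \<open>What the probabilistic analysis uses of the normal form, with \<open>lv\<close> for the
  distance to the 1-sink. Edges into the 0-sink are exempt from the conditions on levels and
  variables, since such edges may skip layers.\<close>

locale layered = nbdd B for B :: "('q, 'v) bdd" +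
  fixes lv :: "'q \<Rightarrow> nat"
  assumes lv_sink: "q \<in> set (nodes B) \<Longrightarrow> is_sink B q \<Longrightarrow> lv q = 0"
    and ite_child: "q \<in> set (nodes B) \<Longrightarrow> gate_of B q = Ite x q1 q0 \<Longrightarrow> e \<in> {q1, q0} \<Longrightarrow>
      gate_of B e \<noteq> Sink False \<Longrightarrow> Suc (lv e) = lv q \<and> node_vars B q = insert x (node_vars B e)"
    and ite_fresh: "q \<in> set (nodes B) \<Longrightarrow> gate_of B q = Ite x q1 q0 \<Longrightarrow> e \<in> {q1, q0} \<Longrightarrow> x \<notin> node_vars B e"
    and ite_live: "q \<in> set (nodes B) \<Longrightarrow> gate_of B q = Ite x q1 q0 \<Longrightarrow> \<exists>e\<in>{q1, q0}. gate_of B e \<noteq> Sink False"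
    and or_child: "q \<in> set (nodes B) \<Longrightarrow> gate_of B q = Or qs \<Longrightarrow> c \<in> set qs \<Longrightarrow>
      is_decision B c \<and> Suc (lv c) = lv q \<and> node_vars B c = node_vars B q"
    and vars_le: "q \<in> set (nodes B) \<Longrightarrow> card (node_vars B q) \<le> card (bdd_vars B)"
begin

definition cnt :: "'q \<Rightarrow> nat" where
  "cnt q = card (Mod B q)"

lemma Mod_dom: "\<alpha> \<in> Mod B q \<Longrightarrow> dom \<alpha> = node_vars B q"
  by (simp add: Mod_def)

lemma Mod_dead: "gate_of B q = Sink False \<Longrightarrow> Mod B q = {}"
  by (auto simp: Mod_def accepts_sink_iff[of B q False])

lemma Mod_true: "q \<in> set (nodes B) \<Longrightarrow> gate_of B q = Sink True \<Longrightarrow> Mod B q = {Map.empty}"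
  by (auto simp: Mod_def accepts_sink_iff node_vars_sink)

lemma lv_nonsink:
  assumes q: "q \<in> set (nodes B)" and ns: "\<not> is_sink B q"
  shows "lv q > 0"
proof (cases "gate_of B q")
  case (Sink b) then show ?thesis using ns by (simp add: is_sink_def)
next
  case (Ite x q1 q0)
  then show ?thesis using ite_live[OF q Ite] ite_child[OF q Ite] by fastforce
next
  case (Or qs)
  then obtain c where "c \<in> set qs" using or_nonempty[OF q] by (cases qs) auto
  then show ?thesis using or_child[OF q Or, of c] by simp
qed

text \<open>A child other than the 0-sink tests exactly the variables of \<open>q\<close> except
  \<open>x\<close>, so erasing \<open>x\<close> adjusts the domain and, as \<open>x\<close> is not
  tested below, keeps acceptance.\<close>

lemma Mod_ite:
  assumes q: "q \<in> set (nodes B)" and g: "gate_of B q = Ite x q1 q0"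
  shows "\<alpha> \<in> Mod B q \<longleftrightarrow> (\<exists>b. \<alpha> x = Some b \<and> \<alpha>(x := None) \<in> Mod B (if b then q1 else q0))"
proof -
  have main: "(dom \<alpha> = node_vars B q \<and> accepts B \<alpha> e) \<longleftrightarrow> \<alpha>(x := None) \<in> Mod B e"
    if b: "\<alpha> x = Some b" and e: "e = (if b then q1 else q0)" for b e
  proof (cases "gate_of B e = Sink False")
    case True then show ?thesis using Mod_dead[OF True] by (simp add: accepts_sink_iff[OF True])
  next
    case False
    have e': "e \<in> {q1, q0}" using e by auto
    note c = ite_child[OF q g e' False] ite_fresh[OF q g e']
    have en: "e \<in> set (nodes B)" using children_nodes[OF q, of e] g e' by (auto simp: children_def)
    have "accepts B \<alpha> e \<longleftrightarrow> accepts B (\<alpha>(x := None)) e"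
      using c by (auto elim!: accepts_mono[OF _ en] split: if_splits)
    moreover have "dom \<alpha> = node_vars B q \<longleftrightarrow> dom (\<alpha>(x := None)) = node_vars B e"
      using c b by (auto simp: dom_def)
    ultimately show ?thesis by (auto simp: Mod_def)
  qed
  have "\<alpha> \<in> Mod B q \<longleftrightarrow> (\<exists>b. \<alpha> x = Some b \<and> (dom \<alpha> = node_vars B q \<and> accepts B \<alpha> (if b then q1 else q0)))"
    unfolding Mod_def accepts_ite_iff[OF g] by blast
  also have "\<dots> \<longleftrightarrow> (\<exists>b. \<alpha> x = Some b \<and> \<alpha>(x := None) \<in> Mod B (if b then q1 else q0))"
    by (intro ex_cong1 conj_cong refl main[OF _ refl])
  finally show ?thesis .
qed

text \<open>All children test the same variables as \<open>q\<close>, so their model sets consist of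
  assignments with the same domain and simply unite.\<close>

lemma Mod_or:
  assumes q: "q \<in> set (nodes B)" and g: "gate_of B q = Or qs"
  shows "\<alpha> \<in> Mod B q \<longleftrightarrow> (\<exists>c\<in>set qs. \<alpha> \<in> Mod B c)"
  using or_child[OF q g] by (auto simp: Mod_def accepts_or_iff[OF g])

lemma finite_Mod: "q \<in> set (nodes B) \<Longrightarrow> finite (Mod B q)"
  and cnt_le: "q \<in> set (nodes B) \<Longrightarrow> cnt q \<le> 2 ^ card (bdd_vars B)"
proof -
  assume q: "q \<in> set (nodes B)"
  have sub: "Mod B q \<subseteq> {m. dom m = node_vars B q}" by (auto simp: Mod_def)
  note m = card_maps_le[OF finite_node_vars[OF q]]
  show "finite (Mod B q)" using finite_subset[OF sub m(1)] .
  have "cnt q \<le> card {m :: 'v \<rightharpoonup> bool. dom m = node_vars B q}"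
    unfolding cnt_def by (intro card_mono m(1) sub)
  also have "\<dots> \<le> 2 ^ card (node_vars B q)" by (rule m(2))
  also have "\<dots> \<le> 2 ^ card (bdd_vars B)" using vars_le[OF q] by (intro power_increasing) auto
  finally show "cnt q \<le> 2 ^ card (bdd_vars B)" .
qed

lemma Mod_ite_union:
  assumes q: "q \<in> set (nodes B)" and g: "gate_of B q = Ite x q1 q0"
  shows "Mod B q = (\<lambda>\<alpha>. \<alpha>(x \<mapsto> True)) ` Mod B q1 \<union> (\<lambda>\<alpha>. \<alpha>(x \<mapsto> False)) ` Mod B q0"
proof -
  have f: "\<beta>(x := None) = \<beta>" if "\<beta> \<in> Mod B e" "e \<in> {q1, q0}" for \<beta> e
    using ite_fresh[OF q g that(2)] Mod_dom[OF that(1)] by (auto simp: fun_eq_iff)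
  show ?thesis
  proof (intro equalityI subsetI)
    fix \<alpha> assume "\<alpha> \<in> Mod B q"
    then obtain b where b: "\<alpha> x = Some b" "\<alpha>(x := None) \<in> Mod B (if b then q1 else q0)" using Mod_ite[OF q g] by blast
    then show "\<alpha> \<in> (\<lambda>\<alpha>. \<alpha>(x \<mapsto> True)) ` Mod B q1 \<union> (\<lambda>\<alpha>. \<alpha>(x \<mapsto> False)) ` Mod B q0"
    proof (cases b)
      case True
      then have "\<alpha> \<in> (\<lambda>\<alpha>. \<alpha>(x \<mapsto> True)) ` Mod B q1"
        using b by (intro image_eqI[where x = "\<alpha>(x := None)"]) auto
      then show ?thesis by blast
    next
      case False
      then have "\<alpha> \<in> (\<lambda>\<alpha>. \<alpha>(x \<mapsto> False)) ` Mod B q0"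
        using b by (intro image_eqI[where x = "\<alpha>(x := None)"]) auto
      then show ?thesis by blast
    qed
  next
    fix \<alpha> assume "\<alpha> \<in> (\<lambda>\<alpha>. \<alpha>(x \<mapsto> True)) ` Mod B q1 \<union> (\<lambda>\<alpha>. \<alpha>(x \<mapsto> False)) ` Mod B q0"
    then obtain b \<beta> where "\<alpha> = \<beta>(x \<mapsto> b)" "\<beta> \<in> Mod B (if b then q1 else q0)" by fastforce
    moreover from this have "\<beta>(x := None) = \<beta>" by (intro f) auto
    ultimately show "\<alpha> \<in> Mod B q" unfolding Mod_ite[OF q g] by (intro exI[of _ b]) auto
  qed
qed

lemma cnt_ite:
  assumes q: "q \<in> set (nodes B)" and g: "gate_of B q = Ite x q1 q0"
  shows "cnt q = cnt q1 + cnt q0"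
proof -
  have n: "q1 \<in> set (nodes B)" "q0 \<in> set (nodes B)" using children_nodes[OF q] g by (auto simp: children_def)
  have inj: "inj_on (\<lambda>\<alpha>. \<alpha>(x \<mapsto> b)) (Mod B e)" if "e \<in> {q1, q0}" for e b
  proof (rule inj_onI)
    fix \<alpha> \<beta> assume "\<alpha> \<in> Mod B e" "\<beta> \<in> Mod B e" and eq: "\<alpha>(x \<mapsto> b) = \<beta>(x \<mapsto> b)"
    then have "\<alpha> x = None" "\<beta> x = None" using ite_fresh[OF q g that] Mod_dom by blast+
    moreover have "\<alpha> y = \<beta> y" if "y \<noteq> x" for y using fun_cong[OF eq, of y] that by simp
    ultimately show "\<alpha> = \<beta>" by (metis ext)
  qed
  have "(\<lambda>\<alpha>. \<alpha>(x \<mapsto> True)) ` Mod B q1 \<inter> (\<lambda>\<alpha>. \<alpha>(x \<mapsto> False)) ` Mod B q0 = {}"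
  proof -
    have "\<alpha>(x \<mapsto> True) \<noteq> \<beta>(x \<mapsto> False)" for \<alpha> \<beta> :: "'v \<rightharpoonup> bool" by (metis fun_upd_same option.inject)
    then show ?thesis by auto
  qed
  then show ?thesis unfolding cnt_def Mod_ite_union[OF q g]
    using n finite_Mod inj by (subst card_Un_disjoint) (auto simp: card_image)
qed

lemma cnt_or:
  assumes q: "q \<in> set (nodes B)" and g: "gate_of B q = Or qs" and c: "c \<in> set qs"
  shows "cnt c \<le> cnt q"
  unfolding cnt_def using Mod_or[OF q g] c by (intro card_mono finite_Mod q) auto

lemma cnt_pos: "q \<in> set (nodes B) \<Longrightarrow> gate_of B q \<noteq> Sink False \<Longrightarrow> cnt q \<ge> 1"
proof (induction "lv q" arbitrary: q rule: less_induct)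
  case less
  show ?case
  proof (cases "gate_of B q")
    case (Sink b) then show ?thesis using less by (cases b) (auto simp: cnt_def Mod_true)
  next
    case (Ite x q1 q0)
    then obtain e where e: "e \<in> {q1, q0}" "gate_of B e \<noteq> Sink False" using ite_live[OF less.prems(1)] by blast
    have "e \<in> set (nodes B)" using children_nodes[OF less.prems(1), of e] Ite e by (auto simp: children_def)
    then have "cnt e \<ge> 1" using less.hyps[of e] ite_child[OF less.prems(1) Ite e] e by simp
    then show ?thesis using cnt_ite[OF less.prems(1) Ite] e by auto
  next
    case (Or qs)
    then obtain c where c: "c \<in> set qs" using or_nonempty[OF less.prems(1)] by (cases qs) auto
    note oc = or_child[OF less.prems(1) Or c]
    have "c \<in> set (nodes B)" using children_nodes[OF less.prems(1), of c] Or c by (auto simp: children_def)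
    then have "cnt c \<ge> 1" using less.hyps[of c] oc by (auto simp: is_decision_def)
    then show ?thesis using cnt_or[OF less.prems(1) Or c] by simp
  qed
qed

text \<open>The derivation chain of a model \<open>\<alpha>\<close> of \<open>q\<close> follows the edges along which the algorithm propagates
  the restrictions of \<open>\<alpha>\<close> from the 1-sink up to \<open>q\<close>.\<close>

fun prev :: "'q \<times> ('v \<rightharpoonup> bool) \<Rightarrow> 'q \<times> ('v \<rightharpoonup> bool)" where
  "prev (q, \<alpha>) = (case gate_of B q of
      Sink b \<Rightarrow> (q, \<alpha>)
    | Ite x q1 q0 \<Rightarrow> (if \<alpha> x = Some True then q1 else q0, \<alpha>(x := None))
    | Or qs \<Rightarrow> (hd (filter (\<lambda>c. \<alpha> \<in> Mod B c) qs), \<alpha>))"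

primrec chain_upto :: "nat \<Rightarrow> 'q \<times> ('v \<rightharpoonup> bool) \<Rightarrow> ('q \<times> ('v \<rightharpoonup> bool)) set" where
  "chain_upto 0 z = {z}"
| "chain_upto (Suc k) z = insert z (chain_upto k (prev z))"

definition chain :: "'q \<times> ('v \<rightharpoonup> bool) \<Rightarrow> ('q \<times> ('v \<rightharpoonup> bool)) set" where
  "chain z = chain_upto (lv (fst z)) z"

definition valid :: "'q \<times> ('v \<rightharpoonup> bool) \<Rightarrow> bool" where
  "valid z \<longleftrightarrow> fst z \<in> set (nodes B) \<and> snd z \<in> Mod B (fst z)"

lemma valid_alive: "valid z \<Longrightarrow> gate_of B (fst z) \<noteq> Sink False"
  using Mod_dead by (auto simp: valid_def)

lemma prev_valid:
  assumes v: "valid z" and l: "lv (fst z) > 0"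
  shows "valid (prev z)" "Suc (lv (fst (prev z))) = lv (fst z)" "fst (prev z) \<in> set (children B (fst z))"
    "node_vars B (fst (prev z)) \<subseteq> node_vars B (fst z)"
proof -
  obtain q \<alpha> where z: "z = (q, \<alpha>)" by (cases z)
  have q: "q \<in> set (nodes B)" and \<alpha>: "\<alpha> \<in> Mod B q" using v z by (auto simp: valid_def)
  have "valid (prev z) \<and> Suc (lv (fst (prev z))) = lv (fst z) \<and> fst (prev z) \<in> set (children B (fst z))
    \<and> node_vars B (fst (prev z)) \<subseteq> node_vars B (fst z)"
  proof (cases "gate_of B q")
    case (Sink b) then show ?thesis using l z lv_sink[OF q] by (simp add: is_sink_def)
  next
    case (Ite x q1 q0)
    then obtain b where b: "\<alpha> x = Some b" "\<alpha>(x := None) \<in> Mod B (if b then q1 else q0)"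
      using Mod_ite[OF q Ite] \<alpha> by blast
    have p: "prev z = ((if b then q1 else q0), \<alpha>(x := None))" using z Ite b by simp
    have "gate_of B (if b then q1 else q0) \<noteq> Sink False" using b Mod_dead by blast
    note ch = ite_child[OF q Ite _ this]
    have c: "(if b then q1 else q0) \<in> set (children B q)" using Ite by (simp add: children_def)
    show ?thesis using p z b c ch children_nodes[OF q c] by (auto simp: valid_def)
  next
    case (Or qs)
    let ?F = "filter (\<lambda>c. \<alpha> \<in> Mod B c) qs"
    have "?F \<noteq> []" using \<alpha> Mod_or[OF q Or] by (auto simp: filter_empty_conv)
    then have "hd ?F \<in> set ?F" by (rule hd_in_set)
    then have h: "hd ?F \<in> set qs" "\<alpha> \<in> Mod B (hd ?F)" unfolding set_filter by blast+
    have p: "prev z = (hd ?F, \<alpha>)" using z Or by simp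
    have c: "hd ?F \<in> set (children B q)" using Or h by (simp add: children_def)
    show ?thesis using p z h c or_child[OF q Or h(1)] children_nodes[OF q c] by (simp add: valid_def)
  qed
  then show "valid (prev z)" "Suc (lv (fst (prev z))) = lv (fst z)" "fst (prev z) \<in> set (children B (fst z))"
    "node_vars B (fst (prev z)) \<subseteq> node_vars B (fst z)" by auto
qed

lemma valid_level0:
  assumes v: "valid z" and l: "lv (fst z) = 0"
  shows "gate_of B (fst z) = Sink True"
proof -
  have "is_sink B (fst z)" using lv_nonsink[of "fst z"] v l by (auto simp: valid_def)
  then obtain b where b: "gate_of B (fst z) = Sink b" by (auto simp: is_sink_def)
  then show ?thesis using valid_alive[OF v] by (cases b) auto
qed

lemma chain_0: "lv (fst z) = 0 \<Longrightarrow> chain z = {z}"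
  by (simp add: chain_def)

lemma chain_Suc: "valid z \<Longrightarrow> lv (fst z) > 0 \<Longrightarrow> chain z = insert z (chain (prev z))"
  using prev_valid(2)[of z] by (cases "lv (fst z)") (auto simp: chain_def)

lemma chain_induct [consumes 1, case_names sink step]:
  assumes "valid z"
    and "\<And>z. valid z \<Longrightarrow> lv (fst z) = 0 \<Longrightarrow> P z"
    and "\<And>z. valid z \<Longrightarrow> lv (fst z) > 0 \<Longrightarrow> valid (prev z) \<Longrightarrow> P (prev z) \<Longrightarrow> P z"
  shows "P z"
  using assms(1)
proof (induction "lv (fst z)" arbitrary: z rule: less_induct)
  case less
  show ?case
  proof (cases "lv (fst z) = 0")
    case True then show ?thesis using assms(2) less by blast
  next
    case False
    then show ?thesis using assms(3)[of z] less prev_valid(1,2)[of z] by simp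
  qed
qed

lemma finite_chain: "valid z \<Longrightarrow> finite (chain z)"
  by (induction z rule: chain_induct) (auto simp: chain_0 chain_Suc)

lemma chain_level: "valid z \<Longrightarrow> y \<in> chain z \<Longrightarrow> y = z \<or> lv (fst y) < lv (fst z)"
proof (induction z rule: chain_induct)
  case (step z)
  then show ?case using prev_valid(2)[OF step(1,2)] by (auto simp: chain_Suc)
qed (auto simp: chain_0)

lemma prev_notin_chain: "valid z \<Longrightarrow> lv (fst z) > 0 \<Longrightarrow> z \<notin> chain (prev z)"
  using chain_level[of "prev z" z] prev_valid(1,2)[of z] by force

text \<open>The edges followed from \<open>z\<close> down to \<open>c\<close> only test variables
  outside \<open>node_vars B c\<close>. Hence the model of \<open>c\<close> is a restriction of that
  of \<open>z\<close>, and replacing this part by any other model of \<open>c\<close> keeps the path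
  intact and gives another model.\<close>

lemma chain_restrict:
  "valid z \<Longrightarrow> (c, \<gamma>) \<in> chain z \<Longrightarrow>
    valid (c, \<gamma>) \<and> node_vars B c \<subseteq> node_vars B (fst z) \<and> \<gamma> = snd z |` node_vars B c \<and>
    (\<forall>\<beta>\<in>Mod B c. snd z ++ \<beta> \<in> Mod B (fst z))"
proof (induction z rule: chain_induct)
  have self: "valid z \<and> node_vars B (fst z) \<subseteq> node_vars B (fst z) \<and> snd z = snd z |` node_vars B (fst z) \<and>
    (\<forall>\<beta>\<in>Mod B (fst z). snd z ++ \<beta> \<in> Mod B (fst z))" if v: "valid z" for z
  proof -
    have d: "dom (snd z) = node_vars B (fst z)" using v Mod_dom by (auto simp: valid_def)
    have "snd z = snd z |` node_vars B (fst z)"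
      using d by (auto simp: restrict_map_def fun_eq_iff domIff)
    moreover have "snd z ++ \<beta> = \<beta>" if "\<beta> \<in> Mod B (fst z)" for \<beta>
    proof
      fix y
      have "dom \<beta> = dom (snd z)" using Mod_dom[OF that] d by simp
      then show "(snd z ++ \<beta>) y = \<beta> y" by (cases "\<beta> y") (auto simp: map_add_def domIff)
    qed
    ultimately show ?thesis using v by auto
  qed
  {
    case (sink z)
    then have "z = (c, \<gamma>)" by (simp add: chain_0)
    then show ?case using self[OF sink(1)] by simp
  next
    case (step z)
    then consider "z = (c, \<gamma>)" | "(c, \<gamma>) \<in> chain (prev z)" by (auto simp: chain_Suc)
    then show ?case
    proof cases
      case 1
      then show ?thesis using self[OF step(1)] by simp
    next
      case 2
      note IH = step.IH[OF 2] and pv = prev_valid[OF step(1,2)]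
      obtain q \<alpha> where z: "z = (q, \<alpha>)" by (cases z)
      have q: "q \<in> set (nodes B)" and \<alpha>: "\<alpha> \<in> Mod B q" using step(1) z by (auto simp: valid_def)
      show ?thesis
      proof (cases "gate_of B q")
        case (Sink b) then show ?thesis using step(2) z lv_sink[OF q] by (simp add: is_sink_def)
      next
        case (Ite x q1 q0)
        then obtain b where b: "\<alpha> x = Some b" "\<alpha>(x := None) \<in> Mod B (if b then q1 else q0)"
          using Mod_ite[OF q Ite] \<alpha> by blast
        have p: "prev z = ((if b then q1 else q0), \<alpha>(x := None))" using z Ite b by simp
        have "x \<notin> node_vars B (if b then q1 else q0)" using ite_fresh[OF q Ite] by auto
        then have xc: "x \<notin> node_vars B c" using IH p by auto
        have "\<gamma> = \<alpha> |` node_vars B c" using IH p xc by (auto simp: restrict_map_def fun_eq_iff)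
        moreover have "\<alpha> ++ \<beta> \<in> Mod B q" if \<beta>: "\<beta> \<in> Mod B c" for \<beta>
        proof -
          have xb: "\<beta> x = None" using Mod_dom[OF \<beta>] xc by auto
          have "(\<alpha> ++ \<beta>)(x := None) = \<alpha>(x := None) ++ \<beta>" using xb by (auto simp: fun_eq_iff map_add_def split: option.splits)
          moreover have "\<alpha>(x := None) ++ \<beta> \<in> Mod B (if b then q1 else q0)"
            using IH \<beta> unfolding p fst_conv snd_conv by blast
          moreover have "(\<alpha> ++ \<beta>) x = Some b" using xb b by (simp add: map_add_def)
          ultimately show ?thesis unfolding Mod_ite[OF q Ite] by (intro exI[of _ b]) simp
        qed
        ultimately show ?thesis using IH pv z by auto
      next
        case (Or qs)
        have p: "snd (prev z) = \<alpha>" using z Or by simp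
        have c: "fst (prev z) \<in> set qs" using pv(3) Or z by (simp add: children_def)
        show ?thesis using IH pv z p c Mod_or[OF q Or] by auto
      qed
    qed
  }
qed

text \<open>Any model \<open>\<beta>\<close> of \<open>c\<close> can be grafted onto any such
  \<open>\<alpha>\<close>, and the pair can be recovered from the graft: \<open>\<beta>\<close> is
  its restriction to the variables of \<open>c\<close>, outside of them it shows
  \<open>\<alpha>\<close>, and on them \<open>\<alpha>\<close> is the common
  \<open>\<gamma>\<close>.\<close>

lemma chain_count:
  assumes q: "q \<in> set (nodes B)" and y: "y = (c, \<gamma>)"
  shows "card {\<alpha> \<in> Mod B q. y \<in> chain (q, \<alpha>)} * cnt c \<le> cnt q"
proof -
  let ?K = "{\<alpha> \<in> Mod B q. y \<in> chain (q, \<alpha>)}"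
  have r: "\<gamma> = \<alpha> |` node_vars B c" "\<And>\<beta>. \<beta> \<in> Mod B c \<Longrightarrow> \<alpha> ++ \<beta> \<in> Mod B q" if "\<alpha> \<in> ?K" for \<alpha>
    using chain_restrict[of "(q, \<alpha>)" c \<gamma>] that q y by (auto simp: valid_def)
  have inj: "inj_on (\<lambda>(\<alpha>, \<beta>). \<alpha> ++ \<beta>) (?K \<times> Mod B c)"
  proof (rule inj_onI, clarsimp simp del: map_add_Some_iff)
    fix \<alpha> \<beta> \<alpha>' \<beta>'
    assume a: "\<alpha> \<in> Mod B q" "y \<in> chain (q, \<alpha>)" "\<alpha>' \<in> Mod B q" "y \<in> chain (q, \<alpha>')"
      and b: "\<beta> \<in> Mod B c" "\<beta>' \<in> Mod B c" and eq: "\<alpha> ++ \<beta> = \<alpha>' ++ \<beta>'"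
    have d: "dom \<beta> = node_vars B c" "dom \<beta>' = node_vars B c" using b Mod_dom by auto
    have g: "\<alpha> |` node_vars B c = \<alpha>' |` node_vars B c" using r(1)[of \<alpha>] r(1)[of \<alpha>'] a by simp
    have "\<alpha> v = \<alpha>' v \<and> \<beta> v = \<beta>' v" for v
    proof (cases "v \<in> node_vars B c")
      case True
      then have "\<alpha> v = \<alpha>' v" using fun_cong[OF g, of v] by (simp add: restrict_map_def)
      moreover have "\<beta> v = \<beta>' v" using fun_cong[OF eq, of v] d True by (auto simp: map_add_def split: option.splits)
      ultimately show ?thesis by simp
    next
      case False
      then have "\<beta> v = None" "\<beta>' v = None" using d by auto
      then show ?thesis using fun_cong[OF eq, of v] by (simp add: map_add_def)
    qed
    then show "\<alpha> = \<alpha>' \<and> \<beta> = \<beta>'" by auto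
  qed
  have "card ?K * cnt c = card ((\<lambda>(\<alpha>, \<beta>). \<alpha> ++ \<beta>) ` (?K \<times> Mod B c))"
    using inj by (simp add: card_image card_cartesian_product cnt_def)
  also have "\<dots> \<le> cnt q" unfolding cnt_def using r(2) by (intro card_mono finite_Mod q) auto
  finally show ?thesis .
qed

text \<open>With \<open>w = 1 / h\<close>, the correction factor by which the joint probability of two derivations exceeds
  \<open>h(q) h(q')\<close>; see \<open>pair_probability\<close>.\<close>

definition gain :: "('q \<Rightarrow> real) \<Rightarrow> 'q \<times> ('v \<rightharpoonup> bool) \<Rightarrow> real" where
  "gain w y = (if lv (fst y) = 0 then w (fst y) else w (fst y) - w (fst (prev y)))"

definition corr :: "('q \<Rightarrow> real) \<Rightarrow> 'q \<times> ('v \<rightharpoonup> bool) \<Rightarrow> 'q \<times> ('v \<rightharpoonup> bool) \<Rightarrow> real" where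
  "corr w z z' = (\<Sum>y\<in>chain z \<inter> chain z'. gain w y)"

lemma corr_sym: "corr w z z' = corr w z' z"
  by (simp add: corr_def Int_commute)

text \<open>The gains along a chain telescope.\<close>

lemma corr_self: "valid z \<Longrightarrow> corr w z z = w (fst z)"
proof (induction z rule: chain_induct)
  case (sink z) then show ?case by (simp add: corr_def chain_0 gain_def)
next
  case (step z)
  then show ?case using finite_chain[OF step(3)] prev_notin_chain[OF step(1,2)]
    by (simp add: corr_def chain_Suc gain_def)
qed

lemma corr_prev: "valid z \<Longrightarrow> lv (fst z) > 0 \<Longrightarrow> z \<notin> chain z' \<Longrightarrow> corr w z z' = corr w (prev z) z'"
  by (simp add: corr_def chain_Suc)

lemma corr_sinks: "valid z \<Longrightarrow> valid z' \<Longrightarrow> lv (fst z) = 0 \<Longrightarrow> lv (fst z') = 0 \<Longrightarrow> z = z'"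
proof -
  assume v: "valid z" "valid z'" "lv (fst z) = 0" "lv (fst z') = 0"
  then have g: "gate_of B (fst z) = Sink True" "gate_of B (fst z') = Sink True" by (auto intro: valid_level0)
  then have "fst z = fst z'" using v sink_ex1[of True] by (auto simp: valid_def)
  moreover have "snd z = Map.empty" "snd z' = Map.empty" using v g Mod_true by (auto simp: valid_def)
  ultimately show "z = z'" by (simp add: prod_eq_iff)
qed

text \<open>Summation by parts: the increments of \<open>w\<close> divided by model counts turn into
  terms \<open>w c * (1 / a - 1 / b)\<close> for consecutive counts \<open>a \<le> b\<close>. Since
  \<open>w c \<le> A * a\<close>, such a term is at most \<open>A * (1 - a / b)\<close>, hence at
  most \<open>A * ln (b / a)\<close>, and the logarithms telescope. The result depends on the number
  of models and not on the length of the chain.\<close>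

lemma chain_sum_bound:
  fixes w :: "'q \<Rightarrow> real" and A :: real
  assumes "valid z" and A: "A \<ge> 0"
    and w1: "\<And>q. q \<in> set (nodes B) \<Longrightarrow> gate_of B q = Sink True \<Longrightarrow> w q = 1"
    and wA: "\<And>y. y \<in> chain z \<Longrightarrow> w (fst y) \<le> A * cnt (fst y)"
  shows "(\<Sum>y\<in>chain z. gain w y / cnt (fst y)) \<le> w (fst z) / cnt (fst z) + A * ln (cnt (fst z))"
  using assms(1) wA
proof (induction z rule: chain_induct)
  case (sink z)
  have "cnt (fst z) = 1" using valid_level0[OF sink(1,2)] sink(1) Mod_true by (auto simp: cnt_def valid_def)
  then show ?case using sink by (simp add: chain_0 gain_def)
next
  case (step z)
  let ?c = "fst (prev z)" and ?q = "fst z"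
  note pv = prev_valid[OF step(1,2)]
  have cp: "cnt ?c \<ge> 1" "cnt ?q \<ge> 1" using cnt_pos valid_alive pv(1) step(1) by (auto simp: valid_def)
  have cq: "cnt ?c \<le> cnt ?q"
  proof (cases "gate_of B ?q")
    case (Sink b) then show ?thesis using step(1,2) lv_sink by (auto simp: is_sink_def valid_def)
  next
    case (Ite x q1 q0)
    then show ?thesis using cnt_ite[OF _ Ite] step(1) pv(3) by (auto simp: valid_def children_def)
  next
    case (Or qs)
    then show ?thesis using cnt_or[OF _ Or] step(1) pv(3) by (auto simp: valid_def children_def)
  qed
  define a where "a = real (cnt ?c)"
  define b where "b = real (cnt ?q)"
  have ab: "1 \<le> a" "a \<le> b" using cp cq by (auto simp: a_def b_def)
  have wc: "w ?c \<le> A * a"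
  proof -
    have "prev z \<in> chain (prev z)" by (cases "lv (fst (prev z))") (auto simp: chain_def)
    then show ?thesis using step.prems[of "prev z"] step(1,2) by (simp add: chain_Suc a_def)
  qed
  have IH: "(\<Sum>y\<in>chain (prev z). gain w y / cnt (fst y)) \<le> w ?c / a + A * ln a"
    unfolding a_def using step by (intro step.IH) (auto simp: chain_Suc)
  have "(\<Sum>y\<in>chain z. gain w y / cnt (fst y)) = (w ?q - w ?c) / b + (\<Sum>y\<in>chain (prev z). gain w y / cnt (fst y))"
    using step prev_notin_chain[OF step(1,2)] finite_chain[OF step(3)]
    by (simp add: chain_Suc gain_def b_def)
  also have "\<dots> \<le> (w ?q - w ?c) / b + (w ?c / a + A * ln a)" using IH by simp
  also have "\<dots> = w ?q / b + w ?c * (1 / a - 1 / b) + A * ln a"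
    using ab by (simp add: field_simps)
  also have "\<dots> \<le> w ?q / b + (A * a) * (1 / a - 1 / b) + A * ln a"
    using wc ab by (intro add_mono mult_right_mono) (auto simp: field_simps)
  also have "\<dots> = w ?q / b + A * (1 - a / b + ln a)" using ab by (simp add: field_simps)
  also have "\<dots> \<le> w ?q / b + A * ln b"
  proof -
    have "ln (a / b) \<le> a / b - 1" using ab by (intro ln_le_minus_one) auto
    then have "1 - a / b + ln a \<le> ln b" using ab by (simp add: ln_div)
    then show ?thesis using A by (intro add_left_mono mult_left_mono) auto
  qed
  finally show ?case by (simp add: b_def)
qed

text \<open>There are at most \<open>2 ^ n\<close> models, and \<open>7 / 10\<close> is a convenient
  rational above \<open>ln 2\<close>.\<close>

lemma ln_cnt_le: "q \<in> set (nodes B) \<Longrightarrow> gate_of B q \<noteq> Sink False \<Longrightarrow> ln (cnt q) \<le> 7 / 10 * card (bdd_vars B)"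
proof -
  assume q: "q \<in> set (nodes B)" "gate_of B q \<noteq> Sink False"
  have "real (cnt q) \<le> 2 ^ card (bdd_vars B)" using of_nat_mono[OF cnt_le[OF q(1)], where 'a = real] by simp
  then have "ln (cnt q) \<le> ln (2 ^ card (bdd_vars B) :: real)" using cnt_pos[OF q] by (subst ln_le_cancel_iff) auto
  also have "\<dots> = card (bdd_vars B) * ln (2::real)" by (simp add: ln_realpow)
  also have "\<dots> \<le> card (bdd_vars B) * (7 / 10 :: real)"
    using ln2_le_25_over_36 by (intro mult_left_mono) auto
  finally show ?thesis by simp
qed

text \<open>For fixed \<open>\<alpha>\<close> the sums are exchanged: an element \<open>y\<close> of
  its chain is counted once for every \<open>\<alpha>'\<close> whose chain contains it, which by
  \<open>chain_count\<close> happens at most \<open>cnt q / cnt (fst y)\<close> times. What remains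
  is the sum bounded in \<open>chain_sum_bound\<close>.\<close>

lemma corr_sum_bound:
  fixes w :: "'q \<Rightarrow> real" and A :: real
  assumes q: "q \<in> set (nodes B)" "gate_of B q \<noteq> Sink False" and A: "A \<ge> 0"
    and w1: "\<And>q. q \<in> set (nodes B) \<Longrightarrow> gate_of B q = Sink True \<Longrightarrow> w q = 1"
    and wA: "\<And>\<alpha> y. \<alpha> \<in> Mod B q \<Longrightarrow> y \<in> chain (q, \<alpha>) \<Longrightarrow> w (fst y) \<le> A * cnt (fst y)"
    and d: "\<And>\<alpha> y. \<alpha> \<in> Mod B q \<Longrightarrow> y \<in> chain (q, \<alpha>) \<Longrightarrow> gain w y \<ge> 0"
  shows "(\<Sum>\<alpha>\<in>Mod B q. \<Sum>\<alpha>'\<in>Mod B q. corr w (q, \<alpha>) (q, \<alpha>'))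
     \<le> (real (cnt q))\<^sup>2 * (A * (1 + 7 / 10 * card (bdd_vars B)))"
proof -
  note fin = finite_Mod[OF q(1)]
  have "(\<Sum>\<alpha>'\<in>Mod B q. corr w (q, \<alpha>) (q, \<alpha>')) \<le> real (cnt q) * (A * (1 + 7 / 10 * card (bdd_vars B)))"
    if \<alpha>: "\<alpha> \<in> Mod B q" for \<alpha>
  proof -
    have v: "valid (q, \<alpha>)" using \<alpha> q by (simp add: valid_def)
    note fc = finite_chain[OF v]
    have "(\<Sum>\<alpha>'\<in>Mod B q. corr w (q, \<alpha>) (q, \<alpha>'))
        = (\<Sum>\<alpha>'\<in>Mod B q. \<Sum>y\<in>chain (q, \<alpha>). if y \<in> chain (q, \<alpha>') then gain w y else 0)"
      unfolding corr_def using fc by (simp add: sum.inter_restrict)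
    also have "\<dots> = (\<Sum>y\<in>chain (q, \<alpha>). \<Sum>\<alpha>'\<in>Mod B q. if y \<in> chain (q, \<alpha>') then gain w y else 0)"
      by (rule sum.swap)
    also have "\<dots> = (\<Sum>y\<in>chain (q, \<alpha>). card {\<alpha>' \<in> Mod B q. y \<in> chain (q, \<alpha>')} * gain w y)"
      using fin by (simp add: sum.inter_filter[symmetric])
    also have "\<dots> \<le> (\<Sum>y\<in>chain (q, \<alpha>). (real (cnt q) / cnt (fst y)) * gain w y)"
    proof (intro sum_mono mult_right_mono)
      fix y assume y: "y \<in> chain (q, \<alpha>)"
      show "gain w y \<ge> 0" using d \<alpha> y by blast
      obtain c \<gamma> where cg: "y = (c, \<gamma>)" by (cases y)
      have "valid (c, \<gamma>)" using chain_restrict[OF v] y cg by blast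
      then have "cnt c \<ge> 1" using cnt_pos valid_alive by (fastforce simp: valid_def)
      moreover have "real (card {\<alpha>' \<in> Mod B q. y \<in> chain (q, \<alpha>')}) * cnt c \<le> cnt q"
        using of_nat_mono[OF chain_count[OF q(1) cg], where 'a = real] by simp
      ultimately show "real (card {\<alpha>' \<in> Mod B q. y \<in> chain (q, \<alpha>')}) \<le> real (cnt q) / cnt (fst y)"
        using cg by (simp add: field_simps)
    qed
    also have "\<dots> = real (cnt q) * (\<Sum>y\<in>chain (q, \<alpha>). gain w y / cnt (fst y))"
      by (simp add: sum_distrib_left mult_ac)
    also have "\<dots> \<le> real (cnt q) * (w q / cnt q + A * ln (cnt q))"
      using chain_sum_bound[OF v A, of w] w1 wA \<alpha> by (intro mult_left_mono) auto
    also have "\<dots> \<le> real (cnt q) * (A + A * (7 / 10 * card (bdd_vars B)))"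
    proof (intro mult_left_mono add_mono)
      have "(q, \<alpha>) \<in> chain (q, \<alpha>)" by (cases "lv q") (auto simp: chain_def)
      then show "w q / cnt q \<le> A" using wA[OF \<alpha>, of "(q, \<alpha>)"] cnt_pos[OF q] by (simp add: field_simps)
    qed (use A ln_cnt_le[OF q] in auto)
    finally show ?thesis by (simp add: algebra_simps)
  qed
  then have "(\<Sum>\<alpha>\<in>Mod B q. \<Sum>\<alpha>'\<in>Mod B q. corr w (q, \<alpha>) (q, \<alpha>'))
     \<le> (\<Sum>\<alpha>\<in>Mod B q. real (cnt q) * (A * (1 + 7 / 10 * card (bdd_vars B))))" by (rule sum_mono)
  also have "\<dots> = (real (cnt q))\<^sup>2 * (A * (1 + 7 / 10 * card (bdd_vars B)))"
    by (simp add: cnt_def power2_eq_square)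
  finally show ?thesis .
qed

end

section \<open>Samples for imposed values\<close>

definition outcome :: "'a rand \<Rightarrow> 'a pmf" where
  "outcome m = map_pmf fst m"

lemma outcome_ret [simp]: "outcome (ret a) = return_pmf a"
  by (simp add: outcome_def ret_def)

lemma outcome_charge [simp]: "outcome (charge t) = return_pmf ()"
  by (simp add: outcome_def charge_def)

lemma outcome_bind [simp]: "outcome (m \<bind>\<^sub>t f) = bind_pmf (outcome m) (\<lambda>a. outcome (f a))"
  by (simp add: outcome_def bind_rand_def map_bind_pmf bind_map_pmf case_prod_unfold pmf.map_comp o_def)

section \<open>Lists of independent draws\<close>

primrec mapM_pmf :: "('a \<Rightarrow> 'b pmf) \<Rightarrow> 'a list \<Rightarrow> 'b list pmf" where
  "mapM_pmf f [] = return_pmf []"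
| "mapM_pmf f (x # xs) = bind_pmf (f x) (\<lambda>y. bind_pmf (mapM_pmf f xs) (\<lambda>ys. return_pmf (y # ys)))"

lemma outcome_map_rand [simp]: "outcome (map_rand f xs) = mapM_pmf (\<lambda>x. outcome (f x)) xs"
  by (induction xs) auto

lemma mapM_pmf_snoc: "mapM_pmf f (xs @ [x]) = bind_pmf (mapM_pmf f xs) (\<lambda>ys. bind_pmf (f x) (\<lambda>y. return_pmf (ys @ [y])))"
  by (induction xs) (auto simp: bind_assoc_pmf bind_return_pmf)

text \<open>Appending a draw at the right end corresponds to inserting a new coordinate into the
  product. In the product form the integrals over one or two entries of the list factorise.\<close>

lemma mapM_pmf_Pi: "mapM_pmf f xs = map_pmf (\<lambda>g. map g [0..<length xs]) (Pi_pmf {..<length xs} d (\<lambda>i. f (xs ! i)))"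
proof (induction xs rule: rev_induct)
  case (snoc x xs)
  let ?n = "length xs"
  let ?P = "Pi_pmf {..<?n} d (\<lambda>i. f ((xs @ [x]) ! i))"
  have P: "?P = Pi_pmf {..<?n} d (\<lambda>i. f (xs ! i))"
    by (intro Pi_pmf_cong) (auto simp: nth_append)
  have "map_pmf (\<lambda>g. map g [0..<length (xs @ [x])]) (Pi_pmf {..<length (xs @ [x])} d (\<lambda>i. f ((xs @ [x]) ! i)))
     = bind_pmf (f x) (\<lambda>y. bind_pmf ?P (\<lambda>g. return_pmf (map (g(?n := y)) [0..<?n] @ [y])))"
    by (simp add: lessThan_Suc Pi_pmf_insert' map_bind_pmf)
  also have "\<dots> = bind_pmf (f x) (\<lambda>y. bind_pmf ?P (\<lambda>g. return_pmf (map g [0..<?n] @ [y])))"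
    by (intro bind_pmf_cong refl arg_cong[of _ _ return_pmf]) auto
  also have "\<dots> = bind_pmf ?P (\<lambda>g. bind_pmf (f x) (\<lambda>y. return_pmf (map g [0..<?n] @ [y])))"
    by (rule bind_commute_pmf)
  also have "\<dots> = mapM_pmf f (xs @ [x])"
    unfolding mapM_pmf_snoc snoc P by (simp add: bind_map_pmf)
  finally show ?case by simp
qed simp

lemma mapM_pmf_upt: "mapM_pmf f [0..<N] = map_pmf (\<lambda>g. map g [0..<N]) (Pi_pmf {..<N} d f)"
  unfolding mapM_pmf_Pi[of f "[0..<N]" d] by (auto intro!: arg_cong[of _ _ "map_pmf _"] Pi_pmf_cong)

lemma set_mapM_pmf: "ys \<in> set_pmf (mapM_pmf f xs) \<Longrightarrow> list_all2 (\<lambda>x y. y \<in> set_pmf (f x)) xs ys"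
  by (induction xs arbitrary: ys) auto

lemma nn_integral_pmf_cong:
  "(\<And>x. x \<in> set_pmf p \<Longrightarrow> f x = g x) \<Longrightarrow> (\<integral>\<^sup>+x. f x \<partial>measure_pmf p) = (\<integral>\<^sup>+x. g x \<partial>measure_pmf p)"
  by (intro nn_integral_cong_AE) (simp add: AE_measure_pmf_iff)

lemma nn_integral_pmf_mono:
  "(\<And>x. x \<in> set_pmf p \<Longrightarrow> f x \<le> g x) \<Longrightarrow> (\<integral>\<^sup>+x. f x \<partial>measure_pmf p) \<le> (\<integral>\<^sup>+x. g x \<partial>measure_pmf p)"
  by (intro nn_integral_mono_AE) (simp add: AE_measure_pmf_iff)

lemma nn_integral_pair_Pi_pmf:
  assumes A: "finite A" and ij: "i \<in> A" "j \<in> A" "i \<noteq> j"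
  shows "(\<integral>\<^sup>+g. F (g i) * G (g j) \<partial>Pi_pmf A d p) = (\<integral>\<^sup>+x. F x \<partial>p i) * (\<integral>\<^sup>+x. G x \<partial>p j)"
proof -
  let ?f = "\<lambda>k x. if k = i then F x else if k = j then G x else 1"
  have pr: "(\<Prod>k\<in>A. h k) = h i * h j" if "\<And>k. k \<in> A \<Longrightarrow> k \<noteq> i \<Longrightarrow> k \<noteq> j \<Longrightarrow> h k = 1" for h :: "'a \<Rightarrow> ennreal"
  proof -
    have "(\<Prod>k\<in>A. h k) = (\<Prod>k\<in>{i, j}. h k)"
      by (rule prod.mono_neutral_right) (use A ij that in auto)
    then show ?thesis using ij by simp
  qed
  have "(\<integral>\<^sup>+g. F (g i) * G (g j) \<partial>Pi_pmf A d p) = (\<integral>\<^sup>+g. (\<Prod>k\<in>A. ?f k (g k)) \<partial>Pi_pmf A d p)"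
    using ij by (intro nn_integral_cong) (subst pr, auto)
  also have "\<dots> = (\<Prod>k\<in>A. \<integral>\<^sup>+x. ?f k x \<partial>p k)" by (rule nn_integral_prod_Pi_pmf[OF A])
  also have "\<dots> = (\<integral>\<^sup>+x. F x \<partial>p i) * (\<integral>\<^sup>+x. G x \<partial>p j)"
    using ij by (subst pr) auto
  finally show ?thesis .
qed

lemma nn_integral_component_Pi_pmf:
  assumes "finite A" "i \<in> A"
  shows "(\<integral>\<^sup>+g. F (g i) \<partial>Pi_pmf A d p) = (\<integral>\<^sup>+x. F x \<partial>p i)"
proof -
  have "(\<integral>\<^sup>+g. F (g i) \<partial>Pi_pmf A d p) = (\<integral>\<^sup>+x. F x \<partial>map_pmf (\<lambda>g. g i) (Pi_pmf A d p))" by simp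
  then show ?thesis using Pi_pmf_component[OF assms(1), of i d p] assms(2) by simp
qed

lemma nn_integral_mapM_nth:
  "i < length xs \<Longrightarrow> (\<integral>\<^sup>+ys. F (ys ! i) \<partial>mapM_pmf f xs) = (\<integral>\<^sup>+y. F y \<partial>f (xs ! i))"
  unfolding mapM_pmf_Pi[of f xs undefined] by (simp add: nn_integral_component_Pi_pmf)

lemma nn_integral_mapM_nth2:
  "i < length xs \<Longrightarrow> j < length xs \<Longrightarrow> i \<noteq> j \<Longrightarrow>
   (\<integral>\<^sup>+ys. F (ys ! i) * G (ys ! j) \<partial>mapM_pmf f xs) = (\<integral>\<^sup>+y. F y \<partial>f (xs ! i)) * (\<integral>\<^sup>+y. G y \<partial>f (xs ! j))"
  unfolding mapM_pmf_Pi[of f xs undefined] by (simp add: nn_integral_pair_Pi_pmf)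

section \<open>Thinning a set\<close>

definition thin :: "'a set \<Rightarrow> ennreal \<Rightarrow> 'a set pmf" where
  "thin T p = map_pmf (\<lambda>k. {a \<in> T. k a}) (Pi_pmf T False (\<lambda>_. bernoulli_pmf (enn2real p)))"

lemma outcome_reduce [simp]: "outcome (reduce T p) = thin T p"
  by (simp add: outcome_def reduce_def thin_def pmf.map_comp o_def)

lemma set_thin: "A \<in> set_pmf (thin T p) \<Longrightarrow> A \<subseteq> T"
  by (auto simp: thin_def)

lemma nn_integral_of_bool_bernoulli:
  assumes "p \<le> (1::ennreal)"
  shows "(\<integral>\<^sup>+k. of_bool k \<partial>bernoulli_pmf (enn2real p)) = p"
proof -
  have "enn2real p \<le> enn2real 1" using assms by (intro enn2real_mono) auto
  moreover have "p \<noteq> \<infinity>" using assms by (auto simp: top_unique)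
  ultimately show ?thesis by (simp add: ennreal_enn2real_if)
qed

lemma thin_marginal:
  assumes T: "finite T" and p: "p \<le> 1"
  shows "(\<integral>\<^sup>+A. of_bool (a \<in> A) \<partial>thin T p) = of_bool (a \<in> T) * p"
proof (cases "a \<in> T")
  case True
  have "(\<integral>\<^sup>+A. of_bool (a \<in> A) \<partial>thin T p) = (\<integral>\<^sup>+k. of_bool (k a) \<partial>Pi_pmf T False (\<lambda>_. bernoulli_pmf (enn2real p)))"
    using True by (simp add: thin_def)
  also have "\<dots> = (\<integral>\<^sup>+k. of_bool k \<partial>bernoulli_pmf (enn2real p))"
    by (rule nn_integral_component_Pi_pmf[OF T True])
  finally show ?thesis using True nn_integral_of_bool_bernoulli[OF p] by simp
qed (simp add: thin_def)

lemma thin_pair: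
  assumes T: "finite T" and p: "p \<le> 1" and ab: "a \<noteq> b"
  shows "(\<integral>\<^sup>+A. of_bool (a \<in> A) * of_bool (b \<in> A) \<partial>thin T p) = (of_bool (a \<in> T) * p) * (of_bool (b \<in> T) * p)"
proof (cases "a \<in> T \<and> b \<in> T")
  case True
  then have m: "a \<in> T" "b \<in> T" by auto
  have "(\<integral>\<^sup>+A. of_bool (a \<in> A) * of_bool (b \<in> A) \<partial>thin T p)
     = (\<integral>\<^sup>+k. of_bool (k a) * of_bool (k b) \<partial>Pi_pmf T False (\<lambda>_. bernoulli_pmf (enn2real p)))"
    using m by (simp add: thin_def)
  also have "\<dots> = (\<integral>\<^sup>+k. of_bool k \<partial>bernoulli_pmf (enn2real p)) * (\<integral>\<^sup>+k. of_bool k \<partial>bernoulli_pmf (enn2real p))"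
    by (rule nn_integral_pair_Pi_pmf[OF T m ab])
  finally show ?thesis using m nn_integral_of_bool_bernoulli[OF p] by simp
qed (auto simp: thin_def)

lemma first_index:
  assumes "filter P qs \<noteq> []"
  obtains i where "i < length qs" "hd (filter P qs) = qs ! i" "P (qs ! i)" "\<And>j. j < i \<Longrightarrow> \<not> P (qs ! j)"
proof -
  have ex: "\<exists>i. i < length qs \<and> P (qs ! i)" using assms by (auto simp: filter_empty_conv in_set_conv_nth)
  define i where "i = (LEAST i. i < length qs \<and> P (qs ! i))"
  have i: "i < length qs" "P (qs ! i)" using LeastI_ex[OF ex] by (auto simp: i_def)
  have m: "\<not> P (qs ! j)" if "j < i" for j 
    using not_less_Least[of j "\<lambda>i. i < length qs \<and> P (qs ! i)"] that i(1) unfolding i_def[symmetric] by auto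
  have "filter P (take i qs) = []" using m by (auto simp: filter_empty_conv in_set_conv_nth)
  moreover have "qs = take i qs @ qs ! i # drop (Suc i) qs" using i by (simp add: id_take_nth_drop)
  ultimately have "filter P qs = qs ! i # filter P (drop (Suc i) qs)"
    using i by (metis append_Nil filter.simps(2) filter_append)
  then show thesis using that i m by simp
qed

section \<open>Membership probabilities in one sampling step\<close>

context layered
begin

definition rho :: "('q \<Rightarrow> ennreal) \<Rightarrow> 'q \<Rightarrow> ennreal" where
  "rho p q = Min (p ` set (children B q))"

definition ite_sample :: "('q \<Rightarrow> ennreal) \<Rightarrow> ennreal \<Rightarrow> 'v \<Rightarrow> 'q \<Rightarrow> 'q \<Rightarrow> ('q \<Rightarrow> ('v \<rightharpoonup> bool) set) \<Rightarrow> ('v \<rightharpoonup> bool) set pmf" where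
  "ite_sample p v x q1 q0 \<sigma> = bind_pmf (thin (\<sigma> q0) (v / p q0)) (\<lambda>A0. bind_pmf (thin (\<sigma> q1) (v / p q1)) (\<lambda>A1.
     return_pmf ((A0 \<otimes>\<^sub>a {[x \<mapsto> False]}) \<union> (A1 \<otimes>\<^sub>a {[x \<mapsto> True]}))))"

definition union_sample :: "('q \<Rightarrow> ennreal) \<Rightarrow> 'q \<Rightarrow> ('q \<Rightarrow> ('v \<rightharpoonup> bool) set) \<Rightarrow> ('v \<rightharpoonup> bool) set pmf" where
  "union_sample p q \<sigma> = map_pmf (union_children B q) (mapM_pmf (\<lambda>c. thin (\<sigma> c) (rho p q / p c)) (children B q))"

definition sub_models :: "('q \<Rightarrow> ('v \<rightharpoonup> bool) set) \<Rightarrow> bool" where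
  "sub_models \<sigma> \<longleftrightarrow> (\<forall>c\<in>set (nodes B). \<sigma> c \<subseteq> Mod B c)"

lemma sub_models_finite: "sub_models \<sigma> \<Longrightarrow> c \<in> set (nodes B) \<Longrightarrow> finite (\<sigma> c)"
  unfolding sub_models_def using finite_Mod finite_subset by blast

lemma mem_otimes:
  assumes "A \<subseteq> Mod B e" "x \<notin> node_vars B e"
  shows "\<alpha> \<in> A \<otimes>\<^sub>a {[x \<mapsto> b]} \<longleftrightarrow> \<alpha> x = Some b \<and> \<alpha>(x := None) \<in> A"
proof
  assume "\<alpha> \<in> A \<otimes>\<^sub>a {[x \<mapsto> b]}"
  then obtain \<beta> where \<beta>: "\<beta> \<in> A" "\<alpha> = \<beta>(x \<mapsto> b)" by (auto simp: otimes_def)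
  then have "x \<notin> dom \<beta>" using assms Mod_dom by blast
  then have "\<beta>(x := None) = \<beta>" by (auto simp: fun_eq_iff)
  then show "\<alpha> x = Some b \<and> \<alpha>(x := None) \<in> A" using \<beta> by simp
next
  assume a: "\<alpha> x = Some b \<and> \<alpha>(x := None) \<in> A"
  then have "\<alpha> = \<alpha>(x := None) ++ [x \<mapsto> b]" by (auto simp: fun_eq_iff)
  then show "\<alpha> \<in> A \<otimes>\<^sub>a {[x \<mapsto> b]}" using a unfolding otimes_def by blast
qed

context
  fixes q x q1 q0 \<sigma>
  assumes q: "q \<in> set (nodes B)" and g: "gate_of B q = Ite x q1 q0" and \<sigma>: "sub_models \<sigma>"
begin

lemma ite_nodes: "q1 \<in> set (nodes B)" "q0 \<in> set (nodes B)"
  using children_nodes[OF q] g by (auto simp: children_def)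

lemma ite_mem:
  assumes "A0 \<subseteq> \<sigma> q0" "A1 \<subseteq> \<sigma> q1"
  shows "\<alpha> \<in> (A0 \<otimes>\<^sub>a {[x \<mapsto> False]}) \<union> (A1 \<otimes>\<^sub>a {[x \<mapsto> True]}) \<longleftrightarrow>
    (\<exists>b. \<alpha> x = Some b \<and> \<alpha>(x := None) \<in> (if b then A1 else A0))"
proof -
  have "A0 \<subseteq> Mod B q0" "A1 \<subseteq> Mod B q1" using assms \<sigma> ite_nodes by (auto simp: sub_models_def)
  then have 1: "\<alpha> \<in> A0 \<otimes>\<^sub>a {[x \<mapsto> False]} \<longleftrightarrow> \<alpha> x = Some False \<and> \<alpha>(x := None) \<in> A0"
    and 2: "\<alpha> \<in> A1 \<otimes>\<^sub>a {[x \<mapsto> True]} \<longleftrightarrow> \<alpha> x = Some True \<and> \<alpha>(x := None) \<in> A1"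
    using ite_fresh[OF q g] by (auto intro!: mem_otimes)
  show ?thesis unfolding Un_iff 1 2 by (auto split: if_splits)
qed

lemma ite_sample_subset: "A \<in> set_pmf (ite_sample p v x q1 q0 \<sigma>) \<Longrightarrow> A \<subseteq> Mod B q"
proof
  fix \<alpha> assume "A \<in> set_pmf (ite_sample p v x q1 q0 \<sigma>)" and \<alpha>: "\<alpha> \<in> A"
  then obtain A0 A1 where A: "A = (A0 \<otimes>\<^sub>a {[x \<mapsto> False]}) \<union> (A1 \<otimes>\<^sub>a {[x \<mapsto> True]})" "A0 \<subseteq> \<sigma> q0" "A1 \<subseteq> \<sigma> q1"
    by (auto simp: ite_sample_def dest: set_thin)
  then obtain b where "\<alpha> x = Some b" "\<alpha>(x := None) \<in> (if b then A1 else A0)" using ite_mem \<alpha> by blast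
  moreover have "A0 \<subseteq> Mod B q0" "A1 \<subseteq> Mod B q1" using A \<sigma> ite_nodes by (auto simp: sub_models_def)
  ultimately show "\<alpha> \<in> Mod B q" unfolding Mod_ite[OF q g] by (intro exI[of _ b]) (auto split: if_splits)
qed

lemma ite_sample_integral:
  "(\<integral>\<^sup>+A. F (\<lambda>\<alpha>. \<alpha> \<in> A) \<partial>ite_sample p v x q1 q0 \<sigma>) =
   (\<integral>\<^sup>+A0. \<integral>\<^sup>+A1. F (\<lambda>\<alpha>. \<exists>b. \<alpha> x = Some b \<and> \<alpha>(x := None) \<in> (if b then A1 else A0)) \<partial>thin (\<sigma> q1) (v / p q1) \<partial>thin (\<sigma> q0) (v / p q0))"
  unfolding ite_sample_def nn_integral_bind_pmf
proof (intro nn_integral_pmf_cong)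
  fix A0 A1 assume "A0 \<in> set_pmf (thin (\<sigma> q0) (v / p q0))" "A1 \<in> set_pmf (thin (\<sigma> q1) (v / p q1))"
  then have "A0 \<subseteq> \<sigma> q0" "A1 \<subseteq> \<sigma> q1" by (auto dest: set_thin)
  from ite_mem[OF this] show "(\<integral>\<^sup>+A. F (\<lambda>\<alpha>. \<alpha> \<in> A) \<partial>return_pmf ((A0 \<otimes>\<^sub>a {[x \<mapsto> False]}) \<union> (A1 \<otimes>\<^sub>a {[x \<mapsto> True]})))
     = F (\<lambda>\<alpha>. \<exists>b. \<alpha> x = Some b \<and> \<alpha>(x := None) \<in> (if b then A1 else A0))" by simp
qed

text \<open>The value of \<open>x\<close> in \<open>\<alpha>\<close> selects one child, and only the
  thinning at that child decides about \<open>\<alpha>\<close>. A child selected by a model is never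
  the 0-sink, so the ratios are constrained at the live children.\<close>

lemma ite_sample_marginal:
  assumes \<alpha>: "\<alpha> \<in> Mod B q" and le: "\<And>e. e \<in> {q1, q0} \<Longrightarrow> gate_of B e \<noteq> Sink False \<Longrightarrow> v / p e \<le> 1"
  shows "(\<integral>\<^sup>+A. of_bool (\<alpha> \<in> A) \<partial>ite_sample p v x q1 q0 \<sigma>) = of_bool (snd (prev (q, \<alpha>)) \<in> \<sigma> (fst (prev (q, \<alpha>)))) * (v / p (fst (prev (q, \<alpha>))))"
proof -
  obtain b where b: "\<alpha> x = Some b" "\<alpha>(x := None) \<in> Mod B (if b then q1 else q0)" using Mod_ite[OF q g] \<alpha> by blast
  have lb: "v / p (if b then q1 else q0) \<le> 1" using le b Mod_dead by (metis empty_iff insertCI)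
  have pr: "prev (q, \<alpha>) = ((if b then q1 else q0), \<alpha>(x := None))" using g b by simp
  note fin = sub_models_finite[OF \<sigma> ite_nodes(1)] sub_models_finite[OF \<sigma> ite_nodes(2)]
  have ex: "(\<exists>b'. \<alpha> x = Some b' \<and> \<alpha>(x := None) \<in> (if b' then A1 else A0)) \<longleftrightarrow> \<alpha>(x := None) \<in> (if b then A1 else A0)" for A0 A1
    using b by auto
  show ?thesis
    unfolding ite_sample_integral[where F = "\<lambda>m. of_bool (m \<alpha>)"] ex pr
    using thin_marginal[OF fin(1), of "v / p q1"] thin_marginal[OF fin(2), of "v / p q0"] lb by (cases b) simp_all
qed

text \<open>Given the samples of the children, the two memberships are independent. Either the
  models take different branches, which are thinned separately, or they take the same branch and
  still differ after \<open>x\<close> is erased, so that two different elements of one set are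
  thinned.\<close>

lemma ite_sample_pair:
  assumes \<alpha>: "\<alpha> \<in> Mod B q" "\<alpha>' \<in> Mod B q" "\<alpha> \<noteq> \<alpha>'" and le: "\<And>e. e \<in> {q1, q0} \<Longrightarrow> gate_of B e \<noteq> Sink False \<Longrightarrow> v / p e \<le> 1"
  shows "(\<integral>\<^sup>+A. of_bool (\<alpha> \<in> A) * of_bool (\<alpha>' \<in> A) \<partial>ite_sample p v x q1 q0 \<sigma>) =
     (of_bool (snd (prev (q, \<alpha>)) \<in> \<sigma> (fst (prev (q, \<alpha>)))) * (v / p (fst (prev (q, \<alpha>))))) *
     (of_bool (snd (prev (q, \<alpha>')) \<in> \<sigma> (fst (prev (q, \<alpha>')))) * (v / p (fst (prev (q, \<alpha>')))))"
proof -
  obtain b where b: "\<alpha> x = Some b" "\<alpha>(x := None) \<in> Mod B (if b then q1 else q0)" using Mod_ite[OF q g] \<alpha> by blast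
  obtain b' where b': "\<alpha>' x = Some b'" "\<alpha>'(x := None) \<in> Mod B (if b' then q1 else q0)" using Mod_ite[OF q g] \<alpha> by blast
  have lb: "v / p (if b then q1 else q0) \<le> 1" "v / p (if b' then q1 else q0) \<le> 1" using le b b' Mod_dead by (metis empty_iff insertCI)+
  have pr: "prev (q, \<alpha>) = ((if b then q1 else q0), \<alpha>(x := None))" "prev (q, \<alpha>') = ((if b' then q1 else q0), \<alpha>'(x := None))"
    using g b b' by simp_all
  note fin = sub_models_finite[OF \<sigma> ite_nodes(1)] sub_models_finite[OF \<sigma> ite_nodes(2)]
  have ex: "(\<exists>b'. \<alpha> x = Some b' \<and> \<alpha>(x := None) \<in> (if b' then A1 else A0)) \<longleftrightarrow> \<alpha>(x := None) \<in> (if b then A1 else A0)"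
    "(\<exists>b. \<alpha>' x = Some b \<and> \<alpha>'(x := None) \<in> (if b then A1 else A0)) \<longleftrightarrow> \<alpha>'(x := None) \<in> (if b' then A1 else A0)" for A0 A1
    using b b' by auto
  have ne: "\<alpha>(x := None) \<noteq> \<alpha>'(x := None)" if "b = b'"
  proof
    assume eq: "\<alpha>(x := None) = \<alpha>'(x := None)"
    have "\<alpha> y = \<alpha>' y" for y using fun_cong[OF eq, of y] b b' that by (cases "y = x") auto
    then show False using \<alpha>(3) by auto
  qed
  note r1 = thin_marginal[OF fin(1), of "v / p q1"] and r0 = thin_marginal[OF fin(2), of "v / p q0"]
    and d1 = thin_pair[OF fin(1), of "v / p q1"] and d0 = thin_pair[OF fin(2), of "v / p q0"]
  consider "b" "b'" | "b" "\<not> b'" | "\<not> b" "b'" | "\<not> b" "\<not> b'" by blast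
  then show ?thesis
    unfolding ite_sample_integral[where F = "\<lambda>m. of_bool (m \<alpha>) * of_bool (m \<alpha>')"] ex pr
    by cases (use r1 r0 d1 d0 lb ne in \<open>simp_all add: nn_integral_multc nn_integral_cmult\<close>)
qed

end

context
  fixes q qs \<sigma>
  assumes q: "q \<in> set (nodes B)" and g: "gate_of B q = Or qs" and \<sigma>: "sub_models \<sigma>"
begin

lemma or_nodes: "c \<in> set qs \<Longrightarrow> c \<in> set (nodes B)"
  using children_nodes[OF q] g by (auto simp: children_def)

lemma union_sample_support:
  assumes "As \<in> set_pmf (mapM_pmf (\<lambda>c. thin (\<sigma> c) (f c)) qs)"
  shows "length As = length qs" "i < length qs \<Longrightarrow> As ! i \<subseteq> Mod B (qs ! i)"
  using set_mapM_pmf[OF assms] set_thin \<sigma> or_nodes[OF nth_mem]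
  by (fastforce simp: list_all2_conv_all_nth sub_models_def)+

text \<open>Only the first child that has \<open>\<alpha>\<close> as a model can contribute it: the
  samples of earlier children consist of their own models, and contributions of later children are
  rejected. So each model enters the union through a single child, the one given by
  \<open>prev\<close>.\<close>

lemma mem_union_sample:
  assumes \<alpha>: "\<alpha> \<in> Mod B q"
  obtains i where "i < length qs" "prev (q, \<alpha>) = (qs ! i, \<alpha>)"
    "\<And>As f. As \<in> set_pmf (mapM_pmf (\<lambda>c. thin (\<sigma> c) (f c)) qs) \<Longrightarrow> \<alpha> \<in> union_children B q As \<longleftrightarrow> \<alpha> \<in> As ! i"
proof -
  have "filter (\<lambda>c. \<alpha> \<in> Mod B c) qs \<noteq> []" using \<alpha> Mod_or[OF q g] by (auto simp: filter_empty_conv)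
  then obtain i where i: "i < length qs" "hd (filter (\<lambda>c. \<alpha> \<in> Mod B c) qs) = qs ! i" "\<alpha> \<in> Mod B (qs ! i)"
    "\<And>j. j < i \<Longrightarrow> \<alpha> \<notin> Mod B (qs ! j)" by (rule first_index) blast
  have ch: "children B q = qs" using g by (simp add: children_def)
  show thesis
  proof (rule that[of i])
    show "prev (q, \<alpha>) = (qs ! i, \<alpha>)" using g i by simp
    fix As f assume As: "As \<in> set_pmf (mapM_pmf (\<lambda>c. thin (\<sigma> c) (f c)) qs)"
    note s = union_sample_support[OF As]
    show "\<alpha> \<in> union_children B q As \<longleftrightarrow> \<alpha> \<in> As ! i"
    proof
      assume "\<alpha> \<in> union_children B q As"
      then obtain k where k: "k < length qs" "\<alpha> \<in> As ! k" "\<forall>j<k. \<alpha> \<notin> Mod B (qs ! j)"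
        by (auto simp: union_children_def ch)
      have "\<alpha> \<in> Mod B (qs ! k)" using s(2)[OF k(1)] k(2) by auto
      then have "k = i" using k(3) i(3,4) by (metis linorder_neqE_nat)
      then show "\<alpha> \<in> As ! i" using k by simp
    next
      assume "\<alpha> \<in> As ! i"
      then show "\<alpha> \<in> union_children B q As" using i by (auto simp: union_children_def ch)
    qed
  qed (use i in auto)
qed

lemma union_sample_subset: "A \<in> set_pmf (union_sample p q \<sigma>) \<Longrightarrow> A \<subseteq> Mod B q"
proof
  fix \<alpha> assume "A \<in> set_pmf (union_sample p q \<sigma>)" and \<alpha>: "\<alpha> \<in> A"
  then obtain As where As: "As \<in> set_pmf (mapM_pmf (\<lambda>c. thin (\<sigma> c) (rho p q / p c)) qs)" "A = union_children B q As"
    using g by (auto simp: union_sample_def children_def)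
  then obtain i where i: "i < length qs" "\<alpha> \<in> As ! i" using \<alpha> g by (auto simp: union_children_def children_def)
  then have "\<alpha> \<in> Mod B (qs ! i)" using union_sample_support(2)[OF As(1)] by auto
  then show "\<alpha> \<in> Mod B q" using Mod_or[OF q g] i by auto
qed

lemma union_sample_marginal:
  assumes \<alpha>: "\<alpha> \<in> Mod B q" and le: "\<And>c. c \<in> set qs \<Longrightarrow> rho p q / p c \<le> 1"
  shows "(\<integral>\<^sup>+A. of_bool (\<alpha> \<in> A) \<partial>union_sample p q \<sigma>) = of_bool (snd (prev (q, \<alpha>)) \<in> \<sigma> (fst (prev (q, \<alpha>)))) * (rho p q / p (fst (prev (q, \<alpha>))))"
proof -
  obtain i where i: "i < length qs" "prev (q, \<alpha>) = (qs ! i, \<alpha>)"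
    "\<And>As f. As \<in> set_pmf (mapM_pmf (\<lambda>c. thin (\<sigma> c) (f c)) qs) \<Longrightarrow> \<alpha> \<in> union_children B q As \<longleftrightarrow> \<alpha> \<in> As ! i"
    using mem_union_sample[OF \<alpha>] by blast
  have "(\<integral>\<^sup>+A. of_bool (\<alpha> \<in> A) \<partial>union_sample p q \<sigma>) = (\<integral>\<^sup>+As. of_bool (\<alpha> \<in> As ! i) \<partial>mapM_pmf (\<lambda>c. thin (\<sigma> c) (rho p q / p c)) qs)"
    unfolding union_sample_def nn_integral_map_pmf using g i(3) by (auto simp: children_def intro!: nn_integral_pmf_cong)
  also have "\<dots> = (\<integral>\<^sup>+A. of_bool (\<alpha> \<in> A) \<partial>thin (\<sigma> (qs ! i)) (rho p q / p (qs ! i)))"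
    by (rule nn_integral_mapM_nth[OF i(1)])
  also have "\<dots> = of_bool (\<alpha> \<in> \<sigma> (qs ! i)) * (rho p q / p (qs ! i))"
    using i le by (intro thin_marginal sub_models_finite[OF \<sigma> or_nodes]) auto
  finally show ?thesis using i by simp
qed

text \<open>Two distinct models enter through different positions, which are thinned separately, or
  as two different elements of the sample at one position. In both cases they are kept
  independently.\<close>

lemma union_sample_pair:
  assumes \<alpha>: "\<alpha> \<in> Mod B q" "\<alpha>' \<in> Mod B q" "\<alpha> \<noteq> \<alpha>'" and le: "\<And>c. c \<in> set qs \<Longrightarrow> rho p q / p c \<le> 1"
  shows "(\<integral>\<^sup>+A. of_bool (\<alpha> \<in> A) * of_bool (\<alpha>' \<in> A) \<partial>union_sample p q \<sigma>) =
     (of_bool (snd (prev (q, \<alpha>)) \<in> \<sigma> (fst (prev (q, \<alpha>)))) * (rho p q / p (fst (prev (q, \<alpha>))))) *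
     (of_bool (snd (prev (q, \<alpha>')) \<in> \<sigma> (fst (prev (q, \<alpha>')))) * (rho p q / p (fst (prev (q, \<alpha>')))))"
proof -
  let ?r = "\<lambda>c. thin (\<sigma> c) (rho p q / p c)"
  obtain i where i: "i < length qs" "prev (q, \<alpha>) = (qs ! i, \<alpha>)"
    "\<And>As f. As \<in> set_pmf (mapM_pmf (\<lambda>c. thin (\<sigma> c) (f c)) qs) \<Longrightarrow> \<alpha> \<in> union_children B q As \<longleftrightarrow> \<alpha> \<in> As ! i"
    using mem_union_sample[OF \<alpha>(1)] by blast
  obtain j where j: "j < length qs" "prev (q, \<alpha>') = (qs ! j, \<alpha>')"
    "\<And>As f. As \<in> set_pmf (mapM_pmf (\<lambda>c. thin (\<sigma> c) (f c)) qs) \<Longrightarrow> \<alpha>' \<in> union_children B q As \<longleftrightarrow> \<alpha>' \<in> As ! j"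
    using mem_union_sample[OF \<alpha>(2)] by blast
  have fin: "finite (\<sigma> (qs ! i))" "finite (\<sigma> (qs ! j))" using i j by (auto intro!: sub_models_finite[OF \<sigma> or_nodes])
  have "(\<integral>\<^sup>+A. of_bool (\<alpha> \<in> A) * of_bool (\<alpha>' \<in> A) \<partial>union_sample p q \<sigma>)
     = (\<integral>\<^sup>+As. of_bool (\<alpha> \<in> As ! i) * of_bool (\<alpha>' \<in> As ! j) \<partial>mapM_pmf ?r qs)"
    unfolding union_sample_def nn_integral_map_pmf using g i(3) j(3) by (auto simp: children_def intro!: nn_integral_pmf_cong)
  also have "\<dots> = (of_bool (\<alpha> \<in> \<sigma> (qs ! i)) * (rho p q / p (qs ! i))) * (of_bool (\<alpha>' \<in> \<sigma> (qs ! j)) * (rho p q / p (qs ! j)))"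
  proof (cases "i = j")
    case True
    then have "(\<integral>\<^sup>+As. of_bool (\<alpha> \<in> As ! i) * of_bool (\<alpha>' \<in> As ! j) \<partial>mapM_pmf ?r qs)
      = (\<integral>\<^sup>+A. of_bool (\<alpha> \<in> A) * of_bool (\<alpha>' \<in> A) \<partial>?r (qs ! i))"
      using nn_integral_mapM_nth[OF i(1), where F = "\<lambda>A. of_bool (\<alpha> \<in> A) * of_bool (\<alpha>' \<in> A)" and f = ?r] by simp
    then show ?thesis using thin_pair[OF fin(1) _ \<alpha>(3)] le i True by simp
  next
    case False
    have "(\<integral>\<^sup>+As. of_bool (\<alpha> \<in> As ! i) * of_bool (\<alpha>' \<in> As ! j) \<partial>mapM_pmf ?r qs)
      = (\<integral>\<^sup>+A. of_bool (\<alpha> \<in> A) \<partial>?r (qs ! i)) * (\<integral>\<^sup>+A. of_bool (\<alpha>' \<in> A) \<partial>?r (qs ! j))"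
      by (rule nn_integral_mapM_nth2[OF i(1) j(1) False])
    then show ?thesis using thin_marginal[OF fin(1)] thin_marginal[OF fin(2)] le i j by simp
  qed
  finally show ?thesis using i j by simp
qed

end

end

lemma ennreal_divide_mult_cancel: "0 < b \<Longrightarrow> b \<le> 1 \<Longrightarrow> a / b * b = (a :: ennreal)"
proof -
  assume b: "0 < b" "b \<le> 1"
  then have "b \<noteq> 0" "b < top" by (auto simp: less_top[symmetric] top_unique)
  then have "b / b = 1" by (simp add: ennreal_divide_self)
  moreover have "a / b * b = a * (b / b)" by (simp add: divide_ennreal_def mult_ac)
  ultimately show ?thesis by simp
qed

lemma ennreal_divide_le_1: "0 < b \<Longrightarrow> b \<le> 1 \<Longrightarrow> a \<le> b \<Longrightarrow> a / b \<le> (1 :: ennreal)"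
proof -
  assume b: "0 < b" "b \<le> 1" "a \<le> b"
  then have "b \<noteq> 0" "b < top" by (auto simp: less_top[symmetric] top_unique)
  then have "b / b = 1" by (simp add: ennreal_divide_self)
  then show ?thesis using b divide_right_mono_ennreal[of a b b] by simp
qed

context layered
begin

definition node_sample :: "('q \<Rightarrow> ennreal) \<Rightarrow> 'q \<Rightarrow> ('q \<Rightarrow> ('v \<rightharpoonup> bool) set) \<Rightarrow> ('v \<rightharpoonup> bool) set pmf" where
  "node_sample h q \<sigma> = (case gate_of B q of
      Sink b \<Rightarrow> return_pmf (\<sigma> q)
    | Ite x q1 q0 \<Rightarrow> ite_sample h (h q) x q1 q0 \<sigma>
    | Or qs \<Rightarrow> bind_pmf (union_sample h q \<sigma>) (\<lambda>T. thin T (h q / rho h q)))"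

text \<open>Values do not increase from a child to its parent, so that all ratios used for thinning
  are probabilities. The 0-sink has the value infinity and is left out.\<close>

definition admissible :: "('q \<Rightarrow> ennreal) \<Rightarrow> 'q \<Rightarrow> bool" where
  "admissible h q \<longleftrightarrow> 0 < h q \<and> (\<forall>c\<in>set (children B q). gate_of B c \<noteq> Sink False \<longrightarrow> h q \<le> h c \<and> h c \<le> 1)"

lemma rho_props:
  assumes q: "q \<in> set (nodes B)" and g: "gate_of B q = Or qs" and h: "\<And>c. c \<in> set qs \<Longrightarrow> 0 < h c \<and> h c \<le> 1"
  shows "0 < rho h q" "rho h q \<le> 1" "c \<in> set qs \<Longrightarrow> rho h q \<le> h c" "c \<in> set qs \<Longrightarrow> rho h q / h c \<le> 1"
proof -
  have ne: "qs \<noteq> []" using or_nonempty[OF q] g by auto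
  then have "rho h q \<in> h ` set qs" unfolding rho_def children_def g by (auto intro!: Min_in)
  then show "0 < rho h q" "rho h q \<le> 1" using h by auto
  show le: "rho h q \<le> h c" if "c \<in> set qs" for c
    using that unfolding rho_def children_def g by (auto intro!: Min_le)
  show "rho h q / h c \<le> 1" if "c \<in> set qs"
    using le[OF that] h[OF that] by (intro ennreal_divide_le_1) auto
qed

lemma or_admissible:
  assumes q: "q \<in> set (nodes B)" and g: "gate_of B q = Or qs" and a: "admissible h q"
  shows "c \<in> set qs \<Longrightarrow> 0 < h c \<and> h c \<le> 1" "h q / rho h q \<le> 1"
proof -
  have l: "gate_of B c \<noteq> Sink False" if "c \<in> set qs" for c using or_child[OF q g that] by (auto simp: is_decision_def)
  show h: "0 < h c \<and> h c \<le> 1" if "c \<in> set qs" for c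
    using a l[OF that] that g by (auto simp: admissible_def children_def intro: less_le_trans)
  have "rho h q \<in> h ` set qs" unfolding rho_def children_def g
    using or_nonempty[OF q] g by (auto intro!: Min_in)
  then have "h q \<le> rho h q" using a l g by (auto simp: admissible_def children_def)
  then show "h q / rho h q \<le> 1"
    using rho_props(1,2)[OF q g h] by (intro ennreal_divide_le_1) auto
qed

text \<open>At an Or-node the thinning from \<open>h c\<close> to \<open>rho h q\<close> and the one
  from there to \<open>h q\<close> compose to the ratio \<open>h q / h c\<close>. Decision nodes and
  Or-nodes thus obey the same formula.\<close>

lemma node_sample_marginal:
  assumes q: "q \<in> set (nodes B)" and ns: "\<not> is_sink B q" and \<sigma>: "sub_models \<sigma>" and a: "admissible h q" and \<alpha>: "\<alpha> \<in> Mod B q"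
  shows "(\<integral>\<^sup>+A. of_bool (\<alpha> \<in> A) \<partial>node_sample h q \<sigma>) = of_bool (snd (prev (q, \<alpha>)) \<in> \<sigma> (fst (prev (q, \<alpha>)))) * (h q / h (fst (prev (q, \<alpha>))))"
proof (cases "gate_of B q")
  case (Sink b) then show ?thesis using ns by (simp add: is_sink_def)
next
  case (Ite x q1 q0)
  have "h q / h e \<le> 1" if "e \<in> {q1, q0}" "gate_of B e \<noteq> Sink False" for e
    using a that Ite by (intro ennreal_divide_le_1) (auto simp: admissible_def children_def intro: less_le_trans)
  then show ?thesis using ite_sample_marginal[OF q Ite \<sigma> \<alpha>, of "h q" h] Ite by (simp add: node_sample_def del: prev.simps)
next
  case (Or qs)
  note oa = or_admissible[OF q Or a]
  have r: "0 < rho h q" "rho h q \<le> 1" and rc: "\<And>c. c \<in> set qs \<Longrightarrow> rho h q / h c \<le> 1"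
    using rho_props[OF q Or, of h] oa(1) by blast+
  have E: "rho h q / h c * (h q / rho h q) = h q / h c" for c
  proof -
    have "rho h q / h c * (h q / rho h q) = (h q / rho h q * rho h q) / h c" by (simp add: divide_ennreal_def mult_ac)
    then show ?thesis using r ennreal_divide_mult_cancel[of "rho h q" "h q"] by simp
  qed
  have "(\<integral>\<^sup>+A. of_bool (\<alpha> \<in> A) \<partial>node_sample h q \<sigma>) = (\<integral>\<^sup>+T. \<integral>\<^sup>+A. of_bool (\<alpha> \<in> A) \<partial>thin T (h q / rho h q) \<partial>union_sample h q \<sigma>)"
    using Or by (simp add: node_sample_def)
  also have "\<dots> = (\<integral>\<^sup>+T. of_bool (\<alpha> \<in> T) * (h q / rho h q) \<partial>union_sample h q \<sigma>)"
  proof (rule nn_integral_pmf_cong)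
    fix T assume "T \<in> set_pmf (union_sample h q \<sigma>)"
    then have "finite T" using union_sample_subset[OF q Or \<sigma>] finite_Mod[OF q] finite_subset by blast
    then show "(\<integral>\<^sup>+A. of_bool (\<alpha> \<in> A) \<partial>thin T (h q / rho h q)) = of_bool (\<alpha> \<in> T) * (h q / rho h q)"
      using oa by (intro thin_marginal) auto
  qed
  also have "\<dots> = (\<integral>\<^sup>+T. of_bool (\<alpha> \<in> T) \<partial>union_sample h q \<sigma>) * (h q / rho h q)"
    by (rule nn_integral_multc) simp
  also have "(\<integral>\<^sup>+T. of_bool (\<alpha> \<in> T) \<partial>union_sample h q \<sigma>)
      = of_bool (snd (prev (q, \<alpha>)) \<in> \<sigma> (fst (prev (q, \<alpha>)))) * (rho h q / h (fst (prev (q, \<alpha>))))"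
    by (rule union_sample_marginal[OF q Or \<sigma> \<alpha>]) (rule rc)
  finally show ?thesis by (simp only: mult.assoc E)
qed

lemma node_sample_pair:
  assumes q: "q \<in> set (nodes B)" and ns: "\<not> is_sink B q" and \<sigma>: "sub_models \<sigma>" and a: "admissible h q"
    and \<alpha>: "\<alpha> \<in> Mod B q" "\<alpha>' \<in> Mod B q" "\<alpha> \<noteq> \<alpha>'"
  shows "(\<integral>\<^sup>+A. of_bool (\<alpha> \<in> A) * of_bool (\<alpha>' \<in> A) \<partial>node_sample h q \<sigma>) =
    (of_bool (snd (prev (q, \<alpha>)) \<in> \<sigma> (fst (prev (q, \<alpha>)))) * (h q / h (fst (prev (q, \<alpha>))))) *
    (of_bool (snd (prev (q, \<alpha>')) \<in> \<sigma> (fst (prev (q, \<alpha>')))) * (h q / h (fst (prev (q, \<alpha>')))))"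
proof (cases "gate_of B q")
  case (Sink b) then show ?thesis using ns by (simp add: is_sink_def)
next
  case (Ite x q1 q0)
  have "h q / h e \<le> 1" if "e \<in> {q1, q0}" "gate_of B e \<noteq> Sink False" for e
    using a that Ite by (intro ennreal_divide_le_1) (auto simp: admissible_def children_def intro: less_le_trans)
  then show ?thesis using ite_sample_pair[OF q Ite \<sigma> \<alpha>, of "h q" h] Ite by (simp add: node_sample_def del: prev.simps)
next
  case (Or qs)
  note oa = or_admissible[OF q Or a]
  have r: "0 < rho h q" "rho h q \<le> 1" and rc: "\<And>c. c \<in> set qs \<Longrightarrow> rho h q / h c \<le> 1"
    using rho_props[OF q Or, of h] oa(1) by blast+
  have E: "rho h q / h c * (h q / rho h q) = h q / h c" for c
  proof -
    have "rho h q / h c * (h q / rho h q) = (h q / rho h q * rho h q) / h c" by (simp add: divide_ennreal_def mult_ac)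
    then show ?thesis using r ennreal_divide_mult_cancel[of "rho h q" "h q"] by simp
  qed
  let ?k = "h q / rho h q"
  have "(\<integral>\<^sup>+A. of_bool (\<alpha> \<in> A) * of_bool (\<alpha>' \<in> A) \<partial>node_sample h q \<sigma>)
     = (\<integral>\<^sup>+T. \<integral>\<^sup>+A. of_bool (\<alpha> \<in> A) * of_bool (\<alpha>' \<in> A) \<partial>thin T ?k \<partial>union_sample h q \<sigma>)"
    using Or by (simp add: node_sample_def)
  also have "\<dots> = (\<integral>\<^sup>+T. (of_bool (\<alpha> \<in> T) * of_bool (\<alpha>' \<in> T)) * (?k * ?k) \<partial>union_sample h q \<sigma>)"
  proof (rule nn_integral_pmf_cong)
    fix T assume "T \<in> set_pmf (union_sample h q \<sigma>)"
    then have "finite T" using union_sample_subset[OF q Or \<sigma>] finite_Mod[OF q] finite_subset by blast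
    then show "(\<integral>\<^sup>+A. of_bool (\<alpha> \<in> A) * of_bool (\<alpha>' \<in> A) \<partial>thin T ?k) = (of_bool (\<alpha> \<in> T) * of_bool (\<alpha>' \<in> T)) * (?k * ?k)"
      using oa \<alpha>(3) by (subst thin_pair) (auto simp: mult_ac)
  qed
  also have "\<dots> = (\<integral>\<^sup>+T. of_bool (\<alpha> \<in> T) * of_bool (\<alpha>' \<in> T) \<partial>union_sample h q \<sigma>) * (?k * ?k)"
    by (rule nn_integral_multc) simp
  also have "(\<integral>\<^sup>+T. of_bool (\<alpha> \<in> T) * of_bool (\<alpha>' \<in> T) \<partial>union_sample h q \<sigma>)
     = (of_bool (snd (prev (q, \<alpha>)) \<in> \<sigma> (fst (prev (q, \<alpha>)))) * (rho h q / h (fst (prev (q, \<alpha>))))) *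
       (of_bool (snd (prev (q, \<alpha>')) \<in> \<sigma> (fst (prev (q, \<alpha>')))) * (rho h q / h (fst (prev (q, \<alpha>')))))"
    by (rule union_sample_pair[OF q Or \<sigma> \<alpha>]) (rule rc)
  also have "\<dots> * (?k * ?k) = (of_bool (snd (prev (q, \<alpha>)) \<in> \<sigma> (fst (prev (q, \<alpha>)))) * (rho h q / h (fst (prev (q, \<alpha>))) * ?k)) *
     (of_bool (snd (prev (q, \<alpha>')) \<in> \<sigma> (fst (prev (q, \<alpha>')))) * (rho h q / h (fst (prev (q, \<alpha>'))) * ?k))"
    by (simp only: mult_ac)
  finally show ?thesis unfolding E .
qed

lemma node_sample_subset:
  assumes q: "q \<in> set (nodes B)" and \<sigma>: "sub_models \<sigma>" and A: "A \<in> set_pmf (node_sample h q \<sigma>)"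
  shows "A \<subseteq> Mod B q"
proof (cases "gate_of B q")
  case (Sink b) then show ?thesis using A \<sigma> q by (auto simp: node_sample_def sub_models_def)
next
  case (Ite x q1 q0)
  then show ?thesis using A ite_sample_subset[OF q Ite \<sigma>] by (simp add: node_sample_def)
next
  case (Or qs)
  then show ?thesis using A union_sample_subset[OF q Or \<sigma>] set_thin by (fastforce simp: node_sample_def)
qed

definition init_samples :: "'q \<Rightarrow> ('v \<rightharpoonup> bool) set" where
  "init_samples q = (if gate_of B q = Sink True then {Map.empty} else {})"

primrec sample_process :: "('q \<Rightarrow> ennreal) \<Rightarrow> 'q list \<Rightarrow> ('q \<Rightarrow> ('v \<rightharpoonup> bool) set) \<Rightarrow> ('q \<Rightarrow> ('v \<rightharpoonup> bool) set) pmf" where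
  "sample_process h [] \<sigma> = return_pmf \<sigma>"
| "sample_process h (q # qs) \<sigma> = bind_pmf (node_sample h q \<sigma>) (\<lambda>A. sample_process h qs (\<sigma>(q := A)))"

lemma sample_process_snoc: "sample_process h (xs @ [q]) \<sigma> = bind_pmf (sample_process h xs \<sigma>) (\<lambda>\<tau>. bind_pmf (node_sample h q \<tau>) (\<lambda>A. return_pmf (\<tau>(q := A))))"
  by (induction xs arbitrary: \<sigma>) (auto simp: bind_assoc_pmf bind_return_pmf)

text \<open>Stronger than a topological order: levels must not decrease, so that the chain of
  another processed pair can never pass through the node processed last. Sinks do not occur because
  their samples are given initially.\<close>

definition level_order :: "'q list \<Rightarrow> bool" where
  "level_order xs \<longleftrightarrow> (\<forall>ys q zs. xs = ys @ q # zs \<longrightarrow> q \<in> set (nodes B) \<and> \<not> is_sink B q \<and> q \<notin> set ys \<and>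
     (\<forall>q'\<in>set ys. lv q' \<le> lv q) \<and> (\<forall>c\<in>set (children B q). is_sink B c \<or> c \<in> set ys))"

lemma level_order_snoc:
  assumes "level_order (xs @ [q])"
  shows "level_order xs" "q \<in> set (nodes B)" "\<not> is_sink B q" "q \<notin> set xs" "\<And>q'. q' \<in> set xs \<Longrightarrow> lv q' \<le> lv q"
    "\<And>c. c \<in> set (children B q) \<Longrightarrow> is_sink B c \<or> c \<in> set xs"
  using assms unfolding level_order_def by (auto, blast+)

lemma sub_models_init_samples: "sub_models init_samples"
  by (auto simp: sub_models_def init_samples_def Mod_true)

lemma sample_process_sub_models: "level_order xs \<Longrightarrow> \<sigma> \<in> set_pmf (sample_process h xs init_samples) \<Longrightarrow> sub_models \<sigma>"
proof (induction xs arbitrary: \<sigma> rule: rev_induct)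
  case Nil then show ?case by (simp add: sub_models_init_samples)
next
  case (snoc q xs)
  from snoc.prems(2) obtain \<tau> A where \<tau>: "\<tau> \<in> set_pmf (sample_process h xs init_samples)" "A \<in> set_pmf (node_sample h q \<tau>)" "\<sigma> = \<tau>(q := A)"
    by (auto simp: sample_process_snoc)
  have s: "sub_models \<tau>" using snoc.IH \<tau> level_order_snoc(1)[OF snoc.prems(1)] by blast
  then show ?case using node_sample_subset[OF level_order_snoc(2)[OF snoc.prems(1)] s \<tau>(2)] \<tau>(3) by (auto simp: sub_models_def)
qed

definition weight :: "('q \<Rightarrow> ennreal) \<Rightarrow> 'q \<Rightarrow> real" where
  "weight h q = 1 / enn2real (h q)"

lemma chain_in:
  assumes "level_order xs"
  shows "valid z \<Longrightarrow> fst z \<in> set xs \<or> is_sink B (fst z) \<Longrightarrow> y \<in> chain z \<Longrightarrow> fst y \<in> set xs \<or> is_sink B (fst y)"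
proof (induction z rule: chain_induct)
  case (sink z) then show ?case by (auto simp: chain_0)
next
  case (step z)
  have "fst z \<in> set xs" using step lv_sink by (auto simp: valid_def)
  then obtain ys zs where "xs = ys @ fst z # zs" by (auto dest: split_list)
  then have "fst (prev z) \<in> set xs \<or> is_sink B (fst (prev z))"
    using assms prev_valid(3)[OF step(1,2)] unfolding level_order_def by fastforce
  then show ?case using step by (auto simp: chain_Suc)
qed

lemma gain_nonneg:
  assumes v: "valid y" and a: "lv (fst y) > 0 \<Longrightarrow> admissible h (fst y)"
  shows "gain (weight h) y \<ge> 0"
proof (cases "lv (fst y) = 0")
  case True then show ?thesis by (simp add: gain_def weight_def)
next
  case False
  then have l: "lv (fst y) > 0" by simp
  have g: "gate_of B (fst (prev y)) \<noteq> Sink False" using valid_alive prev_valid(1)[OF v l] by blast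
  then have "0 < h (fst y)" "h (fst y) \<le> h (fst (prev y))" "h (fst (prev y)) \<le> 1"
    using a[OF l] prev_valid(3)[OF v l] by (auto simp: admissible_def)
  then have "0 < enn2real (h (fst y))" "enn2real (h (fst y)) \<le> enn2real (h (fst (prev y)))"
    by (auto intro!: enn2real_mono simp: enn2real_positive_iff) (metis ennreal_one_less_top le_less_trans order_trans)+
  then show ?thesis using False by (simp add: gain_def weight_def frac_le)
qed

text \<open>Induction on the processing order. A pair at the last node \<open>q\<close> is traced
  back to its predecessor at the cost of a factor \<open>h q / h c\<close>, and \<open>corr\<close>
  does not change as long as the traced pair is not on the other chain. Two distinct pairs at
  \<open>q\<close> are traced back independently. If the pairs coincide, the probability is
  \<open>h q\<close>, which equals \<open>h q * h q * (1 / h q)\<close>, in accordance with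
  \<open>corr_self\<close>.\<close>

lemma pair_probability:
  assumes "level_order xs" "\<And>q. q \<in> set xs \<Longrightarrow> admissible h q" and h1: "\<And>q. q \<in> set (nodes B) \<Longrightarrow> gate_of B q = Sink True \<Longrightarrow> h q = 1"
    and "valid z" "valid z'" "fst z \<in> set xs \<or> is_sink B (fst z)" "fst z' \<in> set xs \<or> is_sink B (fst z')"
  shows "(\<integral>\<^sup>+\<sigma>. of_bool (snd z \<in> \<sigma> (fst z)) * of_bool (snd z' \<in> \<sigma> (fst z')) \<partial>sample_process h xs init_samples)
     = h (fst z) * h (fst z') * ennreal (corr (weight h) z z')"
  using assms(1,2,4-)
proof (induction xs arbitrary: z z' rule: rev_induct)
  case Nil
  then have l: "lv (fst z) = 0" "lv (fst z') = 0" using lv_sink by (auto simp: valid_def)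
  have eq: "z = z'" using corr_sinks Nil l by blast
  have g: "gate_of B (fst z) = Sink True" using valid_level0 Nil l by blast
  have n: "fst z \<in> set (nodes B)" using Nil by (simp add: valid_def)
  have e: "snd z = Map.empty" using Nil Mod_true[OF n g] by (simp add: valid_def)
  show ?case using h1[OF n g] corr_self[OF Nil(3)] g e eq by (simp add: init_samples_def weight_def)
next
  case (snoc q xs)
  note o = level_order_snoc[OF snoc.prems(1)]
  have lq: "lv q > 0" using lv_nonsink o by blast
  have aq: "admissible h q" using snoc.prems by simp
  have IH: "(\<integral>\<^sup>+\<sigma>. of_bool (snd y \<in> \<sigma> (fst y)) * of_bool (snd y' \<in> \<sigma> (fst y')) \<partial>sample_process h xs init_samples)
     = h (fst y) * h (fst y') * ennreal (corr (weight h) y y')"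
    if "valid y" "valid y'" "fst y \<in> set xs \<or> is_sink B (fst y)" "fst y' \<in> set xs \<or> is_sink B (fst y')" for y y'
    using snoc.IH[of y y'] that o(1) snoc.prems(2) by simp
  have sm: "\<sigma> \<in> set_pmf (sample_process h xs init_samples) \<Longrightarrow> sub_models \<sigma>" for \<sigma> using sample_process_sub_models o(1) by blast
  have pr: "valid (prev y)" "fst (prev y) \<in> set xs \<or> is_sink B (fst (prev y))"
    "0 < h (fst (prev y))" "h (fst (prev y)) \<le> 1" "h q / h (fst (prev y)) * h (fst (prev y)) = h q"
    if y: "valid y" "fst y = q" for y
  proof -
    have l: "lv (fst y) > 0" using y lq by simp
    show v: "valid (prev y)" by (rule prev_valid(1)[OF y(1) l])
    have c: "fst (prev y) \<in> set (children B q)" using prev_valid(3)[OF y(1) l] y by simp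
    show "fst (prev y) \<in> set xs \<or> is_sink B (fst (prev y))" using o(6) c by blast
    show p: "0 < h (fst (prev y))" "h (fst (prev y)) \<le> 1" using aq c valid_alive[OF v]
      by (auto simp: admissible_def intro: less_le_trans)
    then show "h q / h (fst (prev y)) * h (fst (prev y)) = h q" by (rule ennreal_divide_mult_cancel)
  qed
  \<comment> \<open>The node \<open>q\<close> has the highest level so far, while the elements of a
    chain below its top lie on strictly lower levels than the top.\<close>
  have nc: "y \<notin> chain y'" if y: "fst y = q" and y': "valid y'" "fst y' \<in> set (xs @ [q]) \<or> is_sink B (fst y')" "y' \<noteq> y" for y y'
  proof
    assume "y \<in> chain y'"
    then have "lv (fst y) < lv (fst y')" using chain_level[OF y'(1)] y'(3) by metis
    moreover have "lv (fst y') \<le> lv q" using y' o(5) lv_sink[of "fst y'"] by (auto simp: valid_def)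
    ultimately show False using y by simp
  qed
  have main: "(\<integral>\<^sup>+\<sigma>. of_bool (snd z \<in> \<sigma> (fst z)) * of_bool (snd z' \<in> \<sigma> (fst z')) \<partial>sample_process h (xs @ [q]) init_samples)
      = h (fst z) * h (fst z') * ennreal (corr (weight h) z z')"
    if z: "fst z = q" "valid z" "valid z'" "fst z' \<noteq> q" "fst z' \<in> set xs \<or> is_sink B (fst z')" for z z'
  proof -
    have zz: "z = (q, snd z)" using z by (metis prod.collapse)
    have m: "snd z \<in> Mod B q" using z by (auto simp: valid_def)
    note p = pr[OF z(2,1)]
    have "(\<integral>\<^sup>+\<sigma>. of_bool (snd z \<in> \<sigma> (fst z)) * of_bool (snd z' \<in> \<sigma> (fst z')) \<partial>sample_process h (xs @ [q]) init_samples)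
      = (\<integral>\<^sup>+\<sigma>. \<integral>\<^sup>+A. of_bool (snd z \<in> A) * of_bool (snd z' \<in> \<sigma> (fst z')) \<partial>node_sample h q \<sigma> \<partial>sample_process h xs init_samples)"
      using z by (simp add: sample_process_snoc)
    also have "\<dots> = (\<integral>\<^sup>+\<sigma>. (h q / h (fst (prev z))) * (of_bool (snd (prev z) \<in> \<sigma> (fst (prev z))) * of_bool (snd z' \<in> \<sigma> (fst z'))) \<partial>sample_process h xs init_samples)"
    proof (rule nn_integral_pmf_cong)
      fix \<sigma> assume "\<sigma> \<in> set_pmf (sample_process h xs init_samples)"
      from node_sample_marginal[OF o(2,3) sm[OF this] aq m]
      show "(\<integral>\<^sup>+A. of_bool (snd z \<in> A) * of_bool (snd z' \<in> \<sigma> (fst z')) \<partial>node_sample h q \<sigma>)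
         = (h q / h (fst (prev z))) * (of_bool (snd (prev z) \<in> \<sigma> (fst (prev z))) * of_bool (snd z' \<in> \<sigma> (fst z')))"
        by (simp add: nn_integral_multc mult_ac zz[symmetric] del: prev.simps)
    qed
    also have "\<dots> = (h q / h (fst (prev z))) * (h (fst (prev z)) * h (fst z') * ennreal (corr (weight h) (prev z) z'))"
      using IH[OF p(1) z(3) p(2) z(5)] by (simp add: nn_integral_cmult)
    also have "\<dots> = (h q / h (fst (prev z)) * h (fst (prev z))) * h (fst z') * ennreal (corr (weight h) (prev z) z')"
      by (simp add: mult_ac)
    also have "\<dots> = h q * h (fst z') * ennreal (corr (weight h) z z')"
    proof -
      have "z' \<noteq> z" using z by auto
      then have "corr (weight h) z z' = corr (weight h) (prev z) z'"
        using z lq nc[OF z(1,3)] by (intro corr_prev) auto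
      then show ?thesis using p(5) by simp
    qed
    finally show ?thesis using z by simp
  qed
  show ?case
  proof (cases "fst z = q")
    case zq: True
    have zz: "z = (q, snd z)" using zq by (metis prod.collapse)
    have m: "snd z \<in> Mod B q" using snoc.prems zq by (auto simp: valid_def)
    note p = pr[OF snoc.prems(3) zq]
    show ?thesis
    proof (cases "fst z' = q")
      case False
      then show ?thesis using main[OF zq snoc.prems(3,4)] snoc.prems by auto
    next
      case z'q: True
      have zz': "z' = (q, snd z')" using z'q by (metis prod.collapse)
      have m': "snd z' \<in> Mod B q" using snoc.prems z'q by (auto simp: valid_def)
      note p' = pr[OF snoc.prems(4) z'q]
      show ?thesis
      proof (cases "z = z'")
        case True
        have "(\<integral>\<^sup>+\<sigma>. of_bool (snd z \<in> \<sigma> (fst z)) * of_bool (snd z' \<in> \<sigma> (fst z')) \<partial>sample_process h (xs @ [q]) init_samples)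
          = (\<integral>\<^sup>+\<sigma>. \<integral>\<^sup>+A. of_bool (snd z \<in> A) \<partial>node_sample h q \<sigma> \<partial>sample_process h xs init_samples)"
          using zq True by (simp add: sample_process_snoc of_bool_conj[symmetric])
        \<comment> \<open>The membership of the predecessor is written twice, so that the induction
          hypothesis about pairs applies to this single event.\<close>
        also have "\<dots> = (\<integral>\<^sup>+\<sigma>. (h q / h (fst (prev z))) * (of_bool (snd (prev z) \<in> \<sigma> (fst (prev z))) * of_bool (snd (prev z) \<in> \<sigma> (fst (prev z)))) \<partial>sample_process h xs init_samples)"
        proof (rule nn_integral_pmf_cong)
          fix \<sigma> assume "\<sigma> \<in> set_pmf (sample_process h xs init_samples)"
          from node_sample_marginal[OF o(2,3) sm[OF this] aq m]
          show "(\<integral>\<^sup>+A. of_bool (snd z \<in> A) \<partial>node_sample h q \<sigma>)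
             = (h q / h (fst (prev z))) * (of_bool (snd (prev z) \<in> \<sigma> (fst (prev z))) * of_bool (snd (prev z) \<in> \<sigma> (fst (prev z))))"
            by (simp add: mult_ac zz[symmetric] del: prev.simps)
        qed
        also have "\<dots> = (h q / h (fst (prev z))) * (h (fst (prev z)) * h (fst (prev z)) * ennreal (corr (weight h) (prev z) (prev z)))"
          using IH[OF p(1) p(1) p(2) p(2)] by (simp add: nn_integral_cmult)
        also have "\<dots> = (h q / h (fst (prev z)) * h (fst (prev z))) * (h (fst (prev z)) * ennreal (corr (weight h) (prev z) (prev z)))"
          by (simp add: mult_ac)
        also have "\<dots> = h q"
        proof -
          have "h (fst (prev z)) * ennreal (corr (weight h) (prev z) (prev z)) = 1"
            unfolding corr_self[OF p(1)] weight_def using p(3,4)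
            by (cases "h (fst (prev z))") (auto simp: ennreal_mult[symmetric] top_unique)
          then show ?thesis using p(5) by simp
        qed
        also have "h q = h (fst z) * h (fst z') * ennreal (corr (weight h) z z')"
        proof -
          have "0 < h q" "h q \<le> 1" using aq p(4) prev_valid(3)[OF snoc.prems(3)] lq zq valid_alive[OF p(1)]
            by (auto simp: admissible_def intro: order_trans)
          then have "h q * ennreal (weight h q) = 1" unfolding weight_def
            by (cases "h q") (auto simp: ennreal_mult[symmetric] top_unique)
          then show ?thesis using True zq corr_self[OF snoc.prems(3), of "weight h"] by (simp add: mult.assoc)
        qed
        finally show ?thesis .
      next
        case False
        then have ne: "snd z \<noteq> snd z'" using zz zz' by metis
        have "(\<integral>\<^sup>+\<sigma>. of_bool (snd z \<in> \<sigma> (fst z)) * of_bool (snd z' \<in> \<sigma> (fst z')) \<partial>sample_process h (xs @ [q]) init_samples)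
          = (\<integral>\<^sup>+\<sigma>. \<integral>\<^sup>+A. of_bool (snd z \<in> A) * of_bool (snd z' \<in> A) \<partial>node_sample h q \<sigma> \<partial>sample_process h xs init_samples)"
          using zq z'q by (simp add: sample_process_snoc)
        also have "\<dots> = (\<integral>\<^sup>+\<sigma>. (h q / h (fst (prev z)) * (h q / h (fst (prev z')))) * (of_bool (snd (prev z) \<in> \<sigma> (fst (prev z))) * of_bool (snd (prev z') \<in> \<sigma> (fst (prev z')))) \<partial>sample_process h xs init_samples)"
        proof (rule nn_integral_pmf_cong)
          fix \<sigma> assume "\<sigma> \<in> set_pmf (sample_process h xs init_samples)"
          from node_sample_pair[OF o(2,3) sm[OF this] aq m m' ne]
          show "(\<integral>\<^sup>+A. of_bool (snd z \<in> A) * of_bool (snd z' \<in> A) \<partial>node_sample h q \<sigma>)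
             = (h q / h (fst (prev z)) * (h q / h (fst (prev z')))) * (of_bool (snd (prev z) \<in> \<sigma> (fst (prev z))) * of_bool (snd (prev z') \<in> \<sigma> (fst (prev z'))))"
            by (simp add: mult_ac zz[symmetric] zz'[symmetric] del: prev.simps)
        qed
        also have "\<dots> = (h q / h (fst (prev z)) * (h q / h (fst (prev z')))) * (h (fst (prev z)) * h (fst (prev z')) * ennreal (corr (weight h) (prev z) (prev z')))"
          using IH[OF p(1) p'(1) p(2) p'(2)] by (simp add: nn_integral_cmult)
        also have "\<dots> = (h q / h (fst (prev z)) * h (fst (prev z))) * (h q / h (fst (prev z')) * h (fst (prev z'))) * ennreal (corr (weight h) (prev z) (prev z'))"
          by (simp add: mult_ac)
        also have "corr (weight h) (prev z) (prev z') = corr (weight h) z z'"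
        proof -
          have "corr (weight h) z z' = corr (weight h) (prev z) z'"
            using snoc.prems zq lq nc[OF zq snoc.prems(4)] z'q False by (intro corr_prev) auto
          also have "\<dots> = corr (weight h) z' (prev z)" by (rule corr_sym)
          also have "\<dots> = corr (weight h) (prev z') (prev z)"
          proof (rule corr_prev)
            \<comment> \<open>After the first pair has been traced back, its node was processed
              before \<open>q\<close>, so its chain cannot contain the second pair and that one may
              be traced back as well.\<close>
            have "prev z \<noteq> z'" using p(2) z'q o(3,4) by auto
            then show "z' \<notin> chain (prev z)" using nc[OF z'q p(1)] p(2) by auto
          qed (use snoc.prems z'q lq in auto)
          finally show ?thesis by (simp add: corr_sym)
        qed
        finally show ?thesis using zq z'q p(5) p'(5) by simp
      qed
    qed
  next
    case False
    show ?thesis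
    proof (cases "fst z' = q")
      case True
      have "(\<integral>\<^sup>+\<sigma>. of_bool (snd z' \<in> \<sigma> (fst z')) * of_bool (snd z \<in> \<sigma> (fst z)) \<partial>sample_process h (xs @ [q]) init_samples)
        = h (fst z') * h (fst z) * ennreal (corr (weight h) z' z)"
        by (rule main) (use True False snoc.prems in auto)
      then show ?thesis by (simp add: mult.commute corr_sym)
    next
      case z'q: False
      have "(\<integral>\<^sup>+\<sigma>. of_bool (snd z \<in> \<sigma> (fst z)) * of_bool (snd z' \<in> \<sigma> (fst z')) \<partial>sample_process h (xs @ [q]) init_samples)
        = (\<integral>\<^sup>+\<sigma>. of_bool (snd z \<in> \<sigma> (fst z)) * of_bool (snd z' \<in> \<sigma> (fst z')) \<partial>sample_process h xs init_samples)"
        using False z'q by (simp add: sample_process_snoc)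
      then show ?thesis using IH False z'q snoc.prems by auto
    qed
  qed
qed

end

section \<open>Moments at an Or-node\<close>

text \<open>\<open>median\<close> is the midpoint of the two middle order statistics, so it can
  leave a half-line only together with half of the entries. The midpoint property is a hypothesis
  because the lemma serves both \<open>ennreal\<close>, for the means at a node, and
  \<open>real\<close>, for the final amplification.\<close>

lemma median_between:
  fixes xs :: "'a::{linorder, numeral, inverse} list"
  assumes mid: "\<And>a b :: 'a. a \<le> b \<Longrightarrow> a \<le> (a + b) / 2 \<and> (a + b) / 2 \<le> b" and ne: "xs \<noteq> []"
  shows "median xs < c \<Longrightarrow> length xs \<le> 2 * card {j. j < length xs \<and> xs ! j < c}"
    and "median xs > c \<Longrightarrow> length xs \<le> 2 * card {j. j < length xs \<and> xs ! j > c}"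
proof -
  define ys where "ys = sort xs"
  define k where "k = length xs"
  have k: "k > 0" "length ys = k" using ne by (auto simp: k_def ys_def)
  have s: "sorted ys" by (simp add: ys_def)
  have cnt: "card {j. j < k \<and> P (xs ! j)} = card {j. j < k \<and> P (ys ! j)}" for P
  proof -
    have "length (filter P xs) = length (filter P ys)"
      by (metis (no_types) mset_filter mset_sort size_mset ys_def)
    then show ?thesis using k by (simp add: length_filter_conv_card k_def)
  qed
  have m: "median xs = (ys ! ((k - 1) div 2) + ys ! (k div 2)) / 2" by (simp add: median_def Let_def ys_def k_def)
  have "ys ! ((k - 1) div 2) \<le> ys ! (k div 2)" using s k by (intro sorted_nth_mono) auto
  from mid[OF this] have b: "ys ! ((k - 1) div 2) \<le> median xs" "median xs \<le> ys ! (k div 2)" by (auto simp: m)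
  {
    assume l: "median xs < c"
    \<comment> \<open>These are \<open>(k - 1) div 2 + 1\<close> positions, at least half of
      \<open>k\<close> for either parity.\<close>
    have "{..(k - 1) div 2} \<subseteq> {j. j < k \<and> ys ! j < c}"
    proof
      fix j assume j: "j \<in> {..(k - 1) div 2}"
      then have "ys ! j \<le> ys ! ((k - 1) div 2)" using s k by (intro sorted_nth_mono) auto
      moreover have "(k - 1) div 2 < k" using k by linarith
      ultimately show "j \<in> {j. j < k \<and> ys ! j < c}" using b l j by auto
    qed
    then have "card {..(k - 1) div 2} \<le> card {j. j < k \<and> ys ! j < c}" by (intro card_mono) auto
    then show "length xs \<le> 2 * card {j. j < length xs \<and> xs ! j < c}" using cnt[of "\<lambda>x. x < c"] k by (simp add: k_def)
  next
    assume l: "median xs > c"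
    have "{k div 2..<k} \<subseteq> {j. j < k \<and> ys ! j > c}"
    proof
      fix j assume j: "j \<in> {k div 2..<k}"
      then have "ys ! (k div 2) \<le> ys ! j" using s k by (intro sorted_nth_mono) auto
      then show "j \<in> {j. j < k \<and> ys ! j > c}" using b l j k by auto
    qed
    then have "card {k div 2..<k} \<le> card {j. j < k \<and> ys ! j > c}" by (intro card_mono) auto
    then show "length xs \<le> 2 * card {j. j < length xs \<and> xs ! j > c}" using cnt[of "\<lambda>x. x > c"] k by (simp add: k_def)
  }
qed

lemma ennreal_mid: "a \<le> b \<Longrightarrow> a \<le> (a + b) / 2 \<and> (a + b) / 2 \<le> (b :: ennreal)"
proof (cases a; cases b)
  fix x y assume "a \<le> b" "a = ennreal x" "0 \<le> x" "b = ennreal y" "0 \<le> y"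
  moreover from this have "x \<le> y" by simp
  moreover have "(ennreal x + ennreal y) / 2 = ennreal ((x + y) / 2)" if "0 \<le> x" "0 \<le> y"
    using that by (simp add: ennreal_plus[symmetric] ennreal_numeral[symmetric] divide_ennreal del: ennreal_plus ennreal_numeral)
  ultimately show ?thesis by (auto intro!: ennreal_leI)
qed (auto simp: top_unique ennreal_top_divide)

text \<open>A block sum fails with probability at most \<open>1 / 3\<close>. With
  \<open>r = sqrt 2\<close> in \<open>sum_pow_half_bad\<close>, two blocks contribute
  \<open>((4 / 3) / sqrt 2)\<^sup>2 = 8 / 9\<close>.\<close>

lemma blocks_tail:
  fixes X :: "'a \<Rightarrow> real"
  assumes fin: "finite (set_pmf D)" and mean: "measure_pmf.expectation D X = \<mu>"
    and var: "measure_pmf.expectation D (\<lambda>x. (X x)\<^sup>2) - \<mu>\<^sup>2 \<le> real ns * a\<^sup>2 / 2" and a: "a > 0" and ns: "ns > 0"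
  shows "measure_pmf.prob (Pi_pmf {..<2 * k * ns} d (\<lambda>_. D))
      {g. 2 * k \<le> 2 * card {j. j < 2 * k \<and> (\<Sum>i<ns. X (g (j * ns + i))) \<ge> real ns * (\<mu> + a)}} \<le> (8 / 9) ^ k" (is ?hi)
    and "measure_pmf.prob (Pi_pmf {..<2 * k * ns} d (\<lambda>_. D))
      {g. 2 * k \<le> 2 * card {j. j < 2 * k \<and> (\<Sum>i<ns. X (g (j * ns + i))) \<le> real ns * (\<mu> - a)}} \<le> (8 / 9) ^ k" (is ?lo)
proof -
  have gen: "measure_pmf.prob (Pi_pmf {..<2 * k * ns} d (\<lambda>_. D))
      {g. 2 * k \<le> 2 * card {j. j < 2 * k \<and> P (\<Sum>i<ns. X (g (j * ns + i)))}} \<le> (8 / 9) ^ k"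
    if P: "measure_pmf.prob (Pi_pmf {..<ns} d (\<lambda>_. D)) {g. P (\<Sum>i<ns. X (g i))} \<le> 1 / 3" for P
  proof -
    let ?\<Phi> = "\<lambda>g j. if j < 2 * k then (\<lambda>i. if i < ns then g (j * ns + i) else d) else (\<lambda>_. d)"
    let ?E = "{f. card {..<2 * k} \<le> 2 * card {j \<in> {..<2 * k}. f j \<in> {g. P (\<Sum>i<ns. X (g i))}}}"
    have "{g. 2 * k \<le> 2 * card {j. j < 2 * k \<and> P (\<Sum>i<ns. X (g (j * ns + i)))}} = ?\<Phi> -` ?E"
      by (auto cong: conj_cong)
    then have "measure_pmf.prob (Pi_pmf {..<2 * k * ns} d (\<lambda>_. D))
      {g. 2 * k \<le> 2 * card {j. j < 2 * k \<and> P (\<Sum>i<ns. X (g (j * ns + i)))}}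
      = measure_pmf.prob (map_pmf ?\<Phi> (Pi_pmf {..<2 * k * ns} d (\<lambda>_. D))) ?E" by simp
    also have "\<dots> = measure_pmf.prob (Pi_pmf {..<2 * k} (\<lambda>_. d) (\<lambda>_. Pi_pmf {..<ns} d (\<lambda>_. D))) ?E"
      by (simp only: Pi_pmf_blocks[OF ns])
    also have "\<dots> \<le> ((1 + ((sqrt 2)\<^sup>2 - 1) * (1 / 3)) / sqrt 2) ^ card {..<2 * k}"
      by (rule sum_pow_half_bad) (use P in auto)
    also have "\<dots> = (((4 / 3) / sqrt 2)\<^sup>2) ^ k" by (simp add: power_mult)
    also have "((4 / 3) / sqrt 2)\<^sup>2 = (8 / 9 :: real)" by (simp add: power_divide)
    finally show ?thesis .
  qed
  note m = mean_tail_third[of "{..<ns}" D X \<mu> a d, OF _ fin mean _ a]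
  show ?hi using gen[of "\<lambda>s. s \<ge> real ns * (\<mu> + a)"] m(1) var ns by (simp add: lessThan_empty_iff)
  show ?lo using gen[of "\<lambda>s. s \<le> real ns * (\<mu> - a)"] m(2) var ns by (simp add: lessThan_empty_iff)
qed

lemma thin_1: "finite T \<Longrightarrow> thin T 1 = return_pmf T"
proof -
  assume T: "finite T"
  have b: "bernoulli_pmf 1 = return_pmf True"
  proof (rule pmf_eqI)
    fix b show "pmf (bernoulli_pmf 1) b = pmf (return_pmf True) b" by (cases b) auto
  qed
  have "Pi_pmf T False (\<lambda>_. bernoulli_pmf (enn2real 1)) = return_pmf (\<lambda>x. if x \<in> T then True else False)"
    using T by (simp add: b)
  then show ?thesis by (simp add: thin_def)
qed

context layered
begin

lemma rho_cong: "(\<And>c. c \<in> set (children B q) \<Longrightarrow> h c = h' c) \<Longrightarrow> rho h q = rho h' q"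
  unfolding rho_def by (intro arg_cong[of _ _ Min] image_cong) auto

lemma mapM_pmf_cong: "(\<And>x. x \<in> set xs \<Longrightarrow> f x = g x) \<Longrightarrow> mapM_pmf f xs = mapM_pmf g xs"
  by (induction xs) auto

lemma union_sample_cong:
  assumes "\<And>c. c \<in> set (children B q) \<Longrightarrow> h c = h' c"
  shows "union_sample h q \<sigma> = union_sample h' q \<sigma>"
  unfolding union_sample_def using rho_cong[of q h h'] assms by (auto intro!: arg_cong[of _ _ "map_pmf _"] mapM_pmf_cong)

lemma ite_sample_cong:
  assumes "h q1 = h' q1" "h q0 = h' q0"
  shows "ite_sample h v x q1 q0 \<sigma> = ite_sample h' v x q1 q0 \<sigma>"
  using assms by (simp add: ite_sample_def)

lemma node_sample_cong:
  assumes "\<And>c. c \<in> set (children B q) \<Longrightarrow> h c = h' c" "h q = h' q"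
  shows "node_sample h q \<sigma> = node_sample h' q \<sigma>"
  unfolding node_sample_def
  using union_sample_cong[of q h h'] rho_cong[of q h h'] ite_sample_cong[of h _ h'] assms
  by (auto split: gate.split simp: children_def)

lemma sample_process_cong:
  assumes "\<And>x c. x \<in> set xs \<Longrightarrow> c \<in> set (children B x) \<Longrightarrow> h c = h' c" "\<And>x. x \<in> set xs \<Longrightarrow> h x = h' x"
  shows "sample_process h xs \<sigma> = sample_process h' xs \<sigma>"
  using assms
proof (induction xs arbitrary: \<sigma>)
  case (Cons q xs)
  have "node_sample h q \<sigma> = node_sample h' q \<sigma>" by (rule node_sample_cong) (use Cons.prems in auto)
  moreover have "sample_process h xs \<tau> = sample_process h' xs \<tau>" for \<tau> by (rule Cons.IH) (use Cons.prems in auto)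
  ultimately show ?case by simp
qed simp

text \<open>The law of a single set formed at the Or-node \<open>q\<close> before its final
  reduction, with the values \<open>h\<close> imposed on the nodes \<open>xs\<close> processed
  earlier.\<close>

definition union_law :: "('q \<Rightarrow> ennreal) \<Rightarrow> 'q list \<Rightarrow> 'q \<Rightarrow> ('v \<rightharpoonup> bool) set pmf" where
  "union_law h xs q = bind_pmf (sample_process h xs init_samples) (union_sample h q)"

context
  fixes xs q qs h A
  assumes okx: "level_order (xs @ [q])" and g: "gate_of B q = Or qs" and admx: "\<And>x. x \<in> set xs \<Longrightarrow> admissible h x"
    and h1: "\<And>q. q \<in> set (nodes B) \<Longrightarrow> gate_of B q = Sink True \<Longrightarrow> h q = 1"
    and hx: "\<And>x. x \<in> set xs \<Longrightarrow> h x \<le> 1"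
    and A: "A \<ge> (1::real)" "\<And>x. x \<in> set xs \<Longrightarrow> weight h x \<le> A * cnt x"
begin

text \<open>With the value \<open>rho h q\<close> imposed at \<open>q\<close>, the final thinning
  there keeps everything. The union formed at \<open>q\<close> is then itself the sample of
  \<open>q\<close> in a process with imposed values, so that \<open>pair_probability\<close> applies
  to it.\<close>

private definition "h' = h(q := rho h q)"

lemma or_children: "c \<in> set qs \<Longrightarrow> c \<in> set xs \<and> 0 < h c \<and> h c \<le> 1"
proof -
  assume c: "c \<in> set qs"
  have "\<not> is_sink B c" using or_child[OF level_order_snoc(2)[OF okx] g c] by (auto simp: is_decision_def is_sink_def)
  then have "c \<in> set xs" using level_order_snoc(6)[OF okx, of c] c g by (auto simp: children_def)
  then show ?thesis using admx[of c] hx[of c] by (auto simp: admissible_def)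
qed

lemma rho_pos: "0 < rho h q" "rho h q \<le> 1"
  using rho_props(1,2)[OF level_order_snoc(2)[OF okx] g] or_children by auto

lemma rho_real: "0 < enn2real (rho h q)" "ennreal (enn2real (rho h q)) = rho h q"
proof -
  have "rho h q < top" using rho_pos by (metis ennreal_one_less_top le_less_trans)
  then show "0 < enn2real (rho h q)" "ennreal (enn2real (rho h q)) = rho h q"
    using rho_pos by (auto simp: enn2real_positive_iff)
qed

lemma h'_child: "x \<in> set (xs @ [q]) \<Longrightarrow> c \<in> set (children B x) \<Longrightarrow> h' c = h c"
proof -
  assume x: "x \<in> set (xs @ [q])" and c: "c \<in> set (children B x)"
  obtain ys zs where s: "xs @ [q] = ys @ x # zs" using x by (auto dest: split_list)
  then have "is_sink B c \<or> c \<in> set ys" using okx c unfolding level_order_def by blast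
  moreover have "q \<notin> set ys"
  proof
    assume "q \<in> set ys"
    moreover from s have "set ys \<subseteq> set xs"
      by (metis append_butlast_last_id butlast_append butlast_snoc list.distinct(1) set_append sup_ge1)
    ultimately show False using level_order_snoc(4)[OF okx] by auto
  qed
  ultimately have "c \<noteq> q" using level_order_snoc(3)[OF okx] by auto
  then show ?thesis by (simp add: h'_def)
qed

lemma admissible_h': "x \<in> set (xs @ [q]) \<Longrightarrow> admissible h' x"
proof (cases "x = q")
  case True
  have "h' q \<le> h' c \<and> h' c \<le> 1" if "c \<in> set (children B q)" for c
    using that h'_child[of q c] or_children[of c] rho_props(3)[OF level_order_snoc(2)[OF okx] g, of h c] g or_children
    by (auto simp: h'_def children_def)
  then show ?thesis using True rho_pos by (auto simp: admissible_def h'_def)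
next
  case False
  assume "x \<in> set (xs @ [q])"
  then have x: "x \<in> set xs" using False by auto
  then have "h' x = h x" using level_order_snoc(4)[OF okx] by (auto simp: h'_def)
  moreover have "h' c = h c" if "c \<in> set (children B x)" for c using h'_child[of x c] x that by auto
  ultimately show ?thesis using admx[OF x] by (auto simp: admissible_def)
qed

lemma union_law_eq: "union_law h xs q = map_pmf (\<lambda>\<sigma>. \<sigma> q) (sample_process h' (xs @ [q]) init_samples)"
proof -
  have s: "sample_process h xs init_samples = sample_process h' xs init_samples"
  proof (rule sample_process_cong)
    show "h c = h' c" if "x \<in> set xs" "c \<in> set (children B x)" for x c using h'_child[of x c] that by simp
    show "h x = h' x" if "x \<in> set xs" for x using that level_order_snoc(4)[OF okx] by (auto simp: h'_def)
  qed
  have "union_sample h q \<sigma> = node_sample h' q \<sigma>" if "\<sigma> \<in> set_pmf (sample_process h' xs init_samples)" for \<sigma>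
  proof -
    have sm: "sub_models \<sigma>" using that sample_process_sub_models level_order_snoc(1)[OF okx] by blast
    have r: "rho h' q = rho h q" by (rule rho_cong) (use h'_child in auto)
    have c: "union_sample h' q \<sigma> = union_sample h q \<sigma>" by (rule union_sample_cong) (use h'_child in auto)
    have d: "h' q / rho h' q = 1" using rho_pos r
      by (simp add: h'_def) (metis ennreal_divide_self ennreal_one_less_top le_less_trans less_numeral_extra(3))
    have "node_sample h' q \<sigma> = bind_pmf (union_sample h q \<sigma>) (\<lambda>T. thin T 1)" using g c d by (simp add: node_sample_def)
    also have "\<dots> = bind_pmf (union_sample h q \<sigma>) return_pmf"
    proof (rule bind_pmf_cong[OF refl])
      fix T assume "T \<in> set_pmf (union_sample h q \<sigma>)"
      then have "finite T" using union_sample_subset[OF level_order_snoc(2)[OF okx] g sm] finite_Mod[OF level_order_snoc(2)[OF okx]] finite_subset by blast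
      then show "thin T 1 = return_pmf T" by (rule thin_1)
    qed
    finally show ?thesis by (simp add: bind_return_pmf')
  qed
  then show ?thesis unfolding union_law_def s sample_process_snoc
    by (auto simp: map_bind_pmf bind_return_pmf' intro!: bind_pmf_cong)
qed

lemma union_law_subset: "T \<in> set_pmf (union_law h xs q) \<Longrightarrow> T \<subseteq> Mod B q"
  using sample_process_sub_models[OF okx] level_order_snoc(2)[OF okx] by (auto simp: union_law_eq sub_models_def)

lemma finite_union_law: "finite (set_pmf (union_law h xs q))"
proof (rule finite_subset)
  show "set_pmf (union_law h xs q) \<subseteq> Pow (Mod B q)" using union_law_subset by blast
  show "finite (Pow (Mod B q))" using finite_Mod[OF level_order_snoc(2)[OF okx]] by simp
qed

lemma union_law_pair:
  assumes "\<alpha> \<in> Mod B q" "\<alpha>' \<in> Mod B q"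
  shows "(\<integral>\<^sup>+T. of_bool (\<alpha> \<in> T) * of_bool (\<alpha>' \<in> T) \<partial>union_law h xs q)
     = rho h q * rho h q * ennreal (corr (weight h') (q, \<alpha>) (q, \<alpha>'))"
proof -
  have h'1: "h' x = 1" if "x \<in> set (nodes B)" "gate_of B x = Sink True" for x
    using that h1[OF that] level_order_snoc(3)[OF okx] by (auto simp: h'_def is_sink_def)
  have v: "valid (q, \<alpha>)" "valid (q, \<alpha>')" using assms level_order_snoc(2)[OF okx] by (auto simp: valid_def)
  have "(\<integral>\<^sup>+T. of_bool (\<alpha> \<in> T) * of_bool (\<alpha>' \<in> T) \<partial>union_law h xs q)
     = (\<integral>\<^sup>+\<sigma>. of_bool (snd (q, \<alpha>) \<in> \<sigma> (fst (q, \<alpha>))) * of_bool (snd (q, \<alpha>') \<in> \<sigma> (fst (q, \<alpha>'))) \<partial>sample_process h' (xs @ [q]) init_samples)"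
    by (simp only: union_law_eq nn_integral_map_pmf fst_conv snd_conv)
  also have "\<dots> = h' (fst (q, \<alpha>)) * h' (fst (q, \<alpha>')) * ennreal (corr (weight h') (q, \<alpha>) (q, \<alpha>'))"
    by (rule pair_probability[OF okx admissible_h' h'1 v]) simp_all
  also have "\<dots> = rho h q * rho h q * ennreal (corr (weight h') (q, \<alpha>) (q, \<alpha>'))"
    by (simp only: h'_def fst_conv fun_upd_same)
  finally show ?thesis .
qed

lemma card_sum_of_bool:
  "T \<subseteq> Mod B q \<Longrightarrow> ennreal (real (card T)) = (\<Sum>\<alpha>\<in>Mod B q. of_bool (\<alpha> \<in> T))"
proof -
  assume T: "T \<subseteq> Mod B q"
  have "(\<Sum>\<alpha>\<in>Mod B q. of_bool (\<alpha> \<in> T) :: ennreal) = of_nat (card (Mod B q \<inter> T))"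
    using finite_Mod[OF level_order_snoc(2)[OF okx]] by (simp add: of_bool_def sum.If_cases Int_def)
  also have "Mod B q \<inter> T = T" using T by blast
  finally show ?thesis by (simp add: ennreal_of_nat_eq_real_of_nat)
qed

text \<open>\<open>pair_probability\<close> for a pair with itself shows that each model is present
  with probability \<open>rho h q\<close>, so the normalised cardinality is an unbiased estimator of
  the number of models.\<close>

lemma union_law_mean: "measure_pmf.expectation (union_law h xs q) (\<lambda>T. real (card T) / enn2real (rho h q)) = cnt q"
proof -
  let ?r = "enn2real (rho h q)"
  have one: "(\<integral>\<^sup>+T. of_bool (\<alpha> \<in> T) \<partial>union_law h xs q) = rho h q" if "\<alpha> \<in> Mod B q" for \<alpha>
  proof -
    have v: "valid (q, \<alpha>)" using that level_order_snoc(2)[OF okx] by (simp add: valid_def)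
    have "(\<integral>\<^sup>+T. of_bool (\<alpha> \<in> T) \<partial>union_law h xs q) = (\<integral>\<^sup>+T. of_bool (\<alpha> \<in> T) * of_bool (\<alpha> \<in> T) \<partial>union_law h xs q)"
      by (simp add: of_bool_conj[symmetric])
    also have "\<dots> = rho h q * rho h q * ennreal (1 / ?r)"
      using union_law_pair[OF that that] corr_self[OF v, of "weight h'"] by (simp add: weight_def h'_def)
    also have "\<dots> = rho h q"
    proof -
      obtain r where r: "r > 0" "rho h q = ennreal r" using rho_real by metis
      then have "enn2real (rho h q) = r" by simp
      then show ?thesis using r by (simp add: ennreal_mult[symmetric])
    qed
    finally show ?thesis .
  qed
  have "(\<integral>\<^sup>+T. ennreal (real (card T)) \<partial>union_law h xs q) = (\<integral>\<^sup>+T. (\<Sum>\<alpha>\<in>Mod B q. of_bool (\<alpha> \<in> T)) \<partial>union_law h xs q)"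
    by (rule nn_integral_pmf_cong) (use card_sum_of_bool union_law_subset in auto)
  also have "\<dots> = (\<Sum>\<alpha>\<in>Mod B q. \<integral>\<^sup>+T. of_bool (\<alpha> \<in> T) \<partial>union_law h xs q)" by (rule nn_integral_sum) auto
  also have "\<dots> = of_nat (cnt q) * rho h q" using one by (simp add: cnt_def)
  also have "\<dots> = ennreal (cnt q * ?r)" using rho_real by (simp add: ennreal_mult ennreal_of_nat_eq_real_of_nat)
  finally have "measure_pmf.expectation (union_law h xs q) (\<lambda>T. real (card T)) = cnt q * ?r"
    by (subst integral_eq_nn_integral) (auto simp: rho_real(1) less_imp_le)
  then show ?thesis using rho_real by simp
qed

text \<open>The second moment of the cardinality is the double sum of the pair probabilities, that
  is \<open>(rho h q)\<^sup>2\<close> times the double sum of \<open>corr\<close> for the weights of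
  \<open>h'\<close>.\<close>

lemma union_law_square:
  "measure_pmf.expectation (union_law h xs q) (\<lambda>T. (real (card T) / enn2real (rho h q))\<^sup>2)
     \<le> (real (cnt q))\<^sup>2 * (A * (1 + 7 / 10 * card (bdd_vars B)))"
proof -
  let ?r = "enn2real (rho h q)" and ?S = "(real (cnt q))\<^sup>2 * (A * (1 + 7 / 10 * card (bdd_vars B)))"
  have q: "q \<in> set (nodes B)" "gate_of B q \<noteq> Sink False" using level_order_snoc(2)[OF okx] g by auto
  have inx: "valid y \<and> (fst y = q \<or> fst y \<in> set xs \<or> gate_of B (fst y) = Sink True)"
    if "\<alpha> \<in> Mod B q" "y \<in> chain (q, \<alpha>)" for \<alpha> y
  proof -
    have v: "valid (q, \<alpha>)" using that q by (simp add: valid_def)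
    have vy: "valid y" using chain_restrict[OF v, of "fst y" "snd y"] that by simp
    have "fst y \<in> set (xs @ [q]) \<or> is_sink B (fst y)" by (rule chain_in[OF okx v _ that(2)]) simp
    then show ?thesis using vy valid_level0[OF vy] lv_sink[of "fst y"] by (auto simp: valid_def)
  qed
  have gn: "gain (weight h') y \<ge> 0" if "\<alpha> \<in> Mod B q" "y \<in> chain (q, \<alpha>)" for \<alpha> y
    using inx[OF that] admissible_h' lv_sink[of "fst y"] by (intro gain_nonneg) (auto simp: valid_def is_sink_def)
  have corr0: "corr (weight h') (q, \<alpha>) (q, \<alpha>') \<ge> 0" if "\<alpha> \<in> Mod B q" for \<alpha> \<alpha>'
    unfolding corr_def using gn[OF that] by (intro sum_nonneg) auto
  have wA: "weight h' (fst y) \<le> A * cnt (fst y)" if ay: "\<alpha> \<in> Mod B q" "y \<in> chain (q, \<alpha>)" for \<alpha> y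
  proof -
    \<comment> \<open>The weight imposed at \<open>q\<close> is that of one of its children. The
      bound for this child carries over to \<open>q\<close>, which has at least as many
      models.\<close>
    have "rho h q \<in> h ` set qs" unfolding rho_def children_def g
      using or_nonempty[OF q(1)] g by (auto intro!: Min_in)
    then obtain c where c: "c \<in> set qs" "rho h q = h c" by auto
    have "weight h' q = weight h c" using c by (simp add: weight_def h'_def)
    also have "\<dots> \<le> A * cnt c" using A(2) or_children[OF c(1)] by blast
    also have "\<dots> \<le> A * cnt q" using cnt_or[OF q(1) g c(1)] A(1) by (intro mult_left_mono) auto
    finally have wq: "weight h' q \<le> A * cnt q" .
    consider "fst y = q" | "fst y \<noteq> q" "fst y \<in> set xs" | "gate_of B (fst y) = Sink True" "fst y \<in> set (nodes B)"
      using inx[OF ay] by (auto simp: valid_def)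
    then show ?thesis
    proof cases
      case 3
      then have "h' (fst y) = 1" using h1[of "fst y"] level_order_snoc(3)[OF okx] by (auto simp: h'_def is_sink_def)
      moreover have "cnt (fst y) = 1" using Mod_true[OF 3(2,1)] by (simp add: cnt_def)
      ultimately show ?thesis using A by (simp add: weight_def)
    qed (use wq A(2) in \<open>auto simp: weight_def h'_def\<close>)
  qed
  have h'1: "weight h' x = 1" if "x \<in> set (nodes B)" "gate_of B x = Sink True" for x
    using that h1[OF that] level_order_snoc(3)[OF okx] by (auto simp: h'_def is_sink_def weight_def)
  have sb: "(\<Sum>\<alpha>\<in>Mod B q. \<Sum>\<alpha>'\<in>Mod B q. corr (weight h') (q, \<alpha>) (q, \<alpha>')) \<le> ?S"
    using A by (intro corr_sum_bound[OF q]) (auto intro: h'1 wA gn)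
  have "(\<integral>\<^sup>+T. ennreal ((real (card T))\<^sup>2) \<partial>union_law h xs q)
      = (\<integral>\<^sup>+T. (\<Sum>\<alpha>\<in>Mod B q. \<Sum>\<alpha>'\<in>Mod B q. of_bool (\<alpha> \<in> T) * of_bool (\<alpha>' \<in> T)) \<partial>union_law h xs q)"
  proof (rule nn_integral_pmf_cong)
    fix T assume "T \<in> set_pmf (union_law h xs q)"
    from card_sum_of_bool[OF union_law_subset[OF this]]
    show "ennreal ((real (card T))\<^sup>2) = (\<Sum>\<alpha>\<in>Mod B q. \<Sum>\<alpha>'\<in>Mod B q. of_bool (\<alpha> \<in> T) * of_bool (\<alpha>' \<in> T))"
      by (simp add: power2_eq_square ennreal_mult sum_product)
  qed
  also have "\<dots> = (\<Sum>\<alpha>\<in>Mod B q. \<Sum>\<alpha>'\<in>Mod B q. \<integral>\<^sup>+T. of_bool (\<alpha> \<in> T) * of_bool (\<alpha>' \<in> T) \<partial>union_law h xs q)"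
    by (simp add: nn_integral_sum)
  also have "\<dots> = (\<Sum>\<alpha>\<in>Mod B q. \<Sum>\<alpha>'\<in>Mod B q. ennreal (?r * ?r * corr (weight h') (q, \<alpha>) (q, \<alpha>')))"
    using rho_real corr0 by (intro sum.cong refl) (simp add: union_law_pair ennreal_mult)
  also have "\<dots> = ennreal (\<Sum>\<alpha>\<in>Mod B q. \<Sum>\<alpha>'\<in>Mod B q. ?r * ?r * corr (weight h') (q, \<alpha>) (q, \<alpha>'))"
    using corr0 rho_real by (simp add: sum_ennreal sum_nonneg)
  also have "\<dots> \<le> ennreal (?r\<^sup>2 * ?S)"
    using mult_left_mono[OF sb, of "?r\<^sup>2"] by (intro ennreal_leI) (simp add: sum_distrib_left power2_eq_square)
  finally have "measure_pmf.expectation (union_law h xs q) (\<lambda>T. (real (card T))\<^sup>2) \<le> ?r\<^sup>2 * ?S"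
    using A by (subst integral_eq_nn_integral) (auto intro!: enn2real_leI)
  then show ?thesis using rho_real by (simp add: power_divide field_simps)
qed

end

end

section \<open>The algorithm without the threshold\<close>

lemma ennreal_inverse_antimono: "a \<le> b \<Longrightarrow> inverse b \<le> inverse (a :: ennreal)"
proof (cases "a = 0 \<or> b = top")
  case False
  assume ab: "a \<le> b"
  from False ab have "a < top" "b < top" "a \<noteq> 0" by (auto simp: less_top[symmetric] top_unique)
  then obtain x y where "a = ennreal x" "b = ennreal y" "x > 0" "y \<ge> 0"
    by (cases a; cases b) (auto simp: less_le)
  then show ?thesis using ab by (auto simp: inverse_ennreal ennreal_le_iff2 intro!: ennreal_leI le_imp_inverse_le)
qed auto

lemma ennreal_inverse_inverse: "inverse (inverse a) = (a :: ennreal)"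
proof (cases "a = 0 \<or> a = top")
  case False
  then obtain x where "a = ennreal x" "x > 0" by (cases a) (auto simp: less_le)
  then show ?thesis by (simp add: inverse_ennreal)
qed auto

text \<open>The values that \<open>round_up\<close> can take on arguments up to 1. Their number is
  the factor by which an Or-node multiplies the histories in the union bound.\<close>

definition grid :: "nat \<Rightarrow> real \<Rightarrow> ennreal set" where
  "grid n \<kappa> = (\<lambda>l. min 1 (ennreal ((1 + \<kappa>) / real l))) ` {1..2 ^ n}"

lemma card_grid: "finite (grid n \<kappa>)" "card (grid n \<kappa>) \<le> 2 ^ n"
  unfolding grid_def using card_image_le[of "{1..2 ^ n :: nat}"] by auto

text \<open>An upper bound of the form \<open>(1 + \<kappa>) / l\<close> with an integer
  \<open>l\<close> is itself a candidate for rounding, so it survives rounding unchanged. The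
  analysis brings all its upper bounds on values into this form.\<close>

lemma round_up_le:
  assumes "v \<le> ennreal ((1 + \<kappa>) / real l)" "1 \<le> l" "l \<le> 2 ^ n"
  shows "round_up n \<kappa> v \<le> min 1 (ennreal ((1 + \<kappa>) / real l))"
proof -
  let ?G = "{g. \<exists>l::nat. 1 \<le> l \<and> l \<le> 2 ^ n \<and> g = ennreal ((1 + \<kappa>) / real l) \<and> v \<le> g}"
  have "?G \<subseteq> (\<lambda>l. ennreal ((1 + \<kappa>) / real l)) ` {1..2 ^ n}" by auto
  then have fin: "finite ?G" by (rule finite_subset) auto
  have m: "ennreal ((1 + \<kappa>) / real l) \<in> ?G" using assms by auto
  then have "Min ?G \<le> ennreal ((1 + \<kappa>) / real l)" using fin by (rule Min_le[rotated])
  then have "min 1 (Min ?G) \<le> min 1 (ennreal ((1 + \<kappa>) / real l))" by (rule min.mono[OF order_refl])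
  moreover have "round_up n \<kappa> v = min 1 (Min ?G)" using m unfolding round_up_def Let_def by (metis (mono_tags, lifting) empty_iff)
  ultimately show ?thesis by simp
qed

lemma round_up_grid:
  assumes "v \<le> 1" "\<kappa> \<ge> 0"
  shows "round_up n \<kappa> v \<in> grid n \<kappa>" "v \<le> round_up n \<kappa> v"
proof -
  let ?G = "{g. \<exists>l::nat. 1 \<le> l \<and> l \<le> 2 ^ n \<and> g = ennreal ((1 + \<kappa>) / real l) \<and> v \<le> g}"
  have "?G \<subseteq> (\<lambda>l. ennreal ((1 + \<kappa>) / real l)) ` {1..2 ^ n}" by auto
  then have fin: "finite ?G" by (rule finite_subset) auto
  \<comment> \<open>For \<open>v \<le> 1\<close> the choice \<open>l = 1\<close> is always a
    candidate, so the result is never infinite.\<close>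
  have a: "(1::ennreal) \<le> ennreal ((1 + \<kappa>) / real (1::nat))" using assms by (simp flip: ennreal_1)
  have m: "ennreal ((1 + \<kappa>) / real (1::nat)) \<in> ?G"
    by (intro CollectI exI[of _ "1::nat"] conjI refl order_trans[OF assms(1) a]) auto
  then have r: "round_up n \<kappa> v = min 1 (Min ?G)" unfolding round_up_def Let_def by (metis (mono_tags, lifting) empty_iff)
  have "Min ?G \<in> ?G" using fin m by (intro Min_in) auto
  then obtain l :: nat where l: "1 \<le> l" "l \<le> 2 ^ n" "Min ?G = ennreal ((1 + \<kappa>) / real l)" "v \<le> Min ?G" by blast
  show "round_up n \<kappa> v \<in> grid n \<kappa>" unfolding r l(3) grid_def using l by (intro imageI) auto
  show "v \<le> round_up n \<kappa> v" unfolding r using assms l by simp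
qed

text \<open>The last claim keeps the values monotone along the edges: the value of a child is on the
  grid, so rounding an argument below it cannot jump over it.\<close>

lemma grid_props:
  assumes "g \<in> grid n \<kappa>" "\<kappa> > 0"
  shows "0 < g" "g \<le> 1" "v \<le> g \<Longrightarrow> round_up n \<kappa> v \<le> g"
proof -
  obtain l where l: "1 \<le> l" "l \<le> 2 ^ n" "g = min 1 (ennreal ((1 + \<kappa>) / real l))" using assms by (auto simp: grid_def)
  have "ennreal ((1 + \<kappa>) / real l) > 0" using l assms by (simp add: ennreal_zero_less_divide)
  then show "0 < g" using l by simp
  show "g \<le> 1" using l by simp
  show "round_up n \<kappa> v \<le> g" if "v \<le> g"
    unfolding l(3) by (rule round_up_le) (use l that in auto)
qed

lemma one_in_grid: "\<kappa> \<ge> 0 \<Longrightarrow> 1 \<in> grid n \<kappa>"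
proof -
  assume "\<kappa> \<ge> 0"
  then have "(1::ennreal) \<le> ennreal ((1 + \<kappa>) / real (1::nat))" by (simp flip: ennreal_1)
  then have "1 = min 1 (ennreal ((1 + \<kappa>) / real (1::nat)))" by (metis min.absorb1)
  then show ?thesis unfolding grid_def by (intro image_eqI[where x = 1]) auto
qed

locale algo = layered B lv for B :: "('q, 'v) bdd" and lv +
  fixes \<kappa> :: real and ns nt :: nat
  assumes \<kappa>: "0 < \<kappa>" and ns: "0 < ns"
begin

abbreviation "nv \<equiv> card (bdd_vars B)"
abbreviation "N \<equiv> ns * nt"
abbreviation "st0 \<equiv> initial_state B N"

definition estimate :: "('q \<Rightarrow> ennreal) \<Rightarrow> 'q \<Rightarrow> ('v \<rightharpoonup> bool) set list \<Rightarrow> ennreal" where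
  "estimate p q Sh = median (map (\<lambda>j. 1 / (rho p q * of_nat ns) * (\<Sum>r = j * ns..<(j + 1) * ns. of_nat (card (Sh ! r)))) [0..<nt])"

definition or_value :: "('q \<Rightarrow> ennreal) \<Rightarrow> 'q \<Rightarrow> ('v \<rightharpoonup> bool) set list \<Rightarrow> ennreal" where
  "or_value p q Sh = round_up nv \<kappa> (min (rho p q) (inverse (estimate p q Sh)))"

definition ite_value :: "('q \<Rightarrow> ennreal) \<Rightarrow> 'q \<Rightarrow> 'q \<Rightarrow> ennreal" where
  "ite_value p q1 q0 = round_up nv \<kappa> (inverse (1 / p q0 + 1 / p q1))"

definition step_law :: "('q, 'v) state \<Rightarrow> 'q \<Rightarrow> (ennreal \<times> ('v \<rightharpoonup> bool) set list) pmf" where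
  "step_law st q = outcome (node_step B nv \<kappa> ns nt st q)"

lemma step_law_ite:
  assumes "gate_of B q = Ite x q1 q0"
  shows "step_law st q = map_pmf (Pair (ite_value (fst st) q1 q0))
     (mapM_pmf (\<lambda>r. ite_sample (fst st) (ite_value (fst st) q1 q0) x q1 q0 (\<lambda>c. snd st c ! r)) [0..<N])"
  using assms by (simp add: step_law_def node_step_def decision_step_def Let_def ite_sample_def ite_value_def map_pmf_def bind_return_pmf)

lemma step_law_or:
  assumes "gate_of B q = Or qs"
  shows "step_law st q = bind_pmf (mapM_pmf (\<lambda>r. union_sample (fst st) q (\<lambda>c. snd st c ! r)) [0..<N]) (\<lambda>Sh.
     map_pmf (Pair (or_value (fst st) q Sh)) (mapM_pmf (\<lambda>r. thin (Sh ! r) (or_value (fst st) q Sh / rho (fst st) q)) [0..<N]))"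
  using assms by (simp add: step_law_def node_step_def or_step_sample_def Let_def union_sample_def or_value_def estimate_def rho_def
    map_pmf_def bind_return_pmf)

primrec unstopped :: "'q list \<Rightarrow> ('q, 'v) state \<Rightarrow> ('q, 'v) state pmf" where
  "unstopped [] st = return_pmf st"
| "unstopped (q # qs) st = bind_pmf (step_law st q) (\<lambda>(pq, Sq). unstopped qs ((fst st)(q := pq), (snd st)(q := Sq)))"

lemma unstopped_snoc: "unstopped (xs @ [q]) st = bind_pmf (unstopped xs st) (\<lambda>st'.
    map_pmf (\<lambda>(pq, Sq). ((fst st')(q := pq), (snd st')(q := Sq))) (step_law st' q))"
  by (induction xs arbitrary: st)
    (auto simp: bind_assoc_pmf bind_return_pmf map_pmf_def case_prod_unfold)

lemma unstopped_other: "st' \<in> set_pmf (unstopped xs st) \<Longrightarrow> x \<notin> set xs \<Longrightarrow> fst st' x = fst st x \<and> snd st' x = snd st x"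
  by (induction xs arbitrary: st) (fastforce split: prod.splits)+

text \<open>The sample sets of a processed node are never overwritten, so whether the run is stopped
  can be read off from the final state of the run that ignores the threshold. Stopping thereby
  becomes an event of that run.\<close>

lemma outcome_process:
  assumes "distinct qs"
  shows "outcome (process B nv \<kappa> ns nt \<theta> qs st)
    = map_pmf (\<lambda>st'. if \<exists>q\<in>set qs. \<exists>A\<in>set (snd st' q). card A \<ge> \<theta> then None else Some st') (unstopped qs st)"
  using assms
proof (induction qs arbitrary: st)
  case (Cons q qs)
  have "outcome (process B nv \<kappa> ns nt \<theta> (q # qs) st) = bind_pmf (step_law st q) (\<lambda>(pq, Sq).
     if \<exists>A\<in>set Sq. card A \<ge> \<theta> then return_pmf None
     else outcome (process B nv \<kappa> ns nt \<theta> qs ((fst st)(q := pq), (snd st)(q := Sq))))"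
    by (simp add: step_law_def) (intro bind_pmf_cong refl, auto split: prod.splits)
  also have "\<dots> = bind_pmf (step_law st q) (\<lambda>(pq, Sq). map_pmf
     (\<lambda>st'. if \<exists>x\<in>set (q # qs). \<exists>A\<in>set (snd st' x). card A \<ge> \<theta> then None else Some st')
     (unstopped qs ((fst st)(q := pq), (snd st)(q := Sq))))"
  proof (intro bind_pmf_cong refl, clarify)
    fix pq Sq
    let ?st = "((fst st)(q := pq), (snd st)(q := Sq))"
    have S: "snd st' q = Sq" if "st' \<in> set_pmf (unstopped qs ?st)" for st'
      using unstopped_other[OF that, of q] Cons.prems by simp
    show "(if \<exists>A\<in>set Sq. card A \<ge> \<theta> then return_pmf None else outcome (process B nv \<kappa> ns nt \<theta> qs ?st))
      = map_pmf (\<lambda>st'. if \<exists>x\<in>set (q # qs). \<exists>A\<in>set (snd st' x). card A \<ge> \<theta> then None else Some st') (unstopped qs ?st)"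
    proof (cases "\<exists>A\<in>set Sq. card A \<ge> \<theta>")
      case True
      then have "map_pmf (\<lambda>st'. if \<exists>x\<in>set (q # qs). \<exists>A\<in>set (snd st' x). card A \<ge> \<theta> then None else Some st') (unstopped qs ?st)
        = map_pmf (\<lambda>_. None) (unstopped qs ?st)" using S by (intro map_pmf_cong) auto
      then show ?thesis using True by simp
    next
      case False
      have "map_pmf (\<lambda>st'. if \<exists>x\<in>set (q # qs). \<exists>A\<in>set (snd st' x). card A \<ge> \<theta> then None else Some st') (unstopped qs ?st)
        = map_pmf (\<lambda>st'. if \<exists>x\<in>set qs. \<exists>A\<in>set (snd st' x). card A \<ge> \<theta> then None else Some st') (unstopped qs ?st)"
        using S False by (intro map_pmf_cong) auto
      then show ?thesis using False Cons by simp
    qed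
  qed
  also have "\<dots> = map_pmf (\<lambda>st'. if \<exists>x\<in>set (q # qs). \<exists>A\<in>set (snd st' x). card A \<ge> \<theta> then None else Some st') (unstopped (q # qs) st)"
    by (simp add: map_bind_pmf case_prod_unfold)
  finally show ?case .
qed simp

text \<open>The invariant of the runs without threshold. It provides that the thinning ratios are
  probabilities, that all sampled sets consist of models, and that the values lie on the
  grid.\<close>

definition consistent :: "'q list \<Rightarrow> ('q, 'v) state \<Rightarrow> bool" where
  "consistent xs st \<longleftrightarrow> (\<forall>x. x \<notin> set xs \<longrightarrow> fst st x = fst st0 x) \<and> (\<forall>r<N. sub_models (\<lambda>c. snd st c ! r))
     \<and> (\<forall>c. length (snd st c) = N) \<and> (\<forall>x\<in>set xs. admissible (fst st) x \<and> fst st x \<in> grid nv \<kappa>)"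

lemma st0_props:
  "gate_of B c = Sink True \<Longrightarrow> fst st0 c = 1" "gate_of B c \<noteq> Sink True \<Longrightarrow> fst st0 c = \<infinity>"
  "snd st0 c = replicate N (init_samples c)"
  by (simp_all add: initial_state_def init_samples_def)

lemma consistent_child:
  assumes s: "consistent xs st" and o: "level_order (xs @ [q])" and c: "c \<in> set (children B q)"
  shows "gate_of B c \<noteq> Sink False \<Longrightarrow> fst st c \<in> grid nv \<kappa>" "gate_of B c = Sink False \<Longrightarrow> fst st c = \<infinity>"
    "c \<in> set (nodes B)" "c \<noteq> q"
proof -
  note oo = level_order_snoc[OF o]
  show "c \<in> set (nodes B)" using children_nodes oo(2) c by blast
  show "c \<noteq> q" using oo(3,4,6) c by blast
  have sk: "is_sink B x \<Longrightarrow> x \<notin> set xs" for x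
  proof
    assume "is_sink B x" "x \<in> set xs"
    then obtain ys zs where "xs = ys @ x # zs" by (auto dest: split_list)
    then show False using oo(1) \<open>is_sink B x\<close> unfolding level_order_def by blast
  qed
  show "fst st c \<in> grid nv \<kappa>" if "gate_of B c \<noteq> Sink False"
  proof (cases "is_sink B c")
    case True
    then have "gate_of B c = Sink True" using that by (auto simp: is_sink_def)
    then show ?thesis using s sk[OF True] one_in_grid \<kappa> by (simp add: consistent_def st0_props)
  next
    case False
    then show ?thesis using s oo(6)[OF c] by (simp add: consistent_def)
  qed
  show "fst st c = \<infinity>" if "gate_of B c = Sink False"
  proof -
    have "is_sink B c" using that by (auto simp: is_sink_def)
    then show ?thesis using that s sk[of c] by (simp add: consistent_def st0_props)
  qed
qed

lemma ennreal_inverse_le: "inverse (1 / a + b) \<le> (a :: ennreal)"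
proof -
  have "inverse (1 / a + b) \<le> inverse (1 / a)" by (rule ennreal_inverse_antimono) simp
  also have "\<dots> = a" by (simp add: divide_ennreal_def ennreal_inverse_inverse)
  finally show ?thesis .
qed

text \<open>Before rounding, the value at a decision node lies below those of both children, being
  the inverse of the sum of their inverses, and the value at an Or-node is at most the minimum over
  its children. Rounding respects this because the values of live children are on the grid.\<close>

lemma step_law_value:
  assumes s: "consistent xs st" and o: "level_order (xs @ [q])" and st: "(pq, Sq) \<in> set_pmf (step_law st q)"
  shows "pq \<in> grid nv \<kappa>" "\<And>c. c \<in> set (children B q) \<Longrightarrow> gate_of B c \<noteq> Sink False \<Longrightarrow> pq \<le> fst st c"
    "length Sq = N" "\<And>r. r < N \<Longrightarrow> Sq ! r \<subseteq> Mod B q"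
proof -
  note oo = level_order_snoc[OF o]
  have sm: "sub_models (\<lambda>c. snd st c ! r)" if "r < N" for r using s that by (simp add: consistent_def)
  have "pq \<in> grid nv \<kappa> \<and> (\<forall>c\<in>set (children B q). gate_of B c \<noteq> Sink False \<longrightarrow> pq \<le> fst st c)
    \<and> length Sq = N \<and> (\<forall>r<N. Sq ! r \<subseteq> Mod B q)"
  proof (cases "gate_of B q")
    case (Sink b) then show ?thesis using oo(3) by (simp add: is_sink_def)
  next
    case (Ite x q1 q0)
    have ch: "set (children B q) = {q1, q0}" using Ite by (simp add: children_def)
    have S: "pq = ite_value (fst st) q1 q0"
      "Sq \<in> set_pmf (mapM_pmf (\<lambda>r. ite_sample (fst st) pq x q1 q0 (\<lambda>c. snd st c ! r)) [0..<N])"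
      using st by (auto simp: step_law_ite[OF Ite])
    have L: "length Sq = N" "\<And>r. r < N \<Longrightarrow> Sq ! r \<subseteq> Mod B q"
      using set_mapM_pmf[OF S(2)] ite_sample_subset[OF oo(2) Ite sm] unfolding list_all2_conv_all_nth by (simp, fastforce)
    let ?v = "inverse (1 / fst st q0 + 1 / fst st q1)"
    have v: "?v \<le> fst st e" if "e \<in> {q1, q0}" for e
      using that ennreal_inverse_le[of "fst st q0" "1 / fst st q1"] ennreal_inverse_le[of "fst st q1" "1 / fst st q0"]
      by (auto simp: add.commute)
    obtain e where e: "e \<in> {q1, q0}" "gate_of B e \<noteq> Sink False" using ite_live[OF oo(2) Ite] by blast
    then have "fst st e \<in> grid nv \<kappa>" using consistent_child(1)[OF s o] ch by auto
    then have "?v \<le> 1" using v[OF e(1)] grid_props(2) \<kappa> order_trans by blast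
    then have "pq \<in> grid nv \<kappa>" using round_up_grid \<kappa> by (simp add: S ite_value_def less_imp_le)
    moreover have "pq \<le> fst st c" if "c \<in> {q1, q0}" "gate_of B c \<noteq> Sink False" for c
      unfolding S ite_value_def using that v[OF that(1)] consistent_child(1)[OF s o] ch \<kappa> by (intro grid_props(3)) auto
    ultimately show ?thesis using L ch by auto
  next
    case (Or qs)
    have ch: "set (children B q) = set qs" using Or by (simp add: children_def)
    obtain Sh where Sh: "Sh \<in> set_pmf (mapM_pmf (\<lambda>r. union_sample (fst st) q (\<lambda>c. snd st c ! r)) [0..<N])"
      "pq = or_value (fst st) q Sh" "Sq \<in> set_pmf (mapM_pmf (\<lambda>r. thin (Sh ! r) (or_value (fst st) q Sh / rho (fst st) q)) [0..<N])"
      using st by (auto simp: step_law_or[OF Or])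
    have L: "length Sq = N" using set_mapM_pmf[OF Sh(3)] by (auto simp: list_all2_conv_all_nth)
    have M: "Sq ! r \<subseteq> Mod B q" if "r < N" for r
    proof -
      have "Sq ! r \<subseteq> Sh ! r" using set_mapM_pmf[OF Sh(3)] set_thin that by (fastforce simp: list_all2_conv_all_nth)
      moreover have "Sh ! r \<in> set_pmf (union_sample (fst st) q (\<lambda>c. snd st c ! r))"
        using set_mapM_pmf[OF Sh(1)] that by (simp add: list_all2_conv_all_nth)
      then have "Sh ! r \<subseteq> Mod B q" by (rule union_sample_subset[OF oo(2) Or sm[OF that]])
      ultimately show ?thesis by blast
    qed
    have alive: "gate_of B c \<noteq> Sink False" if "c \<in> set qs" for c
      using or_child[OF oo(2) Or that] by (auto simp: is_decision_def)
    have "rho (fst st) q \<in> fst st ` set qs" unfolding rho_def ch using or_nonempty[OF oo(2)] Or by (auto intro!: Min_in)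
    then have rg: "rho (fst st) q \<in> grid nv \<kappa>" using consistent_child(1)[OF s o] alive ch by auto
    have "pq \<le> rho (fst st) q" unfolding Sh(2) or_value_def using rg \<kappa> by (intro grid_props(3)) auto
    moreover have "rho (fst st) q \<le> fst st c" if "c \<in> set qs" for c unfolding rho_def ch using that by (intro Min_le) auto
    moreover have "min (rho (fst st) q) x \<le> 1" for x using grid_props(2)[OF rg \<kappa>] by (simp add: min.coboundedI1)
    then have "pq \<in> grid nv \<kappa>" unfolding Sh(2) or_value_def using \<kappa> by (intro round_up_grid) auto
    ultimately show ?thesis using L M ch by (auto intro: order_trans)
  qed
  then show "pq \<in> grid nv \<kappa>" "\<And>c. c \<in> set (children B q) \<Longrightarrow> gate_of B c \<noteq> Sink False \<Longrightarrow> pq \<le> fst st c"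
    "length Sq = N" "\<And>r. r < N \<Longrightarrow> Sq ! r \<subseteq> Mod B q" by auto
qed

lemma level_order_children_before:
  assumes "level_order xs" "x \<in> set xs" "c \<in> set (children B x)" "c \<in> set (nodes B)" "xs @ [q] = zs" "level_order zs"
  shows "c \<noteq> q"
proof -
  obtain ys ws where s: "xs = ys @ x # ws" using assms(2) by (auto dest: split_list)
  then have "is_sink B c \<or> c \<in> set ys" using assms(1,3) unfolding level_order_def by blast
  then show ?thesis using s level_order_snoc(3,4)[of xs q] assms(5,6) by auto
qed

lemma consistent_unstopped: "level_order xs \<Longrightarrow> st \<in> set_pmf (unstopped xs st0) \<Longrightarrow> consistent xs st"
proof (induction xs arbitrary: st rule: rev_induct)
  case Nil
  then show ?case using sub_models_init_samples by (simp add: consistent_def st0_props)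
next
  case (snoc q xs)
  from snoc.prems(2) obtain st' pq Sq where st': "st' \<in> set_pmf (unstopped xs st0)" "(pq, Sq) \<in> set_pmf (step_law st' q)"
    "st = ((fst st')(q := pq), (snd st')(q := Sq))" by (auto simp: unstopped_snoc)
  note o = snoc.prems(1) and oo = level_order_snoc[OF snoc.prems(1)]
  have s: "consistent xs st'" using snoc.IH oo(1) st'(1) by blast
  note av = step_law_value[OF s o st'(2)]
  have "admissible (fst st) x \<and> fst st x \<in> grid nv \<kappa>" if "x \<in> set (xs @ [q])" for x
  proof (cases "x = q")
    case True
    have "fst st c = fst st' c" if "c \<in> set (children B q)" for c using consistent_child(4)[OF s o that] st'(3) by simp
    moreover have "fst st' c \<le> 1" if "c \<in> set (children B q)" "gate_of B c \<noteq> Sink False" for c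
      using grid_props(2)[OF consistent_child(1)[OF s o that] \<kappa>] .
    ultimately show ?thesis using True av(1,2) grid_props(1)[OF av(1) \<kappa>] st'(3)
      by (auto simp: admissible_def)
  next
    case False
    then have x: "x \<in> set xs" using that by auto
    have xn: "x \<in> set (nodes B)"
    proof -
      obtain ys ws where "xs = ys @ x # ws" using x by (auto dest: split_list)
      then show ?thesis using oo(1) unfolding level_order_def by blast
    qed
    have "fst st c = fst st' c" if "c \<in> set (children B x)" for c
      using level_order_children_before[OF oo(1) x that _ refl o] children_nodes[OF xn that] st'(3) by auto
    then show ?thesis using s x False st'(3) by (auto simp: consistent_def admissible_def)
  qed
  moreover have "sub_models (\<lambda>c. snd st c ! r)" if "r < N" for r
    using s av(4)[OF that] that st'(3) by (auto simp: consistent_def sub_models_def)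
  ultimately show ?case using s av(3) st'(3) by (auto simp: consistent_def)
qed

lemma mapM_pmf_bind:
  "mapM_pmf (\<lambda>r. bind_pmf (g r) k) [0..<M] = bind_pmf (mapM_pmf g [0..<M]) (\<lambda>Sh. mapM_pmf (\<lambda>r. k (Sh ! r)) [0..<M])"
  unfolding mapM_pmf_upt[where d = undefined]
  by (simp add: Pi_pmf_bind[where d' = undefined] map_bind_pmf bind_map_pmf)
    (intro bind_pmf_cong refl arg_cong[of _ _ "map_pmf _"] Pi_pmf_cong, auto)

text \<open>At a decision node the value is determined by the children, so the event holds surely or
  never. At an Or-node the value depends on all the unions through the estimate. On the event that
  it equals \<open>h q\<close>, the last thinning is that of the imposed process, and dropping the
  event leaves an upper bound in which the samples are independent.\<close>

lemma step_law_le: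
  assumes agree: "\<And>c. c \<in> set (children B q) \<Longrightarrow> fst st c = h c" and ns': "\<not> is_sink B q"
  shows "(\<integral>\<^sup>+y. of_bool (fst y = h q) * F (snd y) \<partial>step_law st q)
    \<le> (\<integral>\<^sup>+Sq. F Sq \<partial>mapM_pmf (\<lambda>r. node_sample h q (\<lambda>c. snd st c ! r)) [0..<N])"
proof (cases "gate_of B q")
  case (Sink b) then show ?thesis using ns' by (simp add: is_sink_def)
next
  case (Ite x q1 q0)
  have c: "fst st q1 = h q1" "fst st q0 = h q0" using agree Ite by (auto simp: children_def)
  have i: "ite_sample (fst st) v x q1 q0 \<sigma> = ite_sample h v x q1 q0 \<sigma>" for v \<sigma> by (rule ite_sample_cong) (use c in auto)
  show ?thesis
    by (cases "ite_value (fst st) q1 q0 = h q") (simp_all add: step_law_ite[OF Ite] node_sample_def Ite i)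
next
  case (Or qs)
  have i: "union_sample (fst st) q \<sigma> = union_sample h q \<sigma>" for \<sigma> by (rule union_sample_cong) (use agree in auto)
  have r: "rho (fst st) q = rho h q" by (rule rho_cong) (use agree in auto)
  have "(\<integral>\<^sup>+y. of_bool (fst y = h q) * F (snd y) \<partial>step_law st q)
    = (\<integral>\<^sup>+Sh. \<integral>\<^sup>+Sq. of_bool (or_value (fst st) q Sh = h q) * F Sq \<partial>mapM_pmf (\<lambda>r. thin (Sh ! r) (or_value (fst st) q Sh / rho h q)) [0..<N]
        \<partial>mapM_pmf (\<lambda>r. union_sample h q (\<lambda>c. snd st c ! r)) [0..<N])"
    by (simp add: step_law_or[OF Or] i r)
  also have "\<dots> \<le> (\<integral>\<^sup>+Sh. \<integral>\<^sup>+Sq. F Sq \<partial>mapM_pmf (\<lambda>r. thin (Sh ! r) (h q / rho h q)) [0..<N]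
        \<partial>mapM_pmf (\<lambda>r. union_sample h q (\<lambda>c. snd st c ! r)) [0..<N])"
  proof (rule nn_integral_mono)
    fix Sh
    show "(\<integral>\<^sup>+Sq. of_bool (or_value (fst st) q Sh = h q) * F Sq \<partial>mapM_pmf (\<lambda>r. thin (Sh ! r) (or_value (fst st) q Sh / rho h q)) [0..<N])
      \<le> (\<integral>\<^sup>+Sq. F Sq \<partial>mapM_pmf (\<lambda>r. thin (Sh ! r) (h q / rho h q)) [0..<N])"
      by (cases "or_value (fst st) q Sh = h q") simp_all
  qed
  also have "\<dots> = (\<integral>\<^sup>+Sq. F Sq \<partial>mapM_pmf (\<lambda>r. node_sample h q (\<lambda>c. snd st c ! r)) [0..<N])"
    by (simp add: node_sample_def Or mapM_pmf_bind)
  finally show ?thesis .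
qed

definition gather :: "(nat \<Rightarrow> 'q \<Rightarrow> ('v \<rightharpoonup> bool) set) \<Rightarrow> 'q \<Rightarrow> ('v \<rightharpoonup> bool) set list" where
  "gather \<tau> q = map (\<lambda>r. \<tau> r q) [0..<N]"

text \<open>The algorithm, restricted to the runs that compute the values \<open>h\<close>, is dominated by the process
  in which the values \<open>h\<close> are imposed; in the latter the samples with different indices are independent.\<close>

lemma coupling:
  assumes "level_order xs" and sk: "\<And>c. c \<in> set (nodes B) \<Longrightarrow> is_sink B c \<Longrightarrow> h c = fst st0 c"
  shows "(\<integral>\<^sup>+st. of_bool (\<forall>x\<in>set xs. fst st x = h x) * f (snd st) \<partial>unstopped xs st0)
    \<le> (\<integral>\<^sup>+\<tau>. f (gather \<tau>) \<partial>Pi_pmf {..<N} init_samples (\<lambda>_. sample_process h xs init_samples))"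
  using assms(1)
proof (induction xs arbitrary: f rule: rev_induct)
  case Nil
  have "(\<lambda>x::nat. if x \<in> {..<N} then init_samples else init_samples) = (\<lambda>_. init_samples)" by auto
  moreover have "gather (\<lambda>_. init_samples) = snd st0" by (auto simp: gather_def st0_props map_replicate_const)
  ultimately show ?case by simp
next
  case (snoc q xs)
  note o = snoc.prems and oo = level_order_snoc[OF snoc.prems]
  \<comment> \<open>\<open>?G\<close> averages \<open>f\<close> over the samples drawn at the last
    node. The induction hypothesis is applied to it, for which reason \<open>f\<close> is arbitrary
    in the induction.\<close>
  let ?G = "\<lambda>S. \<integral>\<^sup>+Sq. f (S(q := Sq)) \<partial>mapM_pmf (\<lambda>r. node_sample h q (\<lambda>c. S c ! r)) [0..<N]"
  have "(\<integral>\<^sup>+st. of_bool (\<forall>x\<in>set (xs @ [q]). fst st x = h x) * f (snd st) \<partial>unstopped (xs @ [q]) st0)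
    = (\<integral>\<^sup>+st. \<integral>\<^sup>+y. of_bool (\<forall>x\<in>set (xs @ [q]). ((fst st)(q := fst y)) x = h x) * f ((snd st)(q := snd y)) \<partial>step_law st q \<partial>unstopped xs st0)"
    by (simp add: unstopped_snoc case_prod_unfold)
  also have "\<dots> \<le> (\<integral>\<^sup>+st. of_bool (\<forall>x\<in>set xs. fst st x = h x) * ?G (snd st) \<partial>unstopped xs st0)"
  proof (rule nn_integral_pmf_mono)
    fix st assume st: "st \<in> set_pmf (unstopped xs st0)"
    have e: "(\<forall>x\<in>set (xs @ [q]). ((fst st)(q := fst y)) x = h x) \<longleftrightarrow> (\<forall>x\<in>set xs. fst st x = h x) \<and> fst y = h q" for y :: "ennreal \<times> ('v \<rightharpoonup> bool) set list"
      using oo(4) by auto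
    show "(\<integral>\<^sup>+y. of_bool (\<forall>x\<in>set (xs @ [q]). ((fst st)(q := fst y)) x = h x) * f ((snd st)(q := snd y)) \<partial>step_law st q)
      \<le> of_bool (\<forall>x\<in>set xs. fst st x = h x) * ?G (snd st)"
    proof (cases "\<forall>x\<in>set xs. fst st x = h x")
      case True
      have "fst st c = h c" if "c \<in> set (children B q)" for c
      proof (cases "c \<in> set xs")
        case False
        then have "is_sink B c" using oo(6)[OF that] by blast
        then show ?thesis using sk children_nodes[OF oo(2) that] unstopped_other[OF st False] by simp
      qed (use True in auto)
      from step_law_le[of q st h "\<lambda>Sq. f ((snd st)(q := Sq))", OF this oo(3)] True show ?thesis
        unfolding e by simp
    next
      case False
      then show ?thesis by (simp only: e False simp_thms of_bool_eq mult_zero_left nn_integral_const order_refl)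
    qed
  qed
  also have "\<dots> \<le> (\<integral>\<^sup>+\<tau>. ?G (gather \<tau>) \<partial>Pi_pmf {..<N} init_samples (\<lambda>_. sample_process h xs init_samples))"
    by (rule snoc.IH[OF oo(1)])
  also have "\<dots> = (\<integral>\<^sup>+\<tau>. \<integral>\<^sup>+g. f (gather (\<lambda>r. if r < N then (\<tau> r)(q := g r) else init_samples)) \<partial>Pi_pmf {..<N} {} (\<lambda>r. node_sample h q (\<tau> r)) \<partial>Pi_pmf {..<N} init_samples (\<lambda>_. sample_process h xs init_samples))"
  proof (rule nn_integral_cong)
    fix \<tau> :: "nat \<Rightarrow> 'q \<Rightarrow> ('v \<rightharpoonup> bool) set"
    have "Pi_pmf {..<N} {} (\<lambda>r. node_sample h q (\<lambda>c. gather \<tau> c ! r)) = Pi_pmf {..<N} {} (\<lambda>r. node_sample h q (\<tau> r))"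
      by (rule Pi_pmf_cong) (auto simp: gather_def)
    then have "?G (gather \<tau>) = (\<integral>\<^sup>+g. f ((gather \<tau>)(q := map g [0..<N])) \<partial>Pi_pmf {..<N} {} (\<lambda>r. node_sample h q (\<tau> r)))"
      by (simp add: mapM_pmf_upt[where d = "{}"])
    moreover have "(gather \<tau>)(q := map g [0..<N]) = gather (\<lambda>r. if r < N then (\<tau> r)(q := g r) else init_samples)" for g
      by (auto simp: gather_def fun_eq_iff)
    ultimately show "?G (gather \<tau>) = (\<integral>\<^sup>+g. f (gather (\<lambda>r. if r < N then (\<tau> r)(q := g r) else init_samples)) \<partial>Pi_pmf {..<N} {} (\<lambda>r. node_sample h q (\<tau> r)))"
      by simp
  qed
  also have "\<dots> = (\<integral>\<^sup>+\<tau>. f (gather \<tau>) \<partial>Pi_pmf {..<N} init_samples (\<lambda>_. sample_process h (xs @ [q]) init_samples))"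
    unfolding sample_process_snoc
    by (simp add: Pi_pmf_bind[where d' = init_samples] Pi_pmf_bind[where d' = "{}"])
  finally show ?case .
qed

section \<open>Unbiasedness for adaptively chosen values\<close>

lemma one_over_cancel:
  assumes "0 < b" "b \<le> (1::ennreal)"
  shows "b / c * (1 / b) = 1 / c"
proof -
  have "b \<noteq> 0" "b < top" using assms by (auto simp: less_top[symmetric] top_unique)
  then have "b / b = 1" by (simp add: ennreal_divide_self)
  moreover have "b / c * (1 / b) = (b / b) * (1 / c)" by (simp add: divide_ennreal_def mult_ac)
  ultimately show ?thesis by simp
qed

text \<open>The new value may depend on the samples, but it acts as a thinning probability and is
  then divided out. At an Or-node, given the unions, the mean is the indicator divided by
  \<open>rho\<close>, whatever value has been chosen. So the normalised indicator has the martingale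
  property along the chain.\<close>

lemma step_law_mean:
  assumes s: "consistent xs st" and o: "level_order (xs @ [q])" and r: "r < N" and \<alpha>: "\<alpha> \<in> Mod B q"
  shows "(\<integral>\<^sup>+y. of_bool (\<alpha> \<in> snd y ! r) * (1 / fst y) \<partial>step_law st q)
    = of_bool (snd (prev (q, \<alpha>)) \<in> snd st (fst (prev (q, \<alpha>))) ! r) * (1 / fst st (fst (prev (q, \<alpha>))))"
proof -
  note oo = level_order_snoc[OF o]
  have sm: "sub_models (\<lambda>c. snd st c ! r)" using s r by (simp add: consistent_def)
  have v: "valid (q, \<alpha>)" using oo(2) \<alpha> by (simp add: valid_def)
  note pv = prev_valid[OF v, simplified fst_conv, OF lv_nonsink[OF oo(2,3)]]
  show ?thesis
  proof (cases "gate_of B q")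
    case (Sink b) then show ?thesis using oo(3) by (simp add: is_sink_def)
  next
    case (Ite x q1 q0)
    let ?p = "ite_value (fst st) q1 q0"
    obtain y where y: "y \<in> set_pmf (step_law st q)" using set_pmf_not_empty by (metis ex_in_conv)
    then obtain Sq where "(?p, Sq) \<in> set_pmf (step_law st q)" by (auto simp: step_law_ite[OF Ite])
    note av = step_law_value(1,2)[OF s o this]
    have le: "?p / fst st e \<le> 1" if "e \<in> {q1, q0}" "gate_of B e \<noteq> Sink False" for e
      using that av(2)[of e] consistent_child(1)[OF s o, of e] grid_props(1,2)[OF _ \<kappa>] Ite
      by (intro ennreal_divide_le_1) (auto simp: children_def)
    have "(\<integral>\<^sup>+y. of_bool (\<alpha> \<in> snd y ! r) * (1 / fst y) \<partial>step_law st q)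
      = (\<integral>\<^sup>+Sq. of_bool (\<alpha> \<in> Sq ! r) * (1 / ?p) \<partial>mapM_pmf (\<lambda>r. ite_sample (fst st) ?p x q1 q0 (\<lambda>c. snd st c ! r)) [0..<N])"
      by (simp add: step_law_ite[OF Ite])
    also have "\<dots> = (\<integral>\<^sup>+A. of_bool (\<alpha> \<in> A) * (1 / ?p) \<partial>ite_sample (fst st) ?p x q1 q0 (\<lambda>c. snd st c ! r))"
      using nn_integral_mapM_nth[where i = r and xs = "[0..<N]" and F = "\<lambda>A. of_bool (\<alpha> \<in> A) * (1 / ?p)" and f = "\<lambda>r. ite_sample (fst st) ?p x q1 q0 (\<lambda>c. snd st c ! r)"] r by simp
    also have "\<dots> = (\<integral>\<^sup>+A. of_bool (\<alpha> \<in> A) \<partial>ite_sample (fst st) ?p x q1 q0 (\<lambda>c. snd st c ! r)) * (1 / ?p)"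
      by (rule nn_integral_multc) simp
    also have "(\<integral>\<^sup>+A. of_bool (\<alpha> \<in> A) \<partial>ite_sample (fst st) ?p x q1 q0 (\<lambda>c. snd st c ! r))
      = of_bool (snd (prev (q, \<alpha>)) \<in> snd st (fst (prev (q, \<alpha>))) ! r) * (?p / fst st (fst (prev (q, \<alpha>))))"
      by (rule ite_sample_marginal[OF oo(2) Ite sm \<alpha>]) (rule le)
    finally show ?thesis using one_over_cancel[of ?p] grid_props(1,2)[OF av(1) \<kappa>] by (simp only: mult.assoc)
  next
    case (Or qs)
    let ?\<rho> = "rho (fst st) q"
    have alive: "gate_of B c \<noteq> Sink False" if "c \<in> set qs" for c
      using or_child[OF oo(2) Or that] by (auto simp: is_decision_def)
    have cg: "0 < fst st c \<and> fst st c \<le> 1" if "c \<in> set qs" for c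
      using consistent_child(1)[OF s o, of c] alive that grid_props(1,2)[OF _ \<kappa>] Or by (auto simp: children_def)
    have rc: "?\<rho> / fst st c \<le> 1" if "c \<in> set qs" for c using rho_props(4)[OF oo(2) Or, of "fst st" c] cg that by blast
    have rp: "0 < ?\<rho>" "?\<rho> \<le> 1" using rho_props(1,2)[OF oo(2) Or, of "fst st"] cg by blast+
    let ?H = "mapM_pmf (\<lambda>r. union_sample (fst st) q (\<lambda>c. snd st c ! r)) [0..<N]"
    have "(\<integral>\<^sup>+y. of_bool (\<alpha> \<in> snd y ! r) * (1 / fst y) \<partial>step_law st q)
      = (\<integral>\<^sup>+Sh. \<integral>\<^sup>+Sq. of_bool (\<alpha> \<in> Sq ! r) * (1 / or_value (fst st) q Sh) \<partial>mapM_pmf (\<lambda>r. thin (Sh ! r) (or_value (fst st) q Sh / ?\<rho>)) [0..<N] \<partial>?H)"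
      by (simp add: step_law_or[OF Or])
    also have "\<dots> = (\<integral>\<^sup>+Sh. of_bool (\<alpha> \<in> Sh ! r) * (1 / ?\<rho>) \<partial>?H)"
    proof (rule nn_integral_pmf_cong)
      fix Sh assume Sh: "Sh \<in> set_pmf ?H"
      let ?p = "or_value (fst st) q Sh"
      let ?R = "mapM_pmf (\<lambda>r. thin (Sh ! r) (?p / ?\<rho>)) [0..<N]"
      obtain Sq where "Sq \<in> set_pmf ?R" using set_pmf_not_empty by (metis ex_in_conv)
      then have "(?p, Sq) \<in> set_pmf (step_law st q)" using Sh by (auto simp: step_law_or[OF Or])
      note av = step_law_value(1,2)[OF s o this]
      have "?\<rho> \<in> fst st ` set qs" unfolding rho_def using or_nonempty[OF oo(2)] Or by (auto simp: children_def intro!: Min_in)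
      then have "?p \<le> ?\<rho>" using av(2) alive Or by (auto simp: children_def)
      then have le: "?p / ?\<rho> \<le> 1" using rp by (intro ennreal_divide_le_1)
      have "Sh ! r \<in> set_pmf (union_sample (fst st) q (\<lambda>c. snd st c ! r))"
        using set_mapM_pmf[OF Sh] r by (simp add: list_all2_conv_all_nth)
      then have "Sh ! r \<subseteq> Mod B q" by (rule union_sample_subset[OF oo(2) Or sm])
      then have fin: "finite (Sh ! r)" using finite_Mod[OF oo(2)] finite_subset by blast
      have "(\<integral>\<^sup>+Sq. of_bool (\<alpha> \<in> Sq ! r) * (1 / ?p) \<partial>?R) = (\<integral>\<^sup>+A. of_bool (\<alpha> \<in> A) * (1 / ?p) \<partial>thin (Sh ! r) (?p / ?\<rho>))"
        using nn_integral_mapM_nth[where i = r and xs = "[0..<N]" and F = "\<lambda>A. of_bool (\<alpha> \<in> A) * (1 / ?p)" and f = "\<lambda>r. thin (Sh ! r) (?p / ?\<rho>)"] r by simp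
      also have "\<dots> = (\<integral>\<^sup>+A. of_bool (\<alpha> \<in> A) \<partial>thin (Sh ! r) (?p / ?\<rho>)) * (1 / ?p)" by (rule nn_integral_multc) simp
      also have "\<dots> = of_bool (\<alpha> \<in> Sh ! r) * (?p / ?\<rho>) * (1 / ?p)" using thin_marginal[OF fin le] by simp
      also have "\<dots> = of_bool (\<alpha> \<in> Sh ! r) * (1 / ?\<rho>)"
        using one_over_cancel[of ?p] grid_props(1,2)[OF av(1) \<kappa>] by (simp only: mult.assoc)
      finally show "(\<integral>\<^sup>+Sq. of_bool (\<alpha> \<in> Sq ! r) * (1 / ?p) \<partial>?R) = of_bool (\<alpha> \<in> Sh ! r) * (1 / ?\<rho>)" .
    qed
    also have "\<dots> = (\<integral>\<^sup>+A. of_bool (\<alpha> \<in> A) * (1 / ?\<rho>) \<partial>union_sample (fst st) q (\<lambda>c. snd st c ! r))"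
      using nn_integral_mapM_nth[where i = r and xs = "[0..<N]" and F = "\<lambda>A. of_bool (\<alpha> \<in> A) * (1 / ?\<rho>)" and f = "\<lambda>r. union_sample (fst st) q (\<lambda>c. snd st c ! r)"] r by simp
    also have "\<dots> = (\<integral>\<^sup>+A. of_bool (\<alpha> \<in> A) \<partial>union_sample (fst st) q (\<lambda>c. snd st c ! r)) * (1 / ?\<rho>)" by (rule nn_integral_multc) simp
    also have "(\<integral>\<^sup>+A. of_bool (\<alpha> \<in> A) \<partial>union_sample (fst st) q (\<lambda>c. snd st c ! r))
      = of_bool (snd (prev (q, \<alpha>)) \<in> snd st (fst (prev (q, \<alpha>))) ! r) * (?\<rho> / fst st (fst (prev (q, \<alpha>))))"
      by (rule union_sample_marginal[OF oo(2) Or sm \<alpha>]) (rule rc)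
    finally show ?thesis using one_over_cancel[OF rp] by (simp only: mult.assoc)
  qed
qed

text \<open>The martingale is followed down the chain to the 1-sink, where it is 1. As this holds
  for the values that the algorithm itself chooses, the estimate for the threshold does not pay for
  a union bound over histories.\<close>

lemma unstopped_mean:
  assumes "level_order xs" "valid z" "fst z \<in> set xs \<or> is_sink B (fst z)" and r: "r < N"
  shows "(\<integral>\<^sup>+st. of_bool (snd z \<in> snd st (fst z) ! r) * (1 / fst st (fst z)) \<partial>unstopped xs st0) = 1"
  using assms(1-3)
proof (induction xs arbitrary: z rule: rev_induct)
  case Nil
  then have g: "gate_of B (fst z) = Sink True" using valid_level0 lv_sink by (auto simp: valid_def)
  have "snd z = Map.empty" using Nil Mod_true[OF _ g] by (simp add: valid_def)
  then show ?case using g r by (simp add: st0_props init_samples_def)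
next
  case (snoc q xs)
  note o = snoc.prems(1) and oo = level_order_snoc[OF snoc.prems(1)]
  show ?case
  proof (cases "fst z = q")
    case False
    then have "(\<integral>\<^sup>+st. of_bool (snd z \<in> snd st (fst z) ! r) * (1 / fst st (fst z)) \<partial>unstopped (xs @ [q]) st0)
      = (\<integral>\<^sup>+st. of_bool (snd z \<in> snd st (fst z) ! r) * (1 / fst st (fst z)) \<partial>unstopped xs st0)"
      by (simp add: unstopped_snoc case_prod_unfold)
    then show ?thesis using snoc.IH[OF oo(1) snoc.prems(2)] snoc.prems(3) False by auto
  next
    case True
    then have z: "z = (q, snd z)" "snd z \<in> Mod B q" using snoc.prems(2) by (auto simp: valid_def prod_eq_iff)
    have l: "lv (fst z) > 0" using True lv_nonsink[OF oo(2,3)] by simp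
    note pv = prev_valid[OF snoc.prems(2) l]
    have "(\<integral>\<^sup>+st. of_bool (snd z \<in> snd st (fst z) ! r) * (1 / fst st (fst z)) \<partial>unstopped (xs @ [q]) st0)
      = (\<integral>\<^sup>+st. \<integral>\<^sup>+y. of_bool (snd z \<in> snd y ! r) * (1 / fst y) \<partial>step_law st q \<partial>unstopped xs st0)"
      using True by (simp add: unstopped_snoc case_prod_unfold)
    also have "\<dots> = (\<integral>\<^sup>+st. of_bool (snd (prev z) \<in> snd st (fst (prev z)) ! r) * (1 / fst st (fst (prev z))) \<partial>unstopped xs st0)"
    proof (rule nn_integral_pmf_cong)
      fix st assume "st \<in> set_pmf (unstopped xs st0)"
      then have "consistent xs st" by (rule consistent_unstopped[OF oo(1)])
      from step_law_mean[OF this o r z(2)]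
      show "(\<integral>\<^sup>+y. of_bool (snd z \<in> snd y ! r) * (1 / fst y) \<partial>step_law st q)
        = of_bool (snd (prev z) \<in> snd st (fst (prev z)) ! r) * (1 / fst st (fst (prev z)))"
        unfolding z(1)[symmetric] .
    qed
    also have "\<dots> = 1"
      using snoc.IH[OF oo(1) pv(1)] oo(6)[of "fst (prev z)"] pv(3) True by auto
    finally show ?thesis .
  qed
qed

end

section \<open>Failure probability of one run\<close>

lemma prod_lt_nat: "j < (k::nat) \<Longrightarrow> i < b \<Longrightarrow> j * b + i < b * k"
proof -
  assume "j < k" "i < b"
  then have "j * b + i < Suc j * b" by simp
  also have "\<dots> \<le> k * b" using \<open>j < k\<close> by (intro mult_le_mono1) auto
  finally show ?thesis by (simp add: mult.commute)
qed

context layered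
begin

lemma level_order_snocI:
  assumes "level_order xs" "q \<in> set (nodes B)" "\<not> is_sink B q" "q \<notin> set xs" "\<And>q'. q' \<in> set xs \<Longrightarrow> lv q' \<le> lv q"
    "\<And>c. c \<in> set (children B q) \<Longrightarrow> is_sink B c \<or> c \<in> set xs"
  shows "level_order (xs @ [q])"
  unfolding level_order_def
proof (intro allI impI)
  fix ys x zs assume e: "xs @ [q] = ys @ x # zs"
  show "x \<in> set (nodes B) \<and> \<not> is_sink B x \<and> x \<notin> set ys \<and> (\<forall>q'\<in>set ys. lv q' \<le> lv x) \<and>
    (\<forall>c\<in>set (children B x). is_sink B c \<or> c \<in> set ys)"
  proof (cases zs rule: rev_cases)
    case Nil
    then have "xs = ys" "q = x" using e by auto
    then show ?thesis using assms by auto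
  next
    case (snoc zs' z)
    then have "xs = ys @ x # zs'" using e by (metis append_assoc append_Cons butlast_snoc)
    then show ?thesis using assms(1) unfolding level_order_def by blast
  qed
qed

lemma lv_0_iff: "q \<in> set (nodes B) \<Longrightarrow> lv q = 0 \<longleftrightarrow> is_sink B q"
  using lv_sink lv_nonsink by (metis less_numeral_extra(3))

lemma child_level:
  assumes q: "q \<in> set (nodes B)" and c: "c \<in> set (children B q)" "gate_of B c \<noteq> Sink False"
  shows "Suc (lv c) = lv q"
proof (cases "gate_of B q")
  case (Sink b) then show ?thesis using c by (simp add: children_def)
next
  case (Ite x q1 q0) then show ?thesis using ite_child[OF q Ite, of c] c by (auto simp: children_def)
next
  case (Or qs) then show ?thesis using or_child[OF q Or, of c] c by (auto simp: children_def)
qed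

lemma live_child_ex:
  assumes q: "q \<in> set (nodes B)" and ns: "\<not> is_sink B q"
  shows "\<exists>c\<in>set (children B q). gate_of B c \<noteq> Sink False"
proof (cases "gate_of B q")
  case (Sink b) then show ?thesis using ns by (simp add: is_sink_def)
next
  case (Ite x q1 q0) then show ?thesis using ite_live[OF q Ite] by (auto simp: children_def)
next
  case (Or qs)
  then obtain c where c: "c \<in> set qs" using or_nonempty[OF q] by (cases qs) auto
  then have "is_decision B c" using or_child[OF q Or] by blast
  then have "gate_of B c \<noteq> Sink False" by (auto simp: is_decision_def)
  then show ?thesis using c Or by (intro bexI[of _ c]) (auto simp: children_def)
qed

text \<open>Every inner node has a child other than the 0-sink, and all such children lie exactly
  one level below it; the layers of the algorithm are therefore the level sets of
  \<open>lv\<close>.\<close>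

lemma set_layer: "set (layer B i) = {q \<in> set (nodes B). lv q = i}"
proof (induction i)
  case 0 then show ?case using lv_0_iff by auto
next
  case (Suc i)
  have "(\<not> is_sink B q \<and> (\<forall>c\<in>set (children B q). gate_of B c \<noteq> Sink False \<longrightarrow> c \<in> set (layer B i))) \<longleftrightarrow> lv q = Suc i"
    if q: "q \<in> set (nodes B)" for q
  proof
    assume a: "\<not> is_sink B q \<and> (\<forall>c\<in>set (children B q). gate_of B c \<noteq> Sink False \<longrightarrow> c \<in> set (layer B i))"
    then obtain c where "c \<in> set (children B q)" "gate_of B c \<noteq> Sink False" using live_child_ex[OF q] by blast
    then show "lv q = Suc i" using a child_level[OF q, of c] Suc by auto
  next
    assume l: "lv q = Suc i"
    then have "\<not> is_sink B q" using lv_sink[OF q] by auto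
    moreover have "c \<in> set (layer B i)" if "c \<in> set (children B q)" "gate_of B c \<noteq> Sink False" for c
      using child_level[OF q that] l children_nodes[OF q that(1)] Suc by auto
    ultimately show "\<not> is_sink B q \<and> (\<forall>c\<in>set (children B q). gate_of B c \<noteq> Sink False \<longrightarrow> c \<in> set (layer B i))" by blast
  qed
  then show ?case by auto
qed

lemma set_layers: "set (concat (map (layer B) [1..<m])) = {q \<in> set (nodes B). 1 \<le> lv q \<and> lv q < m}"
  by (auto simp: set_layer)

text \<open>Children other than the 0-sink lie in the preceding layer, so the nodes within one layer
  may come in any order; the inner induction runs over an arbitrary distinct list of them.\<close>

lemma level_order_layers: "level_order (concat (map (layer B) [1..<m]))"
proof (induction m)
  case 0 then show ?case by (simp add: level_order_def)
next
  case (Suc m)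
  show ?case
  proof (cases "m \<ge> 1")
    case False then show ?thesis by (simp add: level_order_def)
  next
    case True
    let ?xs = "concat (map (layer B) [1..<m])"
    have "level_order (?xs @ ls)" if "set ls \<subseteq> set (layer B m)" "distinct ls" for ls
      using that
    proof (induction ls rule: rev_induct)
      case Nil then show ?case using Suc by simp
    next
      case (snoc q ls)
      have q: "q \<in> set (nodes B)" "lv q = m" using snoc.prems by (auto simp: set_layer)
      have "level_order ((?xs @ ls) @ [q])"
      proof (rule level_order_snocI)
        show "level_order (?xs @ ls)" using snoc by simp
        show "\<not> is_sink B q" using lv_sink[OF q(1)] q(2) True by auto
        show "q \<notin> set (?xs @ ls)" using snoc.prems q by (auto simp: set_layer)
        show "lv q' \<le> lv q" if "q' \<in> set (?xs @ ls)" for q'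
          using that snoc.prems q by (auto simp: set_layer)
        show "is_sink B c \<or> c \<in> set (?xs @ ls)" if "c \<in> set (children B q)" for c
        proof (cases "is_sink B c")
          case False
          then have "Suc (lv c) = lv q" using child_level[OF q(1) that] by (auto simp: is_sink_def)
          moreover have "c \<in> set (nodes B)" using children_nodes q that by blast
          ultimately have "c \<in> set ?xs" unfolding set_layers using q lv_nonsink[of c] False by auto
          then show ?thesis by simp
        qed simp
      qed (use q in auto)
      then show ?case by simp
    qed
    from this[of "layer B m"] have "level_order (?xs @ layer B m)"
      using distinct_nodes by (cases m) auto
    then show ?thesis using True by simp
  qed
qed

lemma level_order_distinct: "level_order xs \<Longrightarrow> distinct xs"
  by (induction xs rule: rev_induct) (auto dest: level_order_snoc(1,4))

lemma level_order_nodes: "level_order xs \<Longrightarrow> x \<in> set xs \<Longrightarrow> x \<in> set (nodes B) \<and> \<not> is_sink B x"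
  unfolding level_order_def by (meson split_list)

end

text \<open>At a node with \<open>m\<close> models, values \<open>1 / p\<close> above \<open>(1 + u) m\<close> are failures, and so are, at an \<open>Or\<close>-node,
  values below \<open>sg m / (1 + \<kappa>)\<close>. For \<open>\<epsilon> \<ge> 1\<close> no lower bound is needed; this is the case \<open>\<not> lo\<close>.\<close>

locale regime = algo B lv \<kappa> ns nt for B :: "('q, 'v) bdd" and lv \<kappa> ns nt +
  fixes u :: real and sg :: "nat \<Rightarrow> nat" and lo :: bool and k :: nat
  assumes u: "u > 0" and nt: "nt = 2 * k" and k: "k > 0"
    and hi_var: "(1 + u) * (1 + 7 / 10 * card (bdd_vars B)) - 1 \<le> ns * u\<^sup>2 / 2"
    and lo_var: "lo \<Longrightarrow> m \<ge> 1 \<Longrightarrow> sg m \<ge> 2 \<Longrightarrow> real (sg m) / ((1 + \<kappa>) * m) < 1 \<and>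
       (1 + u) * (1 + 7 / 10 * card (bdd_vars B)) - 1 \<le> ns * (1 - real (sg m) / ((1 + \<kappa>) * m))\<^sup>2 / 2"
    and sg: "m \<ge> 1 \<Longrightarrow> (m + 1) div 2 \<le> sg m \<and> sg m \<le> m"
begin

text \<open>The two lower conditions play different parts. \<open>sg\<close> is the accuracy wanted
  at Or-nodes, in particular at the source. The bound by half the models, rounded up, is weaker but
  available at every node, since it is additive over the children of a decision node and integral,
  hence stable under rounding; the estimate for the threshold is based on it.\<close>

definition good :: "('q \<Rightarrow> ennreal) \<Rightarrow> 'q \<Rightarrow> bool" where
  "good p q \<longleftrightarrow> weight p q \<le> (1 + u) * cnt q \<and> (lo \<longrightarrow> enn2real (p q) * ((cnt q + 1) div 2) \<le> 1 + \<kappa> \<and>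
     (is_or B q \<longrightarrow> enn2real (p q) * sg (cnt q) \<le> 1 + \<kappa>))"

lemma grid_real:
  assumes "g \<in> grid nv \<kappa>"
  shows "0 < enn2real g" "enn2real g \<le> 1" "ennreal (enn2real g) = g"
proof -
  have g: "0 < g" "g \<le> 1" using grid_props[OF assms \<kappa>] by auto
  then have "g < top" by (metis ennreal_one_less_top le_less_trans)
  then show "0 < enn2real g" "ennreal (enn2real g) = g" using g by (auto simp: enn2real_positive_iff)
  show "enn2real g \<le> 1" using g(2) by (metis enn2real_1 enn2real_mono ennreal_one_less_top)
qed

lemma grid_real_le: "g \<in> grid nv \<kappa> \<Longrightarrow> g \<le> ennreal x \<Longrightarrow> x \<ge> 0 \<Longrightarrow> enn2real g \<le> x"
  by (rule enn2real_leI)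

lemma grid_real_ge: "g \<in> grid nv \<kappa> \<Longrightarrow> ennreal x \<le> g \<Longrightarrow> x \<le> enn2real g"
  using grid_real(1,3)[of g] by (metis ennreal_le_iff less_imp_le)

context
  fixes xs q st
  assumes s: "consistent xs st" and o: "level_order (xs @ [q])" and gd: "\<And>x. x \<in> set xs \<Longrightarrow> good (fst st) x"
begin

lemma child_good:
  assumes c: "c \<in> set (children B q)"
  shows "1 / fst st c = ennreal (weight (fst st) c)" "weight (fst st) c \<ge> 0"
    "weight (fst st) c \<le> (1 + u) * cnt c" "lo \<Longrightarrow> real ((cnt c + 1) div 2) \<le> (1 + \<kappa>) * weight (fst st) c"
    "gate_of B c \<noteq> Sink False \<Longrightarrow> weight (fst st) c > 0"
proof -
  let ?p = "fst st c"
  have "1 / ?p = ennreal (weight (fst st) c) \<and> weight (fst st) c \<ge> 0 \<and>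
    weight (fst st) c \<le> (1 + u) * cnt c \<and> (lo \<longrightarrow> real ((cnt c + 1) div 2) \<le> (1 + \<kappa>) * weight (fst st) c)
    \<and> (gate_of B c \<noteq> Sink False \<longrightarrow> weight (fst st) c > 0)"
  proof (cases "gate_of B c = Sink False")
    case True
    then have "?p = \<infinity>" using consistent_child(2)[OF s o c] by simp
    moreover have "cnt c = 0" using Mod_dead[OF True] by (simp add: cnt_def)
    ultimately show ?thesis using True by (simp add: weight_def)
  next
    case False
    then have g: "?p \<in> grid nv \<kappa>" using consistent_child(1)[OF s o c] by simp
    note gr = grid_real[OF g]
    have i: "1 / ?p = ennreal (weight (fst st) c)"
    proof -
      have "1 / ?p = ennreal 1 / ennreal (enn2real ?p)" using gr by simp
      then show ?thesis using gr(1) by (simp add: divide_ennreal weight_def del: ennreal_1)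
    qed
    have gd': "weight (fst st) c \<le> (1 + u) * cnt c \<and> (lo \<longrightarrow> enn2real ?p * ((cnt c + 1) div 2) \<le> 1 + \<kappa>)"
    proof (cases "c \<in> set xs")
      case True then show ?thesis using gd[OF True] by (simp add: good_def)
    next
      case F2: False
      then have "is_sink B c" using level_order_snoc(6)[OF o c] by blast
      then have gT: "gate_of B c = Sink True" using False by (auto simp: is_sink_def)
      then have "?p = 1" using s F2 by (simp add: consistent_def st0_props)
      moreover have "cnt c = 1" using Mod_true[OF consistent_child(3)[OF s o c] gT] by (simp add: cnt_def)
      ultimately show ?thesis using u \<kappa> by (simp add: weight_def)
    qed
    have "lo \<longrightarrow> real ((cnt c + 1) div 2) \<le> (1 + \<kappa>) * weight (fst st) c"
      using gd' gr(1) unfolding weight_def by (simp add: field_simps)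
    then show ?thesis using i gd' gr(1) by (simp add: weight_def)
  qed
  then show "1 / ?p = ennreal (weight (fst st) c)" "weight (fst st) c \<ge> 0"
    "weight (fst st) c \<le> (1 + u) * cnt c" "lo \<Longrightarrow> real ((cnt c + 1) div 2) \<le> (1 + \<kappa>) * weight (fst st) c"
    "gate_of B c \<noteq> Sink False \<Longrightarrow> weight (fst st) c > 0" by auto
qed

text \<open>Decision nodes contribute no failure. Weights and model counts both add up over the
  children, rounding can only lower the weight, and the lower bound is passed on through an
  integer.\<close>

lemma ite_good:
  assumes g: "gate_of B q = Ite x q1 q0"
  shows "good ((fst st)(q := ite_value (fst st) q1 q0)) q"
proof -
  note oo = level_order_snoc[OF o]
  let ?p = "fst st"
  let ?v = "inverse (1 / ?p q0 + 1 / ?p q1)"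
  have ch: "q1 \<in> set (children B q)" "q0 \<in> set (children B q)" using g by (auto simp: children_def)
  note c1 = child_good[OF ch(1)] and c0 = child_good[OF ch(2)]
  define S where "S = weight ?p q0 + weight ?p q1"
  have S: "S > 0" using ite_live[OF oo(2) g] c1(2,5) c0(2,5) unfolding S_def
    by (metis add_nonneg_pos add_pos_nonneg insertE singletonD)
  have v: "?v = ennreal (1 / S)"
    using c1(1,2) c0(1,2) S by (simp add: S_def ennreal_plus[symmetric] inverse_ennreal inverse_eq_divide del: ennreal_plus)
  obtain e where e: "e \<in> {q1, q0}" "gate_of B e \<noteq> Sink False" using ite_live[OF oo(2) g] by blast
  have eg: "?p e \<in> grid nv \<kappa>" using consistent_child(1)[OF s o, of e] e ch by auto
  have "?v \<le> ?p e" using e ennreal_inverse_le[of "?p q0" "1 / ?p q1"] ennreal_inverse_le[of "?p q1" "1 / ?p q0"]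
    by (auto simp: add.commute)
  then have v1: "?v \<le> 1" using grid_props(2)[OF eg \<kappa>] by (rule order_trans)
  define pq where "pq = ite_value ?p q1 q0"
  have pq: "pq \<in> grid nv \<kappa>" "?v \<le> pq" using round_up_grid[OF v1, of \<kappa> nv] \<kappa> by (auto simp: pq_def ite_value_def)
  note gr = grid_real[OF pq(1)]
  have cq: "cnt q = cnt q1 + cnt q0" by (rule cnt_ite[OF oo(2) g])
  have "1 / S \<le> enn2real pq" using pq v grid_real_ge by simp
  then have "weight (?p(q := pq)) q \<le> S" using S gr(1) by (simp add: weight_def field_simps)
  also have "S \<le> (1 + u) * cnt q" using c1(3) c0(3) by (simp add: S_def cq algebra_simps)
  finally have up: "weight (?p(q := pq)) q \<le> (1 + u) * cnt q" .
  have low: "enn2real pq * ((cnt q + 1) div 2) \<le> 1 + \<kappa>" if lo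
  proof -
    \<comment> \<open>The sum of the rounded halves of the two counts. It is at least the rounded
      half of their sum, and \<open>l \<le> cnt q \<le> 2 ^ n\<close> makes
      \<open>(1 + \<kappa>) / l\<close> an admissible value for rounding.\<close>
    define l where "l = (cnt q1 + 1) div 2 + (cnt q0 + 1) div 2"
    have "cnt q \<ge> 1" using cnt_pos[OF oo(2)] g by simp
    then have l: "1 \<le> l" "l \<le> cnt q" "(cnt q + 1) div 2 \<le> l" unfolding l_def cq by linarith+
    have "real l \<le> (1 + \<kappa>) * S" using c1(4)[OF that] c0(4)[OF that] by (simp add: l_def S_def algebra_simps)
    then have "1 / S \<le> (1 + \<kappa>) / real l" using S l by (simp add: field_simps)
    then have "?v \<le> ennreal ((1 + \<kappa>) / real l)" unfolding v by (rule ennreal_leI)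
    then have "pq \<le> ennreal ((1 + \<kappa>) / real l)" unfolding pq_def ite_value_def
      using round_up_le[of ?v \<kappa> l nv] l cnt_le[OF oo(2)] by simp
    then have "enn2real pq \<le> (1 + \<kappa>) / real l" using grid_real_le[OF pq(1)] \<kappa> by simp
    then have "enn2real pq * real l \<le> 1 + \<kappa>" using l by (simp add: field_simps)
    moreover have "enn2real pq * ((cnt q + 1) div 2) \<le> enn2real pq * real l" using l gr(1) by (intro mult_left_mono) auto
    ultimately show ?thesis by linarith
  qed
  show ?thesis using up low g unfolding pq_def[symmetric] by (simp add: good_def is_or_def)
qed

text \<open>Failure at an Or-node is reduced to an event about the estimate alone. If the minimum
  over the children is the smaller of the two values, the upper bound on the weight is inherited
  from a child, otherwise it comes from the estimate. A target \<open>sg m\<close> of at most 1 is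
  met because \<open>p \<le> 1\<close>, which explains the condition
  \<open>sg (cnt q) \<ge> 2\<close>.\<close>

lemma or_bad_cases:
  assumes g: "gate_of B q = Or qs" and bad: "\<not> good ((fst st)(q := or_value (fst st) q Sh)) q"
  shows "estimate (fst st) q Sh > ennreal ((1 + u) * cnt q) \<or>
    lo \<and> sg (cnt q) \<ge> 2 \<and> estimate (fst st) q Sh < ennreal (sg (cnt q) / (1 + \<kappa>))"
proof (rule ccontr)
  assume neg: "\<not> ?thesis"
  note oo = level_order_snoc[OF o]
  let ?p = "fst st" and ?E = "estimate (fst st) q Sh"
  have hi: "?E \<le> ennreal ((1 + u) * cnt q)" using neg by (simp add: not_less)
  have ch: "set (children B q) = set qs" using g by (simp add: children_def)
  have q1: "cnt q \<ge> 1" using cnt_pos[OF oo(2)] g by simp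
  have "rho ?p q \<in> ?p ` set qs" unfolding rho_def ch using or_nonempty[OF oo(2)] g by (auto intro!: Min_in)
  then obtain c where c: "c \<in> set qs" "rho ?p q = ?p c" by auto
  have alive: "gate_of B c \<noteq> Sink False" using or_child[OF oo(2) g c(1)] by (auto simp: is_decision_def)
  have cg: "?p c \<in> grid nv \<kappa>" using consistent_child(1)[OF s o _ alive] c ch by auto
  define v where "v = min (rho ?p q) (inverse ?E)"
  have v1: "v \<le> 1" using grid_props(2)[OF cg \<kappa>] c by (simp add: v_def min.coboundedI1)
  define pq where "pq = or_value ?p q Sh"
  have pq: "pq \<in> grid nv \<kappa>" "v \<le> pq" using round_up_grid[OF v1, of \<kappa> nv] \<kappa> by (auto simp: pq_def or_value_def v_def)
  note gr = grid_real[OF pq(1)]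
  have up: "weight (?p(q := pq)) q \<le> (1 + u) * cnt q"
  proof (cases "rho ?p q \<le> inverse ?E")
    case True
    then have "?p c \<le> pq" using pq(2) c by (simp add: v_def)
    then have "enn2real (?p c) \<le> enn2real pq" using grid_real(3)[OF cg] by (intro grid_real_ge[OF pq(1)]) simp
    then have "weight (?p(q := pq)) q \<le> weight ?p c" using grid_real(1)[OF cg] by (simp add: weight_def frac_le)
    also have "\<dots> \<le> (1 + u) * cnt c" using child_good(3)[of c] c ch by simp
    also have "\<dots> \<le> (1 + u) * cnt q" using cnt_or[OF oo(2) g c(1)] u by (intro mult_left_mono) auto
    finally show ?thesis .
  next
    case False
    have pos: "(1 + u) * cnt q > 0" using u q1 by simp
    have "inverse (ennreal ((1 + u) * cnt q)) \<le> inverse ?E" using hi by (rule ennreal_inverse_antimono)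
    also have "\<dots> \<le> pq" using pq(2) False by (simp add: v_def min_def)
    finally have "ennreal (1 / ((1 + u) * cnt q)) \<le> pq" using pos by (simp add: inverse_ennreal inverse_eq_divide)
    then have "1 / ((1 + u) * cnt q) \<le> enn2real pq" by (rule grid_real_ge[OF pq(1)])
    then show ?thesis using pos gr(1) by (simp add: weight_def field_simps)
  qed
  have low: "enn2real pq * sg (cnt q) \<le> 1 + \<kappa>" if lo
  proof (cases "sg (cnt q) \<ge> 2")
    case False
    then have "real (sg (cnt q)) \<le> 1" by simp
    then have "enn2real pq * sg (cnt q) \<le> 1 * 1" using gr by (intro mult_mono) auto
    then show ?thesis using \<kappa> by simp
  next
    case True
    then have E: "ennreal (sg (cnt q) / (1 + \<kappa>)) \<le> ?E" using neg that by (simp add: not_less)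
    have "v \<le> inverse ?E" by (simp add: v_def)
    also have "\<dots> \<le> inverse (ennreal (sg (cnt q) / (1 + \<kappa>)))" using E by (rule ennreal_inverse_antimono)
    also have "\<dots> = ennreal ((1 + \<kappa>) / sg (cnt q))" using True \<kappa> by (simp add: inverse_ennreal)
    finally have "v \<le> ennreal ((1 + \<kappa>) / sg (cnt q))" .
    then have "pq \<le> ennreal ((1 + \<kappa>) / sg (cnt q))" unfolding pq_def or_value_def v_def[symmetric]
      using round_up_le[of v \<kappa> "sg (cnt q)" nv] True sg[OF q1] cnt_le[OF oo(2)] by simp
    then have "enn2real pq \<le> (1 + \<kappa>) / sg (cnt q)" using grid_real_le[OF pq(1)] \<kappa> by simp
    then show ?thesis using True by (simp add: field_simps)
  qed
  moreover have "enn2real pq * ((cnt q + 1) div 2) \<le> enn2real pq * sg (cnt q)"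
    using sg[OF q1] gr(1) by (intro mult_left_mono) auto
  ultimately have "good (?p(q := pq)) q" using up by (auto simp: good_def)
  then show False using bad by (simp add: pq_def)
qed

end

definition bad_sample :: "('q \<Rightarrow> ennreal) \<Rightarrow> 'q \<Rightarrow> ('v \<rightharpoonup> bool) set list \<Rightarrow> bool" where
  "bad_sample h q Sh \<longleftrightarrow> estimate h q Sh > ennreal ((1 + u) * cnt q) \<or>
    lo \<and> sg (cnt q) \<ge> 2 \<and> estimate h q Sh < ennreal (sg (cnt q) / (1 + \<kappa>))"

end

context regime
begin

text \<open>For imposed values the unions with different indices are independent copies of
  \<open>union_law\<close>, whose first two moments are controlled. The relative tolerances are
  \<open>u\<close> upwards and \<open>1 - sg m / ((1 + \<kappa>) * m)\<close> downwards for
  \<open>m = cnt q\<close>, and each direction costs \<open>(8 / 9) ^ k\<close>.\<close>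

lemma bad_sample_tail:
  assumes o: "level_order (xs @ [q])" and g: "gate_of B q = Or qs" and s: "consistent xs (h, S)" and gd: "\<And>x. x \<in> set xs \<Longrightarrow> good h x"
  shows "measure_pmf.prob (Pi_pmf {..<N} {} (\<lambda>_. union_law h xs q)) {g. bad_sample h q (map g [0..<N])} \<le> 2 * (8 / 9) ^ k"
proof -
  note oo = level_order_snoc[OF o]
  have ax: "admissible h x" "h x \<le> 1" "weight h x \<le> (1 + u) * cnt x" if "x \<in> set xs" for x
    using s that gd[OF that] grid_props(2)[OF _ \<kappa>] by (auto simp: consistent_def good_def)
  have h1: "h x = 1" if "x \<in> set (nodes B)" "gate_of B x = Sink True" for x
  proof -
    have "x \<notin> set xs" using level_order_nodes[OF oo(1), of x] that by (auto simp: is_sink_def)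
    then show ?thesis using s that by (simp add: consistent_def st0_props)
  qed
  have A1: "1 + u \<ge> 1" using u by simp
  let ?r = "enn2real (rho h q)"
  let ?X = "\<lambda>T :: ('v \<rightharpoonup> bool) set. real (card T) / ?r"
  have rr: "0 < ?r" "ennreal ?r = rho h q" by (rule rho_real[OF o g ax(1) h1 ax(2) A1 ax(3)], assumption+)+
  have fin: "finite (set_pmf (union_law h xs q))" by (rule finite_union_law[OF o g ax(1) h1 ax(2) A1 ax(3)])
  have mean: "measure_pmf.expectation (union_law h xs q) ?X = real (cnt q)" by (rule union_law_mean[OF o g ax(1) h1 ax(2) A1 ax(3)])
  have sq: "measure_pmf.expectation (union_law h xs q) (\<lambda>T. (?X T)\<^sup>2) \<le> (real (cnt q))\<^sup>2 * ((1 + u) * (1 + 7 / 10 * real nv))"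
    by (rule union_law_square[OF o g ax(1) h1 ax(2) A1 ax(3)])
  let ?P = "Pi_pmf {..<2 * k * ns} {} (\<lambda>_. union_law h xs q)"
  have q1: "real (cnt q) \<ge> 1" using cnt_pos[OF oo(2)] g by simp
  have NN: "N = 2 * k * ns" using nt by simp
  have n0: "0 < real ns" using ns by (simp only: of_nat_0_less_iff)
  have r0: "0 < ?r * ns" by (rule mult_pos_pos[OF rr(1) n0])
  have M: "1 / (rho h q * of_nat ns) * (\<Sum>r = j * ns..<(j + 1) * ns. of_nat (card (map f [0..<N] ! r)))
      = ennreal ((\<Sum>i<ns. ?X (f (j * ns + i))) / ns)" if j: "j < nt" for j and f :: "nat \<Rightarrow> ('v \<rightharpoonup> bool) set"
  proof -
    have lt: "j * ns + i < N" if "i < ns" for i using prod_lt_nat[OF j that] .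
    have "(\<Sum>r = j * ns..<(j + 1) * ns. real (card (map f [0..<N] ! r))) = (\<Sum>i\<in>{0..<ns}. real (card (map f [0..<N] ! (i + j * ns))))"
      using sum.shift_bounds_nat_ivl[of "\<lambda>r. real (card (map f [0..<N] ! r))" 0 "j * ns" ns] by (simp add: add.commute)
    also have "\<dots> = (\<Sum>i<ns. real (card (f (j * ns + i))))"
      using lt by (intro sum.cong) (auto simp: add.commute)
    finally have S: "(\<Sum>r = j * ns..<(j + 1) * ns. real (card (map f [0..<N] ! r))) = (\<Sum>i<ns. real (card (f (j * ns + i))))" .
    have "(\<Sum>r = j * ns..<(j + 1) * ns. of_nat (card (map f [0..<N] ! r)) :: ennreal)
       = ennreal (\<Sum>r = j * ns..<(j + 1) * ns. real (card (map f [0..<N] ! r)))"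
      by (simp add: ennreal_of_nat_eq_real_of_nat sum_ennreal)
    moreover have "1 / (rho h q * of_nat ns) = ennreal (1 / (?r * ns))"
    proof -
      have "ennreal (?r * ns) = ennreal ?r * ennreal ns" by (rule ennreal_mult) auto
      also have "\<dots> = rho h q * of_nat ns" by (simp only: rr(2) ennreal_of_nat_eq_real_of_nat)
      finally have "1 / (rho h q * of_nat ns) = ennreal 1 / ennreal (?r * ns)" by (simp only: ennreal_1)
      also have "\<dots> = ennreal (1 / (?r * ns))" by (rule divide_ennreal[OF zero_le_one r0])
      finally show ?thesis .
    qed
    ultimately have "1 / (rho h q * of_nat ns) * (\<Sum>r = j * ns..<(j + 1) * ns. of_nat (card (map f [0..<N] ! r)))
      = ennreal (1 / (?r * ns) * (\<Sum>i<ns. real (card (f (j * ns + i)))))"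
    proof -
      assume a: "(\<Sum>r = j * ns..<(j + 1) * ns. of_nat (card (map f [0..<N] ! r)) :: ennreal)
        = ennreal (\<Sum>r = j * ns..<(j + 1) * ns. real (card (map f [0..<N] ! r)))"
        "1 / (rho h q * of_nat ns) = ennreal (1 / (?r * ns))"
      show ?thesis unfolding a S by (rule ennreal_mult[symmetric]) (auto intro!: sum_nonneg)
    qed
    also have "1 / (?r * ns) * (\<Sum>i<ns. real (card (f (j * ns + i)))) = (\<Sum>i<ns. ?X (f (j * ns + i))) / ns"
      by (simp add: sum_divide_distrib[symmetric])
    finally show ?thesis .
  qed
  define Ms where "Ms f = map (\<lambda>j. ennreal ((\<Sum>i<ns. ?X (f (j * ns + i))) / ns)) [0..<nt]" for f :: "nat \<Rightarrow> ('v \<rightharpoonup> bool) set"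
  have est: "estimate h q (map f [0..<N]) = median (Ms f)" for f
    unfolding estimate_def Ms_def using M by (intro arg_cong[of _ _ median] map_cong) auto
  have len: "length (Ms f) = 2 * k" "Ms f \<noteq> []" for f using nt k by (auto simp: Ms_def)
  have nth: "Ms f ! j = ennreal ((\<Sum>i<ns. ?X (f (j * ns + i))) / ns)" if "j < 2 * k" for f j using that nt by (simp add: Ms_def)
  have X0: "(\<Sum>i<ns. ?X (f (j * ns + i))) / ns \<ge> 0" for f j by (intro divide_nonneg_nonneg sum_nonneg enn2real_nonneg of_nat_0_le_iff)
  let ?Hi = "{f. 2 * k \<le> 2 * card {j. j < 2 * k \<and> (\<Sum>i<ns. ?X (f (j * ns + i))) \<ge> real ns * (cnt q + u * cnt q)}}"
  let ?t = "1 - real (sg (cnt q)) / ((1 + \<kappa>) * cnt q)"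
  let ?Lo = "{f. 2 * k \<le> 2 * card {j. j < 2 * k \<and> (\<Sum>i<ns. ?X (f (j * ns + i))) \<le> real ns * (cnt q - ?t * cnt q)}}"
  have V: "measure_pmf.expectation (union_law h xs q) (\<lambda>T. (?X T)\<^sup>2) - (real (cnt q))\<^sup>2
      \<le> (real (cnt q))\<^sup>2 * ((1 + u) * (1 + 7 / 10 * card (bdd_vars B)) - 1)"
    using sq by (simp add: algebra_simps)
  have hi: "measure_pmf.prob ?P ?Hi \<le> (8 / 9) ^ k"
  proof (rule blocks_tail(1)[OF fin mean])
    have "(real (cnt q))\<^sup>2 * ((1 + u) * (1 + 7 / 10 * card (bdd_vars B)) - 1) \<le> (real (cnt q))\<^sup>2 * (ns * u\<^sup>2 / 2)"
      using hi_var by (intro mult_left_mono) auto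
    then show "measure_pmf.expectation (union_law h xs q) (\<lambda>T. (?X T)\<^sup>2) - (real (cnt q))\<^sup>2 \<le> real ns * (u * cnt q)\<^sup>2 / 2"
      using V by (simp add: power_mult_distrib mult_ac)
  qed (use u q1 ns in auto)
  have lo: "measure_pmf.prob ?P ?Lo \<le> (8 / 9) ^ k" if lo "sg (cnt q) \<ge> 2"
  proof (rule blocks_tail(2)[OF fin mean])
    have c1: "cnt q \<ge> 1" using q1 by simp
    note lv' = lo_var[OF that(1) c1 that(2)]
    have "(real (cnt q))\<^sup>2 * ((1 + u) * (1 + 7 / 10 * card (bdd_vars B)) - 1) \<le> (real (cnt q))\<^sup>2 * (ns * ?t\<^sup>2 / 2)"
      using lv' by (intro mult_left_mono) auto
    then show "measure_pmf.expectation (union_law h xs q) (\<lambda>T. (?X T)\<^sup>2) - (real (cnt q))\<^sup>2 \<le> real ns * (?t * cnt q)\<^sup>2 / 2"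
      using V by (simp add: power_mult_distrib mult_ac)
    show "?t * cnt q > 0" using lv' q1 by (intro mult_pos_pos) auto
  qed (use ns in auto)
  have sub: "f \<in> ?Hi \<or> (lo \<and> sg (cnt q) \<ge> 2 \<and> f \<in> ?Lo)" if b: "bad_sample h q (map f [0..<N])" for f
  proof (cases "median (Ms f) > ennreal ((1 + u) * cnt q)")
    case True
    from median_between(2)[OF ennreal_mid len(2) True]
    have "2 * k \<le> 2 * card {j. j < 2 * k \<and> Ms f ! j > ennreal ((1 + u) * cnt q)}" by (simp add: len)
    also have "\<dots> \<le> 2 * card {j. j < 2 * k \<and> (\<Sum>i<ns. ?X (f (j * ns + i))) \<ge> real ns * (cnt q + u * cnt q)}"
    proof (intro mult_le_mono2 card_mono)
      show "{j. j < 2 * k \<and> Ms f ! j > ennreal ((1 + u) * cnt q)} \<subseteq> {j. j < 2 * k \<and> (\<Sum>i<ns. ?X (f (j * ns + i))) \<ge> real ns * (cnt q + u * cnt q)}"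
      proof clarify
        fix j assume j: "j < 2 * k" "Ms f ! j > ennreal ((1 + u) * cnt q)"
        then have "(\<Sum>i<ns. ?X (f (j * ns + i))) / ns > (1 + u) * cnt q"
          using u by (simp add: nth ennreal_less_iff)
        then show "(\<Sum>i<ns. ?X (f (j * ns + i))) \<ge> real ns * (cnt q + u * cnt q)" using ns by (simp add: field_simps)
      qed
    qed simp
    finally show ?thesis by simp
  next
    case False
    then have l: lo "sg (cnt q) \<ge> 2" "median (Ms f) < ennreal (sg (cnt q) / (1 + \<kappa>))" using b by (auto simp: bad_sample_def est)
    from median_between(1)[OF ennreal_mid len(2) l(3)]
    have "2 * k \<le> 2 * card {j. j < 2 * k \<and> Ms f ! j < ennreal (sg (cnt q) / (1 + \<kappa>))}" by (simp add: len)
    also have "\<dots> \<le> 2 * card {j. j < 2 * k \<and> (\<Sum>i<ns. ?X (f (j * ns + i))) \<le> real ns * (cnt q - ?t * cnt q)}"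
    proof (intro mult_le_mono2 card_mono)
      show "{j. j < 2 * k \<and> Ms f ! j < ennreal (sg (cnt q) / (1 + \<kappa>))} \<subseteq> {j. j < 2 * k \<and> (\<Sum>i<ns. ?X (f (j * ns + i))) \<le> real ns * (cnt q - ?t * cnt q)}"
      proof clarify
        fix j assume j: "j < 2 * k" "Ms f ! j < ennreal (sg (cnt q) / (1 + \<kappa>))"
        then have a: "(\<Sum>i<ns. ?X (f (j * ns + i))) / ns < sg (cnt q) / (1 + \<kappa>)"
          using X0[of f j] by (simp add: nth ennreal_less_iff)
        have "real (sg (cnt q)) / ((1 + \<kappa>) * cnt q) * cnt q = sg (cnt q) / (1 + \<kappa>)" using q1 by simp
        then have "cnt q - ?t * cnt q = sg (cnt q) / (1 + \<kappa>)" unfolding left_diff_distrib by linarith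
        then show "(\<Sum>i<ns. ?X (f (j * ns + i))) \<le> real ns * (cnt q - ?t * cnt q)" using a ns by (simp add: field_simps)
      qed
    qed simp
    finally show ?thesis using l by simp
  qed
  show ?thesis
  proof (cases "lo \<and> sg (cnt q) \<ge> 2")
    case True
    have "measure_pmf.prob ?P {f. bad_sample h q (map f [0..<N])} \<le> measure_pmf.prob ?P (?Hi \<union> ?Lo)"
      by (intro measure_pmf.finite_measure_mono) (use sub in auto)
    also have "\<dots> \<le> measure_pmf.prob ?P ?Hi + measure_pmf.prob ?P ?Lo" by (rule measure_Un_le) auto
    also have "\<dots> \<le> 2 * (8 / 9) ^ k" using hi lo[OF conjunct1[OF True] conjunct2[OF True]] by linarith
    finally show ?thesis unfolding NN .
  next
    case False
    have "measure_pmf.prob ?P {f. bad_sample h q (map f [0..<N])} \<le> measure_pmf.prob ?P ?Hi"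
      by (intro measure_pmf.finite_measure_mono) (use sub False in auto)
    also have "\<dots> \<le> 2 * (8 / 9) ^ k" using hi zero_le_power[of "8 / 9 :: real" k] by linarith
    finally show ?thesis unfolding NN .
  qed
qed

section \<open>Union bound over histories\<close>

definition num_ors :: "'q list \<Rightarrow> nat" where
  "num_ors xs = length (filter (is_or B) xs)"

text \<open>The value at a decision node is a function of the earlier values, so only an Or-node
  multiplies the number of histories, by the size of the grid.\<close>

lemma card_histories: "level_order xs \<Longrightarrow> finite (fst ` set_pmf (unstopped xs st0)) \<and> card (fst ` set_pmf (unstopped xs st0)) \<le> (2 ^ nv) ^ num_ors xs"
proof (induction xs rule: rev_induct)
  case Nil then show ?case by (simp add: num_ors_def)
next
  case (snoc q xs)
  note o = snoc.prems and oo = level_order_snoc[OF snoc.prems]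
  let ?P = "fst ` set_pmf (unstopped xs st0)" and ?Q = "fst ` set_pmf (unstopped (xs @ [q]) st0)"
  have IH: "finite ?P" "card ?P \<le> (2 ^ nv) ^ num_ors xs" using snoc.IH[OF oo(1)] by auto
  have el: "\<exists>st pq Sq. st \<in> set_pmf (unstopped xs st0) \<and> (pq, Sq) \<in> set_pmf (step_law st q) \<and> p = (fst st)(q := pq)" if "p \<in> ?Q" for p
    using that by (force simp: unstopped_snoc)
  show ?case
  proof (cases "gate_of B q")
    case (Sink b) then show ?thesis using oo(3) by (simp add: is_sink_def)
  next
    case (Ite x q1 q0)
    have sub: "?Q \<subseteq> (\<lambda>p. p(q := ite_value p q1 q0)) ` ?P"
      using el by (force simp: step_law_ite[OF Ite])
    have "card ?Q \<le> card ((\<lambda>p. p(q := ite_value p q1 q0)) ` ?P)" by (rule card_mono[OF _ sub]) (use IH in auto)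
    also have "\<dots> \<le> card ?P" by (rule card_image_le[OF IH(1)])
    finally have "card ?Q \<le> (2 ^ nv) ^ num_ors (xs @ [q])" using IH Ite by (simp add: num_ors_def is_or_def)
    then show ?thesis using finite_subset[OF sub] IH by auto
  next
    case (Or qs)
    have sub: "?Q \<subseteq> (\<lambda>(p, v). p(q := v)) ` (?P \<times> grid nv \<kappa>)"
    proof
      fix p assume "p \<in> ?Q"
      then obtain st pq Sq where st: "st \<in> set_pmf (unstopped xs st0)" "(pq, Sq) \<in> set_pmf (step_law st q)" "p = (fst st)(q := pq)"
        using el by blast
      have "pq \<in> grid nv \<kappa>" by (rule step_law_value(1)[OF consistent_unstopped[OF oo(1) st(1)] o st(2)])
      then show "p \<in> (\<lambda>(p, v). p(q := v)) ` (?P \<times> grid nv \<kappa>)" using st by force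
    qed
    have fin: "finite (?P \<times> grid nv \<kappa>)" using IH card_grid(1) by auto
    have "card ?Q \<le> card ((\<lambda>(p, v). p(q := v)) ` (?P \<times> grid nv \<kappa>))" by (rule card_mono[OF _ sub]) (use fin in auto)
    also have "\<dots> \<le> card (?P \<times> grid nv \<kappa>)" by (rule card_image_le[OF fin])
    also have "\<dots> \<le> (2 ^ nv) ^ num_ors xs * 2 ^ nv"
      using IH card_grid(2)[of nv \<kappa>] by (simp add: card_cartesian_product mult_le_mono)
    also have "\<dots> = (2 ^ nv) ^ num_ors (xs @ [q])" using Or by (simp add: num_ors_def is_or_def)
    finally show ?thesis using finite_subset[OF sub] fin by auto
  qed
qed

text \<open>The event is split according to the values computed before \<open>q\<close>. Only
  histories that are good so far contribute, and for these the hypothesis of the variance bound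
  holds; \<open>coupling\<close> then replaces the run by the process with these values
  imposed.\<close>

lemma or_failure:
  assumes o: "level_order (xs @ [q])" and g: "gate_of B q = Or qs"
  shows "(\<integral>\<^sup>+st. of_bool ((\<forall>x\<in>set xs. good (fst st) x) \<and> \<not> good (fst st) q) \<partial>unstopped (xs @ [q]) st0)
    \<le> ennreal ((2 ^ nv) ^ num_ors xs * (2 * (8 / 9) ^ k))"
proof -
  note oo = level_order_snoc[OF o]
  let ?P = "{p \<in> fst ` set_pmf (unstopped xs st0). \<forall>x\<in>set xs. good p x}"
  have finP: "finite ?P" using card_histories[OF oo(1)] by auto
  let ?F = "\<lambda>h S. \<integral>\<^sup>+Sh. of_bool (bad_sample h q Sh) \<partial>mapM_pmf (\<lambda>r. union_sample h q (\<lambda>c. S c ! r)) [0..<N]"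
  have gx: "good (p(q := v)) x = good p x" if "x \<in> set xs" for p v x
    using that oo(4) by (auto simp: good_def weight_def)
  have "(\<integral>\<^sup>+st. of_bool ((\<forall>x\<in>set xs. good (fst st) x) \<and> \<not> good (fst st) q) \<partial>unstopped (xs @ [q]) st0)
    = (\<integral>\<^sup>+st. \<integral>\<^sup>+y. of_bool ((\<forall>x\<in>set xs. good (fst st) x) \<and> \<not> good ((fst st)(q := fst y)) q) \<partial>step_law st q \<partial>unstopped xs st0)"
    by (simp add: unstopped_snoc case_prod_unfold gx cong: ball_cong)
  also have "\<dots> \<le> (\<integral>\<^sup>+st. (\<Sum>h\<in>?P. of_bool (\<forall>x\<in>set xs. fst st x = h x) * ?F h (snd st)) \<partial>unstopped xs st0)"
  proof (rule nn_integral_pmf_mono)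
    fix st assume st: "st \<in> set_pmf (unstopped xs st0)"
    have s: "consistent xs st" by (rule consistent_unstopped[OF oo(1) st])
    show "(\<integral>\<^sup>+y. of_bool ((\<forall>x\<in>set xs. good (fst st) x) \<and> \<not> good ((fst st)(q := fst y)) q) \<partial>step_law st q)
      \<le> (\<Sum>h\<in>?P. of_bool (\<forall>x\<in>set xs. fst st x = h x) * ?F h (snd st))"
    proof (cases "\<forall>x\<in>set xs. good (fst st) x")
      case False
      then show ?thesis by (simp only: simp_thms of_bool_eq nn_integral_const mult_zero_left zero_le)
    next
      case True
      then have gd: "\<And>x. x \<in> set xs \<Longrightarrow> good (fst st) x" by blast
      have "(\<integral>\<^sup>+y. of_bool ((\<forall>x\<in>set xs. good (fst st) x) \<and> \<not> good ((fst st)(q := fst y)) q) \<partial>step_law st q)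
        \<le> (\<integral>\<^sup>+Sh. of_bool (\<not> good ((fst st)(q := or_value (fst st) q Sh)) q) \<partial>mapM_pmf (\<lambda>r. union_sample (fst st) q (\<lambda>c. snd st c ! r)) [0..<N])"
        using True by (simp add: step_law_or[OF g])
      also have "\<dots> \<le> ?F (fst st) (snd st)"
      proof (rule nn_integral_mono)
        fix Sh
        show "(of_bool (\<not> good ((fst st)(q := or_value (fst st) q Sh)) q) :: ennreal) \<le> of_bool (bad_sample (fst st) q Sh)"
          using or_bad_cases[OF s o gd g, of Sh] by (auto simp: bad_sample_def)
      qed
      also have "\<dots> = of_bool (\<forall>x\<in>set xs. fst st x = fst st x) * ?F (fst st) (snd st)" by simp
      also have "\<dots> \<le> (\<Sum>h\<in>?P. of_bool (\<forall>x\<in>set xs. fst st x = h x) * ?F h (snd st))"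
        by (rule member_le_sum[of "fst st" ?P "\<lambda>h. of_bool (\<forall>x\<in>set xs. fst st x = h x) * ?F h (snd st)"])
          (use st gd finP in auto)
      finally show ?thesis .
    qed
  qed
  also have "\<dots> = (\<Sum>h\<in>?P. \<integral>\<^sup>+st. of_bool (\<forall>x\<in>set xs. fst st x = h x) * ?F h (snd st) \<partial>unstopped xs st0)"
    by (rule nn_integral_sum) auto
  also have "\<dots> \<le> (\<Sum>h\<in>?P. ennreal (2 * (8 / 9) ^ k))"
  proof (rule sum_mono)
    fix h assume "h \<in> ?P"
    then obtain st where st: "st \<in> set_pmf (unstopped xs st0)" "h = fst st" and gd: "\<And>x. x \<in> set xs \<Longrightarrow> good h x" by auto
    have s: "consistent xs (h, snd st)" using consistent_unstopped[OF oo(1) st(1)] st(2) by simp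
    have sk: "h c = fst st0 c" if "c \<in> set (nodes B)" "is_sink B c" for c
      using s level_order_nodes[OF oo(1), of c] that by (auto simp: consistent_def)
    \<comment> \<open>The function of the samples handed to the coupling is the conditional
      probability that the next union is bad.\<close>
    have "(\<integral>\<^sup>+st. of_bool (\<forall>x\<in>set xs. fst st x = h x) * ?F h (snd st) \<partial>unstopped xs st0)
      \<le> (\<integral>\<^sup>+\<tau>. ?F h (gather \<tau>) \<partial>Pi_pmf {..<N} init_samples (\<lambda>_. sample_process h xs init_samples))"
      by (rule coupling[OF oo(1) sk])
    also have "\<dots> = (\<integral>\<^sup>+\<tau>. \<integral>\<^sup>+f. of_bool (bad_sample h q (map f [0..<N])) \<partial>Pi_pmf {..<N} {} (\<lambda>r. union_sample h q (\<tau> r)) \<partial>Pi_pmf {..<N} init_samples (\<lambda>_. sample_process h xs init_samples))"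
    proof (rule nn_integral_cong)
      fix \<tau> :: "nat \<Rightarrow> 'q \<Rightarrow> ('v \<rightharpoonup> bool) set"
      have "Pi_pmf {..<N} {} (\<lambda>r. union_sample h q (\<lambda>c. gather \<tau> c ! r)) = Pi_pmf {..<N} {} (\<lambda>r. union_sample h q (\<tau> r))"
        by (rule Pi_pmf_cong) (auto simp: gather_def)
      then show "?F h (gather \<tau>) = (\<integral>\<^sup>+f. of_bool (bad_sample h q (map f [0..<N])) \<partial>Pi_pmf {..<N} {} (\<lambda>r. union_sample h q (\<tau> r)))"
        by (simp add: mapM_pmf_upt[where d = "{}"])
    qed
    also have "\<dots> = (\<integral>\<^sup>+f. of_bool (bad_sample h q (map f [0..<N])) \<partial>Pi_pmf {..<N} {} (\<lambda>_. union_law h xs q))"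
      unfolding union_law_def by (simp add: Pi_pmf_bind[where d' = init_samples])
    also have "\<dots> = emeasure (Pi_pmf {..<N} {} (\<lambda>_. union_law h xs q)) {f. bad_sample h q (map f [0..<N])}"
    proof -
      have "(\<integral>\<^sup>+f. of_bool (bad_sample h q (map f [0..<N])) \<partial>Pi_pmf {..<N} {} (\<lambda>_. union_law h xs q))
        = (\<integral>\<^sup>+f. indicator {f. bad_sample h q (map f [0..<N])} f \<partial>Pi_pmf {..<N} {} (\<lambda>_. union_law h xs q))"
        by (simp only: indicator_def mem_Collect_eq)
      then show ?thesis by simp
    qed
    also have "\<dots> = ennreal (measure_pmf.prob (Pi_pmf {..<N} {} (\<lambda>_. union_law h xs q)) {f. bad_sample h q (map f [0..<N])})"
      by (rule measure_pmf.emeasure_eq_measure)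
    also have "\<dots> \<le> ennreal (2 * (8 / 9) ^ k)" by (rule ennreal_leI[OF bad_sample_tail[OF o g s gd]])
    finally show "(\<integral>\<^sup>+st. of_bool (\<forall>x\<in>set xs. fst st x = h x) * ?F h (snd st) \<partial>unstopped xs st0) \<le> ennreal (2 * (8 / 9) ^ k)" .
  qed
  also have "\<dots> = ennreal (card ?P * (2 * (8 / 9) ^ k))" by (simp add: ennreal_of_nat_eq_real_of_nat ennreal_mult)
  also have "\<dots> \<le> ennreal ((2 ^ nv) ^ num_ors xs * (2 * (8 / 9) ^ k))"
  proof (intro ennreal_leI mult_right_mono)
    have "card ?P \<le> card (fst ` set_pmf (unstopped xs st0))" using card_histories[OF oo(1)] by (intro card_mono) auto
    also have "\<dots> \<le> (2 ^ nv) ^ num_ors xs" using card_histories[OF oo(1)] by blast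
    finally show "real (card ?P) \<le> (2 ^ nv) ^ num_ors xs" using of_nat_mono[of "card ?P" "(2 ^ nv) ^ num_ors xs", where 'a = real] by simp
  qed simp
  finally show ?thesis .
qed

text \<open>By \<open>ite_good\<close> the first failing node is an Or-node. Summing
  \<open>or_failure\<close> over the Or-nodes gives a geometric sum in the number of
  histories.\<close>

lemma all_good_bound:
  "level_order xs \<Longrightarrow> (\<integral>\<^sup>+st. of_bool (\<not> (\<forall>x\<in>set xs. good (fst st) x)) \<partial>unstopped xs st0)
    \<le> ennreal ((\<Sum>i<num_ors xs. (2 ^ nv) ^ i) * (2 * (8 / 9) ^ k))"
proof (induction xs rule: rev_induct)
  case Nil then show ?case by simp
next
  case (snoc q xs)
  note o = snoc.prems and oo = level_order_snoc[OF snoc.prems]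
  have gx: "good (p(q := v)) x = good p x" if "x \<in> set xs" for p v x
    using that oo(4) by (auto simp: good_def weight_def)
  have bx: "(\<integral>\<^sup>+st. of_bool (\<not> (\<forall>x\<in>set xs. good (fst st) x)) \<partial>unstopped (xs @ [q]) st0)
    = (\<integral>\<^sup>+st. of_bool (\<not> (\<forall>x\<in>set xs. good (fst st) x)) \<partial>unstopped xs st0)"
    by (simp add: unstopped_snoc case_prod_unfold gx cong: ball_cong)
  show ?case
  proof (cases "is_or B q")
    case True
    then obtain qs where g: "gate_of B q = Or qs" by (auto simp: is_or_def)
    have "(\<integral>\<^sup>+st. of_bool (\<not> (\<forall>x\<in>set (xs @ [q]). good (fst st) x)) \<partial>unstopped (xs @ [q]) st0)
      \<le> (\<integral>\<^sup>+st. of_bool (\<not> (\<forall>x\<in>set xs. good (fst st) x)) + of_bool ((\<forall>x\<in>set xs. good (fst st) x) \<and> \<not> good (fst st) q) \<partial>unstopped (xs @ [q]) st0)"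
      by (rule nn_integral_mono) auto
    also have "\<dots> = (\<integral>\<^sup>+st. of_bool (\<not> (\<forall>x\<in>set xs. good (fst st) x)) \<partial>unstopped (xs @ [q]) st0)
      + (\<integral>\<^sup>+st. of_bool ((\<forall>x\<in>set xs. good (fst st) x) \<and> \<not> good (fst st) q) \<partial>unstopped (xs @ [q]) st0)"
      by (rule nn_integral_add) auto
    also have "\<dots> \<le> ennreal ((\<Sum>i<num_ors xs. (2 ^ nv) ^ i) * (2 * (8 / 9) ^ k)) + ennreal ((2 ^ nv) ^ num_ors xs * (2 * (8 / 9) ^ k))"
      unfolding bx by (rule add_mono[OF snoc.IH[OF oo(1)] or_failure[OF o g]])
    also have "\<dots> = ennreal ((\<Sum>i<num_ors (xs @ [q]). (2 ^ nv) ^ i) * (2 * (8 / 9) ^ k))"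
      using True by (simp add: num_ors_def ennreal_plus[symmetric] sum_nonneg algebra_simps del: ennreal_plus)
    finally show ?thesis .
  next
    case False
    obtain x q1 q0 where g: "gate_of B q = Ite x q1 q0" using oo(3) False by (cases "gate_of B q") (auto simp: is_sink_def is_or_def)
    have "(\<integral>\<^sup>+st. of_bool (\<not> (\<forall>x\<in>set (xs @ [q]). good (fst st) x)) \<partial>unstopped (xs @ [q]) st0)
      \<le> (\<integral>\<^sup>+st. of_bool (\<not> (\<forall>x\<in>set xs. good (fst st) x)) \<partial>unstopped (xs @ [q]) st0)"
    proof (rule nn_integral_pmf_mono)
      fix st assume "st \<in> set_pmf (unstopped (xs @ [q]) st0)"
      then obtain st' Sq where st': "st' \<in> set_pmf (unstopped xs st0)" "st = ((fst st')(q := ite_value (fst st') q1 q0), (snd st')(q := Sq))"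
        by (auto simp: unstopped_snoc step_law_ite[OF g])
      have "good (fst st) q" if a: "\<forall>x\<in>set xs. good (fst st) x"
      proof -
        have "good (fst st') x" if "x \<in> set xs" for x using a that gx[OF that] st'(2) by auto
        from ite_good[OF consistent_unstopped[OF oo(1) st'(1)] o this g] show ?thesis using st'(2) by simp
      qed
      then show "(of_bool (\<not> (\<forall>x\<in>set (xs @ [q]). good (fst st) x)) :: ennreal) \<le> of_bool (\<not> (\<forall>x\<in>set xs. good (fst st) x))"
        by auto
    qed
    from order_trans[OF this[unfolded bx] snoc.IH[OF oo(1)]]
    show ?thesis using False by (simp only: num_ors_def filter_append filter.simps append_Nil2 if_False)
  qed
qed

text \<open>Markov's inequality. At a good node the value times the number of models is at most
  \<open>2 * (1 + \<kappa>)\<close>, so a set with \<open>\<theta>\<close> elements forces its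
  cardinality divided by the value up to \<open>\<theta> * cnt x / (2 * (1 + \<kappa>))\<close>,
  whereas the mean of that quotient is \<open>cnt x\<close> by
  \<open>unstopped_mean\<close>.\<close>

lemma overflow_bound:
  assumes o: "level_order xs" and \<theta>: "\<theta> > 0" and lo: lo
  shows "(\<integral>\<^sup>+st. of_bool (\<exists>x\<in>set xs. good (fst st) x \<and> (\<exists>A\<in>set (snd st x). card A \<ge> \<theta>)) \<partial>unstopped xs st0)
    \<le> ennreal (real (length xs) * (real N * (2 * (1 + \<kappa>) / real \<theta>)))"
proof -
  let ?T = "\<lambda>st x r. (\<Sum>\<alpha>\<in>Mod B x. of_bool (\<alpha> \<in> snd st x ! r) * (1 / fst st x)) * ennreal (2 * (1 + \<kappa>) / (real \<theta> * real (cnt x))) :: ennreal"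
  have pt: "(of_bool (\<exists>x\<in>set xs. good (fst st) x \<and> (\<exists>A\<in>set (snd st x). card A \<ge> \<theta>)) :: ennreal) \<le> (\<Sum>x\<in>set xs. \<Sum>r<N. ?T st x r)"
    if st: "st \<in> set_pmf (unstopped xs st0)" for st
  proof (cases "\<exists>x\<in>set xs. good (fst st) x \<and> (\<exists>A\<in>set (snd st x). card A \<ge> \<theta>)")
    case True
    then obtain x A where x: "x \<in> set xs" "good (fst st) x" and A: "A \<in> set (snd st x)" "card A \<ge> \<theta>" by blast
    have s: "consistent xs st" by (rule consistent_unstopped[OF o st])
    obtain r where r: "r < N" "A = snd st x ! r" using A s by (metis in_set_conv_nth consistent_def)
    have xn: "x \<in> set (nodes B)" "\<not> is_sink B x" using level_order_nodes[OF o x(1)] by auto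
    have AM: "A \<subseteq> Mod B x" using s r xn by (auto simp: consistent_def sub_models_def)
    have g: "fst st x \<in> grid nv \<kappa>" using s x by (simp add: consistent_def)
    note gr = grid_real[OF g]
    have c1: "cnt x \<ge> 1" using cnt_pos[OF xn(1)] xn(2) by (auto simp: is_sink_def)
    have "real (cnt x) \<le> 2 * real ((cnt x + 1) div 2)" by linarith
    then have "enn2real (fst st x) * cnt x \<le> enn2real (fst st x) * (2 * real ((cnt x + 1) div 2))" using gr by (intro mult_left_mono) auto
    also have "\<dots> \<le> 2 * (1 + \<kappa>)"
    proof -
      have "enn2real (fst st x) * real ((cnt x + 1) div 2) \<le> 1 + \<kappa>" using x(2) lo unfolding good_def by blast
      then have "2 * (enn2real (fst st x) * real ((cnt x + 1) div 2)) \<le> 2 * (1 + \<kappa>)" by (rule mult_left_mono) simp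
      then show ?thesis by (simp only: mult.left_commute[of "enn2real (fst st x)" 2])
    qed
    finally have pc: "enn2real (fst st x) * cnt x \<le> 2 * (1 + \<kappa>)" .
    have "(\<Sum>\<alpha>\<in>Mod B x. of_bool (\<alpha> \<in> A) * (1 / fst st x)) = of_nat (card A) * (1 / fst st x)"
    proof -
      have "(\<Sum>\<alpha>\<in>Mod B x. of_bool (\<alpha> \<in> A) * (1 / fst st x)) = (\<Sum>\<alpha>\<in>Mod B x. of_bool (\<alpha> \<in> A)) * (1 / fst st x)" by (simp only: sum_distrib_right)
      also have "(\<Sum>\<alpha>\<in>Mod B x. of_bool (\<alpha> \<in> A) :: ennreal) = of_nat (card (Mod B x \<inter> A))"
        using finite_Mod[OF xn(1)] by (simp add: of_bool_def sum.If_cases Int_def)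
      also have "Mod B x \<inter> A = A" using AM by blast
      finally show ?thesis .
    qed
    also have "\<dots> = ennreal (card A / enn2real (fst st x))"
    proof -
      have "1 / fst st x = ennreal 1 / ennreal (enn2real (fst st x))" using gr by simp
      also have "\<dots> = ennreal (1 / enn2real (fst st x))" by (rule divide_ennreal[OF zero_le_one gr(1)])
      finally have "of_nat (card A) * (1 / fst st x) = ennreal (card A) * ennreal (1 / enn2real (fst st x))"
        by (simp only: ennreal_of_nat_eq_real_of_nat)
      also have "\<dots> = ennreal (card A / enn2real (fst st x))" using gr(1) by (simp add: ennreal_mult[symmetric])
      finally show ?thesis .
    qed
    finally have "?T st x r = ennreal (card A / enn2real (fst st x) * (2 * (1 + \<kappa>) / (real \<theta> * real (cnt x))))"
      using r(2) gr \<kappa> by (simp add: ennreal_mult[symmetric])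
    moreover have "1 \<le> card A / enn2real (fst st x) * (2 * (1 + \<kappa>) / (real \<theta> * real (cnt x)))"
    proof -
      have "real \<theta> * (enn2real (fst st x) * cnt x) \<le> card A * (2 * (1 + \<kappa>))"
        by (rule mult_mono[OF _ pc]) (use A(2) gr(1) in auto)
      then show ?thesis using \<theta> c1 gr by (simp add: field_simps)
    qed
    ultimately have "1 \<le> ?T st x r" by (metis ennreal_1 ennreal_leI)
    also have "\<dots> \<le> (\<Sum>r<N. ?T st x r)" using r(1) by (intro member_le_sum) auto
    also have "\<dots> \<le> (\<Sum>x\<in>set xs. \<Sum>r<N. ?T st x r)" using x(1) by (intro member_le_sum) auto
    finally show ?thesis using True by (simp only: of_bool_eq)
  next
    case False then show ?thesis by (simp only: of_bool_eq zero_le)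
  qed
  have "(\<integral>\<^sup>+st. of_bool (\<exists>x\<in>set xs. good (fst st) x \<and> (\<exists>A\<in>set (snd st x). card A \<ge> \<theta>)) \<partial>unstopped xs st0)
    \<le> (\<integral>\<^sup>+st. (\<Sum>x\<in>set xs. \<Sum>r<N. ?T st x r) \<partial>unstopped xs st0)"
    by (rule nn_integral_pmf_mono) (rule pt)
  also have "\<dots> = (\<Sum>x\<in>set xs. \<Sum>r<N. \<integral>\<^sup>+st. ?T st x r \<partial>unstopped xs st0)"
    by (simp add: nn_integral_sum)
  also have "\<dots> = (\<Sum>x\<in>set xs. \<Sum>r<N. ennreal (2 * (1 + \<kappa>) / real \<theta>))"
  proof (intro sum.cong refl)
    fix x r assume x: "x \<in> set xs" and r: "r \<in> {..<N}"
    have xn: "x \<in> set (nodes B)" "\<not> is_sink B x" using level_order_nodes[OF o x] by auto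
    have c1: "cnt x \<ge> 1" using cnt_pos[OF xn(1)] xn(2) by (auto simp: is_sink_def)
    have one: "(\<integral>\<^sup>+st. of_bool (\<alpha> \<in> snd st x ! r) * (1 / fst st x) \<partial>unstopped xs st0) = 1" if "\<alpha> \<in> Mod B x" for \<alpha>
      using unstopped_mean[OF o, of "(x, \<alpha>)" r] that xn x r by (simp add: valid_def)
    have "(\<integral>\<^sup>+st. ?T st x r \<partial>unstopped xs st0) = (\<integral>\<^sup>+st. (\<Sum>\<alpha>\<in>Mod B x. of_bool (\<alpha> \<in> snd st x ! r) * (1 / fst st x)) \<partial>unstopped xs st0) * ennreal (2 * (1 + \<kappa>) / (real \<theta> * real (cnt x)))"
      by (rule nn_integral_multc) simp
    also have "(\<integral>\<^sup>+st. (\<Sum>\<alpha>\<in>Mod B x. of_bool (\<alpha> \<in> snd st x ! r) * (1 / fst st x)) \<partial>unstopped xs st0)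
      = (\<Sum>\<alpha>\<in>Mod B x. \<integral>\<^sup>+st. of_bool (\<alpha> \<in> snd st x ! r) * (1 / fst st x) \<partial>unstopped xs st0)" by (rule nn_integral_sum) simp
    also have "\<dots> = of_nat (cnt x)" using one by (simp add: cnt_def)
    also have "of_nat (cnt x) * ennreal (2 * (1 + \<kappa>) / (real \<theta> * real (cnt x))) = ennreal (cnt x * (2 * (1 + \<kappa>) / (real \<theta> * real (cnt x))))"
      unfolding ennreal_of_nat_eq_real_of_nat by (rule ennreal_mult[symmetric]) (use \<kappa> in auto)
    also have "real (cnt x) * (2 * (1 + \<kappa>) / (real \<theta> * real (cnt x))) = 2 * (1 + \<kappa>) / real \<theta>" using c1 \<theta> by (simp add: divide_simps)
    finally show "(\<integral>\<^sup>+st. ?T st x r \<partial>unstopped xs st0) = ennreal (2 * (1 + \<kappa>) / real \<theta>)" .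
  qed
  also have "\<dots> = ennreal (real (card (set xs)) * (real N * (2 * (1 + \<kappa>) / real \<theta>)))"
  proof -
    have "ennreal (real (card (set xs)) * (real N * (2 * (1 + \<kappa>) / real \<theta>)))
      = ennreal (real (card (set xs))) * (ennreal (real N) * ennreal (2 * (1 + \<kappa>) / real \<theta>))"
      using \<kappa> by (simp only: ennreal_mult of_nat_0_le_iff mult_nonneg_nonneg divide_nonneg_nonneg zero_le_numeral add_nonneg_nonneg zero_le_one less_imp_le)
    then show ?thesis by (simp add: ennreal_of_nat_eq_real_of_nat)
  qed
  also have "\<dots> \<le> ennreal (real (length xs) * (real N * (2 * (1 + \<kappa>) / real \<theta>)))"
    using \<kappa> card_length[of xs] by (intro ennreal_leI mult_right_mono) auto
  finally show ?thesis .
qed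

end

section \<open>Numerical bounds for one run\<close>

lemma sum_powers_le: "(x::real) \<ge> 2 \<Longrightarrow> (\<Sum>i<K. x ^ i) \<le> x ^ K"
proof (induction K)
  case (Suc K)
  have "(\<Sum>i<Suc K. x ^ i) \<le> 2 * x ^ K" using Suc by simp
  also have "\<dots> \<le> x * x ^ K" using Suc.prems by (intro mult_right_mono) auto
  finally show ?case by simp
qed simp

text \<open>With \<open>a = (8 / 9) ^ 8\<close> the failure bound for the medians is
  \<open>a ^ (n * \<beta>)\<close>. Since \<open>2 * a \<le> 1\<close>, the part
  \<open>a ^ (n * K)\<close> cancels all \<open>(2 ^ n) ^ K\<close> histories, and for
  \<open>n \<ge> 2\<close> the two edges by which \<open>\<beta>\<close> exceeds \<open>K\<close>
  leave a spare factor \<open>a ^ 4\<close>. For \<open>n = 1\<close> this spare factor would be too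
  weak, so there the count of a single Or-node is inserted directly.\<close>

lemma history_bound:
  assumes n: "n \<ge> 1" and K: "n = 1 \<Longrightarrow> K \<le> 1" and \<beta>: "\<beta> \<ge> K + 2" and K1: "K \<ge> 1"
  shows "(\<Sum>i<K. (2 ^ n) ^ i) * (2 * (8 / 9) ^ (8 * n * \<beta>)) \<le> (1 / 8 :: real)"
proof (cases "n = 1")
  case True
  then have K': "K = 1" using K K1 by simp
  have "(8 / 9 :: real) ^ (8 * n * \<beta>) \<le> (8 / 9) ^ 24" using True \<beta> K' by (intro power_decreasing) auto
  also have "\<dots> \<le> 1 / 16" by (simp add: power_divide)
  finally show ?thesis by (simp add: K')
next
  case False
  then have n2: "n \<ge> 2" using n by simp
  define a :: real where "a = (8 / 9) ^ 8"
  have a: "0 < a" "2 * a \<le> 1" "a ^ 4 \<le> 1 / 16" "a \<le> 1" by (simp_all add: a_def power_divide)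
  have x2: "(2::real) ^ n \<ge> 2" using n self_le_power[of "2::real" n] by simp
  have "(8 / 9 :: real) ^ (8 * n * \<beta>) = a ^ (n * \<beta>)" by (simp add: a_def power_mult mult.assoc)
  also have "\<dots> \<le> a ^ (n * K + 4)"
  proof (rule power_decreasing)
    have "n * K + 4 \<le> n * (K + 2)" using n2 by simp
    also have "\<dots> \<le> n * \<beta>" by (rule mult_le_mono2[OF \<beta>])
    finally show "n * K + 4 \<le> n * \<beta>" .
  qed (use a in auto)
  also have "\<dots> = a ^ (n * K) * a ^ 4" by (simp add: power_add)
  finally have p: "(8 / 9 :: real) ^ (8 * n * \<beta>) \<le> a ^ (n * K) * a ^ 4" .
  have "(\<Sum>i<K. (2 ^ n) ^ i) * (2 * (8 / 9) ^ (8 * n * \<beta>)) \<le> (2 ^ n) ^ K * (2 * (a ^ (n * K) * a ^ 4))"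
    by (intro mult_mono sum_powers_le x2 mult_left_mono p) auto
  also have "\<dots> = (2 * a) ^ (n * K) * (2 * a ^ 4)" by (simp add: power_mult[symmetric] power_mult_distrib)
  also have "\<dots> \<le> 1 * (2 * (1 / 16))" using a by (intro mult_mono mult_left_mono power_le_one) auto
  finally show ?thesis by simp
qed

lemma prob_map_pmf: "ennreal (measure_pmf.prob (map_pmf f P) X) = (\<integral>\<^sup>+x. of_bool (f x \<in> X) \<partial>measure_pmf P)"
proof -
  have "ennreal (measure_pmf.prob (map_pmf f P) X) = emeasure (measure_pmf P) (f -` X)"
    by (simp add: measure_map_pmf measure_pmf.emeasure_eq_measure)
  also have "\<dots> = (\<integral>\<^sup>+x. indicator (f -` X) x \<partial>measure_pmf P)" by simp
  finally show ?thesis by (simp only: indicator_def vimage_eq)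
qed

context layered
begin

text \<open>A decision node has two outgoing edges and an Or-node at least one. A single decision
  node thus already makes the size exceed the number of Or-nodes by 2, as
  \<open>history_bound\<close> requires.\<close>

lemma length_le_size:
  assumes "level_order xs"
  shows "length xs + length (filter (is_decision B) xs) \<le> bdd_size B"
proof -
  have "length xs + length (filter (is_decision B) xs) = (\<Sum>q\<in>set xs. 1 + of_bool (is_decision B q))"
    using level_order_distinct[OF assms]
    by (induction xs) (auto simp: )
  also have "\<dots> \<le> (\<Sum>q\<in>set xs. length (children B q))"
  proof (rule sum_mono)
    fix q assume "q \<in> set xs"
    then have q: "q \<in> set (nodes B)" "\<not> is_sink B q" using level_order_nodes[OF assms] by auto
    then show "1 + of_bool (is_decision B q) \<le> length (children B q)"
      using or_nonempty[OF q(1)]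
      by (cases "gate_of B q") (auto simp: is_sink_def is_decision_def children_def Suc_le_eq)
  qed
  also have "\<dots> \<le> (\<Sum>q\<in>set (nodes B). length (children B q))"
    using level_order_nodes[OF assms] by (intro sum_mono2) auto
  also have "\<dots> = bdd_size B" using distinct_nodes by (simp add: bdd_size_def sum_list_distinct_conv_sum_set)
  finally show ?thesis .
qed

end

context regime
begin

text \<open>The error is split evenly into \<open>1 / 8\<close> for a wrong value at some node and
  \<open>1 / 8\<close> for reaching the threshold. If \<open>lo\<close> is false, then
  \<open>\<epsilon> \<ge> 1\<close> and the required lower bound is not positive, so the output 0 of
  a stopped run is acceptable and the second part does not arise.\<close>

lemma core_failure:
  assumes n: "nv \<ge> 1" and src: "is_or B (source B)" "lv (source B) = 2 * nv"
    and or_less: "\<And>q. q \<in> set (nodes B) \<Longrightarrow> is_or B q \<Longrightarrow> q \<noteq> source B \<Longrightarrow> card (node_vars B q) < nv"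
    and kb: "k = 8 * nv * bdd_size B"
    and \<theta>: "real \<theta> \<ge> 16 * real ns * real nt * (1 + \<kappa>) * real (bdd_size B)"
    and \<epsilon>: "u \<le> \<epsilon>" "\<not> lo \<Longrightarrow> \<epsilon> \<ge> 1"
      "\<And>m. lo \<Longrightarrow> m \<ge> 1 \<Longrightarrow> (1 - \<epsilon>) * real m \<le> max 1 (real (sg m) / (1 + \<kappa>))"
  shows "measure_pmf.prob (outcome (approxMCnFBDD_core B nv \<kappa> ns nt \<theta>))
    {e. \<not> ((1 - \<epsilon>) * card (models B) \<le> e \<and> e \<le> (1 + \<epsilon>) * card (models B))} \<le> 1 / 4"
proof -
  define xs where "xs = concat (map (layer B) [1..<2 * nv + 1])"
  let ?s = "source B" and ?m = "cnt (source B)"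
  let ?f = "\<lambda>st. case (if \<exists>q\<in>set xs. \<exists>A\<in>set (snd st q). card A \<ge> \<theta> then None else Some st) of None \<Rightarrow> 0 | Some st \<Rightarrow> enn2real (1 / fst st ?s)"
  let ?Bad = "{e. \<not> ((1 - \<epsilon>) * card (models B) \<le> e \<and> e \<le> (1 + \<epsilon>) * card (models B))}"
  have o: "level_order xs" unfolding xs_def by (rule level_order_layers)
  have sx: "set xs = {q \<in> set (nodes B). 1 \<le> lv q \<and> lv q < 2 * nv + 1}" unfolding xs_def by (rule set_layers)
  have s: "?s \<in> set xs" using src(2) n source_node by (simp add: sx)
  obtain qs where gs: "gate_of B ?s = Or qs" using src(1) by (auto simp: is_or_def)
  obtain c where c: "c \<in> set qs" using or_nonempty[OF source_node] gs by (cases qs) auto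
  note oc = or_child[OF source_node gs c]
  have cn: "c \<in> set (nodes B)" using children_nodes[OF source_node] c gs by (auto simp: children_def)
  have "1 \<le> lv c" "lv c < 2 * nv + 1" using oc src(2) n by linarith+
  then have cx: "c \<in> set xs" using cn by (simp add: sx)
  have dec: "length (filter (is_decision B) xs) \<ge> 1"
    using cx oc by (cases "filter (is_decision B) xs") (auto simp: filter_empty_conv)
  have split: "length xs = length (filter (is_or B) xs) + length (filter (is_decision B) xs)"
  proof -
    have "filter (\<lambda>q. \<not> is_or B q) xs = filter (is_decision B) xs"
    proof (rule filter_cong)
      fix q assume "q \<in> set xs"
      then have "\<not> is_sink B q" using level_order_nodes[OF o] by blast
      then show "(\<not> is_or B q) = is_decision B q"
        by (cases "gate_of B q") (auto simp: is_or_def is_decision_def is_sink_def)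
    qed simp
    then show ?thesis using sum_length_filter_compl[of "is_or B" xs] by simp
  qed
  note sz = length_le_size[OF o]
  have K2: "bdd_size B \<ge> num_ors xs + 2" using sz split dec by (simp add: num_ors_def)
  have K1: "num_ors xs \<ge> 1" using s src(1) by (cases "filter (is_or B) xs") (auto simp: num_ors_def filter_empty_conv)
  \<comment> \<open>With one variable an Or-node below the source would test no variable, yet its
    children are decision nodes.\<close>
  have K1': "num_ors xs \<le> 1" if "nv = 1"
  proof -
    have "set (filter (is_or B) xs) \<subseteq> {?s}"
    proof
      fix q assume q: "q \<in> set (filter (is_or B) xs)"
      then have qn: "q \<in> set (nodes B)" using level_order_nodes[OF o] by auto
      obtain qs where g: "gate_of B q = Or qs" using q by (auto simp: is_or_def)
      obtain c where c: "c \<in> set qs" using or_nonempty[OF qn] g by (cases qs) auto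
      have d: "is_decision B c" "node_vars B c = node_vars B q" using or_child[OF qn g c] by auto
      then obtain x where "x \<in> node_vars B c" by (auto simp: is_decision_def node_vars_def decides_def)
      then have "x \<in> node_vars B q" by (simp only: d)
      then have "card (node_vars B q) \<noteq> 0" using finite_node_vars[OF qn] by auto
      then show "q \<in> {?s}" using or_less[OF qn] q that by auto
    qed
    then have "card (set (filter (is_or B) xs)) \<le> 1" using card_mono[of "{?s}"] by auto
    then show ?thesis unfolding num_ors_def using level_order_distinct[OF o] by (simp add: distinct_card[symmetric] del: set_filter)
  qed
  have mc: "card (models B) = ?m" by (simp add: models_def cnt_def)
  have m1: "?m \<ge> 1" using cnt_pos[OF source_node] gs by simp
  have \<theta>0: "\<theta> > 0"
  proof -
    have "0 < 16 * real ns * real nt * (1 + \<kappa>) * real (bdd_size B)"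
      using ns nt k \<kappa> K2 by (intro mult_pos_pos) auto
    then show ?thesis using \<theta> by linarith
  qed
  have v: "outcome (approxMCnFBDD_core B nv \<kappa> ns nt \<theta>) = map_pmf ?f (unstopped xs st0)"
    unfolding approxMCnFBDD_core_def xs_def[symmetric]
    by (simp add: outcome_process[OF level_order_distinct[OF o]] bind_return_pmf map_pmf_def[symmetric] pmf.map_comp o_def)
  have pt: "(of_bool (?f st \<in> ?Bad) :: ennreal) \<le> of_bool (\<not> (\<forall>x\<in>set xs. good (fst st) x))
      + of_bool lo * of_bool (\<exists>x\<in>set xs. good (fst st) x \<and> (\<exists>A\<in>set (snd st x). card A \<ge> \<theta>))"
    if st: "st \<in> set_pmf (unstopped xs st0)" for st
  proof (cases "(\<forall>x\<in>set xs. good (fst st) x) \<and> \<not> (lo \<and> (\<exists>x\<in>set xs. good (fst st) x \<and> (\<exists>A\<in>set (snd st x). card A \<ge> \<theta>)))")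
    case False
    then have "(1 :: ennreal) \<le> of_bool (\<not> (\<forall>x\<in>set xs. good (fst st) x))
      + of_bool lo * of_bool (\<exists>x\<in>set xs. good (fst st) x \<and> (\<exists>A\<in>set (snd st x). card A \<ge> \<theta>))"
      by (cases "\<forall>x\<in>set xs. good (fst st) x") auto
    moreover have "(of_bool (?f st \<in> ?Bad) :: ennreal) \<le> 1" by simp
    ultimately show ?thesis by (rule order_trans[rotated])
  next
    case True
    have gd: "good (fst st) ?s" using True s by blast
    have sn: "consistent xs st" by (rule consistent_unstopped[OF o st])
    have gr: "fst st ?s \<in> grid nv \<kappa>" using sn s by (simp add: consistent_def)
    let ?p = "enn2real (fst st ?s)"
    note p = grid_real[OF gr]
    have "?f st \<notin> ?Bad"
    proof (cases "\<exists>q\<in>set xs. \<exists>A\<in>set (snd st q). card A \<ge> \<theta>")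
      case ov: True
      then have nlo: "\<not> lo" using True by blast
      then have "(1 - \<epsilon>) * ?m \<le> 0" using \<epsilon>(2) by (simp add: mult_le_0_iff)
      moreover have "0 \<le> (1 + \<epsilon>) * ?m" using \<epsilon>(1) u by simp
      ultimately show ?thesis using ov mc by simp
    next
      case nov: False
      have e: "enn2real (1 / fst st ?s) = 1 / ?p"
      proof -
        have "1 / fst st ?s = ennreal 1 / ennreal ?p" using p by simp
        also have "\<dots> = ennreal (1 / ?p)" by (rule divide_ennreal[OF zero_le_one p(1)])
        finally show ?thesis using p(1) by simp
      qed
      have "1 / ?p \<le> (1 + u) * ?m" using gd by (simp add: good_def weight_def)
      also have "\<dots> \<le> (1 + \<epsilon>) * ?m" using \<epsilon>(1) by (intro mult_right_mono) auto
      finally have hi: "1 / ?p \<le> (1 + \<epsilon>) * ?m" .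
      \<comment> \<open>Values never exceed 1. This alone gives the lower bound 1 on the output,
        which is the one to use when the target \<open>sg\<close> is too small to be of
        help.\<close>
      have one: "1 \<le> 1 / ?p" using p by simp
      have lo: "(1 - \<epsilon>) * ?m \<le> 1 / ?p"
      proof (cases lo)
        case True
        have "?p * sg ?m \<le> 1 + \<kappa>" using gd True src(1) unfolding good_def by blast
        then have "sg ?m / (1 + \<kappa>) \<le> 1 / ?p" using p(1) \<kappa> by (simp add: field_simps)
        then show ?thesis using \<epsilon>(3)[OF True m1] one by linarith
      next
        case False
        then have "(1 - \<epsilon>) * ?m \<le> 0" using \<epsilon>(2) by (simp add: mult_le_0_iff)
        then show ?thesis using one by linarith
      qed
      show ?thesis using nov hi lo e mc by simp
    qed
    then show ?thesis by (simp only: of_bool_eq zero_le)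
  qed
  have ov: "(\<integral>\<^sup>+st. of_bool lo * of_bool (\<exists>x\<in>set xs. good (fst st) x \<and> (\<exists>A\<in>set (snd st x). card A \<ge> \<theta>)) \<partial>unstopped xs st0) \<le> ennreal (1 / 8)"
  proof (cases lo)
    case True
    have "(\<integral>\<^sup>+st. of_bool lo * of_bool (\<exists>x\<in>set xs. good (fst st) x \<and> (\<exists>A\<in>set (snd st x). card A \<ge> \<theta>)) \<partial>unstopped xs st0)
      \<le> (\<integral>\<^sup>+st. of_bool (\<exists>x\<in>set xs. good (fst st) x \<and> (\<exists>A\<in>set (snd st x). card A \<ge> \<theta>)) \<partial>unstopped xs st0)"
      by (intro nn_integral_mono) auto
    also note overflow_bound[OF o \<theta>0 True]
    \<comment> \<open>The factor 16 in \<open>\<theta>\<close> is 8 for the error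
      \<open>1 / 8\<close> times the factor 2 lost by bounding only half of the models.\<close>
    also have "real (length xs) * (real N * (2 * (1 + \<kappa>) / real \<theta>)) \<le> 1 / 8"
    proof -
      have "8 * (real (length xs) * (real N * (2 * (1 + \<kappa>)))) \<le> 8 * (real (bdd_size B) * (real N * (2 * (1 + \<kappa>))))"
        using sz \<kappa> by (intro mult_left_mono mult_right_mono) auto
      also have "\<dots> = 16 * real ns * real nt * (1 + \<kappa>) * real (bdd_size B)" by simp
      also have "\<dots> \<le> real \<theta>" by (rule \<theta>)
      finally have "8 * (real (length xs) * (real N * (2 * (1 + \<kappa>)))) \<le> real \<theta>" .
      then show ?thesis using \<theta>0 by (simp only: times_divide_eq_right pos_divide_le_eq of_nat_0_less_iff)
    qed
    finally show ?thesis by (simp only: ennreal_leI)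
  next
    case False
    then show ?thesis by (simp only: of_bool_eq mult_zero_left nn_integral_const zero_le)
  qed
  have ag: "(\<integral>\<^sup>+st. of_bool (\<not> (\<forall>x\<in>set xs. good (fst st) x)) \<partial>unstopped xs st0) \<le> ennreal (1 / 8)"
  proof -
    have "(\<Sum>i<num_ors xs. (2 ^ nv) ^ i) * (2 * (8 / 9) ^ k) \<le> (1 / 8 :: real)"
      unfolding kb by (rule history_bound[OF n K1' K2 K1])
    then show ?thesis by (rule order_trans[OF all_good_bound[OF o] ennreal_leI])
  qed
  have "ennreal (measure_pmf.prob (map_pmf ?f (unstopped xs st0)) ?Bad) = (\<integral>\<^sup>+st. of_bool (?f st \<in> ?Bad) \<partial>unstopped xs st0)"
    by (rule prob_map_pmf)
  also have "\<dots> \<le> (\<integral>\<^sup>+st. of_bool (\<not> (\<forall>x\<in>set xs. good (fst st) x))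
      + of_bool lo * of_bool (\<exists>x\<in>set xs. good (fst st) x \<and> (\<exists>A\<in>set (snd st x). card A \<ge> \<theta>)) \<partial>unstopped xs st0)"
    by (rule nn_integral_pmf_mono[OF pt])
  also have "\<dots> = (\<integral>\<^sup>+st. of_bool (\<not> (\<forall>x\<in>set xs. good (fst st) x)) \<partial>unstopped xs st0)
      + (\<integral>\<^sup>+st. of_bool lo * of_bool (\<exists>x\<in>set xs. good (fst st) x \<and> (\<exists>A\<in>set (snd st x). card A \<ge> \<theta>)) \<partial>unstopped xs st0)"
    by (rule nn_integral_add) auto
  also have "\<dots> \<le> ennreal (1 / 8) + ennreal (1 / 8)" by (rule add_mono[OF ag ov])
  also have "\<dots> = ennreal (1 / 4)" by (simp only: ennreal_plus[symmetric]) simp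
  finally have "measure_pmf.prob (map_pmf ?f (unstopped xs st0)) ?Bad \<le> 1 / 4"
    by (subst (asm) ennreal_le_iff) auto
  then show ?thesis by (simp only: v)
qed

end

section \<open>Choice of the parameters and amplification\<close>

text \<open>The left-hand side bounds the relative variance of one sample. As
  \<open>u \<le> u * n\<close>, it is at most \<open>n\<close> times an expression in
  \<open>u\<close>, and a number of samples proportional to \<open>n / \<kappa>\<^sup>2\<close> then
  leaves a condition on the tolerance \<open>w\<close> that no longer involves
  \<open>n\<close>.\<close>

lemma variance_numerics:
  fixes NS n \<kappa> u w :: real
  assumes n: "n \<ge> 1" and u: "u \<ge> 0" and \<kappa>: "\<kappa> > 0" and NS: "NS \<ge> 4 * n / \<kappa>\<^sup>2"
    and w: "\<kappa>\<^sup>2 * (7 / 10 + 17 / 10 * u) \<le> 2 * w\<^sup>2"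
  shows "(1 + u) * (1 + 7 / 10 * n) - 1 \<le> NS * w\<^sup>2 / 2"
proof -
  have "u * 1 \<le> u * n" using n u by (rule mult_left_mono)
  moreover have "(1 + u) * (1 + 7 / 10 * n) - 1 = u * 1 + 7 / 10 * n + 7 / 10 * (u * n)" by (simp add: algebra_simps)
  moreover have "n * (7 / 10 + 17 / 10 * u) = 7 / 10 * n + 17 / 10 * (u * n)" by (simp add: algebra_simps)
  moreover have "a * 1 + 7 / 10 * b + 7 / 10 * p \<le> 7 / 10 * b + 17 / 10 * p" if "a * 1 \<le> p" for a b p :: real
    using that by simp
  ultimately have "(1 + u) * (1 + 7 / 10 * n) - 1 \<le> n * (7 / 10 + 17 / 10 * u)" by (simp only:)
  also have "\<dots> \<le> n * (2 * w\<^sup>2 / \<kappa>\<^sup>2)"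
    using w \<kappa> n by (intro mult_left_mono) (auto simp: pos_le_divide_eq mult.commute)
  also have "\<dots> = 4 * n / \<kappa>\<^sup>2 * (w\<^sup>2 / 2)" by simp
  also have "\<dots> \<le> NS * (w\<^sup>2 / 2)" by (rule mult_right_mono[OF NS]) simp
  finally show ?thesis by simp
qed

text \<open>The tolerances for \<open>\<epsilon> \<le> 1 / 2\<close>:
  \<open>3 / 4 * \<kappa>\<close> upwards, and
  \<open>\<kappa> / (1 + \<kappa>) = 1 - 1 / (1 + \<kappa>)\<close> downwards. The factor on the
  left is at most \<open>9 / 8 = 2 * (3 / 4)\<^sup>2\<close>, with equality at
  \<open>\<kappa> = 1 / 3\<close>, which is where \<open>3 / 4\<close> comes from.\<close>

lemma small_deviation:
  fixes \<kappa> :: real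
  assumes \<kappa>: "0 < \<kappa>" "\<kappa> \<le> 1 / 3"
  shows "\<kappa>\<^sup>2 * (7 / 10 + 17 / 10 * (3 / 4 * \<kappa>)) \<le> 2 * (3 / 4 * \<kappa>)\<^sup>2"
    and "\<kappa>\<^sup>2 * (7 / 10 + 17 / 10 * (3 / 4 * \<kappa>)) \<le> 2 * (\<kappa> / (1 + \<kappa>))\<^sup>2"
proof -
  have e: "7 / 10 + 17 / 10 * (3 / 4 * \<kappa>) \<le> 9 / 8" using \<kappa> by simp
  have "\<kappa>\<^sup>2 * (7 / 10 + 17 / 10 * (3 / 4 * \<kappa>)) \<le> \<kappa>\<^sup>2 * (9 / 8)" using e by (rule mult_left_mono) simp
  then show "\<kappa>\<^sup>2 * (7 / 10 + 17 / 10 * (3 / 4 * \<kappa>)) \<le> 2 * (3 / 4 * \<kappa>)\<^sup>2" by (simp add: power2_eq_square)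
  have "(1 + \<kappa>)\<^sup>2 \<le> (4 / 3)\<^sup>2" using \<kappa> by (intro power_mono) auto
  moreover have "0 < (1 + \<kappa>)\<^sup>2" using \<kappa> by simp
  ultimately have "9 / 8 \<le> 2 / (1 + \<kappa>)\<^sup>2" by (simp add: pos_le_divide_eq power2_eq_square)
  then have "7 / 10 + 17 / 10 * (3 / 4 * \<kappa>) \<le> 2 / (1 + \<kappa>)\<^sup>2" using e by linarith
  then have "\<kappa>\<^sup>2 * (7 / 10 + 17 / 10 * (3 / 4 * \<kappa>)) \<le> \<kappa>\<^sup>2 * (2 / (1 + \<kappa>)\<^sup>2)" by (rule mult_left_mono) simp
  also have "\<dots> = 2 * (\<kappa> / (1 + \<kappa>))\<^sup>2" by (simp add: power_divide)
  finally show "\<kappa>\<^sup>2 * (7 / 10 + 17 / 10 * (3 / 4 * \<kappa>)) \<le> 2 * (\<kappa> / (1 + \<kappa>))\<^sup>2" .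
qed

text \<open>The tolerances for \<open>1 / 2 \<le> \<epsilon> < 1\<close>: \<open>\<kappa>\<close>
  upwards, and at least \<open>1 - (4 / 5) / (1 + \<kappa>)\<close> downwards. The ratio
  \<open>1250 / 1414\<close> of the latter to \<open>\<kappa>\<close> is chosen so that twice its
  square just exceeds \<open>7 / 10 + 17 / 20\<close>, the factor on the left at
  \<open>\<kappa> = 1 / 2\<close>.\<close>

lemma medium_deviation:
  fixes \<kappa> w :: real
  assumes \<kappa>: "0 < \<kappa>" "\<kappa> \<le> 1 / 2" and w: "w \<ge> (\<kappa> + 1 / 5) / (1 + \<kappa>)"
  shows "\<kappa>\<^sup>2 * (7 / 10 + 17 / 10 * \<kappa>) \<le> 2 * \<kappa>\<^sup>2" "\<kappa>\<^sup>2 * (7 / 10 + 17 / 10 * \<kappa>) \<le> 2 * w\<^sup>2"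
proof -
  have "\<kappa>\<^sup>2 * (7 / 10 + 17 / 10 * \<kappa>) \<le> \<kappa>\<^sup>2 * 2" using \<kappa> by (intro mult_left_mono) auto
  then show "\<kappa>\<^sup>2 * (7 / 10 + 17 / 10 * \<kappa>) \<le> 2 * \<kappa>\<^sup>2" by simp
  have k2: "\<kappa> * \<kappa> \<le> 1 / 2 * \<kappa>" using \<kappa> by (intro mult_right_mono) auto
  have "1250 * \<kappa> * (1 + \<kappa>) \<le> 1414 * (\<kappa> + 1 / 5)" 
  proof -
    have "1250 * \<kappa> * (1 + \<kappa>) = 1250 * \<kappa> + 1250 * (\<kappa> * \<kappa>)" by (simp add: algebra_simps)
    moreover have "1250 * \<kappa> + 1250 * s \<le> 1414 * (\<kappa> + 1 / 5)" if "s \<le> 1 / 2 * \<kappa>" for s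
      using that \<kappa> by simp
    ultimately show ?thesis using k2 by (simp only:)
  qed
  then have "1250 / 1414 * \<kappa> \<le> (\<kappa> + 1 / 5) / (1 + \<kappa>)" using \<kappa> by (simp add: field_simps)
  then have "1250 / 1414 * \<kappa> \<le> w" using w by linarith
  then have "(1250 / 1414 * \<kappa>)\<^sup>2 \<le> w\<^sup>2" using \<kappa> by (intro power_mono) auto
  then have "(1250 / 1414)\<^sup>2 * \<kappa>\<^sup>2 \<le> w\<^sup>2" by (simp only: power_mult_distrib)
  moreover have "\<kappa>\<^sup>2 * (7 / 10 + 17 / 10 * \<kappa>) \<le> \<kappa>\<^sup>2 * (2 * (1250 / 1414)\<^sup>2)"
    using \<kappa> by (intro mult_left_mono) (auto simp: power2_eq_square)
  moreover have "b \<le> 2 * d" if "c * a \<le> d" "b \<le> a * (2 * c)" for a b c d :: real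
    using that by (simp add: mult.commute)
  ultimately show "\<kappa>\<^sup>2 * (7 / 10 + 17 / 10 * \<kappa>) \<le> 2 * w\<^sup>2" by blast
qed

text \<open>For \<open>\<epsilon> \<ge> 1\<close> only the upper tail matters, and
  \<open>2 * \<kappa> \<le> \<epsilon>\<close> permits a generous tolerance.\<close>

lemma large_deviation:
  fixes \<kappa> :: real
  assumes "0 < \<kappa>" "\<kappa> \<le> 1"
  shows "\<kappa>\<^sup>2 * (7 / 10 + 17 / 10 * (2 * \<kappa>)) \<le> 2 * (2 * \<kappa>)\<^sup>2"
proof -
  have "\<kappa>\<^sup>2 * (7 / 10 + 17 / 10 * (2 * \<kappa>)) \<le> \<kappa>\<^sup>2 * 8" using assms by (intro mult_left_mono) auto
  then show ?thesis by (simp add: power_mult_distrib)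
qed

text \<open>For \<open>1 / 3 < \<kappa> < 1 / 2\<close> the variance is too large to exclude values between \<open>four_fifths m / (1 + \<kappa>)\<close> and
  \<open>m / (1 + \<kappa>)\<close>, but these are within the tolerance.\<close>

definition four_fifths :: "nat \<Rightarrow> nat" where
  "four_fifths m = (if m \<le> 2 then 1 else 4 * m div 5)"

context algo
begin

text \<open>Two demands compete: \<open>u \<le> \<epsilon>\<close> and a lower target
  \<open>sg m / (1 + \<kappa>)\<close> of at least \<open>(1 - \<epsilon>) * m\<close> for accuracy,
  against tolerances wide enough for the variance. They are reconciled by a different choice in each
  of three ranges of \<open>\<epsilon>\<close>.\<close>

lemma regime_ex:
  assumes nv: "nv \<ge> 1" and \<epsilon>: "\<epsilon> > 0" and \<kappa>\<epsilon>: "\<kappa> = \<epsilon> / (1 + \<epsilon>)"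
    and ns4: "real ns \<ge> 4 * real nv / \<kappa>\<^sup>2" and nt: "nt = 2 * k" and k: "k > 0"
  obtains u sg lo where "regime B lv \<kappa> ns nt u sg lo k" "u \<le> \<epsilon>" "\<not> lo \<Longrightarrow> \<epsilon> \<ge> 1"
    "\<And>m. lo \<Longrightarrow> m \<ge> 1 \<Longrightarrow> (1 - \<epsilon>) * real m \<le> max 1 (real (sg m) / (1 + \<kappa>))"
proof -
  have al: "algo B lv \<kappa> ns" by unfold_locales
  have n1: "real nv \<ge> 1" using nv by linarith
  note var = variance_numerics[OF n1 _ \<kappa> ns4]
  consider "\<epsilon> \<le> 1 / 2" | "1 / 2 \<le> \<epsilon>" "\<epsilon> < 1" | "\<epsilon> \<ge> 1" by linarith
  then show thesis
  proof cases
    case 1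
    then have \<kappa>3: "\<kappa> \<le> 1 / 3" using \<epsilon> by (simp add: \<kappa>\<epsilon> field_simps)
    have kle: "\<kappa> \<le> \<epsilon>" using \<epsilon> by (simp add: \<kappa>\<epsilon> field_simps)
    have R: "regime B lv \<kappa> ns nt (3 / 4 * \<kappa>) (\<lambda>m. m) True k"
      unfolding regime_def regime_axioms_def
    proof (intro conjI allI impI al nt k)
      show "3 / 4 * \<kappa> > 0" using \<kappa> by simp
      show "(1 + 3 / 4 * \<kappa>) * (1 + 7 / 10 * real nv) - 1 \<le> real ns * (3 / 4 * \<kappa>)\<^sup>2 / 2"
        by (rule var[OF _ small_deviation(1)[OF \<kappa> \<kappa>3]]) (use \<kappa> in simp)
      fix m :: nat assume m: "1 \<le> m"
      have e: "real m / ((1 + \<kappa>) * real m) = 1 / (1 + \<kappa>)" using m by simp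
      show "real m / ((1 + \<kappa>) * real m) < 1" using \<kappa> unfolding e by simp
      have "1 - 1 / (1 + \<kappa>) = \<kappa> / (1 + \<kappa>)" using \<kappa> by (simp add: field_simps)
      then show "(1 + 3 / 4 * \<kappa>) * (1 + 7 / 10 * real nv) - 1 \<le> real ns * (1 - real m / ((1 + \<kappa>) * real m))\<^sup>2 / 2"
        unfolding e using var[OF _ small_deviation(2)[OF \<kappa> \<kappa>3]] \<kappa> by simp
      show "(m + 1) div 2 \<le> m" using m by simp
    qed simp
    have low: "(1 - \<epsilon>) * real m \<le> max 1 (real m / (1 + \<kappa>))" for m :: nat
    proof -
      have "1 - \<epsilon> \<le> 1 / (1 + \<kappa>)"
      proof -
        have "1 / (1 + \<kappa>) = (1 + \<epsilon>) / (1 + 2 * \<epsilon>)" using \<epsilon> by (simp add: \<kappa>\<epsilon> field_simps)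
        moreover have "(1 - \<epsilon>) * (1 + 2 * \<epsilon>) \<le> 1 + \<epsilon>" using \<epsilon> by (simp add: algebra_simps)
        ultimately show ?thesis using \<epsilon> by (simp add: pos_le_divide_eq)
      qed
      then have "(1 - \<epsilon>) * real m \<le> 1 / (1 + \<kappa>) * real m" by (rule mult_right_mono) simp
      then show ?thesis by simp
    qed
    show thesis by (rule that[OF R]) (use kle low \<kappa> in auto)
  next
    case 2
    then have \<kappa>2: "\<kappa> \<le> 1 / 2" using \<epsilon> by (simp add: \<kappa>\<epsilon> field_simps)
    have kle: "\<kappa> \<le> \<epsilon>" using \<epsilon> by (simp add: \<kappa>\<epsilon> field_simps)
    have R: "regime B lv \<kappa> ns nt \<kappa> four_fifths True k"
      unfolding regime_def regime_axioms_def
    proof (intro conjI allI impI al nt k \<kappa>)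
      have v: "(1 + \<kappa>) * (1 + 7 / 10 * real nv) - 1 \<le> real ns * w\<^sup>2 / 2" if "\<kappa>\<^sup>2 * (7 / 10 + 17 / 10 * \<kappa>) \<le> 2 * w\<^sup>2" for w
        by (rule var[OF _ that]) (use \<kappa> in simp)
      show "(1 + \<kappa>) * (1 + 7 / 10 * real nv) - 1 \<le> real ns * \<kappa>\<^sup>2 / 2"
        by (rule v[OF medium_deviation(1)[OF \<kappa> \<kappa>2 order_refl]])
      fix m :: nat assume m: "1 \<le> m"
      show "(m + 1) div 2 \<le> four_fifths m" "four_fifths m \<le> m" using m unfolding four_fifths_def by auto
      assume "2 \<le> four_fifths m"
      \<comment> \<open>The condition \<open>2 \<le> four_fifths m\<close> rules out
        \<open>m \<le> 2\<close>; for \<open>m = 1\<close> the inequality would be false.\<close>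
      then have f: "5 * four_fifths m \<le> 4 * m" by (auto simp: four_fifths_def split: if_splits)
      then have "5 * real (four_fifths m) \<le> 4 * real m" by linarith
      then have s: "real (four_fifths m) / ((1 + \<kappa>) * real m) \<le> (4 / 5) / (1 + \<kappa>)"
      proof -
        have "real (four_fifths m) / real m \<le> 4 / 5" using \<open>5 * real (four_fifths m) \<le> 4 * real m\<close> m by (simp add: divide_le_eq)
        then have "real (four_fifths m) / real m / (1 + \<kappa>) \<le> (4 / 5) / (1 + \<kappa>)" using \<kappa> by (intro divide_right_mono) auto
        then show ?thesis by (simp add: mult.commute)
      qed
      also have "\<dots> < 1" using \<kappa> by simp
      finally show "real (four_fifths m) / ((1 + \<kappa>) * real m) < 1" .
      have "(\<kappa> + 1 / 5) / (1 + \<kappa>) = 1 - (4 / 5) / (1 + \<kappa>)" using \<kappa> by (simp add: field_simps)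
      then show "(1 + \<kappa>) * (1 + 7 / 10 * real nv) - 1 \<le> real ns * (1 - real (four_fifths m) / ((1 + \<kappa>) * real m))\<^sup>2 / 2"
        using s by (intro v medium_deviation(2)[OF \<kappa> \<kappa>2]) linarith
    qed
    have low: "(1 - \<epsilon>) * real m \<le> max 1 (real (four_fifths m) / (1 + \<kappa>))" for m :: nat
    proof (cases "m \<le> 2")
      case True
      have "(1 - \<epsilon>) * real m \<le> 1 / 2 * real m" using 2 by (intro mult_right_mono) auto
      then show ?thesis using True by simp
    next
      case False
      \<comment> \<open>The floor costs little from \<open>m = 3\<close> on, where equality
        holds.\<close>
      have "2 * m \<le> 3 * (4 * m div 5)" using False by presburger
      then have "3 * four_fifths m \<ge> 2 * m" using False by (simp add: four_fifths_def)
      then have f: "2 / 3 * real m \<le> real (four_fifths m)" by linarith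
      have "(1 - \<epsilon>) * (1 + \<kappa>) \<le> 2 / 3"
      proof -
        \<comment> \<open>This product is the difference of the two sides of the next
          inequality.\<close>
        have "(2 * \<epsilon> - 1) * (3 * \<epsilon> + 1) \<ge> 0" using 2 by simp
        then have "(1 - \<epsilon>) * (1 + 2 * \<epsilon>) * 3 \<le> 2 * (1 + \<epsilon>)" by (simp add: algebra_simps)
        then have "(1 - \<epsilon>) * (1 + 2 * \<epsilon>) / (1 + \<epsilon>) \<le> 2 / 3" using \<epsilon> by (simp add: pos_divide_le_eq)
        moreover have "1 + \<kappa> = (1 + 2 * \<epsilon>) / (1 + \<epsilon>)" using \<epsilon> by (simp add: \<kappa>\<epsilon> field_simps)
        ultimately show ?thesis by simp
      qed
      then have "(1 - \<epsilon>) * (1 + \<kappa>) * real m \<le> 2 / 3 * real m" by (rule mult_right_mono) simp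
      also note f
      also have "(1 - \<epsilon>) * (1 + \<kappa>) * real m = (1 - \<epsilon>) * real m * (1 + \<kappa>)" by (simp only: mult_ac)
      finally have "(1 - \<epsilon>) * real m * (1 + \<kappa>) \<le> real (four_fifths m)" .
      then have "(1 - \<epsilon>) * real m \<le> real (four_fifths m) / (1 + \<kappa>)" using \<kappa> by (simp add: pos_le_divide_eq)
      then show ?thesis by simp
    qed
    show thesis by (rule that[OF R]) (use kle low in auto)
  next
    case 3
    have \<kappa>1: "\<kappa> \<le> 1" "2 * \<kappa> \<le> \<epsilon>" using 3 by (simp_all add: \<kappa>\<epsilon> field_simps)
    have R: "regime B lv \<kappa> ns nt (2 * \<kappa>) (\<lambda>m. m) False k"
      unfolding regime_def regime_axioms_def
    proof (intro conjI allI impI al nt k)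
      show "2 * \<kappa> > 0" using \<kappa> by simp
      show "(1 + 2 * \<kappa>) * (1 + 7 / 10 * real nv) - 1 \<le> real ns * (2 * \<kappa>)\<^sup>2 / 2"
        by (rule var[OF _ large_deviation[OF \<kappa> \<kappa>1(1)]]) (use \<kappa> in simp)
    qed auto
    show thesis by (rule that[OF R]) (use \<kappa>1 3 in auto)
  qed
qed

end

text \<open>If the median lies outside the interval, at least half of the runs do so on the same
  side. For \<open>f = 1 / 4\<close> and \<open>r = sqrt 3\<close> the bound
  \<open>sum_pow_half_bad\<close> has the base \<open>sqrt 3 / 2\<close>, which is at most
  \<open>7 / 8\<close> and hence at most \<open>exp (- 1 / 8)\<close>; so
  \<open>8 * ln (1 / \<delta>)\<close> runs suffice.\<close>

lemma median_amplification:
  fixes P :: "real pmf"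
  assumes P: "measure_pmf.prob P {e. \<not> (a \<le> e \<and> e \<le> b)} \<le> 1 / 4" and \<delta>: "0 < \<delta>" "\<delta> < 1"
    and m: "m = nat \<lceil>8 * ln (1 / \<delta>)\<rceil>"
  shows "measure_pmf.prob (map_pmf median (mapM_pmf (\<lambda>_. P) [0..<m])) {e. \<not> (a \<le> e \<and> e \<le> b)} \<le> \<delta>"
proof -
  have m0: "8 * ln (1 / \<delta>) \<le> real m" "m > 0" using \<delta> by (auto simp: m ln_gt_zero)
  let ?Bad = "{e :: real. \<not> (a \<le> e \<and> e \<le> b)}"
  let ?D = "Pi_pmf {..<m} 0 (\<lambda>_. P)"
  have sub: "(\<lambda>g. median (map g [0..<m])) -` ?Bad \<subseteq> {g. card {..<m} \<le> 2 * card {j \<in> {..<m}. g j \<in> ?Bad}}"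
  proof
    fix g :: "nat \<Rightarrow> real" assume "g \<in> (\<lambda>g. median (map g [0..<m])) -` ?Bad"
    then have "median (map g [0..<m]) < a \<or> median (map g [0..<m]) > b" by auto
    then have "\<exists>X\<subseteq>?Bad. m \<le> 2 * card {j. j < m \<and> g j \<in> X}"
    proof
      assume l: "median (map g [0..<m]) < a"
      have "m \<le> 2 * card {j. j < m \<and> map g [0..<m] ! j < a}"
        using median_between(1)[OF _ _ l] m0(2) by simp
      also have "{j. j < m \<and> map g [0..<m] ! j < a} = {j. j < m \<and> g j \<in> {..<a}}" by auto
      finally show ?thesis by (intro exI[of _ "{..<a}"]) auto
    next
      assume l: "median (map g [0..<m]) > b"
      have "m \<le> 2 * card {j. j < m \<and> map g [0..<m] ! j > b}"
        using median_between(2)[OF _ _ l] m0(2) by simp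
      also have "{j. j < m \<and> map g [0..<m] ! j > b} = {j. j < m \<and> g j \<in> {b<..}}" by auto
      finally show ?thesis by (intro exI[of _ "{b<..}"]) auto
    qed
    then obtain X where X: "X \<subseteq> ?Bad" "m \<le> 2 * card {j. j < m \<and> g j \<in> X}" by blast
    have "card {j. j < m \<and> g j \<in> X} \<le> card {j \<in> {..<m}. g j \<in> ?Bad}"
      by (rule card_mono) (use X(1) in auto)
    then show "g \<in> {g. card {..<m} \<le> 2 * card {j \<in> {..<m}. g j \<in> ?Bad}}" using X(2) by simp
  qed
  have "measure_pmf.prob (map_pmf median (mapM_pmf (\<lambda>_. P) [0..<m])) ?Bad
      = measure_pmf.prob ?D ((\<lambda>g. median (map g [0..<m])) -` ?Bad)"
    by (simp only: mapM_pmf_upt[where d = 0] pmf.map_comp measure_map_pmf o_def)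
  also have "\<dots> \<le> measure_pmf.prob ?D {g. card {..<m} \<le> 2 * card {j \<in> {..<m}. g j \<in> ?Bad}}"
    by (rule measure_pmf.finite_measure_mono[OF sub]) simp
  also have "\<dots> \<le> ((1 + ((sqrt 3)\<^sup>2 - 1) * (1 / 4)) / sqrt 3) ^ card {..<m}"
    by (rule sum_pow_half_bad) (use P in auto)
  also have "\<dots> = (sqrt 3 / 2) ^ m"
  proof -
    have "1 + ((sqrt 3)\<^sup>2 - 1) * (1 / 4) = (3 / 2 :: real)" by simp
    moreover have "3 / 2 / sqrt 3 = sqrt 3 / (2 :: real)" using real_div_sqrt[of 3] by (simp add: mult.commute)
    ultimately show ?thesis by (simp only: card_lessThan)
  qed
  also have "\<dots> \<le> exp (- 1 / 8) ^ m"
  proof (rule power_mono)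
    have "sqrt 3 \<le> 7 / 4" by (rule real_le_lsqrt) (auto simp: power2_eq_square)
    then show "sqrt 3 / 2 \<le> exp (- 1 / 8 :: real)" using exp_ge_add_one_self[of "- 1 / 8 :: real"] by simp
  qed simp
  also have "\<dots> = exp (- real m / 8)" by (simp add: exp_of_nat_mult[symmetric])
  also have "\<dots> \<le> exp (- ln (1 / \<delta>))" using m0(1) by simp
  also have "\<dots> = \<delta>" using \<delta> by (simp add: ln_div)
  finally show ?thesis .
qed

section \<open>Application to the normal form\<close>

context nfbdd_live
begin

lemma normal_live: "e \<in> set (nodes N) \<Longrightarrow> gate_of N e \<noteq> Sink False \<longleftrightarrow> e \<noteq> NSink False"
  using normal_sink[of e False] by auto

lemma layered_normal: "layered N level"
proof -
  have nb: "nBDD N" using normal_form by (simp add: normal_form_of_def nFBDD_def)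
  show ?thesis
  proof (unfold_locales)
    show "nBDD N" by (rule nb)
    show "level q = 0" if "q \<in> set (nodes N)" "is_sink N q" for q
      using remaining_true_sink[OF that(2,1)] that(2) by (auto simp: level_def is_sink_def is_or_def)
    show "Suc (level e) = level q \<and> node_vars N q = insert x (node_vars N e)"
      if q: "q \<in> set (nodes N)" and g: "gate_of N q = Ite x q1 q0" and e: "e \<in> {q1, q0}" "gate_of N e \<noteq> Sink False" for q x q1 q0 e
    proof -
      note i = normal_ite(1)[OF q g] normal_ite(2)[OF q g e(1)]
      have e': "e \<noteq> NSink False" using normal_live i(2) e(2) by blast
      have "remaining q = insert x (remaining e)" using i e' by auto
      then show ?thesis using level_ite[OF q g e(1) e'] node_vars_normal[OF q] node_vars_normal[of e] i(2) by simp
    qed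
    show "x \<notin> node_vars N e"
      if q: "q \<in> set (nodes N)" and g: "gate_of N q = Ite x q1 q0" and e: "e \<in> {q1, q0}" for q x q1 q0 e
    proof -
      note i = normal_ite(2)[OF q g e]
      then have "node_vars N e = remaining e" using node_vars_normal by blast
      moreover have "x \<notin> remaining e" using i by (cases "e = NSink False") auto
      ultimately show ?thesis by simp
    qed
    show "\<exists>e\<in>{q1, q0}. gate_of N e \<noteq> Sink False"
      if q: "q \<in> set (nodes N)" and g: "gate_of N q = Ite x q1 q0" for q x q1 q0
      using normal_ite(3)[OF q g] normal_ite(2)[OF q g] normal_live by blast
    show "is_decision N c \<and> Suc (level c) = level q \<and> node_vars N c = node_vars N q"
      if q: "q \<in> set (nodes N)" and g: "gate_of N q = Or qs" and c: "c \<in> set qs" for q qs c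
      using normal_or(2)[OF q g c] level_or[OF q g c] node_vars_normal[OF q] node_vars_normal[of c] by simp
    show "card (node_vars N q) \<le> card (bdd_vars N)" if "q \<in> set (nodes N)" for q
      using card_mono[OF finite_bdd_vars remaining_subset[OF that]] node_vars_normal[OF that] bdd_vars_normal by simp
  qed
qed

lemma source_or: "is_or N (source N)" "level (source N) = 2 * card (bdd_vars N)"
proof -
  show o: "is_or N (source N)" using normal_form by (simp add: normal_form_of_def alternating_def)
  have "remaining (source N) = bdd_vars N"
    using node_vars_normal[OF source_normal_node] by (simp only: source_normal bdd_vars_def)
  then show "level (source N) = 2 * card (bdd_vars N)" using o by (simp only: level_def if_True)
qed

lemma size_normal_pos: "bdd_size N \<ge> 1"
proof -
  obtain qs where qs: "gate_of N (source N) = Or qs" using source_or(1) by (auto simp: is_or_def simp del: normalise_simps)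
  have s: "source N \<in> set (nodes N)" by (simp only: source_normal source_normal_node)
  have "length (children N (source N)) \<le> bdd_size N"
    unfolding bdd_size_def using s by (intro member_le_sum_list) auto
  moreover have "length (children N (source N)) \<ge> 1"
    using normal_or(1)[OF s qs] qs by (cases qs) (simp_all add: children_def del: normalise_simps)
  ultimately show ?thesis by linarith
qed

lemma core_accuracy:
  assumes n: "n = card (bdd_vars N)" and \<epsilon>: "0 < \<epsilon>" and \<kappa>: "\<kappa> = \<epsilon> / (1 + \<epsilon>)"
    and ns: "ns = nat \<lceil>4 * real n / \<kappa>\<^sup>2\<rceil>" and nt: "nt = 16 * n * bdd_size N"
    and \<theta>: "\<theta> = nat \<lceil>16 * real ns * real nt * (1 + \<kappa>) * real (bdd_size N)\<rceil>"
  shows "measure_pmf.prob (outcome (approxMCnFBDD_core N n \<kappa> ns nt \<theta>))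
    {e. \<not> ((1 - \<epsilon>) * card (models B) \<le> e \<and> e \<le> (1 + \<epsilon>) * card (models B))} \<le> 1 / 4"
proof -
  have n1: "n \<ge> 1" using vars_nonempty finite_bdd_vars n bdd_vars_normal by (simp add: Suc_le_eq card_gt_0_iff del: normalise_simps)
  have \<kappa>0: "\<kappa> > 0" using \<epsilon> \<kappa> by simp
  have "0 < 4 * real n / \<kappa>\<^sup>2" using n1 \<kappa>0 by simp
  then have ns0: "ns > 0" and ns4: "real ns \<ge> 4 * real n / \<kappa>\<^sup>2" unfolding ns by linarith+
  interpret L: layered N level by (rule layered_normal)
  interpret A: algo N level \<kappa> ns nt by unfold_locales (use \<kappa>0 ns0 in auto)
  have k0: "8 * n * bdd_size N > 0" using n1 size_normal_pos by simp
  \<comment> \<open>The number of blocks is even, and its half is the exponent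
    \<open>8 * n * bdd_size N\<close> for which \<open>history_bound\<close> is made.\<close>
  have nt2: "nt = 2 * (8 * n * bdd_size N)" using nt by simp
  obtain u sg lo where reg: "regime N level \<kappa> ns nt u sg lo (8 * n * bdd_size N)" "u \<le> \<epsilon>" "\<not> lo \<Longrightarrow> \<epsilon> \<ge> 1"
    "\<And>m. lo \<Longrightarrow> m \<ge> 1 \<Longrightarrow> (1 - \<epsilon>) * real m \<le> max 1 (real (sg m) / (1 + \<kappa>))"
    using A.regime_ex[OF n1[unfolded n] \<epsilon> \<kappa> ns4[unfolded n] nt2 k0] by blast
  interpret R: regime N level \<kappa> ns nt u sg lo "8 * n * bdd_size N" by (rule reg(1))
  have "measure_pmf.prob (outcome (approxMCnFBDD_core N (card (bdd_vars N)) \<kappa> ns nt \<theta>))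
    {e. \<not> ((1 - \<epsilon>) * card (models N) \<le> e \<and> e \<le> (1 + \<epsilon>) * card (models N))} \<le> 1 / 4"
  proof (rule R.core_failure)
    show "1 \<le> card (bdd_vars N)" using n1 n by blast
    show "is_or N (source N)" "level (source N) = 2 * card (bdd_vars N)" by (rule source_or)+
    show "card (node_vars N q) < card (bdd_vars N)" if "q \<in> set (nodes N)" "is_or N q" "q \<noteq> source N" for q
      using or_remaining_less[OF that(1,2)] that(3) node_vars_normal[OF that(1)] source_normal bdd_vars_normal by (simp del: normalise_simps)
    show "8 * n * bdd_size N = 8 * card (bdd_vars N) * bdd_size N" by (simp only: n)
    show "16 * real ns * real nt * (1 + \<kappa>) * real (bdd_size N) \<le> real \<theta>" unfolding \<theta> by linarith
    show "u \<le> \<epsilon>" "\<not> lo \<Longrightarrow> \<epsilon> \<ge> 1" "\<And>m. lo \<Longrightarrow> m \<ge> 1 \<Longrightarrow> (1 - \<epsilon>) * real m \<le> max 1 (real (sg m) / (1 + \<kappa>))" by (fact reg)+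
  qed
  then show ?thesis by (simp only: n models_normal)
qed

lemma running_time:
  assumes n: "n = card (bdd_vars B)" and \<epsilon>: "0 < \<epsilon>" "\<epsilon> \<le> \<epsilon>0" and \<delta>: "0 < \<delta>" "\<delta> \<le> \<delta>0" "\<delta>0 < 1"
    and t: "(est, t) \<in> set_pmf (approxMCnFBDD B \<epsilon> \<delta>)"
  shows "real t \<le> ((101 / ln (1 / \<delta>0) + (8 + 1 / ln (1 / \<delta>0)) * (25 * 1057 * 56\<^sup>2 * 2641\<^sup>2 + 1)) * (1 + \<epsilon>0) ^ 4)
    * real n ^ 11 * real (bdd_size B) ^ 10 * (1 / \<epsilon>) ^ 4 * ln (1 / \<delta>)"
proof -
  let ?\<kappa> = "\<epsilon> / (1 + \<epsilon>)"
  define ns where "ns = nat \<lceil>4 * real n / ?\<kappa>\<^sup>2\<rceil>"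
  define nt where "nt = 16 * n * bdd_size N"
  define \<theta> where "\<theta> = nat \<lceil>16 * real ns * real nt * (1 + ?\<kappa>) * real (bdd_size N)\<rceil>"
  define m where "m = nat \<lceil>8 * ln (1 / \<delta>)\<rceil>"
  have n1: "n \<ge> 1" using vars_nonempty finite_bdd_vars n by (simp add: Suc_le_eq card_gt_0_iff)
  note len = normal_size_bounds[OF n n1]
  have \<kappa>0: "?\<kappa> > 0" using \<epsilon> by simp
  have "0 < 4 * real n / ?\<kappa>\<^sup>2" using n1 by (intro divide_pos_pos zero_less_power \<kappa>0) simp
  then have ns1: "ns \<ge> 1" unfolding ns_def by linarith
  have "0 < 16 * real ns * real nt * (1 + ?\<kappa>) * real (bdd_size N)"
    using ns1 n1 size_normal_pos \<kappa>0 by (intro mult_pos_pos) (auto simp: nt_def)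
  then have \<theta>1: "\<theta> \<ge> 1" unfolding \<theta>_def by linarith
  have core: "cost_le (approxMCnFBDD_core N n ?\<kappa> ns nt \<theta>)
    (25 * n * (ns * nt + 1) * \<theta> * (1 + n + length (nodes N) + bdd_size N)\<^sup>2) (\<lambda>_. True)"
    by (rule core_cost_le[OF distinct_normal_nodes refl _ \<theta>1 n1 refl]) (use ns1 in simp)
  have "cost_le (approxMCnFBDD B \<epsilon> \<delta>) ((1 + normalise_time B)
     + (m * (25 * n * (ns * nt + 1) * \<theta> * (1 + n + length (nodes N) + bdd_size N)\<^sup>2) + m)) (\<lambda>_. True)"
    by (rule approx_cost_le[OF core _ ns_def nt_def \<theta>_def m_def]) (simp only: n bdd_vars_normal)
  then have "real t \<le> real ((1 + normalise_time B)
     + (m * (25 * n * (ns * nt + 1) * \<theta> * (1 + n + length (nodes N) + bdd_size N)\<^sup>2) + m))"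
    using t unfolding cost_le_def by (intro of_nat_mono) blast
  also have "\<dots> \<le> ((101 / ln (1 / \<delta>0) + (8 + 1 / ln (1 / \<delta>0)) * (25 * 1057 * 56\<^sup>2 * 2641\<^sup>2 + 1)) * (1 + \<epsilon>0) ^ 4)
    * real n ^ 11 * real (bdd_size B) ^ 10 * (1 / \<epsilon>) ^ 4 * ln (1 / \<delta>)"
  proof (rule time_numerics[OF n1 len(4,2,1) \<epsilon> _ _ refl ns_def nt_def \<theta>_def m_def refl refl len(3) refl])
    show "0 < ln (1 / \<delta>0)" using \<delta> by simp
    show "ln (1 / \<delta>0) \<le> ln (1 / \<delta>)" using \<delta> by (simp add: frac_le)
  qed
  finally show ?thesis .
qed

end

text \<open>Without variables the source of the normal form is the 1-sink. Then
  \<open>n = 0\<close>, no layer is processed, and the run returns the inverse of the initial value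
  1. This case is treated apart because such a diagram is not alternating.\<close>

lemma (in nfbdd) accuracy_no_vars:
  assumes m: "models B \<noteq> {}" and v: "bdd_vars B = {}" and n: "n = card (bdd_vars N)"
  shows "outcome (approxMCnFBDD_core N n \<kappa> ns nt \<theta>) = return_pmf 1" "card (models B) = 1"
proof -
  have "\<alpha> = Map.empty" if "\<alpha> \<in> models B" for \<alpha> using that v by (auto simp: models_def Mod_def bdd_vars_def)
  then have "models B = {Map.empty}" using m by blast
  then show "card (models B) = 1" by simp
  obtain \<alpha> where "accepts B \<alpha> (source B)" using m by (auto simp: models_def Mod_def)
  then have "targets B (source B) \<noteq> []" using accepts_iff_targets[OF source_node] by (metis bex_empty list.set(1))
  then have s: "source N = NSink True" using v by (simp add: entry_def)
  then have g: "gate_of N (source N) = Sink True" by simp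
  have "edges N `` {source N} = {}" using g by (auto simp: edges_def children_def simp del: normalise_simps)
  then have only: "q = source N" if "(source N, q) \<in> (edges N)\<^sup>*" for q
    using that by (metis Image_singleton_iff converse_rtranclE empty_iff)
  have "\<not> decides N x (source N)" for x by (simp only: decides_def g) simp
  then have "bdd_vars N = {}" using only unfolding bdd_vars_def node_vars_def by blast
  then have n0: "n = 0" using n by simp
  show "outcome (approxMCnFBDD_core N n \<kappa> ns nt \<theta>) = return_pmf 1"
    unfolding approxMCnFBDD_core_def n0 using g by (simp add: bind_return_pmf initial_state_def del: normalise_simps)
qed

lemma accuracy_approx:
  fixes B :: "('q, 'v) bdd"
  assumes B: "nFBDD B" "models B \<noteq> {}" and \<epsilon>: "0 < \<epsilon>" and \<delta>: "0 < \<delta>" "\<delta> < 1"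
  shows "measure_pmf.prob (approxMCnFBDD B \<epsilon> \<delta>)
    {(est, t). (1 - \<epsilon>) * real (card (models B)) \<le> est \<and> est \<le> (1 + \<epsilon>) * real (card (models B))} \<ge> 1 - \<delta>"
proof -
  interpret nfbdd B by unfold_locales (rule B)
  define n where "n = card (bdd_vars N)"
  define \<kappa> where "\<kappa> = \<epsilon> / (1 + \<epsilon>)"
  define ns where "ns = nat \<lceil>4 * real n / \<kappa>\<^sup>2\<rceil>"
  define nt where "nt = 16 * n * bdd_size N"
  define \<theta> where "\<theta> = nat \<lceil>16 * real ns * real nt * (1 + \<kappa>) * real (bdd_size N)\<rceil>"
  define m where "m = nat \<lceil>8 * ln (1 / \<delta>)\<rceil>"
  define P where "P = outcome (approxMCnFBDD_core N n \<kappa> ns nt \<theta>)"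
  let ?Bad = "{e. \<not> ((1 - \<epsilon>) * card (models B) \<le> e \<and> e \<le> (1 + \<epsilon>) * card (models B))}"
  have "measure_pmf.prob P ?Bad \<le> 1 / 4"
  proof (cases "bdd_vars B = {}")
    case True
    have "?Bad \<inter> {1} = {}" using accuracy_no_vars(2)[OF B(2) True n_def] \<epsilon> by auto
    then have "1 \<notin> ?Bad" by blast
    then show ?thesis unfolding P_def accuracy_no_vars(1)[OF B(2) True n_def] by (simp add: measure_return)
  next
    case False
    interpret nfbdd_live B by unfold_locales (use B False in auto)
    show ?thesis unfolding P_def by (rule core_accuracy[OF n_def \<epsilon> \<kappa>_def ns_def nt_def \<theta>_def])
  qed
  then have bad: "measure_pmf.prob (map_pmf median (mapM_pmf (\<lambda>_. P) [0..<m])) ?Bad \<le> \<delta>"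
    by (rule median_amplification[OF _ \<delta> m_def])
  have v: "outcome (approxMCnFBDD B \<epsilon> \<delta>) = map_pmf median (mapM_pmf (\<lambda>_. P) [0..<m])"
    unfolding approxMCnFBDD_def Let_def n_def[symmetric] m_def[symmetric] \<kappa>_def[symmetric] ns_def[symmetric] nt_def[symmetric] \<theta>_def[symmetric]
    by (simp add: bind_return_pmf map_pmf_def[symmetric] P_def del: normalise_simps)
  have "measure_pmf.prob (approxMCnFBDD B \<epsilon> \<delta>) {(est, t). (1 - \<epsilon>) * real (card (models B)) \<le> est \<and> est \<le> (1 + \<epsilon>) * real (card (models B))}
    = measure_pmf.prob (approxMCnFBDD B \<epsilon> \<delta>) (fst -` (- ?Bad))"
    by (intro arg_cong[of _ _ "measure_pmf.prob _"]) auto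
  also have "\<dots> = measure_pmf.prob (outcome (approxMCnFBDD B \<epsilon> \<delta>)) (- ?Bad)" by (simp only: outcome_def measure_map_pmf)
  also have "\<dots> = 1 - measure_pmf.prob (outcome (approxMCnFBDD B \<epsilon> \<delta>)) ?Bad"
    using measure_pmf.prob_compl[of ?Bad "outcome (approxMCnFBDD B \<epsilon> \<delta>)"] by (simp add: Compl_eq_Diff_UNIV)
  finally show ?thesis using bad v by simp
qed

theorem theorem1:
  shows
    "(\<exists>C::real. \<forall>B :: ('q, 'v) bdd.
        nFBDD B \<and> models B \<noteq> {} \<and> card (bdd_vars B) \<ge> 1 \<longrightarrow>
          normal_form_of (normalise B) B \<and>
          real (normalise_time B) \<le> C * real (card (bdd_vars B)) * real (bdd_size B) ^ 2)
   \<and> (\<forall>\<epsilon>0 \<delta>0 :: real. 0 < \<epsilon>0 \<and> 0 < \<delta>0 \<and> \<delta>0 < 1 \<longrightarrow>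
        (\<exists>C::real. \<forall>(B :: ('q, 'v) bdd) n \<epsilon> \<delta>.
           nFBDD B \<and> models B \<noteq> {} \<and> n = card (bdd_vars B) \<and> n \<ge> 1 \<and>
           0 < \<epsilon> \<and> \<epsilon> \<le> \<epsilon>0 \<and> 0 < \<delta> \<and> \<delta> \<le> \<delta>0 \<longrightarrow>
             (\<forall>(est, t) \<in> set_pmf (approxMCnFBDD B \<epsilon> \<delta>).
                real t \<le> C * real n ^ 11 * real (bdd_size B) ^ 10 * (1 / \<epsilon>) ^ 4 * ln (1 / \<delta>))))
   \<and> (\<forall>(B :: ('q, 'v) bdd) \<epsilon> \<delta> :: real.
        nFBDD B \<and> models B \<noteq> {} \<and> 0 < \<epsilon> \<and> 0 < \<delta> \<and> \<delta> < 1 \<longrightarrow>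
          measure_pmf.prob (approxMCnFBDD B \<epsilon> \<delta>)
            {(est, t). (1 - \<epsilon>) * real (card (models B)) \<le> est \<and>
                       est \<le> (1 + \<epsilon>) * real (card (models B))} \<ge> 1 - \<delta>)"
proof (intro conjI)
  have live: "nfbdd_live B" if "nFBDD B" "models B \<noteq> {}" "card (bdd_vars B) \<ge> 1" for B :: "('q, 'v) bdd"
    using that by unfold_locales auto
  show "\<exists>C::real. \<forall>B :: ('q, 'v) bdd.
        nFBDD B \<and> models B \<noteq> {} \<and> card (bdd_vars B) \<ge> 1 \<longrightarrow>
          normal_form_of (normalise B) B \<and>
          real (normalise_time B) \<le> C * real (card (bdd_vars B)) * real (bdd_size B) ^ 2"
  proof (intro exI[of _ 100] allI impI)
    fix B :: "('q, 'v) bdd"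
    assume a: "nFBDD B \<and> models B \<noteq> {} \<and> card (bdd_vars B) \<ge> 1"
    then interpret nfbdd_live B by (intro live) auto
    have "normalise_time B \<le> 100 * card (bdd_vars B) * (bdd_size B)\<^sup>2" using normal_size_bounds(3)[OF refl] a by blast
    then have "real (normalise_time B) \<le> real (100 * card (bdd_vars B) * (bdd_size B)\<^sup>2)" by (rule of_nat_mono)
    then show "normal_form_of (normalise B) B \<and>
          real (normalise_time B) \<le> 100 * real (card (bdd_vars B)) * real (bdd_size B) ^ 2"
      using normal_form by simp
  qed
  show "\<forall>\<epsilon>0 \<delta>0 :: real. 0 < \<epsilon>0 \<and> 0 < \<delta>0 \<and> \<delta>0 < 1 \<longrightarrow>
        (\<exists>C::real. \<forall>(B :: ('q, 'v) bdd) n \<epsilon> \<delta>.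
           nFBDD B \<and> models B \<noteq> {} \<and> n = card (bdd_vars B) \<and> n \<ge> 1 \<and>
           0 < \<epsilon> \<and> \<epsilon> \<le> \<epsilon>0 \<and> 0 < \<delta> \<and> \<delta> \<le> \<delta>0 \<longrightarrow>
             (\<forall>(est, t) \<in> set_pmf (approxMCnFBDD B \<epsilon> \<delta>).
                real t \<le> C * real n ^ 11 * real (bdd_size B) ^ 10 * (1 / \<epsilon>) ^ 4 * ln (1 / \<delta>)))"
  proof (intro allI impI exI, clarify)
    fix \<epsilon>0 \<delta>0 \<epsilon> \<delta> :: real and B :: "('q, 'v) bdd" and n est t
    assume a: "0 < \<epsilon>0" "0 < \<delta>0" "\<delta>0 < 1" "nFBDD B" "models B \<noteq> {}" "card (bdd_vars B) \<ge> 1"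
      "0 < \<epsilon>" "\<epsilon> \<le> \<epsilon>0" "0 < \<delta>" "\<delta> \<le> \<delta>0" "(est, t) \<in> set_pmf (approxMCnFBDD B \<epsilon> \<delta>)"
    interpret nfbdd_live B using a by (intro live) auto
    show "real t \<le> ((101 / ln (1 / \<delta>0) + (8 + 1 / ln (1 / \<delta>0)) * (25 * 1057 * 56\<^sup>2 * 2641\<^sup>2 + 1)) * (1 + \<epsilon>0) ^ 4)
       * real (card (bdd_vars B)) ^ 11 * real (bdd_size B) ^ 10 * (1 / \<epsilon>) ^ 4 * ln (1 / \<delta>)"
      by (rule running_time[OF refl a(7,8,9,10,3,11)])
  qed
  show "\<forall>(B :: ('q, 'v) bdd) \<epsilon> \<delta> :: real.
        nFBDD B \<and> models B \<noteq> {} \<and> 0 < \<epsilon> \<and> 0 < \<delta> \<and> \<delta> < 1 \<longrightarrow>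
          measure_pmf.prob (approxMCnFBDD B \<epsilon> \<delta>)
            {(est, t). (1 - \<epsilon>) * real (card (models B)) \<le> est \<and>
                       est \<le> (1 + \<epsilon>) * real (card (models B))} \<ge> 1 - \<delta>"
    using accuracy_approx by blast
qed

end
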